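(* Let $\Omega\subset\mathbb R^d$ ($d=2$ or $3$) be a polygonal/polyhedral domain partitioned by a mesh $\mathcal Q_h$ of squares ($d=2$) or cubes ($d=3$) of side $h$, and let $k\ge 4$. Assume full regularity of the biharmonic problem: for every $g\in L^2(\Omega)$ the solution $w\in H^2_0(\Omega)$ of $(\Delta w,\Delta v)=(g,v)$ for all $v\in H^2_0(\Omega)$ satisfies $w\in H^4(\Omega)$ and $|w|_4\le C\|g\|_0$. Let $u\in H^{k+1}(\Omega)\cap H^2_0(\Omega)$ be the exact solution of $\Delta^2u=f$ in $\Omega$, $u=\partial_{\mathbf n}u=0$ on $\partial\Omega$, and let $u_h\in V_h$ satisfy $(\Delta u_h,\Delta v)=(f,v)$ for all $v\in V_h$, where $V_h=\{v\in H^2_0(\Omega): v|_T\in V_T \text{ for all } T\in\mathcal Q_h\}$. Then $$\|u-u_h\|_0+h^2|u-u_h|_2\le Ch^{k+1}|u|_{k+1},$$ with $C$ independent of $h$.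
   Context: For each mesh element $T$, $V_T=\{v\in Q_k(T): \partial_{\mathbf n}v|_e\in Q_{k-1}(e)$ for every edge (in 2D) or face (in 3D) $e$ of $T\}$, where $Q_k$ is the space of polynomials of degree at most $k$ in each variable separately, $Q_{k-1}(e)$ is the analogous space in the variables tangential to $e$, and $\partial_{\mathbf n}$ is the derivative in the coordinate direction normal to $e$ (the $C^1$-$Q_k$ Bell element). $(\cdot,\cdot)$ is the $L^2(\Omega)$ inner product, $\|\cdot\|_0$ the $L^2$ norm and $|\cdot|_m$ the $H^m$ seminorm. *)

theory Defs
  imports "HOL-Analysis.Analysis"
begin

definition pdx :: "'n::finite \<Rightarrow> (real^'n \<Rightarrow> real) \<Rightarrow> real^'n \<Rightarrow> real" where
  "pdx i f x = deriv (\<lambda>t. f (x + t *\<^sub>R axis i 1)) 0"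

fun pds :: "'n::finite list \<Rightarrow> (real^'n \<Rightarrow> real) \<Rightarrow> real^'n \<Rightarrow> real" where
  "pds [] f = f"
| "pds (i # is) f = pdx i (pds is f)"

definition test_fun :: "(real^'n::finite) set \<Rightarrow> (real^'n \<Rightarrow> real) \<Rightarrow> bool" where
  "test_fun \<Omega> \<phi> \<longleftrightarrow>
     (\<forall>is. continuous_on UNIV (pds is \<phi>) \<and>
           (\<forall>i x. (\<lambda>t. pds is \<phi> (x + t *\<^sub>R axis i 1)) differentiable (at 0))) \<and>
     compact (closure {x. \<phi> x \<noteq> 0}) \<and> closure {x. \<phi> x \<noteq> 0} \<subseteq> \<Omega>"

definition L2 :: "(real^'n::finite) set \<Rightarrow> (real^'n \<Rightarrow> real) \<Rightarrow> bool" where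
  "L2 \<Omega> u \<longleftrightarrow> u \<in> borel_measurable (lebesgue_on \<Omega>) \<and>
                 integrable (lebesgue_on \<Omega>) (\<lambda>x. (u x)\<^sup>2)"

definition ip0 :: "(real^'n::finite) set \<Rightarrow> (real^'n \<Rightarrow> real) \<Rightarrow> (real^'n \<Rightarrow> real) \<Rightarrow> real" where
  "ip0 \<Omega> u v = (LINT x|lebesgue_on \<Omega>. u x * v x)"

definition norm0 :: "(real^'n::finite) set \<Rightarrow> (real^'n \<Rightarrow> real) \<Rightarrow> real" where
  "norm0 \<Omega> u = sqrt (ip0 \<Omega> u u)"

definition is_wd :: "(real^'n::finite) set \<Rightarrow> 'n list \<Rightarrow> (real^'n \<Rightarrow> real) \<Rightarrow> (real^'n \<Rightarrow> real) \<Rightarrow> bool" where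
  "is_wd \<Omega> is u g \<longleftrightarrow> L2 \<Omega> g \<and>
     (\<forall>\<phi>. test_fun \<Omega> \<phi> \<longrightarrow>
        (LINT x|lebesgue_on \<Omega>. u x * pds is \<phi> x) = (-1) ^ length is * (LINT x|lebesgue_on \<Omega>. g x * \<phi> x))"

definition wd :: "(real^'n::finite) set \<Rightarrow> 'n list \<Rightarrow> (real^'n \<Rightarrow> real) \<Rightarrow> real^'n \<Rightarrow> real" where
  "wd \<Omega> is u = (SOME g. is_wd \<Omega> is u g)"

definition Hm :: "nat \<Rightarrow> (real^'n::finite) set \<Rightarrow> (real^'n \<Rightarrow> real) \<Rightarrow> bool" where
  "Hm m \<Omega> u \<longleftrightarrow> L2 \<Omega> u \<and> (\<forall>is. length is \<le> m \<longrightarrow> (\<exists>g. is_wd \<Omega> is u g))"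

definition semi :: "nat \<Rightarrow> (real^'n::finite) set \<Rightarrow> (real^'n \<Rightarrow> real) \<Rightarrow> real" where
  "semi m \<Omega> u = sqrt (\<Sum>is\<in>{is::'n list. length is = m}. (norm0 \<Omega> (wd \<Omega> is u))\<^sup>2)"

definition Hnorm :: "nat \<Rightarrow> (real^'n::finite) set \<Rightarrow> (real^'n \<Rightarrow> real) \<Rightarrow> real" where
  "Hnorm m \<Omega> u = sqrt (\<Sum>j\<le>m. (semi j \<Omega> u)\<^sup>2)"

definition H20 :: "(real^'n::finite) set \<Rightarrow> (real^'n \<Rightarrow> real) \<Rightarrow> bool" where
  "H20 \<Omega> u \<longleftrightarrow> Hm 2 \<Omega> u \<and>
     (\<forall>\<epsilon>>0. \<exists>\<phi>. test_fun \<Omega> \<phi> \<and> Hnorm 2 \<Omega> (\<lambda>x. u x - \<phi> x) < \<epsilon>)"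

definition wlap :: "(real^'n::finite) set \<Rightarrow> (real^'n \<Rightarrow> real) \<Rightarrow> real^'n \<Rightarrow> real" where
  "wlap \<Omega> u = (\<lambda>x. \<Sum>i\<in>UNIV. wd \<Omega> [i, i] u x)"

definition cube :: "real^'n::finite \<Rightarrow> real \<Rightarrow> (real^'n) set" where
  "cube a h = cbox a (a + h *\<^sub>R One)"

definition cube_mesh :: "(real^'n::finite) set \<Rightarrow> real \<Rightarrow> (real^'n) set \<Rightarrow> bool" where
  "cube_mesh \<Omega> h \<T> \<longleftrightarrow> h > 0 \<and> finite \<T> \<and> \<T> \<noteq> {} \<and>
     (\<forall>a\<in>\<T>. \<forall>b\<in>\<T>. a \<noteq> b \<longrightarrow> interior (cube a h) \<inter> interior (cube b h) = {}) \<and>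
     (\<forall>a\<in>\<T>. \<forall>b\<in>\<T>. \<forall>i. \<exists>z::int. (a - b) $ i = of_int z * h) \<and>
     closure \<Omega> = (\<Union>a\<in>\<T>. cube a h) \<and>
     \<Omega> = interior (\<Union>a\<in>\<T>. cube a h)"

definition Qk :: "nat \<Rightarrow> (real^'n::finite \<Rightarrow> real) \<Rightarrow> bool" where
  "Qk k p \<longleftrightarrow> (\<exists>c :: ('n \<Rightarrow> nat) \<Rightarrow> real. \<forall>x.
      p x = (\<Sum>\<alpha>\<in>{\<alpha>. \<forall>j. \<alpha> j \<le> k}. c \<alpha> * (\<Prod>j\<in>UNIV. (x $ j) ^ \<alpha> j)))"

text \<open>Local space V_T of the C^1-Q_k Bell element on the cube T = cube a h: p in Q_k(T) such
that on each face {x in T. x_i = a_i} and {x in T. x_i = a_i + h} the normal derivative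
d p / d x_i is in Q_{k-1} of the tangential variables.\<close>
definition VT :: "nat \<Rightarrow> real^'n::finite \<Rightarrow> real \<Rightarrow> (real^'n \<Rightarrow> real) \<Rightarrow> bool" where
  "VT k a h p \<longleftrightarrow> Qk k p \<and>
     (\<forall>i. \<forall>s\<in>{a $ i, a $ i + h}. \<exists>c :: ('n \<Rightarrow> nat) \<Rightarrow> real.
        \<forall>x\<in>cube a h. x $ i = s \<longrightarrow>
          pdx i p x = (\<Sum>\<alpha>\<in>{\<alpha>. \<alpha> i = 0 \<and> (\<forall>j. \<alpha> j \<le> k - 1)}. c \<alpha> * (\<Prod>j\<in>UNIV. (x $ j) ^ \<alpha> j)))"

definition Vh :: "nat \<Rightarrow> (real^'n::finite) set \<Rightarrow> real \<Rightarrow> (real^'n) set \<Rightarrow> (real^'n \<Rightarrow> real) \<Rightarrow> bool" where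
  "Vh k \<Omega> h \<T> v \<longleftrightarrow> H20 \<Omega> v \<and>
     (\<forall>a\<in>\<T>. \<exists>p. VT k a h p \<and> (AE x in lebesgue_on (interior (cube a h)). v x = p x))"

end

theory Submission
  imports Defs
begin

text \<open>The error estimate follows from Galerkin orthogonality and the Aubin--Nitsche duality argument once every
  \<open>w\<close> in \<open>H20\<close> with \<open>m\<close> weak derivatives can be approximated from the spline space to order \<open>h ^ (m - 2)\<close> in the
  second-order seminorm. For the approximation, the Bramble--Hilbert lemma gives on every mesh cube a polynomial of total
  degree at most \<open>k\<close>. The local polynomials are glued by a Hermite basis: each vertex, edge, face and cube interior of
  the lattice takes its Hermite coefficients from one adjacent cube, or zero if some adjacent cube lies outside the mesh.
  Total degree at most \<open>k\<close> is what puts the normal derivatives into the smaller tangential spaces. Coefficients of cubes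
  sharing a face are compared by scaled trace inequalities, applied to test functions that approximate \<open>w\<close>, so neither
  Sobolev embeddings nor trace spaces enter.\<close>

section \<open>Square-integrable functions\<close>

text \<open>The difficulty is a C1 interpolant in the Bell space for functions with only
  \<open>m\<close> weak derivatives, where \<open>m\<close> is \<open>k + 1\<close> for the solution
  and 4 for the dual problem: vertex data of tensor Hermite elements include mixed derivatives that
  need not exist pointwise. Local polynomials avoid point values, and the price is the comparison of
  neighbours. If p and q approximate one smooth \<phi> on two cubes with a common face, then p - q =
  (\<phi> - q) - (\<phi> - p) there, so the jump is bounded by the two errors, weighted by powers of
  \<open>h\<close> that make all constants scale invariant. Outside the mesh the polynomial 0 meets
  test functions that vanish, so the error there is 0 and the boundary condition is absorbed. The
  bound on \<open>k\<close> enters where cubic Hermite factors must have degree at most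
  \<open>k - 1\<close> in tangential directions and where 4 must not exceed \<open>k + 1\<close>.
  The regularity hypothesis speaks of given solutions, so the dual solution is constructed, by
  minimising the energy over test functions.\<close>

definition sqint :: "'a measure \<Rightarrow> ('a \<Rightarrow> real) \<Rightarrow> bool" where
  "sqint M f \<longleftrightarrow> f \<in> borel_measurable M \<and> integrable M (\<lambda>x. (f x)\<^sup>2)"

text \<open>Taken over an arbitrary measure because the estimates move between
  \<open>lebesgue_on\<close> of the domain, single mesh cubes and \<open>lborel\<close>.\<close>

definition l2 :: "'a measure \<Rightarrow> ('a \<Rightarrow> real) \<Rightarrow> real" where
  "l2 M f = sqrt (\<integral>x. (f x)\<^sup>2 \<partial>M)"

lemma sqint_meas: "sqint M f \<Longrightarrow> f \<in> borel_measurable M"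
  by (simp add: sqint_def)

lemma sqint_mult:
  assumes "sqint M f" "sqint M g" shows "integrable M (\<lambda>x. f x * g x)"
proof (rule Bochner_Integration.integrable_bound)
  show "integrable M (\<lambda>x. (f x)\<^sup>2 + (g x)\<^sup>2)" using assms by (auto simp: sqint_def)
  show "(\<lambda>x. f x * g x) \<in> borel_measurable M" using assms by (auto simp: sqint_def)
  have "\<bar>a * b\<bar> \<le> a\<^sup>2 + b\<^sup>2" for a b :: real
  proof -
    have "2 * (\<bar>a\<bar> * \<bar>b\<bar>) \<le> a\<^sup>2 + b\<^sup>2"
      using zero_le_power2[of "\<bar>a\<bar> - \<bar>b\<bar>"] by (simp add: power2_diff)
    then show ?thesis by (simp add: abs_mult) (smt (verit) mult_nonneg_nonneg abs_ge_zero)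
  qed
  then show "AE x in M. norm (f x * g x) \<le> norm ((f x)\<^sup>2 + (g x)\<^sup>2)"
    by (auto intro!: AE_I2)
qed

lemma sqint_add: assumes "sqint M f" "sqint M g" shows "sqint M (\<lambda>x. f x + g x)"
proof -
  have "integrable M (\<lambda>x. (f x)\<^sup>2 + 2 * (f x * g x) + (g x)\<^sup>2)"
    using assms sqint_mult[OF assms] by (auto simp: sqint_def)
  moreover have "(\<lambda>x. (f x)\<^sup>2 + 2 * (f x * g x) + (g x)\<^sup>2) = (\<lambda>x. (f x + g x)\<^sup>2)"
    by (auto simp: power2_eq_square algebra_simps)
  ultimately show ?thesis using assms by (auto simp: sqint_def)
qed

lemma sqint_cmult: "sqint M f \<Longrightarrow> sqint M (\<lambda>x. c * f x)"
  by (auto simp: sqint_def power_mult_distrib)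

lemma sqint_minus: "sqint M f \<Longrightarrow> sqint M (\<lambda>x. - f x)"
  by (auto simp: sqint_def)

lemma sqint_diff: "sqint M f \<Longrightarrow> sqint M g \<Longrightarrow> sqint M (\<lambda>x. f x - g x)"
  using sqint_add[OF _ sqint_minus] by fastforce

lemma sqint_zero: "sqint M (\<lambda>x. 0)"
  by (auto simp: sqint_def)

lemma sqint_sum: "(\<And>i. i \<in> I \<Longrightarrow> sqint M (f i)) \<Longrightarrow> sqint M (\<lambda>x. \<Sum>i\<in>I. f i x)"
  by (induction I rule: infinite_finite_induct) (auto intro: sqint_add sqint_zero)

lemma sqint_cong_AE:
  assumes "sqint M f" "g \<in> borel_measurable M" "AE x in M. f x = g x" shows "sqint M g"
proof -
  have "AE x in M. (f x)\<^sup>2 = (g x)\<^sup>2" using assms(3) by eventually_elim simp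
  then show ?thesis using assms unfolding sqint_def
    by (auto intro: integrable_cong_AE_imp)
qed

lemma sqint_bounded:
  assumes "finite_measure M" "f \<in> borel_measurable M" "\<And>x. x \<in> space M \<Longrightarrow> \<bar>f x\<bar> \<le> B"
  shows "sqint M f"
proof -
  interpret finite_measure M by fact
  have "integrable M (\<lambda>x. (f x)\<^sup>2)"
  proof (rule integrable_const_bound[where B = "B\<^sup>2"])
    show "AE x in M. norm ((f x)\<^sup>2) \<le> B\<^sup>2"
    proof (rule AE_I2)
      fix x assume "x \<in> space M"
      then have "\<bar>f x\<bar>\<^sup>2 \<le> B\<^sup>2" using assms(3) by (intro power_mono) auto
      then show "norm ((f x)\<^sup>2) \<le> B\<^sup>2" by simp
    qed
  qed (use assms in simp)
  with assms show ?thesis by (simp add: sqint_def)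
qed

lemma l2_nonneg: "0 \<le> l2 M f"
  by (simp add: l2_def)

lemma l2_sq: "(l2 M f)\<^sup>2 = (\<integral>x. (f x)\<^sup>2 \<partial>M)"
  by (simp add: l2_def)

lemma l2_cong_AE:
  assumes "f \<in> borel_measurable M" "g \<in> borel_measurable M" "AE x in M. f x = g x"
  shows "l2 M f = l2 M g"
proof -
  have "AE x in M. (f x)\<^sup>2 = (g x)\<^sup>2" using assms(3) by eventually_elim simp
  then show ?thesis unfolding l2_def using assms by (auto intro!: arg_cong[where f=sqrt] integral_cong_AE)
qed

text \<open>The quadratic t \<mapsto> \<integral>(t f + g)^2 is nonnegative, and its value at the
  minimiser gives the inequality; a vanishing leading coefficient is treated apart.\<close>

lemma l2_CS:
  assumes f: "sqint M f" and g: "sqint M g"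
  shows "\<bar>\<integral>x. f x * g x \<partial>M\<bar> \<le> l2 M f * l2 M g"
proof -
  let ?A = "\<integral>x. (f x)\<^sup>2 \<partial>M" and ?B = "\<integral>x. (g x)\<^sup>2 \<partial>M" and ?I = "\<integral>x. f x * g x \<partial>M"
  have q: "0 \<le> ?A * t\<^sup>2 + 2 * t * ?I + ?B" for t
  proof -
    have "0 \<le> (\<integral>x. (t * f x + g x)\<^sup>2 \<partial>M)" by simp
    also have "(\<lambda>x. (t * f x + g x)\<^sup>2) = (\<lambda>x. t\<^sup>2 * (f x)\<^sup>2 + (2 * t) * (f x * g x) + (g x)\<^sup>2)"
      by (auto simp: power2_eq_square algebra_simps)
    also have "(\<integral>x. t\<^sup>2 * (f x)\<^sup>2 + (2 * t) * (f x * g x) + (g x)\<^sup>2 \<partial>M) = t\<^sup>2 * ?A + (2 * t) * ?I + ?B"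
      using f g sqint_mult[OF f g] by (simp add: sqint_def)
    finally show ?thesis by (simp add: algebra_simps)
  qed
  have A0: "?A \<ge> 0" and B0: "?B \<ge> 0" by simp_all
  have "?I\<^sup>2 \<le> ?A * ?B"
  proof (cases "?A = 0")
    case True
    have "?I = 0"
    proof (rule ccontr)
      assume n: "?I \<noteq> 0"
      \<comment> \<open>With \<open>?A = 0\<close> the quadratic is linear in t, and this t is
        chosen to make it equal to -1.\<close>
      have "0 \<le> 2 * (- (?B + 1) / (2 * ?I)) * ?I + ?B" using q[of "- (?B + 1) / (2 * ?I)"] True by simp
      also have "2 * (- (?B + 1) / (2 * ?I)) * ?I = - (?B + 1)"
        using n by (simp add: field_simps)
      finally show False by simp
    qed
    then show ?thesis by simp
  next
    case False
    then have p: "?A > 0" using A0 by linarith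
    have "0 \<le> ?A * (- ?I / ?A)\<^sup>2 + 2 * (- ?I / ?A) * ?I + ?B" by (rule q)
    also have "\<dots> = ?B - ?I\<^sup>2 / ?A" using p by (simp add: power2_eq_square field_simps)
    finally show ?thesis using p by (simp add: field_simps)
  qed
  then have "sqrt (?I\<^sup>2) \<le> sqrt (?A * ?B)" by (rule real_sqrt_le_mono)
  then show ?thesis by (simp add: l2_def real_sqrt_mult)
qed

lemma l2_triangle:
  assumes f: "sqint M f" and g: "sqint M g"
  shows "l2 M (\<lambda>x. f x + g x) \<le> l2 M f + l2 M g"
proof (rule power2_le_imp_le)
  have "(l2 M (\<lambda>x. f x + g x))\<^sup>2 = (\<integral>x. (f x)\<^sup>2 + 2 * (f x * g x) + (g x)\<^sup>2 \<partial>M)"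
    unfolding l2_sq by (rule Bochner_Integration.integral_cong) (auto simp: power2_eq_square algebra_simps)
  also have "\<dots> = (l2 M f)\<^sup>2 + 2 * (\<integral>x. f x * g x \<partial>M) + (l2 M g)\<^sup>2"
    unfolding l2_sq using f g sqint_mult[OF f g] by (simp add: sqint_def)
  also have "\<dots> \<le> (l2 M f + l2 M g)\<^sup>2"
    using l2_CS[OF f g] by (simp add: power2_sum)
  finally show "(l2 M (\<lambda>x. f x + g x))\<^sup>2 \<le> (l2 M f + l2 M g)\<^sup>2" .
  show "0 \<le> l2 M f + l2 M g" by (simp add: l2_nonneg)
qed

lemma l2_cmult: "l2 M (\<lambda>x. c * f x) = \<bar>c\<bar> * l2 M f"
  by (simp add: l2_def power_mult_distrib real_sqrt_mult)

lemma l2_diff_commute: "l2 M (\<lambda>x. f x - g x) = l2 M (\<lambda>x. g x - f x)"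
  by (simp add: l2_def power2_commute)

lemma l2_triangle_diff:
  assumes "sqint M f" "sqint M g" "sqint M k"
  shows "l2 M (\<lambda>x. f x - k x) \<le> l2 M (\<lambda>x. f x - g x) + l2 M (\<lambda>x. g x - k x)"
  using l2_triangle[of M "\<lambda>x. f x - g x" "\<lambda>x. g x - k x"] assms by (simp add: sqint_diff)

lemma l2_reverse:
  assumes "sqint M f" "sqint M g"
  shows "\<bar>l2 M f - l2 M g\<bar> \<le> l2 M (\<lambda>x. f x - g x)"
  using l2_triangle_diff[of M f g "\<lambda>_. 0"] l2_triangle_diff[of M g f "\<lambda>_. 0"] assms
  by (simp add: sqint_zero l2_diff_commute[of M g f])

lemma l2_sum_le:
  assumes "\<And>i. i \<in> I \<Longrightarrow> sqint M (f i)"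
  shows "l2 M (\<lambda>x. \<Sum>i\<in>I. f i x) \<le> (\<Sum>i\<in>I. l2 M (f i))"
  using assms
proof (induction I rule: infinite_finite_induct)
  case (insert i I)
  have "l2 M (\<lambda>x. f i x + (\<Sum>i\<in>I. f i x)) \<le> l2 M (f i) + l2 M (\<lambda>x. \<Sum>i\<in>I. f i x)"
    using insert.prems by (intro l2_triangle sqint_sum) auto
  also have "l2 M (\<lambda>x. \<Sum>i\<in>I. f i x) \<le> (\<Sum>i\<in>I. l2 M (f i))"
    using insert by auto
  finally show ?case using insert.hyps by simp
qed (auto simp: l2_def)

lemma l2_tendsto:
  assumes "\<And>n. sqint M (f n)" "sqint M g" "(\<lambda>n. l2 M (\<lambda>x. f n x - g x)) \<longlonglongrightarrow> 0"
  shows "(\<lambda>n. l2 M (f n)) \<longlonglongrightarrow> l2 M g"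
proof -
  have "(\<lambda>n. l2 M (f n) - l2 M g) \<longlonglongrightarrow> 0"
    by (rule Lim_null_comparison[OF _ assms(3)]) (simp add: l2_reverse assms)
  then show ?thesis by (simp add: LIM_zero_iff)
qed

text \<open>The difference of the products splits into (f_n - f') g_n + f' (g_n - g'); the norms of
  g_n stay bounded because they converge.\<close>

lemma l2_ip_tendsto:
  assumes f: "\<And>n. sqint M (f n)" "sqint M f'" "(\<lambda>n. l2 M (\<lambda>x. f n x - f' x)) \<longlonglongrightarrow> 0"
    and g: "\<And>n. sqint M (g n)" "sqint M g'" "(\<lambda>n. l2 M (\<lambda>x. g n x - g' x)) \<longlonglongrightarrow> 0"
  shows "(\<lambda>n. \<integral>x. f n x * g n x \<partial>M) \<longlonglongrightarrow> (\<integral>x. f' x * g' x \<partial>M)"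
proof -
  have b: "\<bar>(\<integral>x. f n x * g n x \<partial>M) - (\<integral>x. f' x * g' x \<partial>M)\<bar>
     \<le> l2 M (\<lambda>x. f n x - f' x) * l2 M (g n) + l2 M f' * l2 M (\<lambda>x. g n x - g' x)" for n
  proof -
    have "(\<integral>x. f n x * g n x \<partial>M) - (\<integral>x. f' x * g' x \<partial>M)
       = (\<integral>x. (f n x - f' x) * g n x \<partial>M) + (\<integral>x. f' x * (g n x - g' x) \<partial>M)"
      by (simp add: left_diff_distrib right_diff_distrib Bochner_Integration.integral_diff
          sqint_mult[OF f(1) g(1)] sqint_mult[OF f(2) g(1)] sqint_mult[OF f(2) g(2)])
    then show ?thesis
      using l2_CS[OF sqint_diff[OF f(1)[of n] f(2)] g(1)[of n]]
        l2_CS[OF f(2) sqint_diff[OF g(1)[of n] g(2)]] by linarith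
  qed
  have "(\<lambda>n. l2 M (\<lambda>x. f n x - f' x) * l2 M (g n) + l2 M f' * l2 M (\<lambda>x. g n x - g' x)) \<longlonglongrightarrow> 0 * l2 M g' + l2 M f' * 0"
    by (intro tendsto_intros f g l2_tendsto)
  then have z: "(\<lambda>n. l2 M (\<lambda>x. f n x - f' x) * l2 M (g n) + l2 M f' * l2 M (\<lambda>x. g n x - g' x)) \<longlonglongrightarrow> 0" by simp
  have "(\<lambda>n. (\<integral>x. f n x * g n x \<partial>M) - (\<integral>x. f' x * g' x \<partial>M)) \<longlonglongrightarrow> 0"
    by (rule Lim_null_comparison[OF _ z]) (simp add: b)
  then show ?thesis by (simp add: LIM_zero_iff)
qed

lemma l2_mono:
  assumes "sqint M g" "f \<in> borel_measurable M" "\<And>x. x \<in> space M \<Longrightarrow> \<bar>f x\<bar> \<le> \<bar>g x\<bar>"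
  shows "sqint M f" "l2 M f \<le> l2 M g"
proof -
  have le: "(f x)\<^sup>2 \<le> (g x)\<^sup>2" if "x \<in> space M" for x using assms(3)[OF that] by (simp add: abs_le_square_iff)
  show s: "sqint M f" unfolding sqint_def
    using assms le by (auto simp: sqint_def intro!: Bochner_Integration.integrable_bound[of M "\<lambda>x. (g x)\<^sup>2"] AE_I2)
  show "l2 M f \<le> l2 M g" unfolding l2_def
    using assms s le by (auto intro!: integral_mono simp: sqint_def)
qed

text \<open>Riesz-Fischer. On a finite measure an L2 Cauchy sequence is L1 Cauchy, which provides a
  subsequence converging almost everywhere; Fatou's lemma then makes the pointwise limit the L2
  limit of the whole sequence.\<close>

theorem l2_complete:
  fixes f :: "nat \<Rightarrow> 'a \<Rightarrow> real"
  assumes M: "finite_measure M" and f: "\<And>n. sqint M (f n)"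
    and C: "\<And>e. e > 0 \<Longrightarrow> \<exists>N. \<forall>i\<ge>N. \<forall>j\<ge>N. l2 M (\<lambda>x. f i x - f j x) < e"
  obtains g where "sqint M g" "(\<lambda>n. l2 M (\<lambda>x. f n x - g x)) \<longlonglongrightarrow> 0"
proof -
  interpret finite_measure M by fact
  have one: "sqint M (\<lambda>x. 1)" by (auto simp: sqint_def)
  have [measurable]: "f n \<in> borel_measurable M" for n using f sqint_meas by auto
  have L1: "integrable M (f n)" for n using sqint_mult[OF f[of n] one] by simp
  have "\<exists>N. \<forall>i\<ge>N. \<forall>j\<ge>N. (LINT x|M. norm (f i x - f j x)) < e" if "e > 0" for e
  proof -
    let ?c = "l2 M (\<lambda>x. 1) + 1"
    have c: "?c > 0" using l2_nonneg[of M "\<lambda>x. 1"] by simp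
    obtain N where N: "\<forall>i\<ge>N. \<forall>j\<ge>N. l2 M (\<lambda>x. f i x - f j x) < e / ?c"
      using C[of "e / ?c"] divide_pos_pos[OF \<open>e > 0\<close> c] by blast
    have "(LINT x|M. norm (f i x - f j x)) < e" if "i \<ge> N" "j \<ge> N" for i j
    proof -
      let ?d = "\<lambda>x. \<bar>f i x - f j x\<bar>"
      have s: "sqint M ?d" using sqint_diff[OF f[of i] f[of j]] by (auto simp: sqint_def)
      have "(LINT x|M. norm (f i x - f j x)) \<le> \<bar>LINT x|M. ?d x * 1\<bar>" by simp
      also have "\<dots> \<le> l2 M ?d * l2 M (\<lambda>x. 1)" using l2_CS[OF s one] .
      also have "l2 M ?d = l2 M (\<lambda>x. f i x - f j x)" by (simp add: l2_def)
      also have "l2 M (\<lambda>x. f i x - f j x) * l2 M (\<lambda>x. 1) \<le> l2 M (\<lambda>x. f i x - f j x) * ?c"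
        by (intro mult_left_mono) (auto simp: l2_nonneg)
      also have "\<dots> < e" using N that c by (simp add: field_simps)
      finally show ?thesis .
    qed
    then show ?thesis by blast
  qed
  from cauchy_L1_AE_cauchy_subseq[OF L1 this]
  obtain r where r: "strict_mono r" and cau: "AE x in M. Cauchy (\<lambda>i. f (r i) x)" by blast
  define g where "g = (\<lambda>x. lim (\<lambda>i. f (r i) x))"
  have gm[measurable]: "g \<in> borel_measurable M" unfolding g_def by measurable
  have lim: "AE x in M. (\<lambda>i. f (r i) x) \<longlonglongrightarrow> g x"
    using cau by eventually_elim (simp add: g_def real_Cauchy_convergent flip: convergent_LIMSEQ_iff)
  \<comment> \<open>Fatou's lemma is applied along the subsequence in the second index only; the
    first index \<open>n\<close> stays free, which is why the whole sequence converges.\<close>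
  have key: "(\<integral>\<^sup>+x. ennreal ((f n x - g x)\<^sup>2) \<partial>M) \<le> ennreal (e\<^sup>2)"
    if e: "e > 0" and N: "\<forall>i\<ge>N. \<forall>j\<ge>N. l2 M (\<lambda>x. f i x - f j x) < e" and n: "n \<ge> N" for n e N
  proof -
    have "(\<integral>\<^sup>+x. ennreal ((f n x - g x)\<^sup>2) \<partial>M) = (\<integral>\<^sup>+x. liminf (\<lambda>i. ennreal ((f n x - f (r i) x)\<^sup>2)) \<partial>M)"
    proof (rule nn_integral_cong_AE)
      show "AE x in M. ennreal ((f n x - g x)\<^sup>2) = liminf (\<lambda>i. ennreal ((f n x - f (r i) x)\<^sup>2))"
        using lim
      proof eventually_elim
        case (elim x)
        then have "(\<lambda>i. ennreal ((f n x - f (r i) x)\<^sup>2)) \<longlonglongrightarrow> ennreal ((f n x - g x)\<^sup>2)"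
          by (intro tendsto_intros)
        then show ?case by (metis lim_imp_Liminf trivial_limit_sequentially)
      qed
    qed
    also have "\<dots> \<le> liminf (\<lambda>i. \<integral>\<^sup>+x. ennreal ((f n x - f (r i) x)\<^sup>2) \<partial>M)"
      by (rule nn_integral_liminf) measurable
    also have "\<dots> \<le> ennreal (e\<^sup>2)"
    proof -
      have "\<forall>\<^sub>F i in sequentially. (\<integral>\<^sup>+x. ennreal ((f n x - f (r i) x)\<^sup>2) \<partial>M) \<le> ennreal (e\<^sup>2)"
      proof (rule eventually_sequentiallyI[of N])
        fix i assume "N \<le> i"
        then have "r i \<ge> N" using seq_suble[OF r, of i] by simp
        then have "l2 M (\<lambda>x. f n x - f (r i) x) < e" using N n by simp
        then have "(l2 M (\<lambda>x. f n x - f (r i) x))\<^sup>2 \<le> e\<^sup>2"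
          using l2_nonneg e by (intro power_mono) auto
        moreover have "integrable M (\<lambda>x. (f n x - f (r i) x)\<^sup>2)"
          using sqint_diff[OF f f] by (simp add: sqint_def)
        ultimately show "(\<integral>\<^sup>+x. ennreal ((f n x - f (r i) x)\<^sup>2) \<partial>M) \<le> ennreal (e\<^sup>2)"
          by (subst nn_integral_eq_integral) (auto simp: l2_sq intro!: ennreal_leI)
      qed
      then have "liminf (\<lambda>i. \<integral>\<^sup>+x. ennreal ((f n x - f (r i) x)\<^sup>2) \<partial>M) \<le> liminf (\<lambda>i. ennreal (e\<^sup>2))"
        by (rule Liminf_mono)
      then show ?thesis by (simp add: Liminf_const)
    qed
    finally show ?thesis .
  qed
  have sq: "sqint M (\<lambda>x. f n x - g x)" if e: "e > 0" and N: "\<forall>i\<ge>N. \<forall>j\<ge>N. l2 M (\<lambda>x. f i x - f j x) < e" and n: "n \<ge> N" for n e N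
    unfolding sqint_def
    by (intro conjI integrableI_nonneg AE_I2) (use key[OF that] in \<open>auto intro: le_less_trans\<close>)
  obtain N0 where N0: "\<forall>i\<ge>N0. \<forall>j\<ge>N0. l2 M (\<lambda>x. f i x - f j x) < 1" using C[of 1] by auto
  \<comment> \<open>The limit is \<open>f N0\<close> minus the difference \<open>f N0 - g\<close>,
    and both are already square integrable.\<close>
  have g: "sqint M g"
    using sqint_diff[OF f[of N0] sq[OF _ N0, of N0]] by simp
  have "(\<lambda>n. l2 M (\<lambda>x. f n x - g x)) \<longlonglongrightarrow> 0"
  proof (rule LIMSEQ_I)
    fix e :: real assume e: "e > 0"
    obtain N where N: "\<forall>i\<ge>N. \<forall>j\<ge>N. l2 M (\<lambda>x. f i x - f j x) < e/2" using C[of "e/2"] e by auto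
    have "norm (l2 M (\<lambda>x. f n x - g x) - 0) < e" if n: "n \<ge> N" for n
    proof -
      have "ennreal (\<integral>x. (f n x - g x)\<^sup>2 \<partial>M) \<le> ennreal ((e/2)\<^sup>2)"
        using key[OF _ N n] e sqint_diff[OF f g, of n]
        by (subst nn_integral_eq_integral[symmetric]) (auto simp: sqint_def)
      then have "(l2 M (\<lambda>x. f n x - g x))\<^sup>2 \<le> (e/2)\<^sup>2" by (simp add: l2_sq)
      then have "l2 M (\<lambda>x. f n x - g x) \<le> e/2" using e power2_le_imp_le by fastforce
      then show ?thesis using e l2_nonneg[of M "\<lambda>x. f n x - g x"] by simp
    qed
    then show "\<exists>no. \<forall>n\<ge>no. norm (l2 M (\<lambda>x. f n x - g x) - 0) < e" by blast
  qed
  with g that show thesis by blast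
qed

section \<open>Passage between Lebesgue measure on a domain and Borel measure\<close>

lemma L2_eq_sqint: "L2 \<Omega> u = sqint (lebesgue_on \<Omega>) u"
  by (simp add: L2_def sqint_def)

lemma norm0_eq_l2: "norm0 \<Omega> u = l2 (lebesgue_on \<Omega>) u"
  by (simp add: norm0_def ip0_def l2_def power2_eq_square)

lemma lebesgue_on_integral_lborel:
  fixes f :: "'a::euclidean_space \<Rightarrow> real"
  assumes "\<Omega> \<in> sets borel" "f \<in> borel_measurable borel"
  shows "(LINT x|lebesgue_on \<Omega>. f x) = (\<integral>x. indicator \<Omega> x * f x \<partial>lborel)"
    and "integrable (lebesgue_on \<Omega>) f \<longleftrightarrow> integrable lborel (\<lambda>x. indicator \<Omega> x * f x)"
  using assms by (simp_all add: integral_restrict_space integrable_restrict_space integral_completion integrable_completion)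

lemma borel_measurable_lebesgue_onI:
  fixes f :: "'a::euclidean_space \<Rightarrow> real"
  shows "f \<in> borel_measurable borel \<Longrightarrow> f \<in> borel_measurable (lebesgue_on \<Omega>)"
  by (intro measurable_restrict_space1 measurable_completion) simp

text \<open>Tonelli's theorem is only available for the incomplete measure, hence the passage to a Borel
  representative extended by zero.\<close>
lemma sqint_borel_rep:
  fixes u :: "'a::euclidean_space \<Rightarrow> real"
  assumes \<Omega>: "\<Omega> \<in> sets borel" and u: "sqint (lebesgue_on \<Omega>) u"
  obtains U where "U \<in> borel_measurable borel" "\<And>x. x \<notin> \<Omega> \<Longrightarrow> U x = 0" "sqint lborel U"
    "AE x in lebesgue_on \<Omega>. u x = U x"
proof -
  have "(\<lambda>x. if x \<in> \<Omega> then u x else 0) \<in> borel_measurable lebesgue"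
    using u \<Omega> by (subst borel_measurable_if[of \<Omega>]) (auto simp: sqint_def)
  then obtain V where V: "V \<in> borel_measurable lborel" and ae: "AE x in lborel. (if x \<in> \<Omega> then u x else 0) = V x"
    using completion_ex_borel_measurable_real by blast
  \<comment> \<open>Multiplication by the indicator makes the representative vanish at every point
    outside \<Omega>, not merely almost everywhere.\<close>
  define U where "U = (\<lambda>x. indicator \<Omega> x * V x)"
  have Um[measurable]: "U \<in> borel_measurable borel" using V \<Omega> by (simp add: U_def)
  have "AE x in lebesgue. (if x \<in> \<Omega> then u x else 0) = V x" using AE_completion[OF ae] .
  then have aeU: "AE x in lebesgue_on \<Omega>. u x = U x"
    using \<Omega> by (subst AE_restrict_space_iff) (auto simp: U_def elim!: eventually_mono)
  have "sqint (lebesgue_on \<Omega>) U"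
    by (rule sqint_cong_AE[OF u _ aeU]) (rule borel_measurable_lebesgue_onI[OF Um])
  then have "integrable lborel (\<lambda>x. indicator \<Omega> x * (U x)\<^sup>2)"
    using lebesgue_on_integral_lborel(2)[OF \<Omega>, of "\<lambda>x. (U x)\<^sup>2"] by (simp add: sqint_def)
  moreover have "(\<lambda>x. indicator \<Omega> x * (U x)\<^sup>2) = (\<lambda>x. (U x)\<^sup>2)"
    by (auto simp: U_def indicator_def)
  ultimately have "sqint lborel U" by (simp add: sqint_def)
  then show thesis using that[of U] aeU Um by (auto simp: U_def)
qed

section \<open>Smooth functions and iterated partial derivatives\<close>

abbreviation ax :: "'n::finite \<Rightarrow> real^'n" where "ax i \<equiv> axis i 1"

text \<open>The first half of \<open>test_fun\<close>, split off so that polynomials and mollified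
  functions fall under it as well. Differentiability is only asked along the axes; other directions
  follow from the continuity of the partial derivatives.\<close>

definition smooth :: "(real^'n::finite \<Rightarrow> real) \<Rightarrow> bool" where
  "smooth \<phi> \<longleftrightarrow> (\<forall>is. continuous_on UNIV (pds is \<phi>) \<and>
           (\<forall>i x. (\<lambda>t. pds is \<phi> (x + t *\<^sub>R ax i)) differentiable (at 0)))"

definition cpt_supp :: "(real^'n::finite \<Rightarrow> real) \<Rightarrow> bool" where
  "cpt_supp \<phi> \<longleftrightarrow> compact (closure {x. \<phi> x \<noteq> 0})"

lemma test_fun_iff:
  "test_fun \<Omega> \<phi> \<longleftrightarrow> smooth \<phi> \<and> cpt_supp \<phi> \<and> closure {x. \<phi> x \<noteq> 0} \<subseteq> \<Omega>"
  by (simp add: test_fun_def smooth_def cpt_supp_def)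

lemma test_funD: assumes "test_fun \<Omega> \<phi>" shows "smooth \<phi>" "cpt_supp \<phi>" "x \<notin> \<Omega> \<Longrightarrow> \<phi> x = 0"
  using assms closure_subset[of "{x. \<phi> x \<noteq> 0}"] by (auto simp: test_fun_iff)

lemma smooth_cont: "smooth \<phi> \<Longrightarrow> continuous_on UNIV (pds is \<phi>)"
  by (simp add: smooth_def)

lemma smooth_borel: "smooth \<phi> \<Longrightarrow> pds is \<phi> \<in> borel_measurable borel"
  by (simp add: smooth_def borel_measurable_continuous_onI)

lemma smooth_deriv0:
  assumes "smooth \<phi>"
  shows "((\<lambda>t. pds is \<phi> (x + t *\<^sub>R ax i)) has_real_derivative pds (i # is) \<phi> x) (at 0)"
  using assms by (auto simp: smooth_def pdx_def DERIV_deriv_iff_real_differentiable)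

lemma smooth_deriv:
  assumes "smooth \<phi>"
  shows "((\<lambda>t. pds is \<phi> (x + t *\<^sub>R ax i)) has_real_derivative pds (i # is) \<phi> (x + t *\<^sub>R ax i)) (at t)"
proof -
  have "((\<lambda>s. pds is \<phi> ((x + t *\<^sub>R ax i) + s *\<^sub>R ax i)) has_real_derivative pds (i # is) \<phi> (x + t *\<^sub>R ax i)) (at 0)"
    by (rule smooth_deriv0[OF assms])
  then show ?thesis
    using DERIV_shift[of "\<lambda>t. pds is \<phi> (x + t *\<^sub>R ax i)" "pds (i # is) \<phi> (x + t *\<^sub>R ax i)" 0 t]
    by (simp add: scaleR_add_left algebra_simps)
qed

text \<open>Reduces smoothness to exhibiting candidates: a family of continuous functions indexed by
  lists and closed under one more axis derivative must be the family of iterated derivatives. Sums,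
  tensor products, mollifications and scaled kernels are all treated this way.\<close>

lemma smooth_family:
  assumes d: "\<And>is i x. ((\<lambda>t. F is (x + t *\<^sub>R ax i)) has_real_derivative F (i # is) x) (at 0)"
    and c: "\<And>is. continuous_on UNIV (F is)" and F0: "F [] = \<phi>"
  shows "smooth \<phi>" "pds is \<phi> = F is"
proof -
  have pds_F: "pds is \<phi> = F is" for "is"
  proof (induction "is")
    case (Cons i "is")
    have "pdx i (F is) x = F (i # is) x" for x
      unfolding pdx_def by (rule DERIV_imp_deriv[OF d])
    with Cons show ?case by auto
  qed (simp add: F0)
  then show "pds is \<phi> = F is" .
  show "smooth \<phi>" unfolding smooth_def pds_F
    using c d real_differentiable_def by blast
qed

lemma pds_append: "pds (is @ js) f = pds is (pds js f)"
  by (induction "is") auto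

lemma smooth_pds: assumes "smooth \<phi>" shows "smooth (pds js \<phi>)"
  using assms unfolding smooth_def pds_append[symmetric] by blast

lemma smooth_add:
  assumes "smooth f" "smooth g"
  shows "smooth (\<lambda>x. f x + g x)" "pds is (\<lambda>x. f x + g x) = (\<lambda>x. pds is f x + pds is g x)"
  by (rule smooth_family[where F = "\<lambda>is x. pds is f x + pds is g x"];
      use assms in \<open>auto intro!: derivative_eq_intros continuous_on_add smooth_deriv0 smooth_cont simp del: pds.simps(2)\<close>; simp)+

lemma smooth_cmult:
  assumes "smooth f"
  shows "smooth (\<lambda>x. c * f x)" "pds is (\<lambda>x. c * f x) = (\<lambda>x. c * pds is f x)"
  by (rule smooth_family[where F = "\<lambda>is x. c * pds is f x"];
      use assms in \<open>auto intro!: DERIV_cmult continuous_on_mult_left smooth_deriv0 smooth_cont simp del: pds.simps(2)\<close>; simp)+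

lemma smooth_zero: "smooth (\<lambda>x. 0)" "pds is (\<lambda>x. 0) = (\<lambda>x. 0)"
  by (rule smooth_family[where F = "\<lambda>is x. 0"]; auto)+

lemma smooth_diff:
  assumes "smooth f" "smooth g"
  shows "smooth (\<lambda>x. f x - g x)" "pds is (\<lambda>x. f x - g x) = (\<lambda>x. pds is f x - pds is g x)"
  using smooth_add[OF assms(1) smooth_cmult(1)[OF assms(2), where c = "-1"]] smooth_cmult(2)[OF assms(2), where c = "-1"]
  by auto

lemma smooth_sum:
  assumes "\<And>a. a \<in> A \<Longrightarrow> smooth (f a)"
  shows "smooth (\<lambda>x. \<Sum>a\<in>A. f a x)" "pds is (\<lambda>x. \<Sum>a\<in>A. f a x) = (\<lambda>x. \<Sum>a\<in>A. pds is (f a) x)"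
proof -
  have "smooth (\<lambda>x. \<Sum>a\<in>A. f a x) \<and> pds is (\<lambda>x. \<Sum>a\<in>A. f a x) = (\<lambda>x. \<Sum>a\<in>A. pds is (f a) x)"
    using assms
  proof (induction A rule: infinite_finite_induct)
    case (insert a A)
    then have "smooth (\<lambda>x. \<Sum>a\<in>A. f a x)" "pds is (\<lambda>x. \<Sum>a\<in>A. f a x) = (\<lambda>x. \<Sum>a\<in>A. pds is (f a) x)" by auto
    with smooth_add[of "f a" "\<lambda>x. \<Sum>a\<in>A. f a x"] insert show ?case by simp
  qed (auto simp: smooth_zero)
  then show "smooth (\<lambda>x. \<Sum>a\<in>A. f a x)" "pds is (\<lambda>x. \<Sum>a\<in>A. f a x) = (\<lambda>x. \<Sum>a\<in>A. pds is (f a) x)" by auto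
qed

text \<open>The open set keeps a whole neighbourhood of the base point on each axis line, so the
  induction hypothesis can be differentiated once more.\<close>

lemma pds_local:
  assumes "open S" "\<And>x. x \<in> S \<Longrightarrow> f x = g x" "x \<in> S"
  shows "pds is f x = pds is g x"
  using assms(3)
proof (induction "is" arbitrary: x)
  case (Cons i "is")
  have "open {t. x + t *\<^sub>R ax i \<in> S}"
  proof -
    have "continuous_on UNIV (\<lambda>t. x + t *\<^sub>R ax i)" by (intro continuous_intros)
    from open_vimage[OF assms(1) this] show ?thesis by (simp add: vimage_def)
  qed
  then have "\<forall>\<^sub>F t in nhds 0. t \<in> {t. x + t *\<^sub>R ax i \<in> S}"
    using Cons.prems by (intro eventually_nhds_in_open) auto
  then have "\<forall>\<^sub>F t in nhds 0. x + t *\<^sub>R ax i \<in> S" by simp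
  then have "\<forall>\<^sub>F t in nhds 0. pds is f (x + t *\<^sub>R ax i) = pds is g (x + t *\<^sub>R ax i)"
    by eventually_elim (rule Cons.IH)
  then show ?case by (simp add: pdx_def deriv_cong_ev)
qed (use assms in auto)

lemma pds_zero_outside:
  assumes "x \<notin> closure {x. \<phi> x \<noteq> 0}" shows "pds is \<phi> x = 0"
proof -
  have "pds is \<phi> x = pds is (\<lambda>x. 0) x"
    by (rule pds_local[of "- closure {x. \<phi> x \<noteq> 0}"]) (use assms closure_subset[of "{x. \<phi> x \<noteq> 0}"] in auto)
  then show ?thesis by (simp add: smooth_zero)
qed

lemma supp_pds: "closure {x. pds is \<phi> x \<noteq> 0} \<subseteq> closure {x. \<phi> x \<noteq> 0}"
  by (rule closure_minimal) (use pds_zero_outside in auto)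

lemma cpt_supp_pds: "cpt_supp \<phi> \<Longrightarrow> cpt_supp (pds is \<phi>)"
  unfolding cpt_supp_def using supp_pds compact_closure bounded_subset by (metis closed_closure closed_Int_compact inf.absorb_iff1)

lemma test_fun_pds: "test_fun \<Omega> \<phi> \<Longrightarrow> test_fun \<Omega> (pds is \<phi>)"
  unfolding test_fun_iff using smooth_pds cpt_supp_pds supp_pds by blast

lemma cpt_supp_bounded:
  assumes "cpt_supp \<phi>" obtains R where "\<And>x. \<phi> x \<noteq> 0 \<Longrightarrow> norm x \<le> R"
  using compact_imp_bounded[OF assms[unfolded cpt_supp_def]] closure_subset[of "{x. \<phi> x \<noteq> 0}"]
  unfolding bounded_iff by blast

lemma bounded_cpt_supp:
  assumes "\<And>x. \<phi> x \<noteq> 0 \<Longrightarrow> norm x \<le> R" shows "cpt_supp \<phi>"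
  unfolding cpt_supp_def compact_closure bounded_iff using assms by blast

lemma cpt_supp_pds_bound:
  assumes "smooth \<phi>" "cpt_supp \<phi>" obtains B where "\<And>x. \<bar>pds is \<phi> x\<bar> \<le> B" "B \<ge> 0"
proof -
  let ?K = "closure {x. \<phi> x \<noteq> 0}"
  have "compact (pds is \<phi> ` ?K)"
    using assms by (intro compact_continuous_image) (auto simp: cpt_supp_def intro: continuous_on_subset[OF smooth_cont])
  then obtain B where B: "\<And>x. x \<in> ?K \<Longrightarrow> \<bar>pds is \<phi> x\<bar> \<le> B"
    unfolding compact_eq_bounded_closed bounded_iff by auto
  have "\<bar>pds is \<phi> x\<bar> \<le> max B 0" for x
    using B[of x] pds_zero_outside[of x \<phi> "is"] by (cases "x \<in> ?K") auto
  then show thesis using that[of "max B 0"] by auto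
qed

lemma lipschitz_axis:
  fixes f :: "real^'n::finite \<Rightarrow> real"
  assumes "\<And>t. ((\<lambda>t. f (x + t *\<^sub>R ax i)) has_real_derivative g (x + t *\<^sub>R ax i)) (at t)" "\<And>y. \<bar>g y\<bar> \<le> B"
  shows "\<bar>f (x + t *\<^sub>R ax i) - f x\<bar> \<le> \<bar>t\<bar> * B"
  using field_differentiable_bound[of UNIV "\<lambda>t. f (x + t *\<^sub>R ax i)" "\<lambda>t. g (x + t *\<^sub>R ax i)" B t 0] assms
  by (simp add: mult.commute)

lemma smooth_lipschitz:
  assumes "smooth \<phi>" "\<And>y. \<bar>pds (i # is) \<phi> y\<bar> \<le> B"
  shows "\<bar>pds is \<phi> (x + t *\<^sub>R ax i) - pds is \<phi> x\<bar> \<le> \<bar>t\<bar> * B"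
  by (rule lipschitz_axis[OF smooth_deriv[OF assms(1)] assms(2)])

text \<open>\<open>F j r\<close> plays the \<open>r\<close>-th derivative of the \<open>j\<close>-th
  factor. Iterated derivatives of a tensor product depend only on how often each index occurs in the
  list, so independence of the order of differentiation is visible at once.\<close>

lemma smooth_tensor:
  fixes F :: "'n::finite \<Rightarrow> nat \<Rightarrow> real \<Rightarrow> real"
  assumes d: "\<And>j r t. (F j r has_real_derivative F j (Suc r) t) (at t)"
  shows "smooth (\<lambda>x. \<Prod>j\<in>UNIV. F j 0 (x $ j))"
    and "pds is (\<lambda>x. \<Prod>j\<in>UNIV. F j 0 (x $ j)) = (\<lambda>x. \<Prod>j\<in>UNIV. F j (count_list is j) (x $ j))"
proof -
  let ?F = "\<lambda>is x. \<Prod>j\<in>UNIV. F j (count_list is j) (x $ j)"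
  have D: "((\<lambda>t. ?F is (x + t *\<^sub>R ax i)) has_real_derivative ?F (i # is) x) (at 0)" for "is" i and x :: "real^'n"
  proof -
    have e: "?F is (x + t *\<^sub>R ax i) = F i (count_list is i) (x $ i + t) * (\<Prod>j\<in>UNIV - {i}. F j (count_list is j) (x $ j))" for t
      by (subst prod.remove[of _ i]) (auto simp: axis_def intro!: prod.cong)
    have e': "?F (i # is) x = F i (Suc (count_list is i)) (x $ i + 0) * (\<Prod>j\<in>UNIV - {i}. F j (count_list is j) (x $ j))"
      by (subst prod.remove[of _ i]) (auto intro!: prod.cong)
    have "((\<lambda>t. F i (count_list is i) (t + x $ i)) has_real_derivative F i (Suc (count_list is i)) (0 + x $ i)) (at 0)"
      using d DERIV_shift by blast
    then show ?thesis unfolding e e' by (intro DERIV_mult[THEN DERIV_cong] DERIV_const) (auto simp: add.commute)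
  qed
  have C: "continuous_on UNIV (?F is)" for "is"
  proof -
    have "continuous_on UNIV (F j r)" for j r
      using d DERIV_isCont continuous_at_imp_continuous_on by blast
    then have "continuous_on UNIV (\<lambda>x::real^'n. F j r (x $ j))" for j r
      by (rule continuous_on_compose2) (auto intro!: continuous_intros)
    then show ?thesis by (intro continuous_on_prod)
  qed
  have e: "?F [] = (\<lambda>x. \<Prod>j\<in>UNIV. F j 0 (x $ j))" by simp
  show "smooth (\<lambda>x. \<Prod>j\<in>UNIV. F j 0 (x $ j))" by (rule smooth_family(1)[where F = ?F, OF D C e])
  show "pds is (\<lambda>x. \<Prod>j\<in>UNIV. F j 0 (x $ j)) = ?F is" by (rule smooth_family(2)[where F = ?F, OF D C e])
qed

text \<open>Dominated convergence of the difference quotients. The Lipschitz bound compares with the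
  base point only and the derivative is demanded only almost everywhere, so that piecewise smooth
  integrands are covered.\<close>

lemma has_real_derivative_integral:
  fixes k :: "real \<Rightarrow> 'a \<Rightarrow> real"
  assumes int: "\<And>t. integrable M (k t)" and B: "integrable M B"
    and bound: "\<And>t x. \<bar>k t x - k 0 x\<bar> \<le> \<bar>t\<bar> * B x"
    and der: "AE x in M. ((\<lambda>t. k t x) has_real_derivative k' x) (at 0)"
    and meas: "k' \<in> borel_measurable M"
  shows "((\<lambda>t. \<integral>x. k t x \<partial>M) has_real_derivative (\<integral>x. k' x \<partial>M)) (at 0)"
  unfolding DERIV_def tendsto_at_iff_sequentially
proof (intro allI impI)
  fix X :: "nat \<Rightarrow> real" assume X: "\<forall>i. X i \<in> UNIV - {0}" "X \<longlonglongrightarrow> 0"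
  have "(\<lambda>n. \<integral>x. (k (X n) x - k 0 x) / X n \<partial>M) \<longlonglongrightarrow> (\<integral>x. k' x \<partial>M)"
  proof (rule integral_dominated_convergence[OF meas _ B])
    show "(\<lambda>x. (k (X n) x - k 0 x) / X n) \<in> borel_measurable M" for n
      using int by (intro borel_measurable_divide borel_measurable_diff borel_measurable_integrable) auto
    show "AE x in M. (\<lambda>n. (k (X n) x - k 0 x) / X n) \<longlonglongrightarrow> k' x"
      using der
    proof eventually_elim
      case (elim x)
      then have "((\<lambda>h. (k (0 + h) x - k 0 x) / h) \<circ> X) \<longlonglongrightarrow> k' x"
        using X unfolding DERIV_def tendsto_at_iff_sequentially by blast
      then show ?case by (simp add: o_def)
    qed
    show "AE x in M. norm ((k (X n) x - k 0 x) / X n) \<le> B x" for n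
      using bound[of "X n"] X by (intro AE_I2) (auto simp: field_simps)
  qed
  moreover have "(\<lambda>n. \<integral>x. (k (X n) x - k 0 x) / X n \<partial>M) = (\<lambda>h. ((\<integral>x. k (0 + h) x \<partial>M) - (\<integral>x. k 0 x \<partial>M)) / h) \<circ> X"
    using int by (auto simp: o_def)
  ultimately show "((\<lambda>h. ((\<integral>x. k (0 + h) x \<partial>M) - (\<integral>x. k 0 x \<partial>M)) / h) \<circ> X) \<longlonglongrightarrow> (\<integral>x. k' x \<partial>M)" by simp
qed

section \<open>A smooth kernel with compact support\<close>

text \<open>The functions p(1/t) exp(-1/t), extended by 0 to t \<le> 0. The class is closed under
  differentiation: \<open>p\<close> turns into s^2 (p - p') in the variable s = 1/t.\<close>

definition pexp :: "real poly \<Rightarrow> real \<Rightarrow> real" where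
  "pexp p t = (if t > 0 then poly p (1/t) * exp (- (1/t)) else 0)"

lemma poly_exp_tendsto_0: "((\<lambda>s. poly p s * exp (- s)) \<longlongrightarrow> 0) at_top" for p :: "real poly"
proof -
  have "((\<lambda>s. \<Sum>i\<le>degree p. coeff p i * (s ^ i / exp s)) \<longlongrightarrow> (\<Sum>i\<le>degree p. coeff p i * 0)) at_top"
    by (intro tendsto_intros tendsto_power_div_exp_0)
  then show ?thesis
    by (simp add: poly_altdef sum_divide_distrib exp_minus field_simps)
qed

text \<open>Only t = 0 needs an argument: the difference quotient from the right is s p(s) exp(-s)
  with s = 1/t tending to infinity, again of the decaying form.\<close>

lemma pexp_deriv: "(pexp p has_real_derivative pexp (monom 1 2 * (p - pderiv p)) t) (at t)"
proof -
  let ?q = "monom 1 2 * (p - pderiv p)"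
  consider "t > 0" | "t < 0" | "t = 0" by linarith
  then show ?thesis
  proof cases
    case 1
    have "((\<lambda>t. poly p (1/t) * exp (- (1/t))) has_real_derivative
       (poly (pderiv p) (1/t) * (- (1/t\<^sup>2))) * exp (- (1/t)) + poly p (1/t) * (exp (- (1/t)) * (1/t\<^sup>2))) (at t)"
      using 1 by (auto intro!: derivative_eq_intros DERIV_chain2[OF poly_DERIV] simp: power2_eq_square)
    also have "(poly (pderiv p) (1/t) * (- (1/t\<^sup>2))) * exp (- (1/t)) + poly p (1/t) * (exp (- (1/t)) * (1/t\<^sup>2)) = pexp ?q t"
      using 1 by (simp add: pexp_def poly_monom power2_eq_square field_simps)
    finally show ?thesis
      by (rule has_field_derivative_transform_within_open[of _ _ _ "{0<..}"]) (use 1 in \<open>auto simp: pexp_def\<close>)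
  next
    case 2
    have "((\<lambda>t. 0) has_real_derivative pexp ?q t) (at t)" using 2 by (simp add: pexp_def)
    then show ?thesis
      by (rule has_field_derivative_transform_within_open[of _ _ _ "{..<0}"]) (use 2 in \<open>auto simp: pexp_def\<close>)
  next
    case 3
    have "((\<lambda>h. pexp p h / h) \<longlongrightarrow> 0) (at 0)"
    proof (rule filterlim_split_at_real)
      show "((\<lambda>h. pexp p h / h) \<longlongrightarrow> 0) (at_left 0)"
        by (rule tendsto_eventually) (auto simp: eventually_at_filter pexp_def)
      have "((\<lambda>s. poly (pCons 0 p) s * exp (- s)) \<longlongrightarrow> 0) at_top" by (rule poly_exp_tendsto_0)
      then have "((\<lambda>h. poly (pCons 0 p) (inverse h) * exp (- inverse h)) \<longlongrightarrow> 0) (at_right 0)"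
        using filterlim_compose[OF _ filterlim_inverse_at_top_right] by fastforce
      then show "((\<lambda>h. pexp p h / h) \<longlongrightarrow> 0) (at_right 0)"
        by (rule Lim_transform_eventually) (auto simp: eventually_at_filter pexp_def field_simps)
    qed
    then show ?thesis using 3 by (simp add: DERIV_def pexp_def)
  qed
qed

text \<open>The bump is exp(-1/(1+t)) exp(-1/(1-t)) on (-1, 1). Its derivatives are sums of products
  \<open>pexp p (1 + t) * pexp q (1 - t)\<close>, coded as lists of polynomial pairs on which
  \<open>step\<close> acts by the product rule.\<close>

lemma smooth_bump_1d:
  obtains D :: "nat \<Rightarrow> real \<Rightarrow> real"
  where "\<And>r t. (D r has_real_derivative D (Suc r) t) (at t)" "\<And>r t. \<bar>t\<bar> \<ge> 1 \<Longrightarrow> D r t = 0"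
    "\<And>t. D 0 t \<ge> 0" "D 0 0 > 0"
proof -
  let ?T = "\<lambda>p. monom 1 2 * (p - pderiv p) :: real poly"
  define step where "step = (\<lambda>L. concat (map (\<lambda>(p, q). [(?T p, q), (- p, ?T q)]) L))"
  define ev where "ev = (\<lambda>L t. \<Sum>(p, q)\<leftarrow>L. pexp p (1 + t) * pexp q (1 - t))"
  have m: "pexp (- p) t = - pexp p t" for p t by (simp add: pexp_def)
  have d: "(ev L has_real_derivative ev (step L) t) (at t)" for L t
  proof (induction L)
    case (Cons a L)
    obtain p q where a: "a = (p, q)" by force
    have "((\<lambda>t. pexp p (1 + t) * pexp q (1 - t) + ev L t) has_real_derivative
      (pexp (?T p) (1 + t) * 1) * pexp q (1 - t) + (pexp (?T q) (1 - t) * (-1)) * pexp p (1 + t) + ev (step L) t) (at t)"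
      by (intro DERIV_add DERIV_mult Cons DERIV_chain2[OF pexp_deriv]) (auto intro!: derivative_eq_intros)
    moreover have "ev (a # L) = (\<lambda>t. pexp p (1 + t) * pexp q (1 - t) + ev L t)" by (auto simp: ev_def a)
    moreover have "ev (step (a # L)) t = (pexp (?T p) (1 + t) * 1) * pexp q (1 - t) + (pexp (?T q) (1 - t) * (-1)) * pexp p (1 + t) + ev (step L) t"
      by (simp add: ev_def step_def a m algebra_simps)
    ultimately show ?case by simp
  qed (simp add: ev_def step_def)
  have z: "ev L t = 0" if "\<bar>t\<bar> \<ge> 1" for L t
  proof -
    have "1 + t \<le> 0 \<or> 1 - t \<le> 0" using that by linarith
    then have "pexp p (1 + t) * pexp q (1 - t) = 0" for p q by (auto simp: pexp_def)
    then have "(\<lambda>(p, q). pexp p (1 + t) * pexp q (1 - t)) = (\<lambda>_. 0)" by auto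
    then show ?thesis by (simp add: ev_def)
  qed
  show thesis
    by (rule that[of "\<lambda>r. ev ((step ^^ r) [(1, 1)])"]) (use d z in \<open>auto simp: ev_def pexp_def\<close>)
qed

text \<open>The tensor product of the one-dimensional bump, divided by its integral. Independence of
  the order of differentiation is recorded because mollification transfers it to all compactly
  supported smooth functions.\<close>

lemma smooth_kernel_exists:
  "\<exists>\<eta> :: real^'n::finite \<Rightarrow> real. smooth \<eta> \<and> (\<forall>x. \<eta> x \<ge> 0) \<and> (\<forall>x is j. \<bar>x $ j\<bar> \<ge> 1 \<longrightarrow> pds is \<eta> x = 0) \<and>
     integrable lborel \<eta> \<and> (\<integral>x. \<eta> x \<partial>lborel) = 1 \<and>
     (\<forall>is js. mset is = mset js \<longrightarrow> pds is \<eta> = pds js \<eta>)"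
proof -
  obtain D :: "nat \<Rightarrow> real \<Rightarrow> real"
  where D: "\<And>r t. (D r has_real_derivative D (Suc r) t) (at t)" "\<And>r t. \<bar>t\<bar> \<ge> 1 \<Longrightarrow> D r t = 0"
    "\<And>t. D 0 t \<ge> 0" "D 0 0 > 0" using smooth_bump_1d by metis
  define b :: "real^'n \<Rightarrow> real" where "b = (\<lambda>x. \<Prod>j\<in>UNIV. D 0 (x $ j))"
  have sb: "smooth b" and pb: "pds is b = (\<lambda>x. \<Prod>j\<in>UNIV. D (count_list is j) (x $ j))" for "is"
    using smooth_tensor[of "\<lambda>_. D", OF D(1)] by (auto simp: b_def)
  have supp: "pds is b x = 0" if "\<bar>x $ j\<bar> \<ge> 1" for x "is" j
    using D(2)[OF that] by (auto simp: pb intro!: prod_zero)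
  have b0: "b x \<ge> 0" for x by (auto simp: b_def D intro!: prod_nonneg)
  have bc: "continuous_on UNIV b" using smooth_cont[OF sb, of "[]"] by simp
  have bz: "b x = 0" if xn: "x \<notin> cbox (-1) 1" for x
  proof -
    have "\<exists>j. \<bar>x $ j\<bar> \<ge> 1"
    proof (rule ccontr)
      assume "\<not> (\<exists>j. \<bar>x $ j\<bar> \<ge> 1)"
      then have "\<bar>x $ j\<bar> < 1" for j by (simp add: not_le)
      then have "- 1 \<le> x $ j \<and> x $ j \<le> 1" for j by (smt (verit))
      then have "x \<in> cbox (-1) 1" by (simp add: mem_box_cart)
      with xn show False by simp
    qed
    then obtain j where "\<bar>x $ j\<bar> \<ge> 1" by blast
    then show ?thesis using supp[of x j "[]"] by simp
  qed
  have bi: "integrable lborel b"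
  proof -
    have "integrable lborel (\<lambda>x. indicator (cbox (-1) 1) x *\<^sub>R b x)"
      by (rule borel_integrable_compact) (auto intro: continuous_on_subset[OF bc])
    moreover have "(\<lambda>x. indicator (cbox (-1) 1) x *\<^sub>R b x) = b" using bz by (fastforce simp: indicator_def)
    ultimately show ?thesis by simp
  qed
  define Z where "Z = (\<integral>x. b x \<partial>lborel)"
  \<comment> \<open>A nonnegative function with zero integral vanishes almost everywhere, but the
    bump is positive on a nonempty open set, and such a set is not null.\<close>
  have "Z \<noteq> 0"
  proof
    assume "Z = 0"
    then have ae: "AE x in lborel. b x = 0"
      using integral_nonneg_eq_0_iff_AE[OF bi] b0 by (simp add: Z_def)
    have op: "open {x. b x > 0}" using open_Collect_less[of "\<lambda>_. 0" b] bc by auto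
    have "{x. b x > 0} \<noteq> {}" using D(4) by (auto intro!: exI[of _ 0] prod_pos simp: b_def)
    then have "\<not> negligible {x. b x > 0}" using op open_not_negligible by blast
    moreover have "{x. b x > 0} \<in> null_sets lborel"
    proof -
      have "{x. b x > 0} \<in> sets lborel" using op by auto
      moreover have "AE x in lborel. x \<notin> {x. b x > 0}" using ae by eventually_elim simp
      ultimately show ?thesis by (simp add: AE_iff_null_sets)
    qed
    ultimately show False using negligible_iff_null_sets null_sets_completionI by blast
  qed
  moreover have "Z \<ge> 0" using b0 by (simp add: Z_def)
  ultimately have Z: "Z > 0" by simp
  show ?thesis
  proof (intro exI[of _ "\<lambda>x. (1 / Z) * b x"] conjI allI impI)
    show "smooth (\<lambda>x. (1 / Z) * b x)" by (rule smooth_cmult(1)[OF sb])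
    show "(1 / Z) * b x \<ge> 0" for x using b0 Z by simp
    show "pds is (\<lambda>x. (1 / Z) * b x) x = 0" if "\<bar>x $ j\<bar> \<ge> 1" for x "is" j
      using supp[OF that] by (simp add: smooth_cmult(2)[OF sb] del: times_divide_eq_left)
    show "integrable lborel (\<lambda>x. (1 / Z) * b x)" using bi by simp
    show "(\<integral>x. (1 / Z) * b x \<partial>lborel) = 1" using bi Z by (simp add: Z_def)
    show "pds is (\<lambda>x. (1 / Z) * b x) = pds js (\<lambda>x. (1 / Z) * b x)" if "mset is = mset js" for "is" js :: "'n list"
    proof -
      have "count_list is = count_list js" using that by (auto simp: fun_eq_iff simp flip: count_mset)
      then show ?thesis unfolding smooth_cmult(2)[OF sb] pb by simp
    qed
  qed
qed

definition ker :: "real^'n::finite \<Rightarrow> real" where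
  "ker = (SOME \<eta>. smooth \<eta> \<and> (\<forall>x. \<eta> x \<ge> 0) \<and> (\<forall>x is j. \<bar>x $ j\<bar> \<ge> 1 \<longrightarrow> pds is \<eta> x = 0) \<and>
     integrable lborel \<eta> \<and> (\<integral>x. \<eta> x \<partial>lborel) = 1 \<and>
     (\<forall>is js. mset is = mset js \<longrightarrow> pds is \<eta> = pds js \<eta>))"

lemma ker:
  shows smooth_ker: "smooth (ker :: real^'n::finite \<Rightarrow> real)"
    and ker_nonneg: "ker (x :: real^'n) \<ge> 0"
    and ker_outside: "\<bar>x $ j\<bar> \<ge> 1 \<Longrightarrow> pds is ker x = 0"
    and ker_integrable: "integrable lborel (ker :: real^'n \<Rightarrow> real)"
    and ker_integral: "(\<integral>x. ker (x :: real^'n) \<partial>lborel) = 1"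
    and ker_commute: "mset is = mset js \<Longrightarrow> pds is (ker :: real^'n \<Rightarrow> real) = pds js ker"
  using someI_ex[OF smooth_kernel_exists] unfolding ker_def[symmetric] by blast+

lemma ker_borel[measurable]: "ker \<in> borel_measurable borel"
  using smooth_borel[OF smooth_ker, of "[]"] by simp

lemma ker_outside0: "\<bar>x $ j\<bar> \<ge> 1 \<Longrightarrow> ker x = 0"
  using ker_outside[of x j "[]"] by simp

lemma ker_support_norm: "ker x \<noteq> 0 \<Longrightarrow> norm (x :: real^'n::finite) \<le> real CARD('n)"
proof -
  assume "ker x \<noteq> 0"
  then have "\<bar>x $ j\<bar> \<le> 1" for j using ker_outside0[of x j] by force
  then have "(\<Sum>j\<in>UNIV. \<bar>x $ j\<bar>) \<le> (\<Sum>j\<in>(UNIV :: 'n set). 1)" by (intro sum_mono)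
  then show ?thesis using norm_le_l1_cart[of x] by simp
qed

lemma ker_cpt_supp: "cpt_supp ker"
  by (rule bounded_cpt_supp[OF ker_support_norm])

section \<open>Mollification\<close>

lemma lborel_nn_integral_affine:
  fixes f :: "'a::euclidean_space \<Rightarrow> ennreal"
  assumes [measurable]: "f \<in> borel_measurable borel" and c: "c \<noteq> 0"
  shows "(\<integral>\<^sup>+x. f x \<partial>lborel) = ennreal (\<bar>c\<bar> ^ DIM('a)) * (\<integral>\<^sup>+x. f (t + c *\<^sub>R x) \<partial>lborel)"
  by (subst lborel_affine[OF c, of t])
     (simp add: nn_integral_density nn_integral_distr nn_integral_cmult)

lemma lborel_integral_affine:
  fixes f :: "'a::euclidean_space \<Rightarrow> real"
  assumes [measurable]: "f \<in> borel_measurable borel" and c: "c \<noteq> 0"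
  shows "(\<integral>x. f x \<partial>lborel) = \<bar>c\<bar> ^ DIM('a) * (\<integral>x. f (t + c *\<^sub>R x) \<partial>lborel)"
    and "integrable lborel f \<longleftrightarrow> integrable lborel (\<lambda>x. f (t + c *\<^sub>R x))"
proof -
  show "(\<integral>x. f x \<partial>lborel) = \<bar>c\<bar> ^ DIM('a) * (\<integral>x. f (t + c *\<^sub>R x) \<partial>lborel)"
    by (subst lborel_affine[OF c, of t]) (simp add: integral_density integral_distr)
  have "integrable lborel f \<longleftrightarrow> integrable lborel (\<lambda>x. \<bar>c\<bar> ^ DIM('a) * f (t + c *\<^sub>R x))"
    by (subst lborel_affine[OF c, of t]) (simp add: integrable_density integrable_distr_eq)
  then show "integrable lborel f \<longleftrightarrow> integrable lborel (\<lambda>x. f (t + c *\<^sub>R x))" using c by simp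
qed

lemma lborel_AE_affine:
  fixes P :: "'a::euclidean_space \<Rightarrow> bool"
  assumes "AE x in lborel. P x" and c: "c \<noteq> 0"
  shows "AE x in lborel. P (t + c *\<^sub>R x)"
proof -
  obtain N where N: "{x. \<not> P x} \<subseteq> N" "N \<in> null_sets lborel" using assms(1) by (auto simp: eventually_ae_filter)
  then have [measurable]: "N \<in> sets borel" by auto
  have "0 = (\<integral>\<^sup>+x. indicator N x \<partial>lborel)" using N by auto
  also have "\<dots> = ennreal (\<bar>c\<bar> ^ DIM('a)) * (\<integral>\<^sup>+x. indicator N (t + c *\<^sub>R x) \<partial>lborel)"
    by (rule lborel_nn_integral_affine[OF _ c]) simp
  finally have "(\<integral>\<^sup>+x. indicator N (t + c *\<^sub>R x) \<partial>lborel) = (0::ennreal)" using c by auto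
  then have "AE x in lborel. indicator N (t + c *\<^sub>R x) = (0::ennreal)"
    by (subst (asm) nn_integral_0_iff_AE) auto
  then show ?thesis by eventually_elim (use N in \<open>auto simp: indicator_def split: if_splits\<close>)
qed

lemma bounded_support_integrable:
  fixes f :: "'a::euclidean_space \<Rightarrow> real"
  assumes [measurable]: "f \<in> borel_measurable borel" and B: "\<And>x. \<bar>f x\<bar> \<le> B" and R: "\<And>x. f x \<noteq> 0 \<Longrightarrow> norm x \<le> R"
  shows "integrable lborel f" "sqint lborel f"
proof -
  have c: "emeasure lborel (cball (0::'a) R) < \<infinity>" by (rule emeasure_bounded_finite) simp
  have i: "integrable lborel g" if [measurable]: "g \<in> borel_measurable borel" and "\<And>x. \<bar>g x\<bar> \<le> B'" "\<And>x. g x \<noteq> 0 \<Longrightarrow> norm x \<le> R" for g :: "'a \<Rightarrow> real" and B'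
  proof -
    have "integrable lborel (\<lambda>x. indicator (cball 0 R) x *\<^sub>R g x)"
      by (rule integrableI_bounded_set_indicator[where B = B']) (use that c in auto)
    moreover have "(\<lambda>x. indicator (cball 0 R) x *\<^sub>R g x) = g" using that by (fastforce simp: indicator_def)
    ultimately show ?thesis by simp
  qed
  show "integrable lborel f" by (rule i[OF assms])
  have "(f x)\<^sup>2 \<le> B\<^sup>2" for x using B[of x] by (metis abs_ge_zero power2_abs power_mono)
  then show "sqint lborel f" unfolding sqint_def by (auto intro!: i[of _ "B\<^sup>2"] R)
qed

lemma smooth_integrable:
  assumes "smooth \<phi>" "cpt_supp \<phi>"
  shows "integrable lborel (pds is \<phi>)" "sqint lborel (pds is \<phi>)"
proof -
  obtain R where R: "\<And>x. pds is \<phi> x \<noteq> 0 \<Longrightarrow> norm x \<le> R"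
    using cpt_supp_bounded[OF cpt_supp_pds[OF assms(2)]] by blast
  obtain B where B: "\<And>x. \<bar>pds is \<phi> x\<bar> \<le> B" using cpt_supp_pds_bound[OF assms] by blast
  show "integrable lborel (pds is \<phi>)" "sqint lborel (pds is \<phi>)"
    using bounded_support_integrable[OF smooth_borel[OF assms(1)] B R] by auto
qed

text \<open>\<open>ker\<close> is a probability density, so \<open>ker y * B\<close> dominates and
  the constant limit is reproduced.\<close>

lemma ker_avg_tendsto:
  fixes g :: "nat \<Rightarrow> real^'n::finite \<Rightarrow> real"
  assumes [measurable]: "\<And>n. g n \<in> borel_measurable borel" and B: "\<And>n y. \<bar>g n y\<bar> \<le> B"
    and L: "\<And>y. (\<lambda>n. g n y) \<longlonglongrightarrow> L"
  shows "(\<lambda>n. \<integral>y. ker y * g n y \<partial>lborel) \<longlonglongrightarrow> L"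
proof -
  have "(\<lambda>n. \<integral>y. ker y * g n y \<partial>lborel) \<longlonglongrightarrow> (\<integral>y. ker (y::real^'n) * L \<partial>lborel)"
  proof (rule integral_dominated_convergence[where w = "\<lambda>y. ker y * B"])
    show "AE y in lborel. (\<lambda>n. ker y * g n y) \<longlonglongrightarrow> ker y * L" by (intro AE_I2 tendsto_intros L)
    show "AE y in lborel. norm (ker y * g n y) \<le> ker y * B" for n
      using B by (intro AE_I2) (auto simp: abs_mult ker_nonneg intro!: mult_left_mono)
  qed (auto simp: ker_integrable)
  then show ?thesis by (simp add: ker_integral)
qed

lemma ker_mult_integrable:
  assumes [measurable]: "g \<in> borel_measurable borel" and B: "\<And>y. \<bar>g y\<bar> \<le> B"
  shows "integrable lborel (\<lambda>y. ker y * g y)"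
proof (rule Bochner_Integration.integrable_bound)
  show "integrable lborel (\<lambda>y. ker y * B)" by (simp add: ker_integrable)
  have "\<bar>g y\<bar> \<le> \<bar>B\<bar>" for y using B[of y] by linarith
  then show "AE y in lborel. norm (ker y * g y) \<le> norm (ker y * B)"
    by (intro AE_I2) (auto simp: abs_mult intro!: mult_left_mono)
qed simp

text \<open>The scale \<open>e\<close> acts on the argument of \<open>f\<close> rather than on the
  kernel, so limits in \<open>e\<close> are taken under one fixed density. \<open>mol_conv\<close>
  moves the scale to the kernel when derivatives are to fall there.\<close>

definition mol :: "real \<Rightarrow> (real^'n::finite \<Rightarrow> real) \<Rightarrow> real^'n \<Rightarrow> real" where
  "mol e f x = (\<integral>y. ker y * f (x - e *\<^sub>R y) \<partial>lborel)"

lemma mol_conv: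
  fixes f :: "real^'n::finite \<Rightarrow> real"
  assumes [measurable]: "f \<in> borel_measurable borel" and e: "e > 0"
  shows "mol e f x = (\<integral>y. (1/e) ^ CARD('n) * ker ((1/e) *\<^sub>R (x - y)) * f y \<partial>lborel)"
proof -
  have "mol e f x = \<bar>- (1/e)\<bar> ^ CARD('n) * (\<integral>y. ker ((1/e) *\<^sub>R x + (- (1/e)) *\<^sub>R y) * f (x - e *\<^sub>R ((1/e) *\<^sub>R x + (- (1/e)) *\<^sub>R y)) \<partial>lborel)"
    unfolding mol_def using e by (subst lborel_integral_affine(1)[of _ "- (1/e)" "(1/e) *\<^sub>R x"]) auto
  also have "(\<lambda>y. ker ((1/e) *\<^sub>R x + (- (1/e)) *\<^sub>R y) * f (x - e *\<^sub>R ((1/e) *\<^sub>R x + (- (1/e)) *\<^sub>R y)))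
      = (\<lambda>y. ker ((1/e) *\<^sub>R (x - y)) * f y)"
    using e by (auto simp: scaleR_diff_right algebra_simps)
  finally show ?thesis using e by (simp add: mult.assoc)
qed

text \<open>All derivatives fall on the kernel, each one costing a factor 1/\<open>e\<close>; bounds
  for the kernel derivatives times the modulus of \<open>f\<close> supply the dominating
  functions.\<close>

lemma mol_smooth:
  fixes f :: "real^'n::finite \<Rightarrow> real"
  assumes [measurable]: "f \<in> borel_measurable borel" and f: "integrable lborel f" and e: "e > 0"
  shows "smooth (mol e f)"
    and "pds is (mol e f) x = (\<integral>y. (1/e) ^ (CARD('n) + length is) * pds is ker ((1/e) *\<^sub>R (x - y)) * f y \<partial>lborel)"
proof -
  let ?k = "\<lambda>is x y. (1/e) ^ (CARD('n) + length is) * pds is ker ((1/e) *\<^sub>R (x - y)) * f y"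
  let ?F = "\<lambda>is x. \<integral>y. ?k is x y \<partial>lborel"
  have [measurable]: "pds is ker \<in> borel_measurable borel" for "is" :: "'n list" by (rule smooth_borel[OF smooth_ker])
  have bd: "\<exists>B\<ge>0. \<forall>x::real^'n. \<bar>pds is ker x\<bar> \<le> B" for "is"
    using cpt_supp_pds_bound[OF smooth_ker ker_cpt_supp] by metis
  have ki: "integrable lborel (?k is x)" for "is" x
  proof -
    obtain B where B: "\<And>x::real^'n. \<bar>pds is ker x\<bar> \<le> B" "B \<ge> 0" using bd by blast
    show ?thesis
      by (rule Bochner_Integration.integrable_bound[of _ "\<lambda>y. (1/e) ^ (CARD('n) + length is) * B * \<bar>f y\<bar>"])
         (use f e B in \<open>auto simp: abs_mult intro!: AE_I2 mult_right_mono mult_left_mono divide_right_mono\<close>)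
  qed
  have D: "((\<lambda>t. ?F is (x + t *\<^sub>R ax i)) has_real_derivative ?F (i # is) x) (at 0)" for "is" i x
  proof -
    obtain B where B: "\<And>x::real^'n. \<bar>pds (i # is) ker x\<bar> \<le> B" "B \<ge> 0" using bd by blast
    show ?thesis
    proof (rule has_real_derivative_integral[where B = "\<lambda>y. (1/e) ^ (CARD('n) + length is) * (1/e * B) * \<bar>f y\<bar>"])
      show "integrable lborel (?k is (x + t *\<^sub>R ax i))" for t by (rule ki)
      show "integrable lborel (\<lambda>y. (1/e) ^ (CARD('n) + length is) * (1/e * B) * \<bar>f y\<bar>)" using f by simp
      show "?k (i # is) x \<in> borel_measurable lborel" using ki by (rule borel_measurable_integrable)
      show "AE y in lborel. ((\<lambda>t. ?k is (x + t *\<^sub>R ax i) y) has_real_derivative ?k (i # is) x y) (at 0)"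
      proof (rule AE_I2)
        fix y
        have "((\<lambda>t. pds is ker ((1/e) *\<^sub>R (x - y) + ((1/e) * t) *\<^sub>R ax i)) has_real_derivative
            pds (i # is) ker ((1/e) *\<^sub>R (x - y) + ((1/e) * 0) *\<^sub>R ax i) * (1/e)) (at 0)"
          by (rule DERIV_chain2[OF smooth_deriv[OF smooth_ker] DERIV_cmult_Id])
        then have "((\<lambda>t. (1/e) ^ (CARD('n) + length is) * pds is ker ((1/e) *\<^sub>R (x - y) + ((1/e) * t) *\<^sub>R ax i) * f y) has_real_derivative
            (1/e) ^ (CARD('n) + length is) * (pds (i # is) ker ((1/e) *\<^sub>R (x - y) + ((1/e) * 0) *\<^sub>R ax i) * (1/e)) * f y) (at 0)"
          by (intro DERIV_cmult DERIV_cmult_right)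
        moreover have eq: "(1/e) *\<^sub>R (x + t *\<^sub>R ax i - y) = (1/e) *\<^sub>R (x - y) + ((1/e) * t) *\<^sub>R ax i" for t
          by (simp add: algebra_simps)
        moreover have "?k (i # is) x y = (1/e) ^ (CARD('n) + length is) * (pds (i # is) ker ((1/e) *\<^sub>R (x - y) + ((1/e) * 0) *\<^sub>R ax i) * (1/e)) * f y"
          by (simp del: pds.simps)
        ultimately show "((\<lambda>t. ?k is (x + t *\<^sub>R ax i) y) has_real_derivative ?k (i # is) x y) (at 0)"
          by (simp only: eq)
      qed
      show "\<bar>?k is (x + t *\<^sub>R ax i) y - ?k is (x + 0 *\<^sub>R ax i) y\<bar> \<le> \<bar>t\<bar> * ((1/e) ^ (CARD('n) + length is) * (1/e * B) * \<bar>f y\<bar>)" for t y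
      proof -
        have eq: "(1/e) *\<^sub>R (x + t *\<^sub>R ax i - y) = (1/e) *\<^sub>R (x - y) + ((1/e) * t) *\<^sub>R ax i"
          by (simp add: algebra_simps)
        have l: "\<bar>pds is ker ((1/e) *\<^sub>R (x - y) + ((1/e) * t) *\<^sub>R ax i) - pds is ker ((1/e) *\<^sub>R (x - y))\<bar> \<le> \<bar>(1/e) * t\<bar> * B"
          by (rule smooth_lipschitz[OF smooth_ker B(1)])
        have "\<bar>?k is (x + t *\<^sub>R ax i) y - ?k is (x + 0 *\<^sub>R ax i) y\<bar> = (1/e) ^ (CARD('n) + length is) *
           \<bar>pds is ker ((1/e) *\<^sub>R (x - y) + ((1/e) * t) *\<^sub>R ax i) - pds is ker ((1/e) *\<^sub>R (x - y))\<bar> * \<bar>f y\<bar>"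
          unfolding eq using e by (simp add: abs_mult flip: left_diff_distrib right_diff_distrib)
        also have "\<dots> \<le> (1/e) ^ (CARD('n) + length is) * (\<bar>(1/e) * t\<bar> * B) * \<bar>f y\<bar>"
          using l e by (intro mult_right_mono mult_left_mono) auto
        finally show ?thesis using e by (simp add: abs_mult mult_ac)
      qed
    qed
  qed
  have C: "continuous_on UNIV (?F is)" for "is"
  proof -
    obtain B where B: "\<And>x::real^'n. \<bar>pds is ker x\<bar> \<le> B" "B \<ge> 0" using bd by blast
    have "(\<lambda>n. ?F is (u n)) \<longlonglongrightarrow> ?F is x" if u: "u \<longlonglongrightarrow> x" for u x
    proof (rule integral_dominated_convergence[where w = "\<lambda>y. (1/e) ^ (CARD('n) + length is) * B * \<bar>f y\<bar>"])
      show "integrable lborel (\<lambda>y. (1/e) ^ (CARD('n) + length is) * B * \<bar>f y\<bar>)" using f by simp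
      show "AE y in lborel. (\<lambda>n. ?k is (u n) y) \<longlonglongrightarrow> ?k is x y"
      proof (intro AE_I2 tendsto_intros)
        fix y
        have "isCont (pds is ker) ((1/e) *\<^sub>R (x - y))"
          using smooth_cont[OF smooth_ker] continuous_on_eq_continuous_at by blast
        moreover have "(\<lambda>n. (1/e) *\<^sub>R (u n - y)) \<longlonglongrightarrow> (1/e) *\<^sub>R (x - y)" by (intro tendsto_intros u)
        ultimately show "(\<lambda>n. pds is ker ((1/e) *\<^sub>R (u n - y))) \<longlonglongrightarrow> pds is ker ((1/e) *\<^sub>R (x - y))"
          by (rule isCont_tendsto_compose)
      qed
      show "AE y in lborel. norm (?k is (u n) y) \<le> (1/e) ^ (CARD('n) + length is) * B * \<bar>f y\<bar>" for n
        using B e by (intro AE_I2) (auto simp: abs_mult intro!: mult_right_mono mult_left_mono divide_right_mono)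
    qed (use ki borel_measurable_integrable in \<open>auto simp del: pds.simps\<close>)
    then show ?thesis by (auto simp: continuous_on_sequentially o_def)
  qed
  have m: "?F [] = mol e f" using mol_conv[OF assms(1) e] by auto
  show "smooth (mol e f)" by (rule smooth_family(1)[where F = ?F, OF D C m])
  show "pds is (mol e f) x = ?F is x" by (subst smooth_family(2)[where F = ?F, OF D C m]) simp
qed

text \<open>Here the derivative falls on \<open>f\<close>, which may be merely Lipschitz along the
  axis with \<open>g\<close> as its derivative almost everywhere. This serves both smooth functions
  and the tensor products of piecewise smooth profiles.\<close>

lemma mol_deriv:
  fixes f g :: "real^'n::finite \<Rightarrow> real"
  assumes [measurable]: "f \<in> borel_measurable borel" "g \<in> borel_measurable borel"
    and fB: "\<And>x. \<bar>f x\<bar> \<le> B" and lip: "\<And>x t. \<bar>f (x + t *\<^sub>R ax i) - f x\<bar> \<le> \<bar>t\<bar> * L"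
    and d: "AE x in lborel. ((\<lambda>t. f (x + t *\<^sub>R ax i)) has_real_derivative g x) (at 0)" and e: "e > 0"
  shows "((\<lambda>t. mol e f (x + t *\<^sub>R ax i)) has_real_derivative mol e g x) (at 0)"
  unfolding mol_def
proof (rule has_real_derivative_integral[where B = "\<lambda>y. ker y * L"])
  show "integrable lborel (\<lambda>y. ker y * f (x + t *\<^sub>R ax i - e *\<^sub>R y))" for t
    by (rule ker_mult_integrable[where B = B]) (auto simp: fB)
  show "integrable lborel (\<lambda>y. ker (y::real^'n) * L)" by (simp add: ker_integrable)
  show "\<bar>ker y * f (x + t *\<^sub>R ax i - e *\<^sub>R y) - ker y * f (x + 0 *\<^sub>R ax i - e *\<^sub>R y)\<bar> \<le> \<bar>t\<bar> * (ker y * L)" for t y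
  proof -
    have "\<bar>f ((x - e *\<^sub>R y) + t *\<^sub>R ax i) - f (x - e *\<^sub>R y)\<bar> \<le> \<bar>t\<bar> * L" by (rule lip)
    then have "ker y * \<bar>f ((x - e *\<^sub>R y) + t *\<^sub>R ax i) - f (x - e *\<^sub>R y)\<bar> \<le> ker y * (\<bar>t\<bar> * L)"
      by (rule mult_left_mono[OF _ ker_nonneg])
    moreover have "\<bar>ker y * f (x + t *\<^sub>R ax i - e *\<^sub>R y) - ker y * f (x + 0 *\<^sub>R ax i - e *\<^sub>R y)\<bar>
       = ker y * \<bar>f ((x - e *\<^sub>R y) + t *\<^sub>R ax i) - f (x - e *\<^sub>R y)\<bar>"
      by (simp add: abs_mult ker_nonneg add_diff_eq diff_add_eq flip: right_diff_distrib)
    ultimately show ?thesis by (simp add: mult_ac)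
  qed
  have "AE y in lborel. ((\<lambda>t. f ((x + (-e) *\<^sub>R y) + t *\<^sub>R ax i)) has_real_derivative g (x + (-e) *\<^sub>R y)) (at 0)"
    by (rule lborel_AE_affine[OF d]) (use e in simp)
  then show "AE y in lborel. ((\<lambda>t. ker y * f (x + t *\<^sub>R ax i - e *\<^sub>R y)) has_real_derivative ker y * g (x - e *\<^sub>R y)) (at 0)"
  proof eventually_elim
    case (elim y)
    have eq: "x + t *\<^sub>R ax i - e *\<^sub>R y = (x + (-e) *\<^sub>R y) + t *\<^sub>R ax i" "x - e *\<^sub>R y = x + (-e) *\<^sub>R y" for t
      by (simp_all add: algebra_simps)
    show ?case unfolding eq by (rule DERIV_cmult[OF elim])
  qed
qed simp

lemma mol_continuous:
  fixes f :: "real^'n::finite \<Rightarrow> real"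
  assumes c: "continuous_on UNIV f" and B: "\<And>x. \<bar>f x\<bar> \<le> B"
  shows "continuous_on UNIV (mol e f)"
proof -
  have [measurable]: "f \<in> borel_measurable borel" by (rule borel_measurable_continuous_onI[OF c])
  have "(\<lambda>n. mol e f (u n)) \<longlonglongrightarrow> mol e f x" if u: "u \<longlonglongrightarrow> x" for u x
    unfolding mol_def
  proof (rule integral_dominated_convergence[where w = "\<lambda>y. ker y * B"])
    show "integrable lborel (\<lambda>y. ker (y::real^'n) * B)" by (simp add: ker_integrable)
    show "AE y in lborel. (\<lambda>n. ker y * f (u n - e *\<^sub>R y)) \<longlonglongrightarrow> ker y * f (x - e *\<^sub>R y)"
      using c by (intro AE_I2 tendsto_intros isCont_tendsto_compose[where g = f] u)
        (simp add: continuous_on_eq_continuous_at)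
    show "AE y in lborel. norm (ker y * f (u n - e *\<^sub>R y)) \<le> ker y * B" for n
      using B by (intro AE_I2) (auto simp: abs_mult ker_nonneg intro!: mult_left_mono)
  qed auto
  then show ?thesis by (auto simp: continuous_on_sequentially o_def)
qed

lemma mol_pds:
  assumes \<phi>: "smooth \<phi>" "cpt_supp \<phi>" and e: "e > 0"
  shows "pds is (mol e \<phi>) = mol e (pds is \<phi>)"
proof (rule smooth_family(2)[where F = "\<lambda>is. mol e (pds is \<phi>)"])
  show "((\<lambda>t. mol e (pds is \<phi>) (x + t *\<^sub>R ax i)) has_real_derivative mol e (pds (i # is) \<phi>) x) (at 0)" for "is" i x
  proof -
    obtain B where B: "\<And>x. \<bar>pds is \<phi> x\<bar> \<le> B" using cpt_supp_pds_bound[OF \<phi>] by blast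
    obtain L where L: "\<And>x. \<bar>pds (i # is) \<phi> x\<bar> \<le> L" using cpt_supp_pds_bound[OF \<phi>] by blast
    show ?thesis
      by (rule mol_deriv[OF smooth_borel[OF \<phi>(1)] smooth_borel[OF \<phi>(1)] B smooth_lipschitz[OF \<phi>(1) L] AE_I2[OF smooth_deriv0[OF \<phi>(1)]] e])
  qed
  show "continuous_on UNIV (mol e (pds is \<phi>))" for "is"
  proof -
    obtain B where B: "\<And>x. \<bar>pds is \<phi> x\<bar> \<le> B" using cpt_supp_pds_bound[OF \<phi>] by blast
    show ?thesis by (rule mol_continuous[OF smooth_cont[OF \<phi>(1)] B])
  qed
qed simp

lemma mol_tendsto_pt:
  assumes [measurable]: "f \<in> borel_measurable borel" and B: "\<And>x. \<bar>f x\<bar> \<le> B" and c: "isCont f x" and e: "e \<longlonglongrightarrow> 0"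
  shows "(\<lambda>n. mol (e n) f x) \<longlonglongrightarrow> f x"
  unfolding mol_def
proof (rule ker_avg_tendsto[OF _ B])
  fix y
  have "(\<lambda>n. x - e n *\<^sub>R y) \<longlonglongrightarrow> x - 0 *\<^sub>R y" by (intro tendsto_intros e)
  then show "(\<lambda>n. f (x - e n *\<^sub>R y)) \<longlonglongrightarrow> f x" using isCont_tendsto_compose[OF c] by simp
qed simp

text \<open>The symmetry is inherited from the tensor-product kernel through mollification.\<close>
lemma pds_commute:
  assumes \<phi>: "smooth \<phi>" "cpt_supp \<phi>" and m: "mset is = mset js"
  shows "pds is \<phi> = pds js \<phi>"
proof
  fix x
  have l: "length is = length js" using m by (metis size_mset)
  have bor: "\<phi> \<in> borel_measurable borel" using smooth_borel[OF \<phi>(1), of "[]"] by simp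
  have int: "integrable lborel \<phi>" using smooth_integrable(1)[OF \<phi>, of "[]"] by simp
  let ?e = "\<lambda>n. inverse (real (Suc n))"
  have e0: "?e \<longlonglongrightarrow> 0" by (rule LIMSEQ_inverse_real_of_nat)
  have lim: "(\<lambda>n. mol (?e n) (pds is \<phi>) x) \<longlonglongrightarrow> pds is \<phi> x" for "is"
  proof -
    obtain B where B: "\<And>x. \<bar>pds is \<phi> x\<bar> \<le> B" using cpt_supp_pds_bound[OF \<phi>] by blast
    show ?thesis
      by (rule mol_tendsto_pt[OF smooth_borel[OF \<phi>(1)] B _ e0])
         (use smooth_cont[OF \<phi>(1)] continuous_on_eq_continuous_at in blast)
  qed
  have "mol (?e n) (pds is \<phi>) x = mol (?e n) (pds js \<phi>) x" for n
    by (simp add: mol_pds[OF \<phi>, symmetric] mol_smooth(2)[OF bor int] l ker_commute[OF m])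
  then have "(\<lambda>n. mol (?e n) (pds is \<phi>) x) \<longlonglongrightarrow> pds js \<phi> x" using lim[of js] by simp
  then show "pds is \<phi> x = pds js \<phi> x" by (rule LIMSEQ_unique[OF lim])
qed

section \<open>L2 bounds and L2 convergence of mollifications\<close>

lemma mol_outside:
  assumes "\<And>y. ker y \<noteq> 0 \<Longrightarrow> f (x - e *\<^sub>R y) = 0" shows "mol e f x = 0"
proof -
  have "(\<lambda>y. ker y * f (x - e *\<^sub>R y)) = (\<lambda>y. 0)" using assms by fastforce
  then show ?thesis by (simp add: mol_def)
qed

text \<open>Jensen's inequality, by Cauchy-Schwarz with the density split into two square roots. If
  the averaged function is not integrable, the Bochner integral is 0 and the bound is
  trivial.\<close>

lemma mol_sq_le:
  fixes f :: "real^'n::finite \<Rightarrow> real"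
  assumes [measurable]: "f \<in> borel_measurable borel"
  shows "ennreal ((mol e f x)\<^sup>2) \<le> (\<integral>\<^sup>+y. ennreal (ker y) * ennreal ((f (x - e *\<^sub>R y))\<^sup>2) \<partial>lborel)"
proof (cases "integrable lborel (\<lambda>y. ker y * f (x - e *\<^sub>R y))")
  case True
  have "ennreal \<bar>mol e f x\<bar> \<le> (\<integral>\<^sup>+y. ennreal \<bar>ker y * f (x - e *\<^sub>R y)\<bar> \<partial>lborel)"
    unfolding mol_def using integral_norm_bound_ennreal[OF True] by simp
  also have "\<dots> = (\<integral>\<^sup>+y. ennreal (sqrt (ker y)) * ennreal (sqrt (ker y) * \<bar>f (x - e *\<^sub>R y)\<bar>) \<partial>lborel)"
    by (intro nn_integral_cong) (auto simp: ker_nonneg abs_mult simp flip: ennreal_mult mult.assoc)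
  finally have "(ennreal \<bar>mol e f x\<bar>)\<^sup>2 \<le> (\<integral>\<^sup>+y. ennreal (sqrt (ker y)) * ennreal (sqrt (ker y) * \<bar>f (x - e *\<^sub>R y)\<bar>) \<partial>lborel)\<^sup>2"
    by (rule power_mono) simp
  also have "\<dots> \<le> (\<integral>\<^sup>+y. (ennreal (sqrt (ker (y::real^'n))))\<^sup>2 \<partial>lborel) * (\<integral>\<^sup>+y. (ennreal (sqrt (ker y) * \<bar>f (x - e *\<^sub>R y)\<bar>))\<^sup>2 \<partial>lborel)"
    by (rule Cauchy_Schwarz_nn_integral) auto
  also have "(\<integral>\<^sup>+y. (ennreal (sqrt (ker (y::real^'n))))\<^sup>2 \<partial>lborel) = (\<integral>\<^sup>+y. ennreal (ker (y::real^'n)) \<partial>lborel)"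
    by (intro nn_integral_cong) (auto simp: ker_nonneg ennreal_power)
  also have "\<dots> = 1" by (subst nn_integral_eq_integral[OF ker_integrable]) (auto simp: ker_nonneg ker_integral)
  also have "(\<integral>\<^sup>+y. (ennreal (sqrt (ker y) * \<bar>f (x - e *\<^sub>R y)\<bar>))\<^sup>2 \<partial>lborel) = (\<integral>\<^sup>+y. ennreal (ker y) * ennreal ((f (x - e *\<^sub>R y))\<^sup>2) \<partial>lborel)"
    by (intro nn_integral_cong) (auto simp: ker_nonneg ennreal_power power_mult_distrib simp flip: ennreal_mult)
  finally show ?thesis by (simp add: ennreal_power)
qed (simp add: mol_def not_integrable_integral_eq)

text \<open>Mollification is a contraction: by Tonelli and translation invariance every translate of
  \<open>f\<close> has the same square integral, and the density has mass 1.\<close>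

lemma mol_l2:
  fixes f :: "real^'n::finite \<Rightarrow> real"
  assumes fm[measurable]: "f \<in> borel_measurable borel" and f: "integrable lborel f" "sqint lborel f" and e: "e > 0"
  shows "sqint lborel (mol e f)" "l2 lborel (mol e f) \<le> l2 lborel f"
proof -
  have [measurable]: "mol e f \<in> borel_measurable borel"
    using smooth_borel[OF mol_smooth(1)[OF fm f(1) e], of "[]"] by simp
  have "(\<integral>\<^sup>+x. ennreal ((mol e f x)\<^sup>2) \<partial>lborel) \<le> (\<integral>\<^sup>+x. \<integral>\<^sup>+y. ennreal (ker y) * ennreal ((f (x - e *\<^sub>R y))\<^sup>2) \<partial>lborel \<partial>lborel)"
    by (intro nn_integral_mono mol_sq_le fm)
  also have "\<dots> = (\<integral>\<^sup>+y. \<integral>\<^sup>+x. ennreal (ker y) * ennreal ((f (x - e *\<^sub>R y))\<^sup>2) \<partial>lborel \<partial>lborel)"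
    by (rule lborel_pair.Fubini') simp
  also have "\<dots> = (\<integral>\<^sup>+y. ennreal (ker (y::real^'n)) * (\<integral>\<^sup>+x. ennreal ((f x)\<^sup>2) \<partial>lborel) \<partial>lborel)"
  proof (intro nn_integral_cong)
    fix y
    have "(\<integral>\<^sup>+x. ennreal ((f x)\<^sup>2) \<partial>lborel) = (\<integral>\<^sup>+x. ennreal ((f (- (e *\<^sub>R y) + 1 *\<^sub>R x))\<^sup>2) \<partial>lborel)"
      by (subst lborel_nn_integral_affine[where c = 1 and t = "- (e *\<^sub>R y)"]) auto
    then show "(\<integral>\<^sup>+x. ennreal (ker y) * ennreal ((f (x - e *\<^sub>R y))\<^sup>2) \<partial>lborel) = ennreal (ker y) * (\<integral>\<^sup>+x. ennreal ((f x)\<^sup>2) \<partial>lborel)"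
      by (subst nn_integral_cmult) auto
  qed
  also have "\<dots> = (\<integral>\<^sup>+x. ennreal ((f x)\<^sup>2) \<partial>lborel)"
    by (subst nn_integral_multc) (auto simp: nn_integral_eq_integral[OF ker_integrable] ker_nonneg ker_integral)
  also have "\<dots> = ennreal (\<integral>x. (f x)\<^sup>2 \<partial>lborel)"
    using f(2) by (intro nn_integral_eq_integral) (auto simp: sqint_def)
  finally have le: "(\<integral>\<^sup>+x. ennreal ((mol e f x)\<^sup>2) \<partial>lborel) \<le> ennreal (\<integral>x. (f x)\<^sup>2 \<partial>lborel)" .
  then show s: "sqint lborel (mol e f)" unfolding sqint_def
    by (auto intro!: integrableI_nonneg le_less_trans[OF le])
  have "ennreal (\<integral>x. (mol e f x)\<^sup>2 \<partial>lborel) \<le> ennreal (\<integral>x. (f x)\<^sup>2 \<partial>lborel)"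
    using le s by (subst nn_integral_eq_integral[symmetric]) (auto simp: sqint_def)
  then show "l2 lborel (mol e f) \<le> l2 lborel f" by (simp add: l2_def ennreal_le_iff)
qed

text \<open>Both the sequence and its limit are dominated by \<open>w\<close>, hence the squared
  differences by 4 w^2.\<close>

lemma l2_dominated:
  assumes [measurable]: "\<And>n. f n \<in> borel_measurable M" "g \<in> borel_measurable M"
    and w: "sqint M w" "\<And>n x. \<bar>f n x\<bar> \<le> w x" and l: "AE x in M. (\<lambda>n. f n x) \<longlonglongrightarrow> g x"
  shows "sqint M g" "(\<lambda>n. l2 M (\<lambda>x. f n x - g x)) \<longlonglongrightarrow> 0"
proof -
  have wm: "integrable M (\<lambda>x. (w x)\<^sup>2)" using w by (simp add: sqint_def)
  have gw: "AE x in M. \<bar>g x\<bar> \<le> w x"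
    using l
  proof eventually_elim
    case (elim x)
    then have "(\<lambda>n. \<bar>f n x\<bar>) \<longlonglongrightarrow> \<bar>g x\<bar>" by (rule tendsto_rabs)
    then show ?case by (rule LIMSEQ_le_const2) (use w in auto)
  qed
  have "AE x in M. norm ((g x)\<^sup>2) \<le> norm ((w x)\<^sup>2)"
    using gw by eventually_elim (auto intro: abs_le_square_iff[THEN iffD1])
  then have "integrable M (\<lambda>x. (g x)\<^sup>2)" by (intro Bochner_Integration.integrable_bound[OF wm]) auto
  then show "sqint M g" by (simp add: sqint_def)
  have "(\<lambda>n. \<integral>x. (f n x - g x)\<^sup>2 \<partial>M) \<longlonglongrightarrow> (\<integral>x. 0 \<partial>M)"
  proof (rule integral_dominated_convergence[where w = "\<lambda>x. 4 * (w x)\<^sup>2"])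
    show "integrable M (\<lambda>x. 4 * (w x)\<^sup>2)" using wm by simp
    show "AE x in M. (\<lambda>n. (f n x - g x)\<^sup>2) \<longlonglongrightarrow> 0"
      using l
    proof eventually_elim
      case (elim x)
      then have "(\<lambda>n. (f n x - g x)\<^sup>2) \<longlonglongrightarrow> (g x - g x)\<^sup>2" by (intro tendsto_intros)
      then show ?case by simp
    qed
    show "AE x in M. norm ((f n x - g x)\<^sup>2) \<le> 4 * (w x)\<^sup>2" for n
      using gw
    proof eventually_elim
      case (elim x)
      have "\<bar>f n x - g x\<bar> \<le> 2 * w x" using elim w(2)[of n x] by linarith
      then have "(f n x - g x)\<^sup>2 \<le> (2 * w x)\<^sup>2" by (metis abs_ge_zero power2_abs power_mono)
      then show ?case by (simp add: power_mult_distrib)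
    qed
  qed auto
  then have "(\<lambda>n. sqrt (\<integral>x. (f n x - g x)\<^sup>2 \<partial>M)) \<longlonglongrightarrow> sqrt 0" by (intro tendsto_real_sqrt) simp
  then show "(\<lambda>n. l2 M (\<lambda>x. f n x - g x)) \<longlonglongrightarrow> 0" by (simp add: l2_def)
qed

text \<open>Two stages: truncation in height and radius, then continuous functions that converge
  almost everywhere to the truncation. These are themselves clamped and cut off, which makes
  dominated convergence applicable.\<close>

lemma sqint_approx_continuous:
  fixes f :: "real^'n::finite \<Rightarrow> real"
  assumes fm[measurable]: "f \<in> borel_measurable borel" and f: "sqint lborel f" and e: "e > 0"
  obtains g R B where "continuous_on UNIV g" "\<And>x. g x \<noteq> 0 \<Longrightarrow> norm x \<le> R" "\<And>x. \<bar>g x\<bar> \<le> B"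
    "l2 lborel (\<lambda>x. f x - g x) < e"
proof -
  define fN where "fN = (\<lambda>N::nat. \<lambda>x. indicator (cball 0 (real N)) x * max (- real N) (min (real N) (f x)))"
  have fNm[measurable]: "fN N \<in> borel_measurable borel" for N unfolding fN_def
    by (intro borel_measurable_times borel_measurable_indicator borel_measurable_max borel_measurable_min borel_measurable_const fm) auto
  have "(\<lambda>N. l2 lborel (\<lambda>x. fN N x - f x)) \<longlonglongrightarrow> 0"
  proof (rule l2_dominated(2)[where w = "\<lambda>x. \<bar>f x\<bar>"])
    show "sqint lborel (\<lambda>x. \<bar>f x\<bar>)" using f by (auto simp: sqint_def)
    show "\<bar>fN N x\<bar> \<le> \<bar>f x\<bar>" for N x by (auto simp: fN_def indicator_def)
    show "AE x in lborel. (\<lambda>N. fN N x) \<longlonglongrightarrow> f x"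
    proof (intro AE_I2 tendsto_eventually)
      fix x
      obtain N0 where N0: "real N0 \<ge> max (norm x) \<bar>f x\<bar>" using real_arch_simple by blast
      show "\<forall>\<^sub>F N in sequentially. fN N x = f x"
        by (rule eventually_sequentiallyI[of N0]) (use N0 in \<open>auto simp: fN_def indicator_def\<close>)
    qed
  qed auto
  then have "\<forall>\<^sub>F N in sequentially. l2 lborel (\<lambda>x. fN N x - f x) < e / 2"
    using e by (intro order_tendstoD) auto
  then obtain N where N: "l2 lborel (\<lambda>x. fN N x - f x) < e / 2" by (auto simp: eventually_sequentially)
  have "fN N \<in> borel_measurable lebesgue" by (intro measurable_completion) simp
  then have "fN N measurable_on UNIV" by (rule lebesgue_measurable_imp_measurable_on) simp
  then obtain Z g where Z: "negligible Z" and gc: "\<And>n. continuous_on UNIV (g n)"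
    and gl: "\<And>x. x \<notin> Z \<Longrightarrow> (\<lambda>n. g n x) \<longlonglongrightarrow> fN N x"
    by (auto simp: measurable_on_def)
  \<comment> \<open>Equal to 1 on the ball of radius \<open>N\<close> and to 0 beyond radius
    \<open>N + 1\<close>, so multiplication by it does not change \<open>fN N\<close>.\<close>
  define cut where "cut = (\<lambda>x::real^'n. max 0 (min 1 (real N + 1 - norm x)))"
  define G where "G = (\<lambda>n x. cut x * max (- real N) (min (real N) (g n x)))"
  have Gc: "continuous_on UNIV (G n)" for n unfolding G_def cut_def
    by (intro continuous_intros gc)
  have [measurable]: "G n \<in> borel_measurable borel" for n by (rule borel_measurable_continuous_onI[OF Gc])
  have cutb: "0 \<le> cut x" "cut x \<le> 1" for x by (auto simp: cut_def)
  have Gb: "\<bar>G n x\<bar> \<le> real N" for n x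
  proof -
    have "\<bar>G n x\<bar> \<le> 1 * real N" unfolding G_def abs_mult by (rule mult_mono) (use cutb[of x] in auto)
    then show ?thesis by simp
  qed
  have Gz: "G n x \<noteq> 0 \<Longrightarrow> norm x \<le> real N + 1" for n x by (auto simp: G_def cut_def)
  have GL: "(\<lambda>n. G n x) \<longlonglongrightarrow> fN N x" if "x \<notin> Z" for x
  proof -
    have "(\<lambda>n. G n x) \<longlonglongrightarrow> cut x * max (- real N) (min (real N) (fN N x))"
      unfolding G_def by (intro tendsto_intros gl that)
    also have "cut x * max (- real N) (min (real N) (fN N x)) = fN N x"
      by (auto simp: fN_def cut_def indicator_def)
    finally show ?thesis .
  qed
  have AEZ: "AE x in lborel. (\<lambda>n. G n x) \<longlonglongrightarrow> fN N x"
  proof -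
    have "AE x in lebesgue. x \<notin> Z" using Z by (simp add: negligible_iff_null_sets AE_not_in)
    then have "AE x in lborel. x \<notin> Z" by (simp add: AE_completion_iff)
    then show ?thesis by eventually_elim (rule GL)
  qed
  have ws: "sqint lborel (\<lambda>x::real^'n. real N * indicator (cball 0 (real N + 1)) x)"
    by (rule bounded_support_integrable(2)[where B = "real N" and R = "real N + 1"]) (auto simp: indicator_def)
  have "(\<lambda>n. l2 lborel (\<lambda>x. G n x - fN N x)) \<longlonglongrightarrow> 0"
  proof (rule l2_dominated(2)[OF _ _ ws _ AEZ])
    show "\<bar>G n x\<bar> \<le> real N * indicator (cball 0 (real N + 1)) x" for n x
      using Gb[of n x] Gz[of n x] by (auto simp: indicator_def)
  qed auto
  then have "\<forall>\<^sub>F n in sequentially. l2 lborel (\<lambda>x. G n x - fN N x) < e / 2"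
    using e by (intro order_tendstoD) auto
  then obtain n where n: "l2 lborel (\<lambda>x. G n x - fN N x) < e / 2" by (auto simp: eventually_sequentially)
  have sG: "sqint lborel (G n)" by (rule bounded_support_integrable(2)[OF _ Gb Gz]) simp
  have sN: "sqint lborel (fN N)"
    by (rule bounded_support_integrable(2)[where B = "real N" and R = "real N"]) (auto simp: fN_def indicator_def)
  have "l2 lborel (\<lambda>x. G n x - f x) < e"
    using l2_triangle_diff[OF sG sN f] n N by linarith
  then have "l2 lborel (\<lambda>x. f x - G n x) < e" by (simp add: l2_diff_commute)
  with that[of "G n" "real N + 1" "real N"] Gc Gz Gb show thesis by blast
qed

text \<open>Density argument: mollifications of a continuous function of bounded support converge
  pointwise under a common bound, and the contraction property controls the remaining part of
  \<open>f\<close> uniformly in the scale.\<close>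

lemma mol_tendsto_l2:
  fixes f :: "real^'n::finite \<Rightarrow> real"
  assumes fm[measurable]: "f \<in> borel_measurable borel" and f: "integrable lborel f" "sqint lborel f"
    and e: "\<And>n. e n > 0" "\<And>n. e n \<le> 1" "e \<longlonglongrightarrow> 0"
  shows "(\<lambda>n. l2 lborel (\<lambda>x. mol (e n) f x - f x)) \<longlonglongrightarrow> 0"
proof (rule LIMSEQ_I)
  fix d :: real assume d: "d > 0"
  obtain g R B where gc: "continuous_on UNIV g" and gR: "\<And>x. g x \<noteq> 0 \<Longrightarrow> norm x \<le> R" and gB: "\<And>x. \<bar>g x\<bar> \<le> B"
    and gf: "l2 lborel (\<lambda>x. f x - g x) < d / 3"
    using sqint_approx_continuous[OF fm f(2), of "d/3"] d by auto
  have gm[measurable]: "g \<in> borel_measurable borel" by (rule borel_measurable_continuous_onI[OF gc])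
  have gi: "integrable lborel g" "sqint lborel g" using bounded_support_integrable[OF gm gB gR] by auto
  have B0: "B \<ge> 0" using gB[of undefined] by linarith
  \<comment> \<open>With scales at most 1 the support grows at most by the radius of the kernel
    support, which is bounded by the dimension.\<close>
  let ?R = "R + real CARD('n)"
  have "(\<lambda>n. l2 lborel (\<lambda>x. mol (e n) g x - g x)) \<longlonglongrightarrow> 0"
  proof (rule l2_dominated(2)[where w = "\<lambda>x::real^'n. B * indicator (cball 0 ?R) x"])
    show "mol (e n) g \<in> borel_measurable lborel" for n
      using smooth_borel[OF mol_smooth(1)[OF gm gi(1) e(1)], of "[]"] by simp
    show "sqint lborel (\<lambda>x::real^'n. B * indicator (cball 0 ?R) x)"
      by (rule bounded_support_integrable(2)[where B = B and R = ?R]) (use B0 in \<open>auto simp: indicator_def\<close>)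
    show "AE x in lborel. (\<lambda>n. mol (e n) g x) \<longlonglongrightarrow> g x"
      using gc by (intro AE_I2 mol_tendsto_pt[OF gm gB _ e(3)]) (simp add: continuous_on_eq_continuous_at)
    show "\<bar>mol (e n) g x\<bar> \<le> B * indicator (cball 0 ?R) x" for n x
    proof (cases "norm x \<le> ?R")
      case True
      have "\<bar>mol (e n) g x\<bar> \<le> (\<integral>y. \<bar>ker y * g (x - e n *\<^sub>R y)\<bar> \<partial>lborel)"
        unfolding mol_def by (rule integral_abs_bound)
      also have "\<dots> \<le> (\<integral>y. ker (y::real^'n) * B \<partial>lborel)"
      proof (intro integral_mono)
        show "integrable lborel (\<lambda>y. \<bar>ker y * g (x - e n *\<^sub>R y)\<bar>)"
          by (intro integrable_abs ker_mult_integrable[where B = B]) (auto simp: gB)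
      qed (auto simp: ker_integrable abs_mult ker_nonneg gB intro!: mult_left_mono)
      finally show ?thesis using True by (simp add: indicator_def ker_integral)
    next
      case False
      have "mol (e n) g x = 0"
      proof (rule mol_outside, rule ccontr)
        fix y :: "real^'n" assume y: "ker y \<noteq> 0" and z: "g (x - e n *\<^sub>R y) \<noteq> 0"
        have "norm (e n *\<^sub>R y) \<le> 1 * real CARD('n)"
          unfolding norm_scaleR using e(1)[of n] e(2)[of n] ker_support_norm[OF y] by (intro mult_mono) auto
        moreover have "norm (x - e n *\<^sub>R y) \<le> R" by (rule gR[OF z])
        ultimately have "norm x \<le> ?R" using norm_triangle_sub[of x "e n *\<^sub>R y"] by linarith
        with False show False by simp
      qed
      then show ?thesis using B0 by (simp add: indicator_def)
    qed
  qed auto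
  then have "\<forall>\<^sub>F n in sequentially. l2 lborel (\<lambda>x. mol (e n) g x - g x) < d / 3"
    using d by (intro order_tendstoD) auto
  then obtain N where N: "\<And>n. n \<ge> N \<Longrightarrow> l2 lborel (\<lambda>x. mol (e n) g x - g x) < d / 3" by (auto simp: eventually_sequentially)
  have "norm (l2 lborel (\<lambda>x. mol (e n) f x - f x) - 0) < d" if n: "n \<ge> N" for n
  proof -
    let ?h = "\<lambda>x. f x - g x"
    have h: "?h \<in> borel_measurable borel" "integrable lborel ?h" "sqint lborel ?h"
      using f gi by (auto intro: sqint_diff)
    have s: "sqint lborel (mol (e n) f)" "sqint lborel (mol (e n) g)" 
      by (rule mol_l2(1)[OF fm f e(1)], rule mol_l2(1)[OF gm gi e(1)])
    have "AE x in lborel. mol (e n) f x - mol (e n) g x = mol (e n) ?h x"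
    proof (rule AE_I2)
      fix x
      have i: "integrable lborel (\<lambda>y. ker y * k (x - e n *\<^sub>R y))" if k: "k \<in> borel_measurable borel" "integrable lborel k" for k :: "real^'n \<Rightarrow> real"
      proof -
        obtain K where K: "\<And>x::real^'n. \<bar>pds [] ker x\<bar> \<le> K" "K \<ge> 0" using cpt_supp_pds_bound[OF smooth_ker ker_cpt_supp] by metis
        have [measurable]: "k \<in> borel_measurable borel" by fact
        have "integrable lborel (\<lambda>y. k (x + (- e n) *\<^sub>R y))"
          using lborel_integral_affine(2)[OF k(1), of "- e n" x] k(2) e(1)[of n] by simp
        then have "integrable lborel (\<lambda>y. K * \<bar>k (x - e n *\<^sub>R y)\<bar>)" by simp
        then show ?thesis
          by (rule Bochner_Integration.integrable_bound)
             (use K in \<open>auto simp: abs_mult intro!: AE_I2 mult_right_mono\<close>)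
      qed
      show "mol (e n) f x - mol (e n) g x = mol (e n) ?h x"
        unfolding mol_def using i[OF fm f(1)] i[OF gm gi(1)] by (simp add: right_diff_distrib)
    qed
    then have "l2 lborel (\<lambda>x. mol (e n) f x - mol (e n) g x) = l2 lborel (mol (e n) ?h)"
      using s mol_l2(1)[OF h e(1)] by (intro l2_cong_AE) (auto simp: sqint_def)
    also have "\<dots> \<le> l2 lborel ?h" by (rule mol_l2(2)[OF h e(1)])
    finally have "l2 lborel (\<lambda>x. mol (e n) f x - mol (e n) g x) < d / 3" using gf by simp
    then have "l2 lborel (\<lambda>x. mol (e n) f x - f x) < d"
      using l2_triangle_diff[OF s(1) s(2) f(2)] l2_triangle_diff[OF s(2) gi(2) f(2)] N[OF n] gf
      by (simp add: l2_diff_commute[of _ g f])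
    then show ?thesis by (simp add: l2_nonneg)
  qed
  then show "\<exists>no. \<forall>n\<ge>no. norm (l2 lborel (\<lambda>x. mol (e n) f x - f x) - 0) < d" by blast
qed

text \<open>By translation invariance the integral of \<open>g\<close> shifted along the axis does
  not depend on the shift; differentiating this constant under the integral gives the integral of
  \<open>g'\<close>.\<close>

lemma integral_deriv_zero:
  fixes g g' :: "real^'n::finite \<Rightarrow> real"
  assumes d: "\<And>x t. ((\<lambda>t. g (x + t *\<^sub>R ax i)) has_real_derivative g' (x + t *\<^sub>R ax i)) (at t)"
    and c: "continuous_on UNIV g" "continuous_on UNIV g'"
    and B: "\<And>x. \<bar>g x\<bar> \<le> B" "\<And>x. \<bar>g' x\<bar> \<le> L" and R: "\<And>x. g x \<noteq> 0 \<Longrightarrow> norm x \<le> R"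
  shows "(\<integral>x. g' x \<partial>lborel) = 0"
proof -
  have [measurable]: "g \<in> borel_measurable borel" "g' \<in> borel_measurable borel"
    using c by (auto intro: borel_measurable_continuous_onI)
  have L0: "L \<ge> 0" using B(2)[of undefined] by linarith
  \<comment> \<open>Clamping the shift to [-1, 1] does not affect the derivative at 0 and keeps the
    translates supported in one ball, on which the constant \<open>L\<close> is an integrable
    bound.\<close>
  define cl where "cl = (\<lambda>t::real. max (-1) (min 1 t))"
  have "((\<lambda>t. \<integral>x. g (x + cl t *\<^sub>R ax i) \<partial>lborel) has_real_derivative (\<integral>x. g' x \<partial>lborel)) (at 0)"
  proof (rule has_real_derivative_integral[where B = "\<lambda>x. L * indicator (cball 0 (R + 1)) x"])
    show "integrable lborel (\<lambda>x. g (x + cl t *\<^sub>R ax i))" for t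
    proof -
      have "integrable lborel (\<lambda>x. g (cl t *\<^sub>R ax i + 1 *\<^sub>R x))"
        by (rule lborel_integral_affine(2)[THEN iffD1]) (auto intro: bounded_support_integrable(1)[OF _ B(1) R])
      then show ?thesis by (simp add: add.commute)
    qed
    show "integrable lborel (\<lambda>x::real^'n. L * indicator (cball 0 (R + 1)) x)"
      by (rule bounded_support_integrable(1)[where B = L and R = "R + 1"]) (use L0 in \<open>auto simp: indicator_def\<close>)
    show "AE x in lborel. ((\<lambda>t. g (x + cl t *\<^sub>R ax i)) has_real_derivative g' x) (at 0)"
    proof (rule AE_I2)
      fix x
      have "((\<lambda>t. g (x + t *\<^sub>R ax i)) has_real_derivative g' x) (at 0)" using d[of x 0] by simp
      then show "((\<lambda>t. g (x + cl t *\<^sub>R ax i)) has_real_derivative g' x) (at 0)"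
        by (rule has_field_derivative_transform_within_open[of _ _ _ "{-1<..<1}"]) (auto simp: cl_def)
    qed
    show "\<bar>g (x + cl t *\<^sub>R ax i) - g (x + cl 0 *\<^sub>R ax i)\<bar> \<le> \<bar>t\<bar> * (L * indicator (cball 0 (R + 1)) x)" for t x
    proof (cases "norm x \<le> R + 1")
      case True
      have "\<bar>g (x + cl t *\<^sub>R ax i) - g x\<bar> \<le> \<bar>cl t\<bar> * L" by (rule lipschitz_axis[OF d B(2)])
      also have "\<dots> \<le> \<bar>t\<bar> * L" using L0 by (intro mult_right_mono) (auto simp: cl_def)
      finally show ?thesis using True by (simp add: cl_def indicator_def)
    next
      case False
      have "norm (cl t *\<^sub>R ax i :: real^'n) \<le> 1" by (auto simp: cl_def norm_axis_1)
      then have "norm (x + cl t *\<^sub>R ax i) > R" using False norm_triangle_ineq2[of x "- (cl t *\<^sub>R ax i)"] by simp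
      then have "g (x + cl t *\<^sub>R ax i) = 0" "g x = 0" using R[of "x + cl t *\<^sub>R ax i"] R[of x] False by force+
      then show ?thesis using L0 by (simp add: cl_def indicator_def)
    qed
  qed simp
  moreover have "(\<integral>x. g (x + cl t *\<^sub>R ax i) \<partial>lborel) = (\<integral>x. g x \<partial>lborel)" for t
    by (subst (2) lborel_integral_affine(1)[where c = 1 and t = "cl t *\<^sub>R ax i"]) (auto simp: add.commute)
  ultimately have "((\<lambda>t::real. \<integral>x. g x \<partial>lborel) has_real_derivative (\<integral>x. g' x \<partial>lborel)) (at 0)" by simp
  then show ?thesis using DERIV_const DERIV_unique by blast
qed

lemma bounded_support_bounded:
  fixes g :: "real^'n::finite \<Rightarrow> real"
  assumes "continuous_on UNIV g" "\<And>x. g x \<noteq> 0 \<Longrightarrow> norm x \<le> R"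
  obtains B where "\<And>x. \<bar>g x\<bar> \<le> B"
proof -
  have "compact (g ` cball 0 R)" using assms(1) continuous_on_subset by (intro compact_continuous_image) auto
  then obtain B where "\<forall>y\<in>g ` cball 0 R. \<bar>y\<bar> \<le> B"
    unfolding compact_eq_bounded_closed bounded_iff by auto
  then have B: "norm x \<le> R \<Longrightarrow> \<bar>g x\<bar> \<le> B" for x by simp
  have "\<bar>g x\<bar> \<le> max B 0" for x using B[of x] assms(2)[of x] by (cases "g x = 0") auto
  with that show thesis by blast
qed

lemma bounded_support_continuous_integrable:
  fixes g :: "real^'n::finite \<Rightarrow> real"
  assumes "continuous_on UNIV g" "\<And>x. g x \<noteq> 0 \<Longrightarrow> norm x \<le> R"
  shows "integrable lborel g"
proof -
  obtain B where "\<And>x. \<bar>g x\<bar> \<le> B" using bounded_support_bounded[OF assms] by blast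
  with assms show ?thesis by (intro bounded_support_integrable(1)) (auto intro: borel_measurable_continuous_onI)
qed

text \<open>The product of \<open>p\<close> and \<psi> inherits bounded support from \<psi>, so its
  axis derivative integrates to 0.\<close>

lemma ibp_smooth:
  fixes p \<psi> :: "real^'n::finite \<Rightarrow> real"
  assumes p: "smooth p" and \<psi>: "smooth \<psi>" "cpt_supp \<psi>"
  shows "(\<integral>x. p x * pdx i \<psi> x \<partial>lborel) = - (\<integral>x. pdx i p x * \<psi> x \<partial>lborel)"
proof -
  obtain R where R: "\<And>x. \<psi> x \<noteq> 0 \<Longrightarrow> norm x \<le> R" using cpt_supp_bounded[OF \<psi>(2)] by blast
  obtain R' where R': "\<And>x. pdx i \<psi> x \<noteq> 0 \<Longrightarrow> norm x \<le> R'"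
    using cpt_supp_bounded[OF cpt_supp_pds[OF \<psi>(2), of "[i]"]] by auto
  have c: "continuous_on UNIV p" "continuous_on UNIV (pdx i p)" "continuous_on UNIV \<psi>" "continuous_on UNIV (pdx i \<psi>)"
    using smooth_cont[OF p, of "[]"] smooth_cont[OF p, of "[i]"] smooth_cont[OF \<psi>(1), of "[]"] smooth_cont[OF \<psi>(1), of "[i]"] by auto
  let ?g = "\<lambda>x. p x * \<psi> x" and ?g' = "\<lambda>x. pdx i p x * \<psi> x + p x * pdx i \<psi> x"
  have gc: "continuous_on UNIV ?g" "continuous_on UNIV ?g'" by (intro continuous_intros c)+
  have gR: "?g x \<noteq> 0 \<Longrightarrow> norm x \<le> R" for x using R by auto
  have gR': "?g' x \<noteq> 0 \<Longrightarrow> norm x \<le> max R R'" for x using R[of x] R'[of x] by fastforce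
  obtain B where B: "\<And>x. \<bar>?g x\<bar> \<le> B" using bounded_support_bounded[OF gc(1) gR] by blast
  obtain L where L: "\<And>x. \<bar>?g' x\<bar> \<le> L" using bounded_support_bounded[OF gc(2) gR'] by blast
  have "(\<integral>x. ?g' x \<partial>lborel) = 0"
  proof (rule integral_deriv_zero[OF _ gc B L gR])
    fix x t
    have "((\<lambda>t. p (x + t *\<^sub>R ax i)) has_real_derivative pdx i p (x + t *\<^sub>R ax i)) (at t)"
      "((\<lambda>t. \<psi> (x + t *\<^sub>R ax i)) has_real_derivative pdx i \<psi> (x + t *\<^sub>R ax i)) (at t)"
      using smooth_deriv[OF p, of "[]"] smooth_deriv[OF \<psi>(1), of "[]"] by auto
    from DERIV_mult[OF this]
    show "((\<lambda>t. p (x + t *\<^sub>R ax i) * \<psi> (x + t *\<^sub>R ax i)) has_real_derivative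
      pdx i p (x + t *\<^sub>R ax i) * \<psi> (x + t *\<^sub>R ax i) + p (x + t *\<^sub>R ax i) * pdx i \<psi> (x + t *\<^sub>R ax i)) (at t)"
      by (simp add: mult.commute)
  qed auto
  moreover have "integrable lborel (\<lambda>x. pdx i p x * \<psi> x)" "integrable lborel (\<lambda>x. p x * pdx i \<psi> x)"
    by (rule bounded_support_continuous_integrable[of _ "max R R'"], intro continuous_intros c, use R R' in fastforce)+
  ultimately show ?thesis by simp
qed

text \<open>The outermost derivative of \<psi> is moved first and becomes the innermost one on
  \<open>p\<close>, hence \<open>rev is\<close>.\<close>

lemma ibp_pds:
  fixes p \<psi> :: "real^'n::finite \<Rightarrow> real"
  assumes "smooth p" "smooth \<psi>" "cpt_supp \<psi>"
  shows "(\<integral>x. p x * pds is \<psi> x \<partial>lborel) = (-1) ^ length is * (\<integral>x. pds (rev is) p x * \<psi> x \<partial>lborel)"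
  using assms
proof (induction "is" arbitrary: p)
  case (Cons i "is")
  have "(\<integral>x. p x * pds (i # is) \<psi> x \<partial>lborel) = - (\<integral>x. pds [i] p x * pds is \<psi> x \<partial>lborel)"
    using ibp_smooth[of p "pds is \<psi>" i] Cons.prems by (simp add: smooth_pds cpt_supp_pds)
  also have "\<dots> = - ((-1) ^ length is * (\<integral>x. pds (rev is) (pds [i] p) x * \<psi> x \<partial>lborel))"
    by (subst Cons.IH) (use Cons.prems in \<open>auto intro: smooth_pds simp del: pds.simps(2)\<close>)
  finally show ?case by (simp add: pds_append)
qed simp

section \<open>Weak derivatives\<close>

lemma finite_measure_on_bounded:
  assumes "open \<Omega>" "bounded (\<Omega> :: (real^'n::finite) set)" shows "finite_measure (lebesgue_on \<Omega>)"
  using assms by (simp add: finite_measure_lebesgue_on lmeasurable_open)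

lemma smooth_sqint_on:
  assumes "open \<Omega>" "bounded \<Omega>" "smooth \<phi>" shows "sqint (lebesgue_on \<Omega>) (pds is \<phi>)"
proof -
  have "compact (pds is \<phi> ` closure \<Omega>)"
    using assms smooth_cont[OF assms(3)] by (intro compact_continuous_image) (auto intro: continuous_on_subset)
  then obtain B where "\<forall>y\<in>pds is \<phi> ` closure \<Omega>. \<bar>y\<bar> \<le> B"
    unfolding compact_eq_bounded_closed bounded_iff by auto
  then have "\<bar>pds is \<phi> x\<bar> \<le> B" if "x \<in> \<Omega>" for x using that closure_subset by auto
  then show ?thesis
    by (intro sqint_bounded[OF finite_measure_on_bounded[OF assms(1,2)] borel_measurable_lebesgue_onI[OF smooth_borel[OF assms(3)]]]) simp
qed

lemma smooth_sqint_on0: "open \<Omega> \<Longrightarrow> bounded \<Omega> \<Longrightarrow> smooth \<phi> \<Longrightarrow> sqint (lebesgue_on \<Omega>) \<phi>"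
  using smooth_sqint_on[of \<Omega> \<phi> "[]"] by simp

lemma integral_test_on:
  fixes f g :: "real^'n::finite \<Rightarrow> real"
  assumes "open \<Omega>" "f \<in> borel_measurable borel" "g \<in> borel_measurable borel" "\<And>x. x \<notin> \<Omega> \<Longrightarrow> f x * g x = 0"
  shows "(LINT x|lebesgue_on \<Omega>. f x * g x) = (\<integral>x. f x * g x \<partial>lborel)"
proof -
  have "(\<lambda>x. indicator \<Omega> x * (f x * g x)) = (\<lambda>x. f x * g x)" using assms(4) by (fastforce simp: indicator_def)
  then show ?thesis using assms by (subst lebesgue_on_integral_lborel(1)) auto
qed

lemma pds_test_outside: "test_fun \<Omega> \<phi> \<Longrightarrow> x \<notin> \<Omega> \<Longrightarrow> pds is \<phi> x = 0"
  using test_funD(3)[OF test_fun_pds] .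

text \<open>Symmetry of the derivatives of \<open>p\<close> is a hypothesis because \<open>p\<close>
  carries no support condition; it is verified by mollification for test functions and by explicit
  derivatives for polynomials.\<close>

lemma is_wd_smooth:
  assumes "open \<Omega>" "bounded \<Omega>" "smooth p" "pds (rev is) p = pds is p"
  shows "is_wd \<Omega> is p (pds is p)"
  unfolding is_wd_def L2_eq_sqint
proof (intro conjI allI impI)
  show "sqint (lebesgue_on \<Omega>) (pds is p)" by (rule smooth_sqint_on[OF assms(1-3)])
  fix \<phi> assume t: "test_fun \<Omega> \<phi>"
  have b: "pds js p \<in> borel_measurable borel" "pds js \<phi> \<in> borel_measurable borel" for js
    using assms(3) test_funD(1)[OF t] smooth_borel by auto
  have "(LINT x|lebesgue_on \<Omega>. p x * pds is \<phi> x) = (\<integral>x. p x * pds is \<phi> x \<partial>lborel)"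
    using b[of "[]"] b pds_test_outside[OF t] by (intro integral_test_on[OF assms(1)]) auto
  also have "\<dots> = (-1) ^ length is * (\<integral>x. pds is p x * \<phi> x \<partial>lborel)"
    using ibp_pds[OF assms(3) test_funD(1,2)[OF t]] assms(4) by simp
  also have "(\<integral>x. pds is p x * \<phi> x \<partial>lborel) = (LINT x|lebesgue_on \<Omega>. pds is p x * \<phi> x)"
    using b[of "[]"] b test_funD(3)[OF t] by (intro integral_test_on[OF assms(1), symmetric]) auto
  finally show "(LINT x|lebesgue_on \<Omega>. p x * pds is \<phi> x) = (-1) ^ length is * (LINT x|lebesgue_on \<Omega>. pds is p x * \<phi> x)" .
qed

lemma is_wd_test:
  assumes "open \<Omega>" "bounded \<Omega>" "test_fun \<Omega> \<phi>" shows "is_wd \<Omega> is \<phi> (pds is \<phi>)"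
  by (rule is_wd_smooth[OF assms(1,2) test_funD(1)[OF assms(3)]], rule pds_commute) (use test_funD[OF assms(3)] in auto)

text \<open>Mollifying at x means testing against the kernel recentred at x, which is admissible as
  soon as the cube of half-width \<open>e\<close> about x lies in \<Omega>. Each derivative
  contributes the factor -1/\<open>e\<close> of the inner map.\<close>

lemma kernel_test_fun:
  fixes x :: "real^'n::finite"
  assumes e: "e > 0" and sub: "\<And>y. (\<And>j. \<bar>y $ j - x $ j\<bar> \<le> e) \<Longrightarrow> y \<in> \<Omega>"
  shows "test_fun \<Omega> (\<lambda>y. ker ((1/e) *\<^sub>R (x - y)))"
    and "pds is (\<lambda>y. ker ((1/e) *\<^sub>R (x - y))) y = (- (1/e)) ^ length is * pds is ker ((1/e) *\<^sub>R (x - y))"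
proof -
  let ?f = "\<lambda>y. ker ((1/e) *\<^sub>R (x - y))"
  let ?F = "\<lambda>is y. (- (1/e)) ^ length is * pds is ker ((1/e) *\<^sub>R (x - y))"
  have D: "((\<lambda>t. ?F is (y + t *\<^sub>R ax i)) has_real_derivative ?F (i # is) y) (at 0)" for "is" i y
  proof -
    have eq: "(1/e) *\<^sub>R (x - (y + t *\<^sub>R ax i)) = (1/e) *\<^sub>R (x - y) + ((- (1/e)) * t) *\<^sub>R ax i" for t
      by (simp add: algebra_simps)
    have "((\<lambda>t. pds is ker ((1/e) *\<^sub>R (x - y) + ((- (1/e)) * t) *\<^sub>R ax i)) has_real_derivative
       pds (i # is) ker ((1/e) *\<^sub>R (x - y) + ((- (1/e)) * 0) *\<^sub>R ax i) * (- (1/e))) (at 0)"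
      by (rule DERIV_chain2[OF smooth_deriv[OF smooth_ker] DERIV_cmult_Id])
    from DERIV_cmult[OF this, of "(- (1/e)) ^ length is"]
    show ?thesis unfolding eq by (simp add: mult_ac del: pds.simps)
  qed
  have C: "continuous_on UNIV (?F is)" for "is"
    by (intro continuous_intros continuous_on_compose2[OF smooth_cont[OF smooth_ker]]) auto
  have z: "?F [] = ?f" by simp
  have s: "smooth ?f" by (rule smooth_family(1)[where F = ?F, OF D C z])
  show "pds is ?f y = ?F is y" by (subst smooth_family(2)[where F = ?F, OF D C z]) simp
  let ?K = "cbox (x - (\<chi> j. e)) (x + (\<chi> j. e))"
  have "{y. ?f y \<noteq> 0} \<subseteq> ?K"
  proof
    fix y assume "y \<in> {y. ?f y \<noteq> 0}"
    then have "\<bar>((1/e) *\<^sub>R (x - y)) $ j\<bar> < 1" for j using ker_outside0 not_le by blast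
    then have "\<bar>x $ j - y $ j\<bar> < e" for j using e by (simp add: abs_mult field_simps)
    then have "x $ j - e \<le> y $ j \<and> y $ j \<le> x $ j + e" for j by (smt (verit))
    then show "y \<in> ?K" by (simp add: mem_box_cart)
  qed
  then have cl: "closure {y. ?f y \<noteq> 0} \<subseteq> ?K" by (rule closure_minimal) (rule closed_cbox)
  have "y \<in> \<Omega>" if "y \<in> ?K" for y
  proof (rule sub)
    fix j show "\<bar>y $ j - x $ j\<bar> \<le> e" using that by (auto simp: mem_box_cart abs_le_iff algebra_simps)
  qed
  moreover have "compact (closure {y. ?f y \<noteq> 0})"
    using cl bounded_subset[OF bounded_cbox] by (simp add: compact_eq_bounded_closed) blast
  ultimately show "test_fun \<Omega> ?f" unfolding test_fun_iff cpt_supp_def using s cl by blast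
qed

section \<open>Mollified weak derivatives and the fundamental lemma of the calculus of
  variations\<close>

lemma bounded_sqint_integrable:
  fixes U :: "real^'n::finite \<Rightarrow> real"
  assumes "bounded \<Omega>" "sqint lborel U" "\<And>x. x \<notin> \<Omega> \<Longrightarrow> U x = 0"
  shows "integrable lborel U"
proof -
  obtain R where R: "\<And>x. x \<in> \<Omega> \<Longrightarrow> norm x \<le> R" using assms(1) by (auto simp: bounded_iff)
  have "sqint lborel (indicator (cball 0 R) :: real^'n \<Rightarrow> real)"
    by (rule bounded_support_integrable(2)[where B = 1 and R = R]) (auto simp: indicator_eq_0_iff indicator_le_1 intro!: borel_measurable_indicator)
  from sqint_mult[OF assms(2) this]
  have "integrable lborel (\<lambda>x. U x * indicator (cball 0 R) x)" .
  moreover have "(\<lambda>x. U x * indicator (cball 0 R) x) = U" using assms(3) R by (fastforce simp: indicator_def)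
  ultimately show ?thesis by simp
qed

lemma integral_rep:
  fixes u U f :: "real^'n::finite \<Rightarrow> real"
  assumes \<Omega>: "open \<Omega>" and u: "sqint (lebesgue_on \<Omega>) u" and U: "U \<in> borel_measurable borel" "\<And>x. x \<notin> \<Omega> \<Longrightarrow> U x = 0"
    "AE x in lebesgue_on \<Omega>. u x = U x" and f: "f \<in> borel_measurable borel"
  shows "(LINT x|lebesgue_on \<Omega>. u x * f x) = (\<integral>x. U x * f x \<partial>lborel)"
proof -
  have "(LINT x|lebesgue_on \<Omega>. u x * f x) = (LINT x|lebesgue_on \<Omega>. U x * f x)"
  proof (rule integral_cong_AE)
    show "AE x in lebesgue_on \<Omega>. u x * f x = U x * f x" using U(3) by eventually_elim simp
    show "(\<lambda>x. u x * f x) \<in> borel_measurable (lebesgue_on \<Omega>)" "(\<lambda>x. U x * f x) \<in> borel_measurable (lebesgue_on \<Omega>)"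
      using sqint_meas[OF u] borel_measurable_lebesgue_onI[OF f] borel_measurable_lebesgue_onI[OF U(1)] by auto
  qed
  also have "\<dots> = (\<integral>x. U x * f x \<partial>lborel)" using U f by (intro integral_test_on[OF \<Omega>]) auto
  finally show ?thesis .
qed

text \<open>The weak derivative is tested with the recentred kernel. The sign in the definition of
  the weak derivative cancels the sign from the reflected argument, so mollification commutes with
  weak differentiation at points away from the boundary.\<close>

lemma mol_wd:
  fixes x :: "real^'n::finite"
  assumes \<Omega>: "open \<Omega>" "bounded \<Omega>" and u: "sqint (lebesgue_on \<Omega>) u" and w: "is_wd \<Omega> is u g"
    and U: "U \<in> borel_measurable borel" "\<And>x. x \<notin> \<Omega> \<Longrightarrow> U x = 0" "AE x in lebesgue_on \<Omega>. u x = U x" "sqint lborel U"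
    and G: "G \<in> borel_measurable borel" "\<And>x. x \<notin> \<Omega> \<Longrightarrow> G x = 0" "AE x in lebesgue_on \<Omega>. g x = G x"
    and e: "e > 0" and sub: "\<And>y. (\<And>j. \<bar>y $ j - x $ j\<bar> \<le> e) \<Longrightarrow> y \<in> \<Omega>"
  shows "pds is (mol e U) x = mol e G x"
proof -
  let ?k = "\<lambda>y. ker ((1/e) *\<^sub>R (x - y))"
  have t: "test_fun \<Omega> ?k" by (rule kernel_test_fun(1)[OF e sub])
  have pk: "pds is ?k y = (- (1/e)) ^ length is * pds is ker ((1/e) *\<^sub>R (x - y))" for y by (rule kernel_test_fun(2)[OF e sub])
  have kb: "pds js ?k \<in> borel_measurable borel" for js by (rule smooth_borel[OF test_funD(1)[OF t]])
  have g: "sqint (lebesgue_on \<Omega>) g" using w by (simp add: is_wd_def L2_eq_sqint)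
  have "pds is (mol e U) x = (\<integral>y. (1/e) ^ (CARD('n) + length is) * pds is ker ((1/e) *\<^sub>R (x - y)) * U y \<partial>lborel)"
    by (rule mol_smooth(2)[OF U(1) bounded_sqint_integrable[OF \<Omega>(2) U(4,2)] e])
  also have "\<dots> = (\<integral>y. (1/e) ^ CARD('n) * (-1) ^ length is * (U y * pds is ?k y) \<partial>lborel)"
  proof (rule Bochner_Integration.integral_cong[OF refl])
    fix y
    have eq: "(1/e) ^ length is = (-1) ^ length is * (- (1/e)) ^ length is" by (simp flip: power_mult_distrib)
    show "(1/e) ^ (CARD('n) + length is) * pds is ker ((1/e) *\<^sub>R (x - y)) * U y = (1/e) ^ CARD('n) * (-1) ^ length is * (U y * pds is ?k y)"
      unfolding pk power_add eq by (simp only: mult_ac)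
  qed
  also have "\<dots> = (1/e) ^ CARD('n) * (-1) ^ length is * (LINT y|lebesgue_on \<Omega>. u y * pds is ?k y)"
    by (simp add: integral_rep[OF \<Omega>(1) u U(1-3) kb])
  also have "(LINT y|lebesgue_on \<Omega>. u y * pds is ?k y) = (-1) ^ length is * (LINT y|lebesgue_on \<Omega>. g y * ?k y)"
    using w t unfolding is_wd_def by blast
  also have "(LINT y|lebesgue_on \<Omega>. g y * ?k y) = (\<integral>y. G y * ?k y \<partial>lborel)"
    by (rule integral_rep[OF \<Omega>(1) g G kb[of "[]", unfolded pds.simps(1)]])
  also have "(1/e) ^ CARD('n) * (-1) ^ length is * ((-1) ^ length is * (\<integral>y. G y * ?k y \<partial>lborel)) = (1/e) ^ CARD('n) * (\<integral>y. G y * ?k y \<partial>lborel)"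
    by (simp add: mult.assoc flip: power_add mult_2)
  also have "\<dots> = mol e G x"
    unfolding mol_conv[OF G(1) e] integral_mult_right_zero[symmetric] by (simp only: mult_ac)
  finally show ?thesis .
qed

text \<open>At each fixed point of \<Omega> the mollifications of the representative
  \<open>G\<close> vanish for small scales, while a subsequence of them tends to \<open>G\<close>
  almost everywhere.\<close>

lemma weak_zero_AE:
  fixes g :: "real^'n::finite \<Rightarrow> real"
  assumes \<Omega>: "open \<Omega>" "bounded \<Omega>" and g: "sqint (lebesgue_on \<Omega>) g"
    and z: "\<And>\<phi>. test_fun \<Omega> \<phi> \<Longrightarrow> (LINT x|lebesgue_on \<Omega>. g x * \<phi> x) = 0"
  shows "AE x in lebesgue_on \<Omega>. g x = 0"
proof -
  have \<Omega>b: "\<Omega> \<in> sets borel" using \<Omega> by auto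
  obtain G where G: "G \<in> borel_measurable borel" "\<And>x. x \<notin> \<Omega> \<Longrightarrow> G x = 0" "sqint lborel G" "AE x in lebesgue_on \<Omega>. g x = G x"
    using sqint_borel_rep[OF \<Omega>b g] by metis
  note [measurable] = G(1)
  have Gi: "integrable lborel G" by (rule bounded_sqint_integrable[OF \<Omega>(2) G(3,2)])
  let ?e = "\<lambda>n. inverse (real (Suc n))"
  have e: "?e n > 0" "?e n \<le> 1" "?e \<longlonglongrightarrow> 0" for n
    by (simp, simp add: field_simps, rule LIMSEQ_inverse_real_of_nat)
  \<comment> \<open>Orthogonality to all test functions says that \<open>g\<close> is a weak
    derivative of order 0 of the zero function, so \<open>mol_wd\<close> applies.\<close>
  have w: "is_wd \<Omega> [] (\<lambda>x. 0) g" unfolding is_wd_def L2_eq_sqint using g z by simp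
  have zero: "mol (?e n) G x = 0" if "\<And>y. (\<And>j. \<bar>y $ j - x $ j\<bar> \<le> ?e n) \<Longrightarrow> y \<in> \<Omega>" for n x
  proof -
    have "pds [] (mol (?e n) (\<lambda>x. 0)) x = mol (?e n) G x"
      by (rule mol_wd[OF \<Omega> sqint_zero w _ _ _ _ G(1,2,4) e(1) that]) (auto simp: sqint_zero)
    then show ?thesis by (simp add: mol_def)
  qed
  have l: "(\<lambda>n. l2 lborel (\<lambda>x. mol (?e n) G x - G x)) \<longlonglongrightarrow> 0"
    by (rule mol_tendsto_l2[OF G(1) Gi G(3) e])
  have s: "sqint lborel (\<lambda>x. mol (?e n) G x - G x)" for n
    by (intro sqint_diff G(3) mol_l2(1)[OF G(1) Gi G(3) e(1)])
  have "(\<lambda>n. \<integral>x. norm ((mol (?e n) G x - G x)\<^sup>2) \<partial>lborel) \<longlonglongrightarrow> 0"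
    using tendsto_power[OF l, of 2] by (simp add: l2_sq)
  from tendsto_L1_AE_subseq[OF _ this] s
  obtain r where r: "strict_mono r" "AE x in lborel. (\<lambda>n. (mol (?e (r n)) G x - G x)\<^sup>2) \<longlonglongrightarrow> 0"
    unfolding sqint_def by blast
  have "AE x in lborel. G x = 0"
    using r(2)
  proof eventually_elim
    case (elim x)
    show ?case
    proof (cases "x \<in> \<Omega>")
      case True
      obtain d where d: "d > 0" "ball x d \<subseteq> \<Omega>" using \<Omega>(1) True open_contains_ball by blast
      \<comment> \<open>Coordinate deviations of at most \<open>c\<close> add up to at most
        \<open>d\<close>/2 in the l1 norm, which dominates the Euclidean norm.\<close>
      define c where "c = d / (2 * real CARD('n))"
      have c0: "c > 0" using d by (simp add: c_def)
      have box: "y \<in> \<Omega>" if "\<And>j. \<bar>y $ j - x $ j\<bar> \<le> c" for y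
      proof -
        have "norm (y - x) \<le> (\<Sum>j\<in>UNIV. \<bar>(y - x) $ j\<bar>)" by (rule norm_le_l1_cart)
        also have "\<dots> \<le> (\<Sum>j\<in>(UNIV::'n set). c)" by (rule sum_mono) (use that in simp)
        also have "\<dots> < d" using d by (simp add: c_def)
        finally show ?thesis using d(2) by (auto simp: dist_norm norm_minus_commute)
      qed
      have "\<forall>\<^sub>F n in sequentially. ?e (r n) < c"
      proof -
        have "(\<lambda>n. ?e (r n)) \<longlonglongrightarrow> 0" using LIMSEQ_subseq_LIMSEQ[OF e(3) r(1)] by (simp add: o_def)
        then show ?thesis using c0 by (rule order_tendstoD(2))
      qed
      then have "\<forall>\<^sub>F n in sequentially. (mol (?e (r n)) G x - G x)\<^sup>2 = (G x)\<^sup>2"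
      proof eventually_elim
        case (elim n)
        have "mol (?e (r n)) G x = 0"
        proof (rule zero)
          fix y assume "\<And>j. \<bar>y $ j - x $ j\<bar> \<le> ?e (r n)"
          then have "\<bar>y $ j - x $ j\<bar> \<le> c" for j by (rule order_trans[OF _ less_imp_le[OF elim]])
          then show "y \<in> \<Omega>" by (rule box)
        qed
        then show ?case by simp
      qed
      then have "(\<lambda>n. (mol (?e (r n)) G x - G x)\<^sup>2) \<longlonglongrightarrow> (G x)\<^sup>2" by (rule tendsto_eventually)
      then have "(G x)\<^sup>2 = 0" using elim LIMSEQ_unique by blast
      then show ?thesis by simp
    qed (rule G(2))
  qed
  then have "AE x in lebesgue. G x = 0" by (rule AE_completion)
  then have "AE x in lebesgue_on \<Omega>. G x = 0" using \<Omega>b by (subst AE_restrict_space_iff) (auto elim: eventually_mono)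
  with G(4) show ?thesis by eventually_elim simp
qed

lemma is_wd_sqint: "is_wd \<Omega> is u g \<Longrightarrow> sqint (lebesgue_on \<Omega>) g"
  by (simp add: is_wd_def L2_eq_sqint)

lemma is_wd_lin:
  assumes \<Omega>: "open \<Omega>" "bounded \<Omega>" and u: "sqint (lebesgue_on \<Omega>) u" "sqint (lebesgue_on \<Omega>) v"
    and w: "is_wd \<Omega> is u f" "is_wd \<Omega> is v g"
  shows "is_wd \<Omega> is (\<lambda>x. a * u x + b * v x) (\<lambda>x. a * f x + b * g x)"
  unfolding is_wd_def L2_eq_sqint
proof (intro conjI allI impI)
  let ?M = "lebesgue_on \<Omega>"
  have f: "sqint ?M f" "sqint ?M g" using w by (auto dest: is_wd_sqint)
  then show "sqint ?M (\<lambda>x. a * f x + b * g x)" by (intro sqint_add sqint_cmult)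
  fix \<phi> assume t: "test_fun \<Omega> \<phi>"
  have p: "sqint ?M (pds is \<phi>)" "sqint ?M \<phi>"
    using smooth_sqint_on[OF \<Omega> test_funD(1)[OF t]] smooth_sqint_on0[OF \<Omega> test_funD(1)[OF t]] by auto
  have "(LINT x|?M. (a * u x + b * v x) * pds is \<phi> x) = a * (LINT x|?M. u x * pds is \<phi> x) + b * (LINT x|?M. v x * pds is \<phi> x)"
    using sqint_mult[OF u(1) p(1)] sqint_mult[OF u(2) p(1)] by (simp add: distrib_right mult.assoc)
  also have "(LINT x|?M. u x * pds is \<phi> x) = (-1) ^ length is * (LINT x|?M. f x * \<phi> x)"
    using w(1) t unfolding is_wd_def by blast
  also have "(LINT x|?M. v x * pds is \<phi> x) = (-1) ^ length is * (LINT x|?M. g x * \<phi> x)"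
    using w(2) t unfolding is_wd_def by blast
  also have "a * ((-1) ^ length is * (LINT x|?M. f x * \<phi> x)) + b * ((-1) ^ length is * (LINT x|?M. g x * \<phi> x)) = (-1) ^ length is * (a * (LINT x|?M. f x * \<phi> x) + b * (LINT x|?M. g x * \<phi> x))"
    by (simp add: algebra_simps)
  also have "a * (LINT x|?M. f x * \<phi> x) + b * (LINT x|?M. g x * \<phi> x) = (LINT x|?M. (a * f x + b * g x) * \<phi> x)"
    using sqint_mult[OF f(1) p(2)] sqint_mult[OF f(2) p(2)] by (simp add: distrib_right mult.assoc)
  finally show "(LINT x|?M. (a * u x + b * v x) * pds is \<phi> x) = (-1) ^ length is * (LINT x|?M. (a * f x + b * g x) * \<phi> x)" .
qed

lemma is_wd_diff:
  assumes "open \<Omega>" "bounded \<Omega>" "sqint (lebesgue_on \<Omega>) u" "sqint (lebesgue_on \<Omega>) v" "is_wd \<Omega> is u f" "is_wd \<Omega> is v g"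
  shows "is_wd \<Omega> is (\<lambda>x. u x - v x) (\<lambda>x. f x - g x)"
  using is_wd_lin[OF assms, of 1 "-1"] by simp

lemma is_wd_unique:
  assumes \<Omega>: "open \<Omega>" "bounded \<Omega>" and w: "is_wd \<Omega> is u f" "is_wd \<Omega> is u g"
  shows "AE x in lebesgue_on \<Omega>. f x = g x"
proof -
  let ?M = "lebesgue_on \<Omega>"
  have f: "sqint ?M f" "sqint ?M g" using w by (auto dest: is_wd_sqint)
  have "AE x in ?M. f x - g x = 0"
  proof (rule weak_zero_AE[OF \<Omega> sqint_diff[OF f]])
    fix \<phi> assume t: "test_fun \<Omega> \<phi>"
    have p: "sqint ?M \<phi>" using smooth_sqint_on0[OF \<Omega> test_funD(1)[OF t]] .
    have "(LINT x|?M. u x * pds is \<phi> x) = (-1) ^ length is * (LINT x|?M. f x * \<phi> x)"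
      "(LINT x|?M. u x * pds is \<phi> x) = (-1) ^ length is * (LINT x|?M. g x * \<phi> x)"
      using w t unfolding is_wd_def by blast+
    then show "(LINT x|?M. (f x - g x) * \<phi> x) = 0"
      using sqint_mult[OF f(1) p] sqint_mult[OF f(2) p] by (simp add: left_diff_distrib)
  qed
  then show ?thesis by eventually_elim simp
qed

lemma wd_is_wd: "is_wd \<Omega> is u g \<Longrightarrow> is_wd \<Omega> is u (wd \<Omega> is u)"
  unfolding wd_def by (rule someI[where P = "is_wd \<Omega> is u"])

lemma wd_AE: "open \<Omega> \<Longrightarrow> bounded \<Omega> \<Longrightarrow> is_wd \<Omega> is u g \<Longrightarrow> AE x in lebesgue_on \<Omega>. wd \<Omega> is u x = g x"
  by (rule is_wd_unique[OF _ _ wd_is_wd])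

text \<open>\<open>wd\<close> is a Hilbert choice; uniqueness up to null sets makes its norm
  computable from any known weak derivative.\<close>

lemma norm0_wd:
  assumes "open \<Omega>" "bounded \<Omega>" "is_wd \<Omega> is u g" shows "norm0 \<Omega> (wd \<Omega> is u) = l2 (lebesgue_on \<Omega>) g"
  unfolding norm0_eq_l2 using wd_AE[OF assms] is_wd_sqint[OF assms(3)] is_wd_sqint[OF wd_is_wd[OF assms(3)]]
  by (intro l2_cong_AE) (auto simp: sqint_def)

lemma Hm_wd: "Hm m \<Omega> u \<Longrightarrow> length is \<le> m \<Longrightarrow> is_wd \<Omega> is u (wd \<Omega> is u)"
  unfolding Hm_def using wd_is_wd by blast

lemma Hm_sqint: "Hm m \<Omega> u \<Longrightarrow> sqint (lebesgue_on \<Omega>) u"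
  by (simp add: Hm_def L2_eq_sqint)

lemma is_wd_cong:
  assumes "is_wd \<Omega> is u g" "sqint (lebesgue_on \<Omega>) u" "sqint (lebesgue_on \<Omega>) v" "AE x in lebesgue_on \<Omega>. u x = v x"
  shows "is_wd \<Omega> is v g"
proof -
  have "(LINT x|lebesgue_on \<Omega>. v x * pds is \<phi> x) = (LINT x|lebesgue_on \<Omega>. u x * pds is \<phi> x)" if "test_fun \<Omega> \<phi>" for \<phi>
  proof (rule integral_cong_AE)
    show "AE x in lebesgue_on \<Omega>. v x * pds is \<phi> x = u x * pds is \<phi> x" using assms(4) by eventually_elim simp
    have "pds is \<phi> \<in> borel_measurable (lebesgue_on \<Omega>)"
      by (intro borel_measurable_lebesgue_onI smooth_borel test_funD(1)[OF that])
    then show "(\<lambda>x. v x * pds is \<phi> x) \<in> borel_measurable (lebesgue_on \<Omega>)" "(\<lambda>x. u x * pds is \<phi> x) \<in> borel_measurable (lebesgue_on \<Omega>)"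
      using assms(2,3) by (auto simp: sqint_def)
  qed
  then show ?thesis using assms(1) unfolding is_wd_def by simp
qed

lemma is_wd_Nil: "sqint (lebesgue_on \<Omega>) u \<Longrightarrow> is_wd \<Omega> [] u u"
  by (simp add: is_wd_def L2_eq_sqint)

lemma lebesgue_on_sub:
  fixes f :: "real^'n::finite \<Rightarrow> real"
  assumes "open \<Omega>'" "open \<Omega>" "\<Omega>' \<subseteq> \<Omega>"
  shows "integrable (lebesgue_on \<Omega>) f \<Longrightarrow> integrable (lebesgue_on \<Omega>') f"
    and "f \<in> borel_measurable (lebesgue_on \<Omega>) \<Longrightarrow> f \<in> borel_measurable (lebesgue_on \<Omega>')"
    and "sqint (lebesgue_on \<Omega>) f \<Longrightarrow> sqint (lebesgue_on \<Omega>') f"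
    and "(\<And>x. x \<notin> \<Omega>' \<Longrightarrow> f x = 0) \<Longrightarrow> (LINT x|lebesgue_on \<Omega>'. f x) = (LINT x|lebesgue_on \<Omega>. f x)"
proof -
  have s: "\<Omega>' \<in> sets (lebesgue_on \<Omega>)" using assms by (auto simp: sets_restrict_space_iff)
  have eq: "lebesgue_on \<Omega>' = restrict_space (lebesgue_on \<Omega>) \<Omega>'"
    using assms by (simp add: restrict_restrict_space inf.absorb2)
  show i: "integrable (lebesgue_on \<Omega>) f \<Longrightarrow> integrable (lebesgue_on \<Omega>') f" for f :: "real^'n \<Rightarrow> real"
    unfolding eq using s assms by (subst integrable_restrict_space) (auto dest: integrable_mult_indicator[where f = f] simp: inf.absorb1)
  show m: "f \<in> borel_measurable (lebesgue_on \<Omega>) \<Longrightarrow> f \<in> borel_measurable (lebesgue_on \<Omega>')" for f :: "real^'n \<Rightarrow> real"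
    unfolding eq by (rule measurable_restrict_space1)
  show "sqint (lebesgue_on \<Omega>) f \<Longrightarrow> sqint (lebesgue_on \<Omega>') f" unfolding sqint_def using i m by blast
  show "(LINT x|lebesgue_on \<Omega>'. f x) = (LINT x|lebesgue_on \<Omega>. f x)" if "\<And>x. x \<notin> \<Omega>' \<Longrightarrow> f x = 0"
  proof -
    have "(\<lambda>x. indicator \<Omega>' x *\<^sub>R f x) = f" using that by (fastforce simp: indicator_def)
    then show ?thesis unfolding eq using s assms by (subst integral_restrict_space) (auto simp: inf.absorb1)
  qed
qed

text \<open>A test function of the smaller domain is one of the larger domain, and all integrands
  vanish off its support.\<close>

lemma is_wd_sub:
  assumes "open \<Omega>'" "open \<Omega>" "\<Omega>' \<subseteq> \<Omega>" "is_wd \<Omega> is u g"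
  shows "is_wd \<Omega>' is u g"
  unfolding is_wd_def L2_eq_sqint
proof (intro conjI allI impI)
  show "sqint (lebesgue_on \<Omega>') g" by (rule lebesgue_on_sub(3)[OF assms(1-3) is_wd_sqint[OF assms(4)]])
  fix \<phi> assume t: "test_fun \<Omega>' \<phi>"
  then have t': "test_fun \<Omega> \<phi>" using assms(3) by (auto simp: test_fun_iff)
  have "(LINT x|lebesgue_on \<Omega>'. u x * pds is \<phi> x) = (LINT x|lebesgue_on \<Omega>. u x * pds is \<phi> x)"
    by (rule lebesgue_on_sub(4)[OF assms(1-3)]) (simp add: pds_test_outside[OF t])
  also have "\<dots> = (-1) ^ length is * (LINT x|lebesgue_on \<Omega>. g x * \<phi> x)" using assms(4) t' unfolding is_wd_def by blast
  also have "(LINT x|lebesgue_on \<Omega>. g x * \<phi> x) = (LINT x|lebesgue_on \<Omega>'. g x * \<phi> x)"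
    by (rule lebesgue_on_sub(4)[OF assms(1-3), symmetric]) (simp add: test_funD(3)[OF t])
  finally show "(LINT x|lebesgue_on \<Omega>'. u x * pds is \<phi> x) = (-1) ^ length is * (LINT x|lebesgue_on \<Omega>'. g x * \<phi> x)" .
qed

text \<open>The new index goes to the end of the list because \<open>pds (is @ [i])\<close> applies
  \<open>pds is\<close> to the function \<open>pds [i] \<phi>\<close>, which is again a test
  function. This is the passage to the next order in iterated Poincare estimates.\<close>

lemma is_wd_snoc:
  assumes "is_wd \<Omega> is u g" "is_wd \<Omega> (is @ [i]) u g'"
  shows "is_wd \<Omega> [i] g g'"
  unfolding is_wd_def
proof (intro conjI allI impI)
  show "L2 \<Omega> g'" using assms by (simp add: is_wd_def)
  fix \<phi> assume t: "test_fun \<Omega> \<phi>"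
  have "(LINT x|lebesgue_on \<Omega>. u x * pds is (pds [i] \<phi>) x) = (-1) ^ length is * (LINT x|lebesgue_on \<Omega>. g x * pds [i] \<phi> x)"
    using assms(1) test_fun_pds[OF t] unfolding is_wd_def by blast
  moreover have "(LINT x|lebesgue_on \<Omega>. u x * pds (is @ [i]) \<phi> x) = (-1) ^ length (is @ [i]) * (LINT x|lebesgue_on \<Omega>. g' x * \<phi> x)"
    using assms(2) t unfolding is_wd_def by blast
  ultimately have "(-1) ^ length is * (LINT x|lebesgue_on \<Omega>. g x * pds [i] \<phi> x) = (-1) ^ length is * (- (LINT x|lebesgue_on \<Omega>. g' x * \<phi> x))"
    by (simp add: pds_append)
  then show "(LINT x|lebesgue_on \<Omega>. g x * pds [i] \<phi> x) = (-1) ^ length [i] * (LINT x|lebesgue_on \<Omega>. g' x * \<phi> x)"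
    unfolding mult_cancel_left by simp
qed

lemma is_wd_perm:
  assumes "is_wd \<Omega> is u g" "mset is = mset js" shows "is_wd \<Omega> js u g"
proof -
  have "length is = length js" using assms(2) by (metis size_mset)
  moreover have "pds js \<phi> = pds is \<phi>" if "test_fun \<Omega> \<phi>" for \<phi>
    using pds_commute[OF test_funD(1,2)[OF that] assms(2)] by simp
  ultimately show ?thesis using assms(1) unfolding is_wd_def by simp
qed

section \<open>Approximation of \<open>H20\<close> by test functions\<close>

lemma finite_lists_length[simp]: "finite {is :: 'n::finite list. length is = m}"
  using finite_lists_length_eq[of "UNIV :: 'n set" m] by simp

lemma semi_sq: "(semi m \<Omega> u)\<^sup>2 = (\<Sum>is | length is = m. (norm0 \<Omega> (wd \<Omega> is u))\<^sup>2)"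
  unfolding semi_def by (simp add: sum_nonneg)

lemma semi_nonneg: "semi m \<Omega> u \<ge> 0"
  unfolding semi_def by (simp add: sum_nonneg)

lemma norm0_wd_le_semi: "norm0 \<Omega> (wd \<Omega> is u) \<le> semi (length is) \<Omega> u"
proof (rule power2_le_imp_le[OF _ semi_nonneg])
  show "(norm0 \<Omega> (wd \<Omega> is u))\<^sup>2 \<le> (semi (length is) \<Omega> u)\<^sup>2"
    unfolding semi_sq by (rule member_le_sum) auto
qed

lemma semi_le_Hnorm: "j \<le> m \<Longrightarrow> semi j \<Omega> u \<le> Hnorm m \<Omega> u"
  unfolding Hnorm_def by (rule real_le_rsqrt, rule member_le_sum) auto

lemma H20_approx:
  fixes u :: "real^'n::finite \<Rightarrow> real"
  assumes \<Omega>: "open \<Omega>" "bounded \<Omega>" and u: "H20 \<Omega> u"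
  obtains \<phi> :: "nat \<Rightarrow> real^'n \<Rightarrow> real" where "\<And>n. test_fun \<Omega> (\<phi> n)"
    "\<And>is. length is \<le> 2 \<Longrightarrow> (\<lambda>n. l2 (lebesgue_on \<Omega>) (\<lambda>x. pds is (\<phi> n) x - wd \<Omega> is u x)) \<longlonglongrightarrow> 0"
proof -
  let ?M = "lebesgue_on \<Omega>"
  have "\<forall>n. \<exists>\<phi>. test_fun \<Omega> \<phi> \<and> Hnorm 2 \<Omega> (\<lambda>x. u x - \<phi> x) < inverse (real (Suc n))"
    using u unfolding H20_def by auto
  then obtain \<phi> where t: "\<And>n. test_fun \<Omega> (\<phi> n)" and h: "\<And>n. Hnorm 2 \<Omega> (\<lambda>x. u x - \<phi> n x) < inverse (real (Suc n))" by metis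
  have H: "Hm 2 \<Omega> u" using u by (simp add: H20_def)
  have "(\<lambda>n. l2 ?M (\<lambda>x. pds is (\<phi> n) x - wd \<Omega> is u x)) \<longlonglongrightarrow> 0" if l: "length is \<le> 2" for "is"
  proof (rule Lim_null_comparison[OF _ LIMSEQ_inverse_real_of_nat], rule always_eventually, rule allI)
    fix n
    have "is_wd \<Omega> is (\<lambda>x. u x - \<phi> n x) (\<lambda>x. wd \<Omega> is u x - pds is (\<phi> n) x)"
      by (rule is_wd_diff[OF \<Omega> Hm_sqint[OF H] smooth_sqint_on0[OF \<Omega> test_funD(1)[OF t]] Hm_wd[OF H l] is_wd_test[OF \<Omega> t]])
    from norm0_wd[OF \<Omega> this] norm0_wd_le_semi[of \<Omega> "is" "\<lambda>x. u x - \<phi> n x"] semi_le_Hnorm[OF l, of \<Omega> "\<lambda>x. u x - \<phi> n x"] h[of n]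
    have "l2 ?M (\<lambda>x. wd \<Omega> is u x - pds is (\<phi> n) x) \<le> inverse (real (Suc n))" by linarith
    then show "norm (l2 ?M (\<lambda>x. pds is (\<phi> n) x - wd \<Omega> is u x)) \<le> inverse (real (Suc n))"
      by (simp add: l2_nonneg l2_diff_commute[of ?M "pds is (\<phi> n)"])
  qed
  with t that show thesis by blast
qed

text \<open>Converse of \<open>H20_approx\<close>: if the derivatives up to order 2 of a sequence of
  test functions converge in L2, the limits are weak derivatives of the limit, because the defining
  identity is L2 continuous. The biharmonic solution and the spline basis both enter
  \<open>H20\<close> this way.\<close>

lemma H20I:
  fixes u :: "real^'n::finite \<Rightarrow> real"
  assumes \<Omega>: "open \<Omega>" "bounded \<Omega>" and u: "sqint (lebesgue_on \<Omega>) u"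
    and t: "\<And>n::nat. test_fun \<Omega> (\<phi> n)" and U: "\<And>is. length is \<le> 2 \<Longrightarrow> sqint (lebesgue_on \<Omega>) (U is)"
    and l: "\<And>is. length is \<le> 2 \<Longrightarrow> (\<lambda>n. l2 (lebesgue_on \<Omega>) (\<lambda>x. pds is (\<phi> n) x - U is x)) \<longlonglongrightarrow> 0"
    and ae: "AE x in lebesgue_on \<Omega>. U [] x = u x"
  shows "H20 \<Omega> u" "length is \<le> 2 \<Longrightarrow> is_wd \<Omega> is u (U is)"
proof -
  let ?M = "lebesgue_on \<Omega>"
  have ps: "sqint ?M (pds is (\<phi> n))" for "is" n by (rule smooth_sqint_on[OF \<Omega> test_funD(1)[OF t]])
  have ps0: "sqint ?M (\<phi> n)" for n by (rule smooth_sqint_on0[OF \<Omega> test_funD(1)[OF t]])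
  have wd': "is_wd \<Omega> is u (U is)" if L: "length is \<le> 2" for "is"
  proof -
    have "is_wd \<Omega> is (U []) (U is)"
      unfolding is_wd_def L2_eq_sqint
    proof (intro conjI allI impI U L)
      fix \<psi> assume s: "test_fun \<Omega> \<psi>"
      have q: "sqint ?M (pds is \<psi>)" "sqint ?M \<psi>"
        by (rule smooth_sqint_on[OF \<Omega> test_funD(1)[OF s]], rule smooth_sqint_on0[OF \<Omega> test_funD(1)[OF s]])
      have z: "(\<lambda>n::nat. l2 ?M (\<lambda>x. k x - k x)) \<longlonglongrightarrow> 0" for k by (simp add: l2_def)
      have A: "(\<lambda>n. LINT x|?M. \<phi> n x * pds is \<psi> x) \<longlonglongrightarrow> (LINT x|?M. U [] x * pds is \<psi> x)"
        by (rule l2_ip_tendsto[where g = "\<lambda>_. pds is \<psi>", OF ps0 U _ q(1) q(1) z]) (use l[of "[]"] in auto)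
      have B: "(\<lambda>n. (-1) ^ length is * (LINT x|?M. pds is (\<phi> n) x * \<psi> x)) \<longlonglongrightarrow> (-1) ^ length is * (LINT x|?M. U is x * \<psi> x)"
        by (intro tendsto_mult_left l2_ip_tendsto[where g = "\<lambda>_. \<psi>", OF ps U[OF L] l[OF L] q(2) q(2) z])
      have "(LINT x|?M. \<phi> n x * pds is \<psi> x) = (-1) ^ length is * (LINT x|?M. pds is (\<phi> n) x * \<psi> x)" for n
        using is_wd_test[OF \<Omega> t, of "is" n] s unfolding is_wd_def by blast
      with A have "(\<lambda>n. (-1) ^ length is * (LINT x|?M. pds is (\<phi> n) x * \<psi> x)) \<longlonglongrightarrow> (LINT x|?M. U [] x * pds is \<psi> x)" by simp
      then show "(LINT x|?M. U [] x * pds is \<psi> x) = (-1) ^ length is * (LINT x|?M. U is x * \<psi> x)" by (rule LIMSEQ_unique[OF _ B])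
    qed
    then show ?thesis by (rule is_wd_cong[OF _ U u ae]) simp
  qed
  then show "length is \<le> 2 \<Longrightarrow> is_wd \<Omega> is u (U is)" .
  have H: "Hm 2 \<Omega> u" unfolding Hm_def L2_eq_sqint using u wd' by blast
  show "H20 \<Omega> u" unfolding H20_def
  proof (intro conjI H allI impI)
    fix e :: real assume e: "e > 0"
    have nw: "norm0 \<Omega> (wd \<Omega> is (\<lambda>x. u x - \<phi> n x)) = l2 ?M (\<lambda>x. pds is (\<phi> n) x - U is x)" if L: "length is \<le> 2" for n "is"
      by (subst norm0_wd[OF \<Omega> is_wd_diff[OF \<Omega> u ps0 wd'[OF L] is_wd_test[OF \<Omega> t]]]) (rule l2_diff_commute)
    have "(\<lambda>n. Hnorm 2 \<Omega> (\<lambda>x. u x - \<phi> n x)) \<longlonglongrightarrow> sqrt (\<Sum>j\<le>(2::nat). \<Sum>is | length (is::'n list) = j. 0\<^sup>2)"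
      unfolding Hnorm_def semi_sq
    proof (intro tendsto_real_sqrt tendsto_sum tendsto_power)
      fix j :: nat and "is" :: "'n list" assume "j \<in> {..2}" "is \<in> {is. length is = j}"
      then have L: "length is \<le> 2" by simp
      show "(\<lambda>n. norm0 \<Omega> (wd \<Omega> is (\<lambda>x. u x - \<phi> n x))) \<longlonglongrightarrow> 0" unfolding nw[OF L] by (rule l[OF L])
    qed
    then have "(\<lambda>n. Hnorm 2 \<Omega> (\<lambda>x. u x - \<phi> n x)) \<longlonglongrightarrow> 0" by simp
    from order_tendstoD(2)[OF this e] obtain n where "Hnorm 2 \<Omega> (\<lambda>x. u x - \<phi> n x) < e" by (auto simp: eventually_sequentially)
    with t show "\<exists>\<phi>. test_fun \<Omega> \<phi> \<and> Hnorm 2 \<Omega> (\<lambda>x. u x - \<phi> x) < e" by blast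
  qed
qed

section \<open>The biharmonic form on \<open>H20\<close>\<close>

text \<open>Fundamental theorem of calculus, then Cauchy-Schwarz against the indicator of the
  interval. The right-hand side is a nonnegative integral so that Tonelli applies to it without
  integrability conditions.\<close>

lemma deriv_sq_le:
  fixes f f' :: "real \<Rightarrow> real"
  assumes d: "\<And>t. (f has_real_derivative f' t) (at t)" and c: "continuous_on UNIV f'" and ab: "a \<le> b"
  shows "ennreal ((f b - f a)\<^sup>2) \<le> ennreal (b - a) * (\<integral>\<^sup>+t. indicator {a..b} t * ennreal ((f' t)\<^sup>2) \<partial>lborel)"
proof -
  let ?i = "indicator {a..b} :: real \<Rightarrow> real"
  have [measurable]: "f' \<in> borel_measurable borel" by (rule borel_measurable_continuous_onI[OF c])
  have "f b - f a = (\<integral>t. ?i t *\<^sub>R f' t \<partial>lborel)"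
  proof (rule integral_FTC_atLeastAtMost[symmetric, OF ab])
    show "(f has_vector_derivative f' x) (at x within {a..b})" for x
      using d[of x] by (auto intro: has_vector_derivative_at_within simp: has_real_derivative_iff_has_vector_derivative)
    show "continuous_on {a..b} f'" by (rule continuous_on_subset[OF c]) simp
  qed
  also have "\<dots> = (\<integral>t. ?i t * (?i t * f' t) \<partial>lborel)"
    by (rule Bochner_Integration.integral_cong) (auto simp: indicator_def)
  finally have e: "f b - f a = (\<integral>t. ?i t * (?i t * f' t) \<partial>lborel)" .
  have s1: "sqint lborel ?i" unfolding sqint_def using ab by (auto simp: power2_eq_square indicator_inter_arith[symmetric])
  have i2: "integrable lborel (\<lambda>t. ?i t *\<^sub>R (f' t)\<^sup>2)"
    by (rule borel_integrable_compact) (auto intro!: continuous_intros continuous_on_subset[OF c])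
  have sq: "(\<lambda>t. (?i t * f' t)\<^sup>2) = (\<lambda>t. ?i t * (f' t)\<^sup>2)" by (auto simp: indicator_def)
  have s2: "sqint lborel (\<lambda>t. ?i t * f' t)" unfolding sqint_def sq using i2 by simp
  have "\<bar>f b - f a\<bar> \<le> l2 lborel ?i * l2 lborel (\<lambda>t. ?i t * f' t)" unfolding e by (rule l2_CS[OF s1 s2])
  then have "\<bar>f b - f a\<bar>\<^sup>2 \<le> (l2 lborel ?i * l2 lborel (\<lambda>t. ?i t * f' t))\<^sup>2" by (rule power_mono) simp
  also have "\<dots> = (b - a) * (\<integral>t. ?i t * (f' t)\<^sup>2 \<partial>lborel)"
    using ab by (simp add: power_mult_distrib l2_sq sq) (simp add: power2_eq_square flip: indicator_inter_arith)
  finally have "ennreal ((f b - f a)\<^sup>2) \<le> ennreal ((b - a) * (\<integral>t. ?i t * (f' t)\<^sup>2 \<partial>lborel))" by (intro ennreal_leI) simp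
  also have "\<dots> = ennreal (b - a) * (\<integral>\<^sup>+t. ennreal (?i t * (f' t)\<^sup>2) \<partial>lborel)"
    using i2 ab by (subst nn_integral_eq_integral) (auto simp: ennreal_mult)
  also have "(\<lambda>t. ennreal (?i t * (f' t)\<^sup>2)) = (\<lambda>t. indicator {a..b} t * ennreal ((f' t)\<^sup>2))"
    by (auto simp: indicator_def)
  finally show ?thesis .
qed

text \<open>After the integrals are exchanged, the shift by \<open>t\<close> along \<open>v\<close>
  leaves the inner space integral unchanged.\<close>

lemma nn_integral_lines:
  fixes F :: "real^'n::finite \<Rightarrow> ennreal"
  assumes [measurable]: "F \<in> borel_measurable borel" and D: "D \<ge> 0"
  shows "(\<integral>\<^sup>+x. \<integral>\<^sup>+t. indicator {0..D} t * F (x + t *\<^sub>R v) \<partial>lborel \<partial>lborel) = ennreal D * (\<integral>\<^sup>+x. F x \<partial>lborel)"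
proof -
  have "(\<integral>\<^sup>+x. \<integral>\<^sup>+t. indicator {0..D} t * F (x + t *\<^sub>R v) \<partial>lborel \<partial>lborel) = (\<integral>\<^sup>+t. \<integral>\<^sup>+x. indicator {0..D} t * F (x + t *\<^sub>R v) \<partial>lborel \<partial>lborel)"
    by (rule lborel_pair.Fubini') simp
  also have "\<dots> = (\<integral>\<^sup>+t. indicator {0..D} t * (\<integral>\<^sup>+x. F x \<partial>lborel) \<partial>lborel)"
  proof (intro nn_integral_cong)
    fix t :: real
    have "(\<integral>\<^sup>+x. F x \<partial>lborel) = (\<integral>\<^sup>+x. F (t *\<^sub>R v + 1 *\<^sub>R x) \<partial>lborel)"
      by (subst lborel_nn_integral_affine[where c = 1 and t = "t *\<^sub>R v"]) auto
    then show "(\<integral>\<^sup>+x. indicator {0..D} t * F (x + t *\<^sub>R v) \<partial>lborel) = indicator {0..D} t * (\<integral>\<^sup>+x. F x \<partial>lborel)"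
      by (subst nn_integral_cmult) (auto simp: add.commute)
  qed
  also have "\<dots> = ennreal D * (\<integral>\<^sup>+x. F x \<partial>lborel)" using D by (subst nn_integral_multc) auto
  finally show ?thesis .
qed

text \<open>Moving by \<open>D\<close> along the axis leaves the support, so the value at a point is
  minus the integral of the derivative along that segment. One factor \<open>D\<close> comes from
  Cauchy-Schwarz and one from Tonelli, and the square root leaves a single \<open>D\<close>.\<close>

lemma friedrichs_axis:
  fixes \<phi> :: "real^'n::finite \<Rightarrow> real"
  assumes \<phi>: "smooth \<phi>" "cpt_supp \<phi>" and R: "\<And>x. \<phi> x \<noteq> 0 \<Longrightarrow> norm x \<le> R" and D: "D = 2 * \<bar>R\<bar> + 1"
  shows "l2 lborel \<phi> \<le> D * l2 lborel (pds [i] \<phi>)"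
proof -
  have [measurable]: "pdx i \<phi> \<in> borel_measurable borel" "\<phi> \<in> borel_measurable borel"
    using smooth_borel[OF \<phi>(1), of "[i]"] smooth_borel[OF \<phi>(1), of "[]"] by auto
  have s: "sqint lborel (pdx i \<phi>)" "sqint lborel \<phi>" using smooth_integrable(2)[OF \<phi>, of "[i]"] smooth_integrable(2)[OF \<phi>, of "[]"] by auto
  have D0: "D > 0" using D by simp
  have pt: "ennreal ((\<phi> x)\<^sup>2) \<le> ennreal D * (\<integral>\<^sup>+t. indicator {0..D} t * ennreal ((pdx i \<phi> (x + t *\<^sub>R ax i))\<^sup>2) \<partial>lborel)" for x
  proof (cases "\<phi> x = 0")
    case False
    \<comment> \<open>Two points where \<phi> is nonzero are at most 2 \<open>R\<close> apart, and
      \<open>D\<close> exceeds that.\<close>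
    have "\<phi> (x + D *\<^sub>R ax i) = 0"
    proof (rule ccontr)
      assume "\<phi> (x + D *\<^sub>R ax i) \<noteq> 0"
      from R[OF this] R[OF False] norm_triangle_ineq4[of "x + D *\<^sub>R ax i" x]
      have "norm (D *\<^sub>R (ax i :: real^'n)) \<le> 2 * R" by simp
      then show False using D by (simp add: norm_axis_1)
    qed
    moreover have "ennreal ((\<phi> (x + D *\<^sub>R ax i) - \<phi> (x + 0 *\<^sub>R ax i))\<^sup>2) \<le> ennreal (D - 0) * (\<integral>\<^sup>+t. indicator {0..D} t * ennreal ((pdx i \<phi> (x + t *\<^sub>R ax i))\<^sup>2) \<partial>lborel)"
    proof (rule deriv_sq_le)
      show "((\<lambda>t. \<phi> (x + t *\<^sub>R ax i)) has_real_derivative pdx i \<phi> (x + t *\<^sub>R ax i)) (at t)" for t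
        using smooth_deriv[OF \<phi>(1), of "[]"] by simp
      show "continuous_on UNIV (\<lambda>t. pdx i \<phi> (x + t *\<^sub>R ax i))"
        by (rule continuous_on_compose2[OF smooth_cont[OF \<phi>(1), of "[i]", simplified]]) (auto intro!: continuous_intros)
    qed (use D0 in simp)
    ultimately show ?thesis by simp
  qed simp
  have "(\<integral>\<^sup>+x. ennreal ((\<phi> x)\<^sup>2) \<partial>lborel) \<le> (\<integral>\<^sup>+x. ennreal D * (\<integral>\<^sup>+t. indicator {0..D} t * ennreal ((pdx i \<phi> (x + t *\<^sub>R ax i))\<^sup>2) \<partial>lborel) \<partial>lborel)"
    by (intro nn_integral_mono pt)
  also have "\<dots> = ennreal D * (ennreal D * (\<integral>\<^sup>+x. ennreal ((pdx i \<phi> x)\<^sup>2) \<partial>lborel))"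
    using D0 by (subst nn_integral_cmult) (auto simp: nn_integral_lines[where F = "\<lambda>x. ennreal ((pdx i \<phi> x)\<^sup>2)"])
  finally have "ennreal (\<integral>x. (\<phi> x)\<^sup>2 \<partial>lborel) \<le> ennreal (D * (D * (\<integral>x. (pdx i \<phi> x)\<^sup>2 \<partial>lborel)))"
    using s D0 by (auto simp: sqint_def nn_integral_eq_integral ennreal_mult)
  then have "(\<integral>x. (\<phi> x)\<^sup>2 \<partial>lborel) \<le> D * (D * (\<integral>x. (pdx i \<phi> x)\<^sup>2 \<partial>lborel))"
    using D0 by (subst (asm) ennreal_le_iff) auto
  then have "(l2 lborel \<phi>)\<^sup>2 \<le> (D * l2 lborel (pds [i] \<phi>))\<^sup>2"
    by (simp add: power_mult_distrib l2_sq power2_eq_square[of D])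
  then show ?thesis by (rule power2_le_imp_le) (use D0 in \<open>simp add: l2_nonneg\<close>)
qed

definition lap :: "(real^'n::finite \<Rightarrow> real) \<Rightarrow> real^'n \<Rightarrow> real" where
  "lap \<phi> = (\<lambda>x. \<Sum>i\<in>UNIV. pds [i, i] \<phi> x)"

lemma lap_lin:
  assumes "smooth \<phi>" "smooth \<psi>"
  shows "lap (\<lambda>x. a * \<phi> x + b * \<psi> x) = (\<lambda>x. a * lap \<phi> x + b * lap \<psi> x)"
proof -
  note s = smooth_add(2)[OF smooth_cmult(1)[OF assms(1), where c = a] smooth_cmult(1)[OF assms(2), where c = b]]
  show ?thesis unfolding lap_def s smooth_cmult(2)[OF assms(1)] smooth_cmult(2)[OF assms(2)]
    by (simp add: sum.distrib sum_distrib_left)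
qed

lemma sum_lists_snoc:
  fixes f :: "'n::finite list \<Rightarrow> 'b::comm_monoid_add"
  shows "(\<Sum>is | length is = Suc m. f is) = (\<Sum>is | length is = m. \<Sum>i\<in>UNIV. f (is @ [i]))"
proof -
  have "(\<Sum>is | length is = m. \<Sum>i\<in>UNIV. f (is @ [i])) = (\<Sum>p\<in>{is. length is = m} \<times> UNIV. f (fst p @ [snd p]))"
    by (subst sum.cartesian_product) (auto simp: case_prod_beta)
  also have "\<dots> = (\<Sum>is | length is = Suc m. f is)"
  proof (rule sum.reindex_bij_witness[where i = "\<lambda>is. (butlast is, last is)" and j = "\<lambda>p. fst p @ [snd p]"])
    fix b :: "'n list" assume "b \<in> {is. length is = Suc m}"
    then have "b \<noteq> []" by auto
    then show "fst (butlast b, last b) @ [snd (butlast b, last b)] = b" by simp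
  qed auto
  finally show ?thesis by simp
qed

lemma sum_lists_2:
  fixes f :: "'n::finite list \<Rightarrow> 'b::comm_monoid_add"
  shows "(\<Sum>is | length is = 2. f is) = (\<Sum>i\<in>UNIV. \<Sum>j\<in>UNIV. f [i, j])"
  by (simp add: sum_lists_snoc numeral_2_eq_2)

text \<open>Two integrations by parts turn the square of a mixed second derivative into the product
  of two pure ones, and these products sum to the square of the Laplacian. Hence the H2 seminorm of
  a test function equals the norm of its Laplacian exactly.\<close>

lemma lap_identity:
  assumes \<phi>: "smooth \<phi>" "cpt_supp \<phi>"
  shows "(\<Sum>is | length is = 2. (l2 lborel (pds is \<phi>))\<^sup>2) = (l2 lborel (lap \<phi>))\<^sup>2"
proof -
  have s: "sqint lborel (pds is \<phi>)" for "is" by (rule smooth_integrable(2)[OF \<phi>])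
  have ip: "(\<integral>x. pds [i,j] \<phi> x * pds [i,j] \<phi> x \<partial>lborel) = (\<integral>x. pds [i,i] \<phi> x * pds [j,j] \<phi> x \<partial>lborel)" for i j
  proof -
    have "(\<integral>x. pds [i,j] \<phi> x * pds [i,j] \<phi> x \<partial>lborel) = - (\<integral>x. pds [i,i,j] \<phi> x * pds [j] \<phi> x \<partial>lborel)"
      using ibp_smooth[OF smooth_pds[OF \<phi>(1), of "[i,j]"] smooth_pds[OF \<phi>(1), of "[j]"] cpt_supp_pds[OF \<phi>(2), of "[j]"], of i] by simp
    also have "pds [i,i,j] \<phi> = pds [j,i,i] \<phi>" by (rule pds_commute[OF \<phi>]) simp
    also have "- (\<integral>x. pds [j,i,i] \<phi> x * pds [j] \<phi> x \<partial>lborel) = (\<integral>x. pds [i,i] \<phi> x * pds [j,j] \<phi> x \<partial>lborel)"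
      using ibp_smooth[OF smooth_pds[OF \<phi>(1), of "[i,i]"] smooth_pds[OF \<phi>(1), of "[j]"] cpt_supp_pds[OF \<phi>(2), of "[j]"], of j] by simp
    finally show ?thesis .
  qed
  have "(l2 lborel (lap \<phi>))\<^sup>2 = (\<integral>x. (\<Sum>i\<in>UNIV. \<Sum>j\<in>UNIV. pds [i,i] \<phi> x * pds [j,j] \<phi> x) \<partial>lborel)"
    unfolding l2_sq by (simp add: lap_def power2_eq_square sum_product del: pds.simps)
  also have "\<dots> = (\<Sum>i\<in>UNIV. \<Sum>j\<in>UNIV. \<integral>x. pds [i,i] \<phi> x * pds [j,j] \<phi> x \<partial>lborel)"
    using sqint_mult[OF s s] by (simp add: Bochner_Integration.integral_sum del: pds.simps)
  also have "\<dots> = (\<Sum>i\<in>UNIV. \<Sum>j\<in>UNIV. (l2 lborel (pds [i,j] \<phi>))\<^sup>2)"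
    unfolding l2_sq by (simp add: power2_eq_square ip del: pds.simps)
  finally show ?thesis by (simp add: sum_lists_2)
qed

lemma l2_on_test:
  assumes "open \<Omega>" "f \<in> borel_measurable borel" "\<And>x. x \<notin> \<Omega> \<Longrightarrow> f x = 0"
  shows "l2 (lebesgue_on \<Omega>) f = l2 lborel (f :: real^'n::finite \<Rightarrow> real)"
  unfolding l2_def power2_eq_square using assms by (subst integral_test_on) auto

lemma lap_borel: "smooth \<phi> \<Longrightarrow> lap \<phi> \<in> borel_measurable borel"
  unfolding lap_def by (intro borel_measurable_sum smooth_borel)

lemma lap_sqint: "open \<Omega> \<Longrightarrow> bounded \<Omega> \<Longrightarrow> smooth \<phi> \<Longrightarrow> sqint (lebesgue_on \<Omega>) (lap \<phi>)"
  unfolding lap_def by (intro sqint_sum smooth_sqint_on)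

lemma lap_identity_on:
  assumes "open \<Omega>" "test_fun \<Omega> \<phi>"
  shows "(\<Sum>is | length is = 2. (l2 (lebesgue_on \<Omega>) (pds is \<phi>))\<^sup>2) = (l2 (lebesgue_on \<Omega>) (lap \<phi>))\<^sup>2"
proof -
  note t = test_funD[OF assms(2)]
  have "l2 (lebesgue_on \<Omega>) (pds is \<phi>) = l2 lborel (pds is \<phi>)" for "is"
    by (rule l2_on_test[OF assms(1) smooth_borel[OF t(1)] pds_test_outside[OF assms(2)]])
  moreover have "l2 (lebesgue_on \<Omega>) (lap \<phi>) = l2 lborel (lap \<phi>)"
    by (rule l2_on_test[OF assms(1) lap_borel[OF t(1)]]) (simp add: lap_def pds_test_outside[OF assms(2)] del: pds.simps)
  ultimately show ?thesis using lap_identity[OF t(1,2)] by simp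
qed

text \<open>Second derivatives are bounded by the Laplacian with constant 1; orders 1 and 0 follow
  by one and two one-dimensional steps in a single fixed direction.\<close>

lemma friedrichs:
  assumes \<Omega>: "open \<Omega>" "bounded (\<Omega> :: (real^'n::finite) set)"
  obtains K where "K > 0" "\<And>\<phi> is. test_fun \<Omega> \<phi> \<Longrightarrow> length is \<le> 2 \<Longrightarrow>
     l2 (lebesgue_on \<Omega>) (pds is \<phi>) \<le> K * l2 (lebesgue_on \<Omega>) (lap \<phi>)"
proof -
  let ?M = "lebesgue_on \<Omega>"
  obtain R where R: "\<And>x. x \<in> \<Omega> \<Longrightarrow> norm x \<le> R" using \<Omega>(2) by (auto simp: bounded_iff)
  define D where "D = 2 * \<bar>R\<bar> + 1"
  have D0: "D > 0" by (simp add: D_def)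
  \<comment> \<open>Any direction serves, and index types are nonempty.\<close>
  define i0 where "i0 = (undefined :: 'n)"
  have step: "l2 ?M (pds js \<phi>) \<le> D * l2 ?M (pds (i0 # js) \<phi>)" if t: "test_fun \<Omega> \<phi>" for \<phi> js
  proof -
    have t': "test_fun \<Omega> (pds js \<phi>)" by (rule test_fun_pds[OF t])
    have "l2 lborel (pds js \<phi>) \<le> D * l2 lborel (pds [i0] (pds js \<phi>))"
      by (rule friedrichs_axis[OF test_funD(1,2)[OF t'], of R]) (use R test_funD(3)[OF t'] in \<open>force simp: D_def\<close>)+
    moreover have "l2 ?M (pds is \<phi>) = l2 lborel (pds is \<phi>)" for "is"
      by (rule l2_on_test[OF \<Omega>(1) smooth_borel[OF test_funD(1)[OF t]] pds_test_outside[OF t]])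
    ultimately show ?thesis unfolding pds_append[symmetric] by (simp del: pds.simps)
  qed
  have two: "l2 ?M (pds is \<phi>) \<le> l2 ?M (lap \<phi>)" if t: "test_fun \<Omega> \<phi>" and l: "length is = 2" for \<phi> "is"
  proof (rule power2_le_imp_le[OF _ l2_nonneg])
    show "(l2 ?M (pds is \<phi>))\<^sup>2 \<le> (l2 ?M (lap \<phi>))\<^sup>2"
      unfolding lap_identity_on[OF \<Omega>(1) t, symmetric] by (rule member_le_sum) (use l in auto)
  qed
  have "l2 ?M (pds is \<phi>) \<le> (1 + D + D * D) * l2 ?M (lap \<phi>)" if t: "test_fun \<Omega> \<phi>" and l: "length is \<le> 2" for \<phi> "is"
  proof -
    have L: "l2 ?M (lap \<phi>) \<ge> 0" by (rule l2_nonneg)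
    have one: "l2 ?M (pds js \<phi>) \<le> D * l2 ?M (lap \<phi>)" if "length js = 1" for js
      using order_trans[OF step[OF t, of js] mult_left_mono[OF two[OF t]]] that D0 by simp
    consider "length is = 2" | "length is = 1" | "is = []" using l by (cases "is") (auto simp: le_Suc_eq numeral_2_eq_2)
    then have "l2 ?M (pds is \<phi>) \<le> 1 * l2 ?M (lap \<phi>) \<or> l2 ?M (pds is \<phi>) \<le> D * l2 ?M (lap \<phi>) \<or> l2 ?M (pds is \<phi>) \<le> (D * D) * l2 ?M (lap \<phi>)"
    proof cases
      case 3
      then show ?thesis using order_trans[OF step[OF t, of "[]"] mult_left_mono[OF one[of "[i0]"]]] D0 by (simp add: mult.assoc)
    qed (use two[OF t] one in auto)
    moreover have "1 * l2 ?M (lap \<phi>) \<le> (1 + D + D * D) * l2 ?M (lap \<phi>)" "D * l2 ?M (lap \<phi>) \<le> (1 + D + D * D) * l2 ?M (lap \<phi>)"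
      "(D * D) * l2 ?M (lap \<phi>) \<le> (1 + D + D * D) * l2 ?M (lap \<phi>)"
      using D0 mult_pos_pos[OF D0 D0] by (intro mult_right_mono[OF _ L]; linarith)+
    ultimately show ?thesis by linarith
  qed
  with that[of "1 + D + D * D"] D0 show thesis by (smt (verit) mult_pos_pos)
qed

lemma wlap_sqint:
  assumes "Hm 2 \<Omega> u" shows "sqint (lebesgue_on \<Omega>) (wlap \<Omega> u)"
  unfolding wlap_def by (intro sqint_sum is_wd_sqint[OF Hm_wd[OF assms]]) simp

lemma wlap_approx:
  fixes u :: "real^'n::finite \<Rightarrow> real"
  assumes \<Omega>: "open \<Omega>" "bounded \<Omega>" and u: "Hm 2 \<Omega> u" and t: "\<And>n. test_fun \<Omega> (\<phi> n)"
    and l: "\<And>is. length is \<le> 2 \<Longrightarrow> (\<lambda>n. l2 (lebesgue_on \<Omega>) (\<lambda>x. pds is (\<phi> n) x - wd \<Omega> is u x)) \<longlonglongrightarrow> 0"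
  shows "(\<lambda>n. l2 (lebesgue_on \<Omega>) (\<lambda>x. lap (\<phi> n) x - wlap \<Omega> u x)) \<longlonglongrightarrow> 0"
proof (rule Lim_null_comparison)
  let ?M = "lebesgue_on \<Omega>"
  have "l2 ?M (\<lambda>x. lap (\<phi> n) x - wlap \<Omega> u x) \<le> (\<Sum>i\<in>UNIV. l2 ?M (\<lambda>x. pds [i,i] (\<phi> n) x - wd \<Omega> [i,i] u x))" for n
    unfolding lap_def wlap_def sum_subtractf[symmetric]
    by (intro l2_sum_le sqint_diff smooth_sqint_on[OF \<Omega> test_funD(1)[OF t]] is_wd_sqint[OF Hm_wd[OF u]]) simp
  then show "\<forall>\<^sub>F n in sequentially. norm (l2 ?M (\<lambda>x. lap (\<phi> n) x - wlap \<Omega> u x)) \<le> (\<Sum>i\<in>UNIV. l2 ?M (\<lambda>x. pds [i,i] (\<phi> n) x - wd \<Omega> [i,i] u x))"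
    by (simp add: l2_nonneg)
  have "(\<lambda>n. \<Sum>i\<in>UNIV. l2 ?M (\<lambda>x. pds [i,i] (\<phi> n) x - wd \<Omega> [i,i] u x)) \<longlonglongrightarrow> (\<Sum>i\<in>(UNIV::'n set). 0)"
    by (intro tendsto_sum l) simp
  then show "(\<lambda>n. \<Sum>i\<in>UNIV. l2 ?M (\<lambda>x. pds [i,i] (\<phi> n) x - wd \<Omega> [i,i] u x)) \<longlonglongrightarrow> 0" by simp
qed

text \<open>Both sides are continuous along approximating test functions, where they agree. Energy
  norm and H2 seminorm can therefore be exchanged in the error analysis.\<close>

lemma semi2_wlap:
  fixes u :: "real^'n::finite \<Rightarrow> real"
  assumes \<Omega>: "open \<Omega>" "bounded \<Omega>" and u: "H20 \<Omega> u"
  shows "semi 2 \<Omega> u = norm0 \<Omega> (wlap \<Omega> u)"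
proof -
  let ?M = "lebesgue_on \<Omega>"
  have H: "Hm 2 \<Omega> u" using u by (simp add: H20_def)
  obtain \<phi> :: "nat \<Rightarrow> real^'n \<Rightarrow> real" where t: "\<And>n. test_fun \<Omega> (\<phi> n)"
    and l: "\<And>is. length is \<le> 2 \<Longrightarrow> (\<lambda>n. l2 ?M (\<lambda>x. pds is (\<phi> n) x - wd \<Omega> is u x)) \<longlonglongrightarrow> 0"
    by (rule H20_approx[OF \<Omega> u]) (rule that)
  have A: "(\<lambda>n. \<Sum>is | length is = 2. (l2 ?M (pds is (\<phi> n)))\<^sup>2) \<longlonglongrightarrow> (\<Sum>is | length is = 2. (l2 ?M (wd \<Omega> is u))\<^sup>2)"
    by (intro tendsto_sum tendsto_power l2_tendsto smooth_sqint_on[OF \<Omega> test_funD(1)[OF t]] is_wd_sqint[OF Hm_wd[OF H]] l) auto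
  have B: "(\<lambda>n. (l2 ?M (lap (\<phi> n)))\<^sup>2) \<longlonglongrightarrow> (l2 ?M (wlap \<Omega> u))\<^sup>2"
    by (intro tendsto_power l2_tendsto lap_sqint[OF \<Omega> test_funD(1)[OF t]] wlap_sqint[OF H] wlap_approx[OF \<Omega> H t l])
  have "(semi 2 \<Omega> u)\<^sup>2 = (norm0 \<Omega> (wlap \<Omega> u))\<^sup>2"
    unfolding semi_sq norm0_eq_l2 by (rule LIMSEQ_unique[OF A]) (use B in \<open>simp add: lap_identity_on[OF \<Omega>(1) t]\<close>)
  then show ?thesis
    using semi_nonneg[of 2 \<Omega> u] l2_nonneg[of ?M "wlap \<Omega> u"] by (simp add: norm0_eq_l2 power2_eq_iff_nonneg)
qed

lemma test_fun_lin:
  assumes "test_fun \<Omega> \<phi>" "test_fun \<Omega> \<psi>" shows "test_fun \<Omega> (\<lambda>x. a * \<phi> x + b * \<psi> x)"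
proof -
  have sub: "closure {x. a * \<phi> x + b * \<psi> x \<noteq> 0} \<subseteq> closure {x. \<phi> x \<noteq> 0} \<union> closure {x. \<psi> x \<noteq> 0}"
    unfolding closure_Un[symmetric] by (rule closure_mono) auto
  have c: "compact (closure {x. \<phi> x \<noteq> 0} \<union> closure {x. \<psi> x \<noteq> 0})"
    using assms by (auto simp: test_fun_iff cpt_supp_def)
  have "compact (closure {x. a * \<phi> x + b * \<psi> x \<noteq> 0})"
    using compact_Int_closed[OF c closed_closure[of "{x. a * \<phi> x + b * \<psi> x \<noteq> 0}"]] sub by (simp add: inf.absorb2)
  then show ?thesis unfolding test_fun_iff cpt_supp_def
    using assms sub by (auto simp: test_fun_iff intro!: smooth_add(1) smooth_cmult(1))
qed

lemma pds_lin:
  assumes "smooth \<phi>" "smooth \<psi>"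
  shows "pds is (\<lambda>x. a * \<phi> x + b * \<psi> x) = (\<lambda>x. a * pds is \<phi> x + b * pds is \<psi> x)"
  unfolding smooth_add(2)[OF smooth_cmult(1)[OF assms(1), where c = a] smooth_cmult(1)[OF assms(2), where c = b]]
    smooth_cmult(2)[OF assms(1)] smooth_cmult(2)[OF assms(2)] ..

lemma H20_lin:
  fixes u v :: "real^'n::finite \<Rightarrow> real"
  assumes \<Omega>: "open \<Omega>" "bounded \<Omega>" and u: "H20 \<Omega> u" and v: "H20 \<Omega> v"
  shows "H20 \<Omega> (\<lambda>x. a * u x + b * v x)"
proof -
  let ?M = "lebesgue_on \<Omega>"
  have Hu: "Hm 2 \<Omega> u" and Hv: "Hm 2 \<Omega> v" using u v by (auto simp: H20_def)
  obtain \<phi> :: "nat \<Rightarrow> real^'n \<Rightarrow> real" where t: "\<And>n. test_fun \<Omega> (\<phi> n)"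
    and l: "\<And>is. length is \<le> 2 \<Longrightarrow> (\<lambda>n. l2 ?M (\<lambda>x. pds is (\<phi> n) x - wd \<Omega> is u x)) \<longlonglongrightarrow> 0"
    by (rule H20_approx[OF \<Omega> u]) (rule that)
  obtain \<psi> :: "nat \<Rightarrow> real^'n \<Rightarrow> real" where t': "\<And>n. test_fun \<Omega> (\<psi> n)"
    and l': "\<And>is. length is \<le> 2 \<Longrightarrow> (\<lambda>n. l2 ?M (\<lambda>x. pds is (\<psi> n) x - wd \<Omega> is v x)) \<longlonglongrightarrow> 0"
    by (rule H20_approx[OF \<Omega> v]) (rule that)
  have w: "is_wd \<Omega> is (\<lambda>x. a * u x + b * v x) (\<lambda>x. a * wd \<Omega> is u x + b * wd \<Omega> is v x)" if "length is \<le> 2" for "is"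
    by (rule is_wd_lin[OF \<Omega> Hm_sqint[OF Hu] Hm_sqint[OF Hv] Hm_wd[OF Hu that] Hm_wd[OF Hv that]])
  show ?thesis
  proof (rule H20I(1)[OF \<Omega>, where \<phi> = "\<lambda>n x. a * \<phi> n x + b * \<psi> n x" and U = "\<lambda>is x. a * wd \<Omega> is u x + b * wd \<Omega> is v x"])
    show "sqint ?M (\<lambda>x. a * u x + b * v x)" by (intro sqint_add sqint_cmult Hm_sqint[OF Hu] Hm_sqint[OF Hv])
    show "test_fun \<Omega> (\<lambda>x. a * \<phi> n x + b * \<psi> n x)" for n by (rule test_fun_lin[OF t t'])
    show "sqint ?M (\<lambda>x. a * wd \<Omega> is u x + b * wd \<Omega> is v x)" if "length is \<le> 2" for "is" using w[OF that] by (rule is_wd_sqint)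
    show "AE x in ?M. a * wd \<Omega> [] u x + b * wd \<Omega> [] v x = a * u x + b * v x"
      using wd_AE[OF \<Omega> is_wd_Nil[OF Hm_sqint[OF Hu]]] wd_AE[OF \<Omega> is_wd_Nil[OF Hm_sqint[OF Hv]]] by eventually_elim simp
    fix "is" :: "'n list" assume L: "length is \<le> 2"
    have s: "sqint ?M (\<lambda>x. a * (pds is (\<phi> n) x - wd \<Omega> is u x))" "sqint ?M (\<lambda>x. b * (pds is (\<psi> n) x - wd \<Omega> is v x))" for n
      by (intro sqint_cmult sqint_diff smooth_sqint_on[OF \<Omega> test_funD(1)[OF t]] smooth_sqint_on[OF \<Omega> test_funD(1)[OF t']]
            is_wd_sqint[OF Hm_wd[OF Hu L]] is_wd_sqint[OF Hm_wd[OF Hv L]])+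
    show "(\<lambda>n. l2 ?M (\<lambda>x. pds is (\<lambda>x. a * \<phi> n x + b * \<psi> n x) x - (a * wd \<Omega> is u x + b * wd \<Omega> is v x))) \<longlonglongrightarrow> 0"
    proof (rule Lim_null_comparison)
      have "l2 ?M (\<lambda>x. pds is (\<lambda>x. a * \<phi> n x + b * \<psi> n x) x - (a * wd \<Omega> is u x + b * wd \<Omega> is v x))
        \<le> \<bar>a\<bar> * l2 ?M (\<lambda>x. pds is (\<phi> n) x - wd \<Omega> is u x) + \<bar>b\<bar> * l2 ?M (\<lambda>x. pds is (\<psi> n) x - wd \<Omega> is v x)" for n
        using l2_triangle[OF s[of n]] unfolding l2_cmult pds_lin[OF test_funD(1)[OF t] test_funD(1)[OF t']]
        by (simp add: algebra_simps)
      then show "\<forall>\<^sub>F n in sequentially. norm (l2 ?M (\<lambda>x. pds is (\<lambda>x. a * \<phi> n x + b * \<psi> n x) x - (a * wd \<Omega> is u x + b * wd \<Omega> is v x)))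
        \<le> \<bar>a\<bar> * l2 ?M (\<lambda>x. pds is (\<phi> n) x - wd \<Omega> is u x) + \<bar>b\<bar> * l2 ?M (\<lambda>x. pds is (\<psi> n) x - wd \<Omega> is v x)"
        by (simp add: l2_nonneg)
      show "(\<lambda>n. \<bar>a\<bar> * l2 ?M (\<lambda>x. pds is (\<phi> n) x - wd \<Omega> is u x) + \<bar>b\<bar> * l2 ?M (\<lambda>x. pds is (\<psi> n) x - wd \<Omega> is v x)) \<longlonglongrightarrow> 0"
        using tendsto_add[OF tendsto_mult_left[OF l[OF L], of "\<bar>a\<bar>"] tendsto_mult_left[OF l'[OF L], of "\<bar>b\<bar>"]] by simp
    qed
  qed
qed

lemma H20_diff:
  fixes u v :: "real^'n::finite \<Rightarrow> real"
  assumes \<Omega>: "open \<Omega>" "bounded \<Omega>" and u: "H20 \<Omega> u" and v: "H20 \<Omega> v"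
  shows "H20 \<Omega> (\<lambda>x. u x - v x)" "AE x in lebesgue_on \<Omega>. wlap \<Omega> (\<lambda>x. u x - v x) x = wlap \<Omega> u x - wlap \<Omega> v x"
    "length is \<le> 2 \<Longrightarrow> is_wd \<Omega> is (\<lambda>x. u x - v x) (\<lambda>x. wd \<Omega> is u x - wd \<Omega> is v x)"
proof -
  let ?M = "lebesgue_on \<Omega>"
  have Hu: "Hm 2 \<Omega> u" and Hv: "Hm 2 \<Omega> v" using u v by (auto simp: H20_def)
  have w: "is_wd \<Omega> is (\<lambda>x. u x - v x) (\<lambda>x. wd \<Omega> is u x - wd \<Omega> is v x)" if "length is \<le> 2" for "is"
    by (rule is_wd_diff[OF \<Omega> Hm_sqint[OF Hu] Hm_sqint[OF Hv] Hm_wd[OF Hu that] Hm_wd[OF Hv that]])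
  then show "length is \<le> 2 \<Longrightarrow> is_wd \<Omega> is (\<lambda>x. u x - v x) (\<lambda>x. wd \<Omega> is u x - wd \<Omega> is v x)" .
  show "H20 \<Omega> (\<lambda>x. u x - v x)" using H20_lin[OF \<Omega> u v, of 1 "-1"] by simp
  have "AE x in ?M. \<forall>i\<in>UNIV. wd \<Omega> [i,i] (\<lambda>x. u x - v x) x = wd \<Omega> [i,i] u x - wd \<Omega> [i,i] v x"
    by (rule AE_ball_countable[THEN iffD2]) (use wd_AE[OF \<Omega> w] in auto)
  then show "AE x in ?M. wlap \<Omega> (\<lambda>x. u x - v x) x = wlap \<Omega> u x - wlap \<Omega> v x"
    by eventually_elim (simp add: wlap_def sum_subtractf)
qed

text \<open>Direct method: the energy \<open>J\<close> is minimised over test functions, and the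
  parallelogram law makes a minimising sequence Cauchy in the energy norm. The theorem supplies the
  solution of the dual problem.\<close>

theorem biharmonic_solution_exists:
  fixes \<Omega> :: "(real^'n::finite) set"
  assumes \<Omega>: "open \<Omega>" "bounded \<Omega>" and g: "sqint (lebesgue_on \<Omega>) g"
  obtains w where "H20 \<Omega> w" "\<And>v. H20 \<Omega> v \<Longrightarrow> ip0 \<Omega> (wlap \<Omega> w) (wlap \<Omega> v) = ip0 \<Omega> g v"
proof -
  let ?M = "lebesgue_on \<Omega>"
  obtain K where K0: "K > 0" and K: "\<And>\<phi> is. test_fun \<Omega> \<phi> \<Longrightarrow> length is \<le> 2 \<Longrightarrow> l2 ?M (pds is \<phi>) \<le> K * l2 ?M (lap \<phi>)"
    using friedrichs[OF \<Omega>] by metis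
  define J where "J = (\<lambda>\<phi>. (l2 ?M (lap \<phi>))\<^sup>2 - 2 * (LINT x|?M. g x * \<phi> x))"
  have ls: "sqint ?M (lap \<phi>)" if "test_fun \<Omega> \<phi>" for \<phi> using lap_sqint[OF \<Omega> test_funD(1)[OF that]] .
  have ts: "sqint ?M \<phi>" if "test_fun \<Omega> \<phi>" for \<phi> using smooth_sqint_on0[OF \<Omega> test_funD(1)[OF that]] .
  \<comment> \<open>Completing the square in the norm of the Laplacian.\<close>
  have lower: "J \<phi> \<ge> - (K * l2 ?M g)\<^sup>2" if t: "test_fun \<Omega> \<phi>" for \<phi>
  proof -
    have "\<bar>LINT x|?M. g x * \<phi> x\<bar> \<le> l2 ?M g * l2 ?M \<phi>" by (rule l2_CS[OF g ts[OF t]])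
    also have "\<dots> \<le> l2 ?M g * (K * l2 ?M (lap \<phi>))" using K[OF t, of "[]"] by (intro mult_left_mono) (auto simp: l2_nonneg)
    finally have "J \<phi> \<ge> (l2 ?M (lap \<phi>))\<^sup>2 - 2 * (K * l2 ?M g * l2 ?M (lap \<phi>))" by (simp add: J_def mult_ac)
    then show ?thesis using zero_le_power2[of "l2 ?M (lap \<phi>) - K * l2 ?M g"] by (simp add: power2_diff mult_ac)
  qed
  define T where "T = {\<phi>. test_fun \<Omega> \<phi>}"
  have t0: "(\<lambda>x. 0) \<in> T" by (auto simp: T_def test_fun_iff smooth_zero cpt_supp_def)
  define m where "m = Inf (J ` T)"
  have bdd: "bdd_below (J ` T)" unfolding bdd_below_def using lower by (auto simp: T_def)
  have mle: "m \<le> J \<phi>" if "test_fun \<Omega> \<phi>" for \<phi> unfolding m_def by (rule cInf_lower) (use that bdd in \<open>auto simp: T_def\<close>)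
  have "\<forall>n. \<exists>\<phi>. test_fun \<Omega> \<phi> \<and> J \<phi> < m + inverse (real (Suc n))"
  proof
    fix n
    have "Inf (J ` T) < m + inverse (real (Suc n))" unfolding m_def by simp
    then show "\<exists>\<phi>. test_fun \<Omega> \<phi> \<and> J \<phi> < m + inverse (real (Suc n))"
      using cInf_lessD[of "J ` T"] t0 by (auto simp: T_def)
  qed
  then obtain \<phi> where t: "\<And>n. test_fun \<Omega> (\<phi> n)" and Jn: "\<And>n. J (\<phi> n) < m + inverse (real (Suc n))" by metis
  have Jlin: "J (\<lambda>x. a * \<phi> x + b * \<psi> x) = a\<^sup>2 * (l2 ?M (lap \<phi>))\<^sup>2 + 2 * a * b * (LINT x|?M. lap \<phi> x * lap \<psi> x) + b\<^sup>2 * (l2 ?M (lap \<psi>))\<^sup>2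
     - 2 * a * (LINT x|?M. g x * \<phi> x) - 2 * b * (LINT x|?M. g x * \<psi> x)"
    and l2lin: "(l2 ?M (lap (\<lambda>x. a * \<phi> x + b * \<psi> x)))\<^sup>2 = a\<^sup>2 * (l2 ?M (lap \<phi>))\<^sup>2 + 2 * a * b * (LINT x|?M. lap \<phi> x * lap \<psi> x) + b\<^sup>2 * (l2 ?M (lap \<psi>))\<^sup>2"
    if p: "test_fun \<Omega> \<phi>" and q: "test_fun \<Omega> \<psi>" for \<phi> \<psi> a b
  proof -
    have "(l2 ?M (lap (\<lambda>x. a * \<phi> x + b * \<psi> x)))\<^sup>2 = (LINT x|?M. a\<^sup>2 * (lap \<phi> x)\<^sup>2 + 2 * a * b * (lap \<phi> x * lap \<psi> x) + b\<^sup>2 * (lap \<psi> x)\<^sup>2)"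
      unfolding l2_sq lap_lin[OF test_funD(1)[OF p] test_funD(1)[OF q]]
      by (rule Bochner_Integration.integral_cong) (auto simp: power2_eq_square algebra_simps)
    also have "\<dots> = a\<^sup>2 * (l2 ?M (lap \<phi>))\<^sup>2 + 2 * a * b * (LINT x|?M. lap \<phi> x * lap \<psi> x) + b\<^sup>2 * (l2 ?M (lap \<psi>))\<^sup>2"
      unfolding l2_sq using ls[OF p] ls[OF q] sqint_mult[OF ls[OF p] ls[OF q]] by (simp add: sqint_def)
    finally show l: "(l2 ?M (lap (\<lambda>x. a * \<phi> x + b * \<psi> x)))\<^sup>2 = \<dots>" .
    have "(LINT x|?M. g x * (a * \<phi> x + b * \<psi> x)) = (LINT x|?M. a * (g x * \<phi> x) + b * (g x * \<psi> x))"
      by (rule Bochner_Integration.integral_cong) (auto simp: algebra_simps)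
    also have "\<dots> = a * (LINT x|?M. g x * \<phi> x) + b * (LINT x|?M. g x * \<psi> x)"
      using sqint_mult[OF g ts[OF p]] sqint_mult[OF g ts[OF q]] by simp
    finally show "J (\<lambda>x. a * \<phi> x + b * \<psi> x) = a\<^sup>2 * (l2 ?M (lap \<phi>))\<^sup>2 + 2 * a * b * (LINT x|?M. lap \<phi> x * lap \<psi> x) + b\<^sup>2 * (l2 ?M (lap \<psi>))\<^sup>2
     - 2 * a * (LINT x|?M. g x * \<phi> x) - 2 * b * (LINT x|?M. g x * \<psi> x)" unfolding J_def l by (simp add: algebra_simps)
  qed
  \<comment> \<open>The midpoint of two members still has energy at least \<open>m\<close>; by the
    parallelogram law their squared distance is at most twice the sum of their excesses over
    \<open>m\<close>.\<close>
  have cauchy: "(l2 ?M (lap (\<lambda>x. 1 * \<phi> i x + (-1) * \<phi> j x)))\<^sup>2 \<le> 2 * inverse (real (Suc i)) + 2 * inverse (real (Suc j))" for i j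
  proof -
    have "m \<le> J (\<lambda>x. (1/2) * \<phi> i x + (1/2) * \<phi> j x)" by (rule mle[OF test_fun_lin[OF t t]])
    note this[unfolded Jlin[OF t t]]
    then have "4 * m \<le> 2 * J (\<phi> i) + 2 * J (\<phi> j) - (l2 ?M (lap (\<lambda>x. 1 * \<phi> i x + (-1) * \<phi> j x)))\<^sup>2"
      unfolding l2lin[OF t t] J_def by (simp add: power2_eq_square field_simps)
    then show ?thesis using Jn[of i] Jn[of j] by linarith
  qed
  have "\<exists>U. sqint ?M U \<and> (\<lambda>n. l2 ?M (\<lambda>x. pds is (\<phi> n) x - U x)) \<longlonglongrightarrow> 0" if L: "length is \<le> 2" for "is"
  proof -
    have s: "sqint ?M (pds is (\<phi> n))" for n by (rule smooth_sqint_on[OF \<Omega> test_funD(1)[OF t]])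
    have "\<exists>N. \<forall>i\<ge>N. \<forall>j\<ge>N. l2 ?M (\<lambda>x. pds is (\<phi> i) x - pds is (\<phi> j) x) < e" if e: "e > 0" for e
    proof -
      have "(\<lambda>n. inverse (real (Suc n))) \<longlonglongrightarrow> 0" by (rule LIMSEQ_inverse_real_of_nat)
      \<comment> \<open>Two excesses enter with the factor 2, hence the division by 4;
        \<open>K\<close> converts the energy norm into the norm of the derivative.\<close>
      moreover have "0 < (e / K)\<^sup>2 / 4" using e K0 by simp
      ultimately have "\<forall>\<^sub>F n in sequentially. inverse (real (Suc n)) < (e / K)\<^sup>2 / 4" by (rule order_tendstoD(2))
      then obtain N where N: "\<And>n. n \<ge> N \<Longrightarrow> inverse (real (Suc n)) < (e / K)\<^sup>2 / 4" by (auto simp: eventually_sequentially)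
      have "l2 ?M (\<lambda>x. pds is (\<phi> i) x - pds is (\<phi> j) x) < e" if "i \<ge> N" "j \<ge> N" for i j
      proof -
        let ?d = "\<lambda>x. 1 * \<phi> i x + (-1) * \<phi> j x"
        have "(l2 ?M (lap ?d))\<^sup>2 < (e / K)\<^sup>2" using cauchy[of i j] N[OF that(1)] N[OF that(2)] by linarith
        then have "l2 ?M (lap ?d) < e / K" using e K0 by (intro power2_less_imp_less[of _ "e / K"]) auto
        then have "K * l2 ?M (lap ?d) < e" using K0 by (simp add: field_simps)
        moreover have "l2 ?M (pds is ?d) \<le> K * l2 ?M (lap ?d)" by (rule K[OF test_fun_lin[OF t t] L])
        ultimately show ?thesis unfolding pds_lin[OF test_funD(1)[OF t] test_funD(1)[OF t]] by simp
      qed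
      then show ?thesis by blast
    qed
    from l2_complete[OF finite_measure_on_bounded[OF \<Omega>] s this] show ?thesis by blast
  qed
  then have "\<forall>is. \<exists>U. length is \<le> 2 \<longrightarrow> sqint ?M U \<and> (\<lambda>n. l2 ?M (\<lambda>x. pds is (\<phi> n) x - U x)) \<longlonglongrightarrow> 0" by blast
  from choice[OF this] obtain U where
    U': "\<forall>is. length is \<le> 2 \<longrightarrow> sqint ?M (U is) \<and> (\<lambda>n. l2 ?M (\<lambda>x. pds is (\<phi> n) x - U is x)) \<longlonglongrightarrow> 0" ..
  have U: "sqint ?M (U is)" and l: "(\<lambda>n. l2 ?M (\<lambda>x. pds is (\<phi> n) x - U is x)) \<longlonglongrightarrow> 0" if "length is \<le> 2" for "is"
    using U' that by auto
  define w where "w = U []"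
  have w: "H20 \<Omega> w" and wwd: "\<And>is. length is \<le> 2 \<Longrightarrow> is_wd \<Omega> is w (U is)"
    using H20I[OF \<Omega> U[of "[]"] t U l] by (auto simp: w_def)
  have Hw: "Hm 2 \<Omega> w" using w by (simp add: H20_def)
  have lw: "(\<lambda>n. l2 ?M (\<lambda>x. pds is (\<phi> n) x - wd \<Omega> is w x)) \<longlonglongrightarrow> 0" if L: "length is \<le> 2" for "is"
  proof -
    have "l2 ?M (\<lambda>x. pds is (\<phi> n) x - wd \<Omega> is w x) = l2 ?M (\<lambda>x. pds is (\<phi> n) x - U is x)" for n
    proof (rule l2_cong_AE)
      show "AE x in ?M. pds is (\<phi> n) x - wd \<Omega> is w x = pds is (\<phi> n) x - U is x"
        using wd_AE[OF \<Omega> wwd[OF L]] by eventually_elim simp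
    qed (auto intro!: sqint_meas sqint_diff smooth_sqint_on[OF \<Omega> test_funD(1)[OF t]] U[OF L] is_wd_sqint[OF Hm_wd[OF Hw L]])
    then show ?thesis using l[OF L] by simp
  qed
  note lapw = wlap_approx[OF \<Omega> Hw t lw]
  have z: "(\<lambda>n::nat. l2 ?M (\<lambda>x. k x - k x)) \<longlonglongrightarrow> 0" for k by (simp add: l2_def)
  have test: "ip0 \<Omega> (wlap \<Omega> w) (lap \<psi>) = ip0 \<Omega> g \<psi>" if q: "test_fun \<Omega> \<psi>" for \<psi>
  proof -
    let ?E = "ip0 \<Omega> (wlap \<Omega> w) (lap \<psi>) - ip0 \<Omega> g \<psi>" and ?A = "(l2 ?M (lap \<psi>))\<^sup>2"
    have lim: "(\<lambda>n. LINT x|?M. lap (\<phi> n) x * lap \<psi> x) \<longlonglongrightarrow> (LINT x|?M. wlap \<Omega> w x * lap \<psi> x)"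
      by (rule l2_ip_tendsto[where g = "\<lambda>_. lap \<psi>", OF ls[OF t] wlap_sqint[OF Hw] lapw ls[OF q] ls[OF q] z])
    \<comment> \<open>First-order optimality: adding a multiple of \<psi> to the minimising sequence
      cannot undercut the infimum, and the inequality survives the limit.\<close>
    have ge: "0 \<le> 2 * s * ?E + s\<^sup>2 * ?A" for s
    proof -
      have "0 \<le> inverse (real (Suc n)) + (2 * s * ((LINT x|?M. lap (\<phi> n) x * lap \<psi> x) - ip0 \<Omega> g \<psi>) + s\<^sup>2 * ?A)" for n
      proof -
        have "m \<le> J (\<lambda>x. 1 * \<phi> n x + s * \<psi> x)" by (rule mle[OF test_fun_lin[OF t q]])
        note this[unfolded Jlin[OF t q]]
        then have "m \<le> J (\<phi> n) + (2 * s * ((LINT x|?M. lap (\<phi> n) x * lap \<psi> x) - ip0 \<Omega> g \<psi>) + s\<^sup>2 * ?A)"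
          unfolding J_def ip0_def by (simp add: algebra_simps)
        then show ?thesis using Jn[of n] by linarith
      qed
      moreover have "(\<lambda>n. inverse (real (Suc n)) + (2 * s * ((LINT x|?M. lap (\<phi> n) x * lap \<psi> x) - ip0 \<Omega> g \<psi>) + s\<^sup>2 * ?A))
         \<longlonglongrightarrow> 0 + (2 * s * (ip0 \<Omega> (wlap \<Omega> w) (lap \<psi>) - ip0 \<Omega> g \<psi>) + s\<^sup>2 * ?A)"
        unfolding ip0_def by (intro tendsto_intros lim LIMSEQ_inverse_real_of_nat)
      ultimately show ?thesis using LIMSEQ_le_const by fastforce
    qed
    have A0: "?A \<ge> 0" by simp
    \<comment> \<open>This value of the parameter makes the quadratic negative unless
      \<open>?E\<close> is 0; the added 1 keeps the denominator positive when \<open>?A\<close>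
      vanishes.\<close>
    have "2 * (- ?E / (?A + 1)) * ?E + (- ?E / (?A + 1))\<^sup>2 * ?A = - (?E\<^sup>2 * (?A + 2)) / (?A + 1)\<^sup>2"
      using A0 by (simp add: power2_eq_square divide_simps) (simp add: algebra_simps)
    with ge[of "- ?E / (?A + 1)"] have "0 \<le> - (?E\<^sup>2 * (?A + 2)) / (?A + 1)\<^sup>2" by simp
    then have "?E\<^sup>2 * (?A + 2) \<le> 0" using A0 by (simp add: divide_le_0_iff zero_le_divide_iff add_nonneg_eq_0_iff)
    then have "?E\<^sup>2 \<le> 0" using A0 by (simp add: mult_le_0_iff)
    then show ?thesis by simp
  qed
  have "ip0 \<Omega> (wlap \<Omega> w) (wlap \<Omega> v) = ip0 \<Omega> g v" if v: "H20 \<Omega> v" for v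
  proof -
    have Hv: "Hm 2 \<Omega> v" using v by (simp add: H20_def)
    obtain \<psi> :: "nat \<Rightarrow> real^'n \<Rightarrow> real" where q: "\<And>n. test_fun \<Omega> (\<psi> n)"
      and lv: "\<And>is. length is \<le> 2 \<Longrightarrow> (\<lambda>n. l2 ?M (\<lambda>x. pds is (\<psi> n) x - wd \<Omega> is v x)) \<longlonglongrightarrow> 0"
      by (rule H20_approx[OF \<Omega> v]) (rule that)
    have "(\<lambda>n. ip0 \<Omega> (wlap \<Omega> w) (lap (\<psi> n))) \<longlonglongrightarrow> ip0 \<Omega> (wlap \<Omega> w) (wlap \<Omega> v)"
      unfolding ip0_def by (rule l2_ip_tendsto[where f = "\<lambda>_. wlap \<Omega> w", OF wlap_sqint[OF Hw] wlap_sqint[OF Hw] z ls[OF q] wlap_sqint[OF Hv] wlap_approx[OF \<Omega> Hv q lv]])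
    moreover have "(\<lambda>n. ip0 \<Omega> g (pds [] (\<psi> n))) \<longlonglongrightarrow> ip0 \<Omega> g (wd \<Omega> [] v)"
      unfolding ip0_def by (rule l2_ip_tendsto[where f = "\<lambda>_. g", OF g g z smooth_sqint_on[OF \<Omega> test_funD(1)[OF q]] is_wd_sqint[OF Hm_wd[OF Hv]] lv]) auto
    ultimately have "ip0 \<Omega> (wlap \<Omega> w) (wlap \<Omega> v) = ip0 \<Omega> g (wd \<Omega> [] v)"
      using test[OF q] LIMSEQ_unique by simp
    also have "\<dots> = ip0 \<Omega> g v"
      unfolding ip0_def
    proof (rule integral_cong_AE)
      show "AE x in ?M. g x * wd \<Omega> [] v x = g x * v x"
        using wd_AE[OF \<Omega> is_wd_Nil[OF Hm_sqint[OF Hv]]] by eventually_elim simp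
    qed (use g Hm_sqint[OF Hv] is_wd_sqint[OF Hm_wd[OF Hv, of "[]"]] in \<open>auto simp: sqint_def\<close>)
    finally show ?thesis .
  qed
  with w that show thesis by blast
qed

section \<open>The Poincare inequality on cubes\<close>

text \<open>Continuous partial derivatives give the chain rule along arbitrary directions: the
  increment is built up one coordinate at a time, with the mean value inequality on each
  leg.\<close>

lemma smooth_line_deriv:
  fixes \<phi> :: "real^'n::finite \<Rightarrow> real"
  assumes \<phi>: "smooth \<phi>"
  shows "((\<lambda>t. \<phi> (x + t *\<^sub>R v)) has_real_derivative (\<Sum>i\<in>UNIV. v $ i * pdx i \<phi> (x + t *\<^sub>R v))) (at t)"
proof -
  \<comment> \<open>The added 1 keeps \<open>V\<close> positive for the zero direction.\<close>
  define V where "V = (\<Sum>i\<in>UNIV. \<bar>v $ i\<bar>) + 1"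
  have V0: "V > 0" by (simp add: V_def add_nonneg_pos sum_nonneg)
  have main: "((\<lambda>t. \<phi> (x + t *\<^sub>R v)) has_real_derivative (\<Sum>i\<in>UNIV. v $ i * pdx i \<phi> x)) (at 0)" for x
    unfolding DERIV_def
  proof (rule LIM_I)
    fix r :: real assume r: "r > 0"
    \<comment> \<open>The errors of all legs add up to at most e |s| V = r |s| / 2.\<close>
    define e where "e = r / (2 * V)"
    have e0: "e > 0" using r V0 by (simp add: e_def)
    have "\<forall>\<^sub>F y in nhds x. \<forall>i\<in>UNIV. dist (pdx i \<phi> y) (pdx i \<phi> x) < e"
    proof (rule eventually_ball_finite)
      show "\<forall>i\<in>UNIV. \<forall>\<^sub>F y in nhds x. dist (pdx i \<phi> y) (pdx i \<phi> x) < e"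
      proof
        fix i :: 'n
        have "continuous_on UNIV (pdx i \<phi>)" using smooth_cont[OF \<phi>, of "[i]"] by simp
        then have "isCont (pdx i \<phi>) x" by (simp add: continuous_on_eq_continuous_at)
        then have "(pdx i \<phi> \<longlongrightarrow> pdx i \<phi> x) (nhds x)" by (simp add: continuous_at tendsto_at_iff_tendsto_nhds)
        then show "\<forall>\<^sub>F y in nhds x. dist (pdx i \<phi> y) (pdx i \<phi> x) < e" using e0 by (rule tendstoD)
      qed
    qed simp
    then obtain d where d0: "d > 0" and d': "\<forall>y. dist y x < d \<longrightarrow> (\<forall>i\<in>UNIV. dist (pdx i \<phi> y) (pdx i \<phi> x) < e)"
      unfolding eventually_nhds_metric by blast
    then have d: "d > 0" "\<And>y i. dist y x < d \<Longrightarrow> \<bar>pdx i \<phi> y - pdx i \<phi> x\<bar> \<le> e"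
      by (auto simp: dist_real_def less_imp_le)
    have part: "\<bar>\<phi> (x + (\<Sum>i\<in>S. (s * v $ i) *\<^sub>R ax i)) - \<phi> x - (\<Sum>i\<in>S. s * v $ i * pdx i \<phi> x)\<bar> \<le> e * (\<Sum>i\<in>S. \<bar>s * v $ i\<bar>)"
      if s: "\<bar>s\<bar> * V < d" for s and S :: "'n set"
      using finite[of S]
    proof (induction S rule: finite_induct)
      case (insert i S)
      define w where "w = (\<Sum>i\<in>S. (s * v $ i) *\<^sub>R (ax i :: real^'n))"
      define g where "g = (\<lambda>\<tau>. \<phi> (x + w + \<tau> *\<^sub>R ax i) - \<tau> * pdx i \<phi> x)"
      have gd: "(g has_real_derivative pdx i \<phi> (x + w + \<tau> *\<^sub>R ax i) - pdx i \<phi> x) (at \<tau>)" for \<tau>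
        unfolding g_def using smooth_deriv[OF \<phi>, of "[]" "x + w" i \<tau>] by (auto intro!: derivative_eq_intros)
      have "norm (g (s * v $ i) - g 0) \<le> e * norm (s * v $ i - 0)"
      proof (rule field_differentiable_bound[of "{- \<bar>s * v $ i\<bar>..\<bar>s * v $ i\<bar>}"])
        fix \<tau> assume \<tau>: "\<tau> \<in> {- \<bar>s * v $ i\<bar>..\<bar>s * v $ i\<bar>}"
        show "(g has_field_derivative pdx i \<phi> (x + w + \<tau> *\<^sub>R ax i) - pdx i \<phi> x) (at \<tau> within {- \<bar>s * v $ i\<bar>..\<bar>s * v $ i\<bar>})"
          by (rule has_field_derivative_at_within[OF gd])
        have "norm (w + \<tau> *\<^sub>R ax i) \<le> (\<Sum>i\<in>S. \<bar>s * v $ i\<bar>) + \<bar>\<tau>\<bar>"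
          unfolding w_def by (rule order_trans[OF norm_triangle_ineq add_mono]) (auto intro!: order_trans[OF norm_sum] simp: norm_axis_1)
        also have "\<dots> \<le> (\<Sum>i\<in>insert i S. \<bar>s * v $ i\<bar>)" using insert.hyps \<tau> by auto
        also have "\<dots> \<le> (\<Sum>i\<in>UNIV. \<bar>s * v $ i\<bar>)" by (rule sum_mono2) auto
        also have "\<dots> = \<bar>s\<bar> * (\<Sum>i\<in>UNIV. \<bar>v $ i\<bar>)" by (simp add: abs_mult sum_distrib_left)
        also have "\<dots> \<le> \<bar>s\<bar> * V" by (rule mult_left_mono) (auto simp: V_def)
        also have "\<dots> < d" by (rule s)
        finally have "dist (x + w + \<tau> *\<^sub>R ax i) x < d" by (simp add: dist_norm add.assoc)
        then show "norm (pdx i \<phi> (x + w + \<tau> *\<^sub>R ax i) - pdx i \<phi> x) \<le> e" using d(2) by simp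
      qed auto
      then have "\<bar>\<phi> (x + w + (s * v $ i) *\<^sub>R ax i) - s * v $ i * pdx i \<phi> x - \<phi> (x + w)\<bar> \<le> e * \<bar>s * v $ i\<bar>" by (simp add: g_def)
      moreover have "\<bar>\<phi> (x + w) - \<phi> x - (\<Sum>i\<in>S. s * v $ i * pdx i \<phi> x)\<bar> \<le> e * (\<Sum>i\<in>S. \<bar>s * v $ i\<bar>)"
        using insert.IH by (simp add: w_def)
      ultimately have "\<bar>\<phi> (x + w + (s * v $ i) *\<^sub>R ax i) - \<phi> x - (s * v $ i * pdx i \<phi> x + (\<Sum>i\<in>S. s * v $ i * pdx i \<phi> x))\<bar>
         \<le> e * \<bar>s * v $ i\<bar> + e * (\<Sum>i\<in>S. \<bar>s * v $ i\<bar>)" by linarith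
      moreover have eq: "x + (\<Sum>i\<in>insert i S. (s * v $ i) *\<^sub>R ax i) = x + w + (s * v $ i) *\<^sub>R ax i"
        using insert.hyps by (simp add: w_def algebra_simps)
      ultimately show ?case unfolding eq using insert.hyps by (simp add: distrib_left)
    qed simp
    have rep: "(\<Sum>i\<in>UNIV. (s * v $ i) *\<^sub>R ax i) = s *\<^sub>R v" for s
      by (simp add: vec_eq_iff axis_def if_distrib cong: if_cong)
    show "\<exists>d'>0. \<forall>s. s \<noteq> 0 \<and> norm (s - 0) < d' \<longrightarrow> norm ((\<phi> (x + (0 + s) *\<^sub>R v) - \<phi> (x + 0 *\<^sub>R v)) / s - (\<Sum>i\<in>UNIV. v $ i * pdx i \<phi> x)) < r"
    proof (intro exI[of _ "d / V"] conjI allI impI)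
      show "d / V > 0" using d V0 by simp
      fix s :: real assume "s \<noteq> 0 \<and> norm (s - 0) < d / V"
      then have s0: "s \<noteq> 0" and s: "\<bar>s\<bar> * V < d" using V0 by (auto simp: field_simps)
      have "\<bar>\<phi> (x + s *\<^sub>R v) - \<phi> x - s * (\<Sum>i\<in>UNIV. v $ i * pdx i \<phi> x)\<bar> \<le> e * (\<bar>s\<bar> * (\<Sum>i\<in>UNIV. \<bar>v $ i\<bar>))"
        using part[OF s, of UNIV] unfolding rep by (simp add: abs_mult sum_distrib_left mult.assoc)
      also have "\<dots> \<le> e * (\<bar>s\<bar> * V)" using e0 by (intro mult_left_mono) (auto simp: V_def)
      also have "\<dots> = r / 2 * \<bar>s\<bar>" using V0 by (simp add: e_def)
      also have "\<dots> < r * \<bar>s\<bar>" using r s0 by simp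
      finally have "\<bar>(\<phi> (x + s *\<^sub>R v) - \<phi> x - s * (\<Sum>i\<in>UNIV. v $ i * pdx i \<phi> x)) / s\<bar> < r"
        using s0 by (simp add: abs_divide divide_less_eq)
      moreover have "(\<phi> (x + s *\<^sub>R v) - \<phi> x - s * (\<Sum>i\<in>UNIV. v $ i * pdx i \<phi> x)) / s = (\<phi> (x + s *\<^sub>R v) - \<phi> x) / s - (\<Sum>i\<in>UNIV. v $ i * pdx i \<phi> x)"
        using s0 by (simp add: diff_divide_distrib)
      ultimately show "norm ((\<phi> (x + (0 + s) *\<^sub>R v) - \<phi> (x + 0 *\<^sub>R v)) / s - (\<Sum>i\<in>UNIV. v $ i * pdx i \<phi> x)) < r" by simp
    qed
  qed
  have "((\<lambda>s. \<phi> ((x + t *\<^sub>R v) + s *\<^sub>R v)) has_real_derivative (\<Sum>i\<in>UNIV. v $ i * pdx i \<phi> (x + t *\<^sub>R v))) (at 0)"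
    by (rule main)
  then show ?thesis
    using DERIV_shift[of "\<lambda>t. \<phi> (x + t *\<^sub>R v)" "\<Sum>i\<in>UNIV. v $ i * pdx i \<phi> (x + t *\<^sub>R v)" 0 t]
    by (simp add: scaleR_add_left algebra_simps)
qed

text \<open>The substitution has Jacobian t^n with n the dimension, which is at least 2^(-n) for t
  \<ge> 1/2.\<close>

lemma nn_integral_segment_half:
  fixes F :: "real^'n::finite \<Rightarrow> ennreal"
  assumes [measurable]: "F \<in> borel_measurable borel" and t: "t \<ge> 1/2"
  shows "(\<integral>\<^sup>+x. F ((1 - t) *\<^sub>R y + t *\<^sub>R x) \<partial>lborel) \<le> 2 ^ CARD('n) * (\<integral>\<^sup>+x. F x \<partial>lborel)"
proof -
  have "(\<integral>\<^sup>+x. F x \<partial>lborel) = ennreal (\<bar>t\<bar> ^ DIM(real^'n)) * (\<integral>\<^sup>+x. F ((1 - t) *\<^sub>R y + t *\<^sub>R x) \<partial>lborel)"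
    by (rule lborel_nn_integral_affine) (use t in auto)
  then have "2 ^ CARD('n) * (\<integral>\<^sup>+x. F x \<partial>lborel) = ennreal (2 ^ CARD('n) * t ^ CARD('n)) * (\<integral>\<^sup>+x. F ((1 - t) *\<^sub>R y + t *\<^sub>R x) \<partial>lborel)"
    using t by (simp add: ennreal_mult mult.assoc ennreal_power flip: ennreal_numeral)
  moreover have "(1::real) \<le> 2 ^ CARD('n) * t ^ CARD('n)"
    unfolding power_mult_distrib[symmetric] using t by (intro one_le_power) simp
  then have "1 * (\<integral>\<^sup>+x. F ((1 - t) *\<^sub>R y + t *\<^sub>R x) \<partial>lborel) \<le> ennreal (2 ^ CARD('n) * t ^ CARD('n)) * (\<integral>\<^sup>+x. F ((1 - t) *\<^sub>R y + t *\<^sub>R x) \<partial>lborel)"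
    by (intro mult_right_mono) (auto simp flip: ennreal_1 intro!: ennreal_leI)
  ultimately show ?thesis by simp
qed

text \<open>For a segment parameter t at least 1/2 the endpoint x is the integration variable that is
  rescaled, otherwise y; this keeps the Jacobian bounded.\<close>
lemma nn_integral_segment:
  fixes F :: "real^'n::finite \<Rightarrow> ennreal"
  assumes [measurable]: "F \<in> borel_measurable borel" "K \<in> sets borel" and K: "convex K" and F: "\<And>x. x \<notin> K \<Longrightarrow> F x = 0"
    and t: "0 \<le> t" "t \<le> 1"
  shows "(\<integral>\<^sup>+x. \<integral>\<^sup>+y. indicator K x * indicator K y * F (y + t *\<^sub>R (x - y)) \<partial>lborel \<partial>lborel) \<le> 2 ^ CARD('n) * emeasure lborel K * (\<integral>\<^sup>+x. F x \<partial>lborel)"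
proof -
  let ?I = "\<integral>\<^sup>+x. F x \<partial>lborel"
  have eq: "y + t *\<^sub>R (x - y) = (1 - t) *\<^sub>R y + t *\<^sub>R x" "y + t *\<^sub>R (x - y) = (1 - (1 - t)) *\<^sub>R x + (1 - t) *\<^sub>R y" for x y :: "real^'n"
    by (auto simp: algebra_simps)
  show ?thesis
  proof (cases "t \<ge> 1/2")
    case True
    have "(\<integral>\<^sup>+x. \<integral>\<^sup>+y. indicator K x * indicator K y * F (y + t *\<^sub>R (x - y)) \<partial>lborel \<partial>lborel)
        = (\<integral>\<^sup>+y. \<integral>\<^sup>+x. indicator K x * indicator K y * F (y + t *\<^sub>R (x - y)) \<partial>lborel \<partial>lborel)"
      by (rule lborel_pair.Fubini') simp
    also have "\<dots> \<le> (\<integral>\<^sup>+y. \<integral>\<^sup>+x. indicator K y * F ((1 - t) *\<^sub>R y + t *\<^sub>R x) \<partial>lborel \<partial>lborel)"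
      unfolding eq(1) by (intro nn_integral_mono) (auto simp: indicator_def)
    also have "\<dots> = (\<integral>\<^sup>+y. indicator K y * (\<integral>\<^sup>+x. F ((1 - t) *\<^sub>R y + t *\<^sub>R x) \<partial>lborel) \<partial>lborel)"
      by (intro nn_integral_cong nn_integral_cmult) simp
    also have "\<dots> \<le> (\<integral>\<^sup>+y. indicator K y * (2 ^ CARD('n) * ?I) \<partial>lborel)"
      by (intro nn_integral_mono mult_left_mono nn_integral_segment_half) (use True in auto)
    also have "\<dots> = 2 ^ CARD('n) * emeasure lborel K * ?I" by (subst nn_integral_multc) (auto simp: mult_ac)
    finally show ?thesis .
  next
    case False
    have "(\<integral>\<^sup>+x. \<integral>\<^sup>+y. indicator K x * indicator K y * F (y + t *\<^sub>R (x - y)) \<partial>lborel \<partial>lborel)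
      \<le> (\<integral>\<^sup>+x. \<integral>\<^sup>+y. indicator K x * F ((1 - (1 - t)) *\<^sub>R x + (1 - t) *\<^sub>R y) \<partial>lborel \<partial>lborel)"
      unfolding eq(2) by (intro nn_integral_mono) (auto simp: indicator_def)
    also have "\<dots> = (\<integral>\<^sup>+x. indicator K x * (\<integral>\<^sup>+y. F ((1 - (1 - t)) *\<^sub>R x + (1 - t) *\<^sub>R y) \<partial>lborel) \<partial>lborel)"
      by (intro nn_integral_cong nn_integral_cmult) simp
    also have "\<dots> \<le> (\<integral>\<^sup>+x. indicator K x * (2 ^ CARD('n) * ?I) \<partial>lborel)"
      by (intro nn_integral_mono mult_left_mono nn_integral_segment_half) (use False in auto)
    also have "\<dots> = 2 ^ CARD('n) * emeasure lborel K * ?I" by (subst nn_integral_multc) (auto simp: mult_ac)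
    finally show ?thesis .
  qed
qed

text \<open>The difference of two values is an integral along the segment between them, which stays
  in the convex box. The factor n h^2 bounds the squared length of the segment, and 2^n comes from
  the Jacobian after the integrals are exchanged.\<close>

lemma poincare_smooth_nn:
  fixes \<phi> :: "real^'n::finite \<Rightarrow> real"
  assumes \<phi>: "smooth \<phi>" and ab: "\<And>i. b $ i - a $ i \<le> h" and h: "h > 0"
  defines "K \<equiv> cbox a b"
  defines "\<Psi> \<equiv> \<lambda>x. \<Sum>i\<in>UNIV. (pdx i \<phi> x)\<^sup>2"
  shows "(\<integral>\<^sup>+x. \<integral>\<^sup>+y. indicator K x * indicator K y * ennreal ((\<phi> x - \<phi> y)\<^sup>2) \<partial>lborel \<partial>lborel)
    \<le> ennreal (real CARD('n) * h\<^sup>2 * 2 ^ CARD('n)) * emeasure lborel K * (\<integral>\<^sup>+x. indicator K x * ennreal (\<Psi> x) \<partial>lborel)"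
proof -
  have pc: "continuous_on UNIV (pdx i \<phi>)" for i using smooth_cont[OF \<phi>, of "[i]"] by simp
  have [measurable]: "pdx i \<phi> \<in> borel_measurable borel" "\<phi> \<in> borel_measurable borel" for i
    using smooth_borel[OF \<phi>, of "[i]"] smooth_borel[OF \<phi>, of "[]"] by auto
  have [measurable]: "K \<in> sets borel" by (simp add: K_def)
  have [measurable]: "\<Psi> \<in> borel_measurable borel" by (simp add: \<Psi>_def)
  have \<Psi>0: "\<Psi> x \<ge> 0" for x by (simp add: \<Psi>_def sum_nonneg)
  let ?F = "\<lambda>z. indicator K z * ennreal (\<Psi> z)"
  let ?c = "ennreal (real CARD('n) * h\<^sup>2)"
  have cx: "convex K" by (simp add: K_def)
  have pt: "indicator K x * indicator K y * ennreal ((\<phi> x - \<phi> y)\<^sup>2)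
      \<le> (\<integral>\<^sup>+t. ?c * (indicator {0..1} t * (indicator K x * indicator K y * ?F (y + t *\<^sub>R (x - y)))) \<partial>lborel)" for x y
  proof (cases "x \<in> K \<and> y \<in> K")
    case True
    let ?v = "x - y"
    let ?d = "\<lambda>t. \<Sum>i\<in>UNIV. ?v $ i * pdx i \<phi> (y + t *\<^sub>R ?v)"
    have "ennreal ((\<phi> (y + 1 *\<^sub>R ?v) - \<phi> (y + 0 *\<^sub>R ?v))\<^sup>2) \<le> ennreal (1 - 0) * (\<integral>\<^sup>+t. indicator {0..1} t * ennreal ((?d t)\<^sup>2) \<partial>lborel)"
    proof (rule deriv_sq_le[OF smooth_line_deriv[OF \<phi>]])
      have "continuous_on UNIV (\<lambda>t. pdx i \<phi> (y + t *\<^sub>R ?v))" for i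
        by (rule continuous_on_compose2[OF pc]) (auto intro!: continuous_intros)
      then show "continuous_on UNIV ?d" by (intro continuous_intros)
    qed simp
    also have "\<dots> = (\<integral>\<^sup>+t. indicator {0..1} t * ennreal ((?d t)\<^sup>2) \<partial>lborel)" by simp
    also have "\<dots> \<le> (\<integral>\<^sup>+t. ?c * (indicator {0..1} t * (indicator K x * indicator K y * ?F (y + t *\<^sub>R (x - y)))) \<partial>lborel)"
    proof (intro nn_integral_mono)
      fix t :: real
      show "indicator {0..1} t * ennreal ((?d t)\<^sup>2) \<le> ?c * (indicator {0..1} t * (indicator K x * indicator K y * ?F (y + t *\<^sub>R (x - y))))"
      proof (cases "t \<in> {0..1}")
        case t: True
        have "(1 - t) *\<^sub>R y + t *\<^sub>R x \<in> K" using cx True t by (intro convexD) auto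
        then have inK: "y + t *\<^sub>R ?v \<in> K" by (simp add: algebra_simps)
        have "(?d t)\<^sup>2 \<le> (\<Sum>i\<in>UNIV. (?v $ i)\<^sup>2) * \<Psi> (y + t *\<^sub>R ?v)"
          unfolding \<Psi>_def by (rule Cauchy_Schwarz_ineq_sum)
        also have "(\<Sum>i\<in>UNIV. (?v $ i)\<^sup>2) \<le> (\<Sum>i\<in>(UNIV :: 'n set). h\<^sup>2)"
        proof (rule sum_mono)
          fix i :: 'n
          have "a $ i \<le> x $ i" "x $ i \<le> b $ i" "a $ i \<le> y $ i" "y $ i \<le> b $ i" using True by (auto simp: K_def mem_box_cart)
          then have "\<bar>?v $ i\<bar> \<le> h" using ab[of i] by simp
          then show "(?v $ i)\<^sup>2 \<le> h\<^sup>2" by (metis abs_ge_zero power2_abs power_mono)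
        qed
        finally have "(?d t)\<^sup>2 \<le> (real CARD('n) * h\<^sup>2) * \<Psi> (y + t *\<^sub>R ?v)" using \<Psi>0 by (simp add: mult_right_mono)
        then have "ennreal ((?d t)\<^sup>2) \<le> ?c * ennreal (\<Psi> (y + t *\<^sub>R ?v))"
          using \<Psi>0 by (simp add: ennreal_leI flip: ennreal_mult)
        then show ?thesis using t True inK by simp
      qed simp
    qed
    finally show ?thesis using True by simp
  qed auto
  have "(\<integral>\<^sup>+x. \<integral>\<^sup>+y. indicator K x * indicator K y * ennreal ((\<phi> x - \<phi> y)\<^sup>2) \<partial>lborel \<partial>lborel)
    \<le> (\<integral>\<^sup>+x. \<integral>\<^sup>+y. \<integral>\<^sup>+t. ?c * (indicator {0..1} t * (indicator K x * indicator K y * ?F (y + t *\<^sub>R (x - y)))) \<partial>lborel \<partial>lborel \<partial>lborel)"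
    by (intro nn_integral_mono pt)
  also have "\<dots> = (\<integral>\<^sup>+x. \<integral>\<^sup>+t. \<integral>\<^sup>+y. ?c * (indicator {0..1} t * (indicator K x * indicator K y * ?F (y + t *\<^sub>R (x - y)))) \<partial>lborel \<partial>lborel \<partial>lborel)"
    by (intro nn_integral_cong lborel_pair.Fubini') simp
  also have "\<dots> = (\<integral>\<^sup>+t. \<integral>\<^sup>+x. \<integral>\<^sup>+y. ?c * (indicator {0..1} t * (indicator K x * indicator K y * ?F (y + t *\<^sub>R (x - y)))) \<partial>lborel \<partial>lborel \<partial>lborel)"
    by (rule lborel_pair.Fubini') simp
  also have "\<dots> = (\<integral>\<^sup>+t. ?c * (indicator {0..1} t * (\<integral>\<^sup>+x. \<integral>\<^sup>+y. indicator K x * indicator K y * ?F (y + t *\<^sub>R (x - y)) \<partial>lborel \<partial>lborel)) \<partial>lborel)"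
    by (simp add: nn_integral_cmult)
  also have "\<dots> \<le> (\<integral>\<^sup>+t. ?c * (indicator {0..1::real} t * (2 ^ CARD('n) * emeasure lborel K * (\<integral>\<^sup>+x. ?F x \<partial>lborel))) \<partial>lborel)"
  proof (rule nn_integral_mono, rule mult_left_mono)
    fix t :: real
    show "indicator {0..1} t * (\<integral>\<^sup>+x. \<integral>\<^sup>+y. indicator K x * indicator K y * ?F (y + t *\<^sub>R (x - y)) \<partial>lborel \<partial>lborel)
       \<le> indicator {0..1} t * (2 ^ CARD('n) * emeasure lborel K * (\<integral>\<^sup>+x. ?F x \<partial>lborel))"
    proof (cases "t \<in> {0..1}")
      case True
      then show ?thesis by (intro mult_left_mono nn_integral_segment[OF _ _ cx]) auto
    qed simp
  qed simp
  also have "\<dots> = ?c * (2 ^ CARD('n) * emeasure lborel K * (\<integral>\<^sup>+x. ?F x \<partial>lborel))"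
    by (simp add: nn_integral_cmult nn_integral_multc)
  also have "\<dots> = ennreal (real CARD('n) * h\<^sup>2 * 2 ^ CARD('n)) * emeasure lborel K * (\<integral>\<^sup>+x. ?F x \<partial>lborel)"
  proof -
    have "ennreal (real CARD('n) * h\<^sup>2 * 2 ^ CARD('n)) = ?c * 2 ^ CARD('n)"
      by (subst ennreal_mult) (auto simp flip: ennreal_power)
    then show ?thesis by (simp add: mult.assoc)
  qed
  finally show ?thesis .
qed

text \<open>Expanding (\<phi> x - \<phi> y)^2 in the double integral gives twice the measure times
  the square integral minus twice the square of the integral, which is a Poincare inequality with
  the mean still present.\<close>

lemma poincare_smooth:
  fixes \<phi> :: "real^'n::finite \<Rightarrow> real"
  assumes \<phi>: "smooth \<phi>" and ab: "\<And>i. b $ i - a $ i \<le> h" and h: "h > 0"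
  defines "K \<equiv> cbox a b"
  shows "2 * measure lborel K * (\<integral>x. indicator K x * (\<phi> x)\<^sup>2 \<partial>lborel) - 2 * (\<integral>x. indicator K x * \<phi> x \<partial>lborel)\<^sup>2
    \<le> real CARD('n) * h\<^sup>2 * 2 ^ CARD('n) * measure lborel K * (\<Sum>i\<in>UNIV. \<integral>x. indicator K x * (pdx i \<phi> x)\<^sup>2 \<partial>lborel)"
proof -
  have pc: "continuous_on UNIV (pdx i \<phi>)" "continuous_on UNIV \<phi>" for i using smooth_cont[OF \<phi>, of "[i]"] smooth_cont[OF \<phi>, of "[]"] by auto
  have [measurable]: "pdx i \<phi> \<in> borel_measurable borel" "\<phi> \<in> borel_measurable borel" for i
    using smooth_borel[OF \<phi>, of "[i]"] smooth_borel[OF \<phi>, of "[]"] by auto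
  have [measurable]: "K \<in> sets borel" by (simp add: K_def)
  have int: "integrable lborel (\<lambda>x. indicator K x * f x)" if "continuous_on UNIV f" for f :: "real^'n \<Rightarrow> real"
    using borel_integrable_compact[of K f] continuous_on_subset[OF that] by (simp add: K_def)
  have i1: "integrable lborel (\<lambda>x. indicator K x * \<phi> x)" and i2: "integrable lborel (\<lambda>x. indicator K x * (\<phi> x)\<^sup>2)"
    and i3: "integrable lborel (\<lambda>x. indicator K x * (pdx i \<phi> x)\<^sup>2)" for i
    by (intro int continuous_intros pc)+
  have i0: "integrable lborel (indicator K :: real^'n \<Rightarrow> real)" using int[of "\<lambda>_. 1"] by simp
  have em: "emeasure lborel K = ennreal (measure lborel K)"
    by (rule emeasure_eq_ennreal_measure) (simp add: K_def emeasure_lborel_cbox_eq)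
  let ?m = "measure lborel K" and ?A = "\<integral>x. indicator K x * \<phi> x \<partial>lborel" and ?B = "\<integral>x. indicator K x * (\<phi> x)\<^sup>2 \<partial>lborel"
  have m: "(\<integral>x. indicator K x \<partial>lborel) = ?m" by simp
  have inner: "(\<integral>\<^sup>+y. indicator K x * indicator K y * ennreal ((\<phi> x - \<phi> y)\<^sup>2) \<partial>lborel)
      = ennreal (indicator K x * ((\<phi> x)\<^sup>2 * ?m - 2 * \<phi> x * ?A + ?B))" for x
  proof -
    have "(\<integral>\<^sup>+y. indicator K x * indicator K y * ennreal ((\<phi> x - \<phi> y)\<^sup>2) \<partial>lborel) = (\<integral>\<^sup>+y. ennreal (indicator K x * ((\<phi> x)\<^sup>2 * indicator K y - 2 * \<phi> x * (indicator K y * \<phi> y) + indicator K y * (\<phi> y)\<^sup>2)) \<partial>lborel)"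
      by (intro nn_integral_cong) (auto simp: indicator_def power2_diff algebra_simps)
    also have "\<dots> = ennreal (\<integral>y. indicator K x * ((\<phi> x)\<^sup>2 * indicator K y - 2 * \<phi> x * (indicator K y * \<phi> y) + indicator K y * (\<phi> y)\<^sup>2) \<partial>lborel)"
    proof (rule nn_integral_eq_integral)
      show "integrable lborel (\<lambda>y. indicator K x * ((\<phi> x)\<^sup>2 * indicator K y - 2 * \<phi> x * (indicator K y * \<phi> y) + indicator K y * (\<phi> y)\<^sup>2))"
        using i0 i1 i2 by auto
      have "0 \<le> (\<phi> x)\<^sup>2 - 2 * \<phi> x * \<phi> y + (\<phi> y)\<^sup>2" for y using zero_le_power2[of "\<phi> x - \<phi> y"] by (simp add: power2_diff)
      then show "AE y in lborel. 0 \<le> indicator K x * ((\<phi> x)\<^sup>2 * indicator K y - 2 * \<phi> x * (indicator K y * \<phi> y) + indicator K y * (\<phi> y)\<^sup>2)"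
        by (intro AE_I2) (auto simp: indicator_def)
    qed
    also have "(\<integral>y. indicator K x * ((\<phi> x)\<^sup>2 * indicator K y - 2 * \<phi> x * (indicator K y * \<phi> y) + indicator K y * (\<phi> y)\<^sup>2) \<partial>lborel) = indicator K x * ((\<phi> x)\<^sup>2 * ?m - 2 * \<phi> x * ?A + ?B)"
      using i0 i1 i2 m by simp
    finally show ?thesis .
  qed
  have pos: "indicator K x * ((\<phi> x)\<^sup>2 * ?m - 2 * \<phi> x * ?A + ?B) \<ge> 0" for x
  proof -
    have "0 \<le> (\<integral>y. indicator K y * (\<phi> x - \<phi> y)\<^sup>2 \<partial>lborel)" by simp
    also have "\<dots> = (\<integral>y. (\<phi> x)\<^sup>2 * indicator K y - 2 * \<phi> x * (indicator K y * \<phi> y) + indicator K y * (\<phi> y)\<^sup>2 \<partial>lborel)"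
      by (intro Bochner_Integration.integral_cong) (auto simp: power2_diff algebra_simps)
    also have "\<dots> = (\<phi> x)\<^sup>2 * ?m - 2 * \<phi> x * ?A + ?B" using i0 i1 i2 m by simp
    finally show ?thesis by simp
  qed
  have re: "(\<lambda>x. indicator K x * ((\<phi> x)\<^sup>2 * ?m - 2 * \<phi> x * ?A + ?B)) = (\<lambda>x. ?m * (indicator K x * (\<phi> x)\<^sup>2) - 2 * ?A * (indicator K x * \<phi> x) + ?B * indicator K x)"
    by (auto simp: algebra_simps)
  have oi: "integrable lborel (\<lambda>x. indicator K x * ((\<phi> x)\<^sup>2 * ?m - 2 * \<phi> x * ?A + ?B))"
    unfolding re using i0 i1 i2 by auto
  have "(\<integral>\<^sup>+x. \<integral>\<^sup>+y. indicator K x * indicator K y * ennreal ((\<phi> x - \<phi> y)\<^sup>2) \<partial>lborel \<partial>lborel) = ennreal (\<integral>x. indicator K x * ((\<phi> x)\<^sup>2 * ?m - 2 * \<phi> x * ?A + ?B) \<partial>lborel)"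
    unfolding inner by (rule nn_integral_eq_integral[OF oi]) (use pos in simp)
  also have "(\<integral>x. indicator K x * ((\<phi> x)\<^sup>2 * ?m - 2 * \<phi> x * ?A + ?B) \<partial>lborel) = 2 * ?m * ?B - 2 * ?A\<^sup>2"
    unfolding re using i0 i1 i2 m by (simp add: power2_eq_square)
  finally have L: "(\<integral>\<^sup>+x. \<integral>\<^sup>+y. indicator K x * indicator K y * ennreal ((\<phi> x - \<phi> y)\<^sup>2) \<partial>lborel \<partial>lborel) = ennreal (2 * ?m * ?B - 2 * ?A\<^sup>2)" .
  have "(\<integral>\<^sup>+x. indicator K x * ennreal (\<Sum>i\<in>UNIV. (pdx i \<phi> x)\<^sup>2) \<partial>lborel) = (\<integral>\<^sup>+x. ennreal (\<Sum>i\<in>UNIV. indicator K x * (pdx i \<phi> x)\<^sup>2) \<partial>lborel)"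
    by (intro nn_integral_cong) (auto simp: indicator_def sum_nonneg)
  also have "\<dots> = ennreal (\<Sum>i\<in>UNIV. \<integral>x. indicator K x * (pdx i \<phi> x)\<^sup>2 \<partial>lborel)"
    unfolding Bochner_Integration.integral_sum[OF i3, symmetric]
    by (rule nn_integral_eq_integral[OF Bochner_Integration.integrable_sum[OF i3]]) (auto intro!: AE_I2 sum_nonneg)
  finally have R: "(\<integral>\<^sup>+x. indicator K x * ennreal (\<Sum>i\<in>UNIV. (pdx i \<phi> x)\<^sup>2) \<partial>lborel) = ennreal (\<Sum>i\<in>UNIV. \<integral>x. indicator K x * (pdx i \<phi> x)\<^sup>2 \<partial>lborel)" .
  have "ennreal (2 * ?m * ?B - 2 * ?A\<^sup>2) \<le> ennreal (real CARD('n) * h\<^sup>2 * 2 ^ CARD('n)) * ennreal ?m * ennreal (\<Sum>i\<in>UNIV. \<integral>x. indicator K x * (pdx i \<phi> x)\<^sup>2 \<partial>lborel)"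
    using poincare_smooth_nn[OF \<phi> ab h] unfolding K_def[symmetric] L R em .
  also have "\<dots> = ennreal (real CARD('n) * h\<^sup>2 * 2 ^ CARD('n) * ?m * (\<Sum>i\<in>UNIV. \<integral>x. indicator K x * (pdx i \<phi> x)\<^sup>2 \<partial>lborel))"
    by (subst ennreal_mult[symmetric]; (simp add: sum_nonneg)?)+
  finally show ?thesis by (subst (asm) ennreal_le_iff) (auto simp: sum_nonneg)
qed

lemma l2_rep:
  fixes f F :: "real^'n::finite \<Rightarrow> real"
  assumes "open Q" "sqint (lebesgue_on Q) f" "F \<in> borel_measurable borel" "\<And>x. x \<notin> Q \<Longrightarrow> F x = 0" "AE x in lebesgue_on Q. f x = F x"
  shows "l2 (lebesgue_on Q) f = l2 lborel F"
proof -
  have "l2 (lebesgue_on Q) f = l2 (lebesgue_on Q) F"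
    by (rule l2_cong_AE[OF sqint_meas[OF assms(2)] borel_measurable_lebesgue_onI[OF assms(3)] assms(5)])
  then show ?thesis using l2_on_test[OF assms(1,3,4)] by simp
qed

text \<open>Mollified weak derivatives are only identified away from the boundary, so everything is
  restricted to sets \<open>K n\<close> that exhaust \<open>Q\<close>; the restriction disappears in
  the L2 limit.\<close>

lemma cut_mol_tendsto:
  fixes F :: "real^'n::finite \<Rightarrow> real"
  assumes Fm[measurable]: "F \<in> borel_measurable borel" and F: "integrable lborel F" "sqint lborel F" "\<And>x. x \<notin> Q \<Longrightarrow> F x = 0"
    and e: "\<And>n. e n > 0" "\<And>n. e n \<le> 1" "e \<longlonglongrightarrow> 0"
    and K[measurable]: "\<And>n. K n \<in> sets borel" and KQ: "\<And>x. x \<in> Q \<Longrightarrow> \<forall>\<^sub>F n in sequentially. x \<in> K n"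
  shows "sqint lborel (\<lambda>x. indicator (K n) x * mol (e n) F x)"
    "(\<lambda>n. l2 lborel (\<lambda>x. indicator (K n) x * mol (e n) F x - F x)) \<longlonglongrightarrow> 0"
proof -
  have [measurable]: "mol (e n) F \<in> borel_measurable borel" for n
    using smooth_borel[OF mol_smooth(1)[OF Fm F(1) e(1)], of "[]"] by simp
  have s: "sqint lborel (mol (e n) F)" for n by (rule mol_l2(1)[OF Fm F(1,2) e(1)])
  have ind: "\<bar>indicator (K n) x * y\<bar> \<le> \<bar>y\<bar>" for n and x :: "real^'n" and y :: real by (simp add: indicator_def)
  show sA: "sqint lborel (\<lambda>x. indicator (K n) x * mol (e n) F x)" for n
    by (rule l2_mono(1)[OF s[of n]]) (auto simp: ind)
  have sF: "sqint lborel (\<lambda>x. indicator (K n) x * F x)" for n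
    by (rule l2_mono(1)[OF F(2)]) (auto simp: ind)
  have a: "l2 lborel (\<lambda>x. indicator (K n) x * mol (e n) F x - indicator (K n) x * F x) \<le> l2 lborel (\<lambda>x. mol (e n) F x - F x)" for n
    by (rule l2_mono(2)[OF sqint_diff[OF s F(2)]]) (auto simp: ind simp flip: right_diff_distrib)
  have b: "(\<lambda>n. l2 lborel (\<lambda>x. indicator (K n) x * F x - F x)) \<longlonglongrightarrow> 0"
  proof (rule l2_dominated(2)[where w = "\<lambda>x. \<bar>F x\<bar>"])
    show "sqint lborel (\<lambda>x. \<bar>F x\<bar>)" using F(2) by (auto simp: sqint_def)
    show "AE x in lborel. (\<lambda>n. indicator (K n) x * F x) \<longlonglongrightarrow> F x"
    proof (rule AE_I2)
      fix x
      show "(\<lambda>n. indicator (K n) x * F x) \<longlonglongrightarrow> F x"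
      proof (cases "x \<in> Q")
        case True
        then show ?thesis by (intro tendsto_eventually eventually_mono[OF KQ[OF True]]) simp
      qed (simp add: F(3))
    qed
  qed (auto simp: ind)
  show "(\<lambda>n. l2 lborel (\<lambda>x. indicator (K n) x * mol (e n) F x - F x)) \<longlonglongrightarrow> 0"
  proof (rule Lim_null_comparison)
    show "\<forall>\<^sub>F n in sequentially. norm (l2 lborel (\<lambda>x. indicator (K n) x * mol (e n) F x - F x)) \<le> l2 lborel (\<lambda>x. mol (e n) F x - F x) + l2 lborel (\<lambda>x. indicator (K n) x * F x - F x)"
    proof (rule always_eventually, rule allI)
      fix n
      show "norm (l2 lborel (\<lambda>x. indicator (K n) x * mol (e n) F x - F x)) \<le> l2 lborel (\<lambda>x. mol (e n) F x - F x) + l2 lborel (\<lambda>x. indicator (K n) x * F x - F x)"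
        using l2_triangle_diff[OF sA[of n] sF[of n] F(2)] a[of n] by (simp add: l2_nonneg)
    qed
    show "(\<lambda>n. l2 lborel (\<lambda>x. mol (e n) F x - F x) + l2 lborel (\<lambda>x. indicator (K n) x * F x - F x)) \<longlonglongrightarrow> 0"
      using tendsto_add[OF mol_tendsto_l2[OF Fm F(1,2) e] b] by simp
  qed
qed

text \<open>The smooth inequality is applied to mollifications on slightly smaller cubes and passed
  to the limit, where the term with the squared integral vanishes by the mean-zero
  hypothesis.\<close>

lemma poincare_weak:
  fixes f :: "real^'n::finite \<Rightarrow> real"
  assumes side: "\<And>i. b $ i - a $ i = h" and h: "h > 0"
  defines "Q \<equiv> box a b"
  assumes f: "sqint (lebesgue_on Q) f" and g: "\<And>i. is_wd Q [i] f (g i)" and mean: "(LINT x|lebesgue_on Q. f x) = 0"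
  shows "(l2 (lebesgue_on Q) f)\<^sup>2 \<le> real CARD('n) * 2 ^ CARD('n) / 2 * h\<^sup>2 * (\<Sum>i\<in>UNIV. (l2 (lebesgue_on Q) (g i))\<^sup>2)"
proof -
  have Q: "open Q" "bounded Q" "Q \<in> sets borel" by (auto simp: Q_def)
  obtain F where F: "F \<in> borel_measurable borel" "\<And>x. x \<notin> Q \<Longrightarrow> F x = 0" "sqint lborel F" "AE x in lebesgue_on Q. f x = F x"
    using sqint_borel_rep[OF Q(3) f] by metis
  have "\<forall>i. \<exists>G. G \<in> borel_measurable borel \<and> (\<forall>x. x \<notin> Q \<longrightarrow> G x = 0) \<and> sqint lborel G \<and> (AE x in lebesgue_on Q. g i x = G x)"
    using sqint_borel_rep[OF Q(3) is_wd_sqint[OF g]] by metis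
  from choice[OF this] obtain G where G': "\<forall>i. G i \<in> borel_measurable borel \<and> (\<forall>x. x \<notin> Q \<longrightarrow> G i x = 0) \<and> sqint lborel (G i) \<and> (AE x in lebesgue_on Q. g i x = G i x)" ..
  then have G: "\<And>i. G i \<in> borel_measurable borel" "\<And>i x. x \<notin> Q \<Longrightarrow> G i x = 0" "\<And>i. sqint lborel (G i)" "\<And>i. AE x in lebesgue_on Q. g i x = G i x" by auto
  have Fi: "integrable lborel F" by (rule bounded_sqint_integrable[OF Q(2) F(3,2)])
  have Gi: "integrable lborel (G i)" for i by (rule bounded_sqint_integrable[OF Q(2) G(3,2)])
  \<comment> \<open>The margin is at most \<open>h\<close>/3 on each side, so that already the first
    cube \<open>K 0\<close> has positive measure; the mollification scale \<open>e m\<close> stays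
    below the margin.\<close>
  define d where "d = (\<lambda>m::nat. h / (real m + 3))"
  define e where "e = (\<lambda>m. min 1 (d m) / 2)"
  define K where "K = (\<lambda>m. cbox (a + (\<chi> i. d m)) (b - (\<chi> i. d m)))"
  have d0: "d m > 0" for m using h by (simp add: d_def)
  have d3: "d m \<le> h / 3" for m using h unfolding d_def by (intro divide_left_mono) auto
  have dlim: "d \<longlonglongrightarrow> 0" unfolding d_def by real_asymp
  have e: "e m > 0" "e m \<le> 1" "e m < d m" for m using d0[of m] by (auto simp: e_def min_def)
  have elim: "e \<longlonglongrightarrow> 0"
  proof (rule Lim_null_comparison[OF _ dlim])
    show "\<forall>\<^sub>F m in sequentially. norm (e m) \<le> d m" using e by (intro always_eventually) (simp add: less_imp_le)
  qed
  have Kb: "K m \<in> sets borel" for m by (simp add: K_def)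
  have KQ: "\<forall>\<^sub>F m in sequentially. x \<in> K m" if "x \<in> Q" for x
  proof -
    have "\<forall>\<^sub>F m in sequentially. \<forall>i\<in>UNIV. d m < x $ i - a $ i \<and> d m < b $ i - x $ i"
    proof (rule eventually_ball_finite, simp, rule ballI)
      fix i
      have "a $ i < x $ i" "x $ i < b $ i" using that by (auto simp: Q_def mem_box_cart)
      then show "\<forall>\<^sub>F m in sequentially. d m < x $ i - a $ i \<and> d m < b $ i - x $ i"
        by (intro eventually_conj order_tendstoD(2)[OF dlim]) auto
    qed
    then show ?thesis
    proof eventually_elim
      case (elim m)
      then have "a $ i + d m \<le> x $ i \<and> x $ i \<le> b $ i - d m" for i by (smt (verit) UNIV_I)
      then show ?case by (simp add: K_def mem_box_cart)
    qed
  qed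
  let ?A = "\<lambda>m x. indicator (K m) x * mol (e m) F x" and ?B = "\<lambda>i m x. indicator (K m) x * mol (e m) (G i) x"
  note A = cut_mol_tendsto[where Q = Q, OF F(1) Fi F(3,2) e(1,2) elim Kb KQ]
  note B = cut_mol_tendsto[where Q = Q, OF G(1) Gi G(3,2) e(1,2) elim Kb KQ]
  have der: "pdx i (mol (e m) F) x = mol (e m) (G i) x" if "x \<in> K m" for i m x
  proof -
    have "pds [i] (mol (e m) F) x = mol (e m) (G i) x"
    proof (rule mol_wd[OF Q(1,2) f g F(1,2,4,3) G(1,2,4) e(1)])
      fix y assume y: "\<And>j. \<bar>y $ j - x $ j\<bar> \<le> e m"
      have "a $ j < y $ j \<and> y $ j < b $ j" for j
      proof -
        have "a $ j + d m \<le> x $ j" "x $ j \<le> b $ j - d m" using that by (auto simp: K_def mem_box_cart)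
        then show ?thesis using y[of j] e(3)[of m] by linarith
      qed
      then show "y \<in> Q" by (simp add: Q_def mem_box_cart)
    qed
    then show ?thesis by simp
  qed
  have K0: "measure lborel (K 0) > 0"
  proof -
    have "a $ i + d 0 < b $ i - d 0" for i using d3[of 0] side[of i] h by linarith
    then have "0 < measure lborel (K 0)" unfolding K_def
      by (subst content_pos_lt_eq) (auto simp: Basis_vec_def inner_axis)
    then show ?thesis .
  qed
  have Kmono: "measure lborel (K 0) \<le> measure lborel (K m)" for m
  proof (rule measure_mono_fmeasurable)
    have "d m \<le> d 0" using h unfolding d_def by (intro divide_left_mono) auto
    then show "K 0 \<subseteq> K m" unfolding K_def by (auto simp: mem_box_cart) (meson add_left_mono diff_left_mono order_trans)+
  qed (auto simp: K_def)
  let ?C = "real CARD('n) * 2 ^ CARD('n) / 2 * h\<^sup>2"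
  have ineq: "(l2 lborel (?A m))\<^sup>2 \<le> (\<integral>x. ?A m x * indicator Q x \<partial>lborel)\<^sup>2 / measure lborel (K 0) + ?C * (\<Sum>i\<in>UNIV. (l2 lborel (?B i m))\<^sup>2)" for m
  proof -
    let ?\<mu> = "measure lborel (K m)"
    have \<mu>: "?\<mu> > 0" using K0 Kmono[of m] by linarith
    have sub: "K m \<subseteq> Q" using d0[of m] by (auto simp: K_def Q_def mem_box_cart) (smt (verit))+
    have P: "2 * ?\<mu> * (\<integral>x. indicator (K m) x * (mol (e m) F x)\<^sup>2 \<partial>lborel) - 2 * (\<integral>x. indicator (K m) x * mol (e m) F x \<partial>lborel)\<^sup>2
      \<le> real CARD('n) * h\<^sup>2 * 2 ^ CARD('n) * ?\<mu> * (\<Sum>i\<in>UNIV. \<integral>x. indicator (K m) x * (pdx i (mol (e m) F) x)\<^sup>2 \<partial>lborel)"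
      unfolding K_def
    proof (rule poincare_smooth[OF mol_smooth(1)[OF F(1) Fi e(1)] _ h])
      show "(b - (\<chi> i. d m)) $ i - (a + (\<chi> i. d m)) $ i \<le> h" for i using side[of i] d0[of m] by simp
    qed
    have q1: "(\<integral>x. indicator (K m) x * (mol (e m) F x)\<^sup>2 \<partial>lborel) = (l2 lborel (?A m))\<^sup>2"
      unfolding l2_sq by (rule Bochner_Integration.integral_cong) (auto simp: indicator_def)
    have q2: "(\<integral>x. indicator (K m) x * (pdx i (mol (e m) F) x)\<^sup>2 \<partial>lborel) = (l2 lborel (?B i m))\<^sup>2" for i
      unfolding l2_sq by (rule Bochner_Integration.integral_cong) (auto simp: indicator_def der)
    have q3: "(\<integral>x. indicator (K m) x * mol (e m) F x \<partial>lborel) = (\<integral>x. ?A m x * indicator Q x \<partial>lborel)"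
      by (rule Bochner_Integration.integral_cong) (use sub in \<open>auto simp: indicator_def\<close>)
    have "2 * ?\<mu> * (l2 lborel (?A m))\<^sup>2 \<le> 2 * (\<integral>x. ?A m x * indicator Q x \<partial>lborel)\<^sup>2 + 2 * ?\<mu> * (?C * (\<Sum>i\<in>UNIV. (l2 lborel (?B i m))\<^sup>2))"
      using P unfolding q1 q2 q3 by (simp add: field_simps)
    then have "(l2 lborel (?A m))\<^sup>2 \<le> (\<integral>x. ?A m x * indicator Q x \<partial>lborel)\<^sup>2 / ?\<mu> + ?C * (\<Sum>i\<in>UNIV. (l2 lborel (?B i m))\<^sup>2)"
      using \<mu> by (simp add: field_simps)
    \<comment> \<open>Replacing the measure of \<open>K m\<close> by the smaller one of
      \<open>K 0\<close> makes the coefficient independent of \<open>m\<close>.\<close>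
    also have "(\<integral>x. ?A m x * indicator Q x \<partial>lborel)\<^sup>2 / ?\<mu> \<le> (\<integral>x. ?A m x * indicator Q x \<partial>lborel)\<^sup>2 / measure lborel (K 0)"
      using K0 Kmono[of m] \<mu> by (intro divide_left_mono) auto
    finally show ?thesis by simp
  qed
  have iQ: "sqint lborel (indicator Q :: real^'n \<Rightarrow> real)"
  proof -
    obtain R where "\<And>x. x \<in> Q \<Longrightarrow> norm x \<le> R" using Q(2) by (auto simp: bounded_iff)
    then show ?thesis using Q(3)
      by (intro bounded_support_integrable(2)[where B = 1 and R = R]) (auto simp: indicator_eq_0_iff indicator_le_1)
  qed
  have z: "(\<lambda>n::nat. l2 lborel (\<lambda>x. k x - k x)) \<longlonglongrightarrow> 0" for k by (simp add: l2_def)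
  have "(\<integral>x. F x * indicator Q x \<partial>lborel) = (LINT x|lebesgue_on Q. f x * indicator Q x)"
    using Q(3) by (intro integral_rep[OF Q(1) f F(1,2,4), symmetric]) auto
  also have "\<dots> = (LINT x|lebesgue_on Q. f x)" by (rule Bochner_Integration.integral_cong) auto
  finally have mF: "(\<integral>x. F x * indicator Q x \<partial>lborel) = 0" using mean by simp
  have L: "(\<lambda>m. (\<integral>x. ?A m x * indicator Q x \<partial>lborel)\<^sup>2 / measure lborel (K 0) + ?C * (\<Sum>i\<in>UNIV. (l2 lborel (?B i m))\<^sup>2))
      \<longlonglongrightarrow> (\<integral>x. F x * indicator Q x \<partial>lborel)\<^sup>2 / measure lborel (K 0) + ?C * (\<Sum>i\<in>UNIV. (l2 lborel (G i))\<^sup>2)"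
    by (intro tendsto_intros l2_tendsto B G(3) l2_ip_tendsto[where g = "\<lambda>_. indicator Q"] A F(3) iQ z) (use K0 in auto)
  have "(l2 lborel F)\<^sup>2 \<le> (\<integral>x. F x * indicator Q x \<partial>lborel)\<^sup>2 / measure lborel (K 0) + ?C * (\<Sum>i\<in>UNIV. (l2 lborel (G i))\<^sup>2)"
    by (rule LIMSEQ_le[OF tendsto_power[OF l2_tendsto[OF A(1) F(3) A(2)]] L]) (assumption | intro exI allI impI ineq)+
  moreover have "l2 (lebesgue_on Q) f = l2 lborel F" by (rule l2_rep[OF Q(1) f F(1) _ F(4)]) (rule F(2))
  moreover have "l2 (lebesgue_on Q) (g i) = l2 lborel (G i)" for i by (rule l2_rep[OF Q(1) is_wd_sqint[OF g] G(1) _ G(4)]) (rule G(2))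
  ultimately show ?thesis unfolding mF by simp
qed

section \<open>Polynomials and the Bramble--Hilbert lemma\<close>

definition Idx :: "nat \<Rightarrow> ('n::finite \<Rightarrow> nat) set" where "Idx k = {\<alpha>. \<forall>j. \<alpha> j \<le> k}"

lemma finite_Idx[simp]: "finite (Idx k :: ('n::finite \<Rightarrow> nat) set)"
proof -
  have "Idx k = PiE (UNIV :: 'n set) (\<lambda>_. {..k})" by (auto simp: Idx_def PiE_def)
  then show ?thesis using finite_PiE[of "UNIV :: 'n set" "\<lambda>_. {..k}"] by auto
qed

text \<open>The \<open>r\<close>-th derivative of t^a in falling-factorial form, total in
  \<open>r\<close> so that it can be fed to \<open>smooth_tensor\<close>.\<close>

definition dpow :: "nat \<Rightarrow> nat \<Rightarrow> real \<Rightarrow> real" where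
  "dpow a r t = (if r \<le> a then fact a / fact (a - r) * t ^ (a - r) else 0)"

lemma dpow_deriv: "(dpow a r has_real_derivative dpow a (Suc r) t) (at t)"
proof (cases "r < a")
  case True
  have s: "a - r = Suc (a - Suc r)" using True by simp
  have "((\<lambda>t. fact a / fact (a - r) * t ^ (a - r)) has_real_derivative fact a / fact (a - r) * (real (a - r) * t ^ (a - r - 1))) (at t)"
    by (auto intro!: derivative_eq_intros)
  moreover have "fact a / fact (a - r) * (real (a - r) * t ^ (a - r - 1)) = dpow a (Suc r) t"
    using True unfolding s by (simp add: dpow_def divide_simps del: of_nat_Suc)
  moreover have "dpow a r = (\<lambda>t. fact a / fact (a - r) * t ^ (a - r))" using True by (auto simp: dpow_def)
  ultimately show ?thesis by simp
next
  case False
  then have "dpow a r = (\<lambda>t. if r = a then fact a else 0)" "dpow a (Suc r) t = 0" by (auto simp: dpow_def)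
  then show ?thesis by (auto intro!: derivative_eq_intros)
qed

text \<open>Centred and scaled by \<open>h\<close>: coefficients are dimensionless and a derivative
  of order r costs exactly h^(-r). The centre is the common lattice origin or a lattice
  vertex.\<close>

definition mnm :: "real \<Rightarrow> real^'n::finite \<Rightarrow> ('n \<Rightarrow> nat) \<Rightarrow> real^'n \<Rightarrow> real" where
  "mnm h o' \<alpha> x = (\<Prod>j\<in>UNIV. ((x $ j - o' $ j) / h) ^ \<alpha> j)"

lemma smooth_mnm:
  assumes h: "h \<noteq> 0"
  shows "smooth (mnm h o' \<alpha>)"
    "pds is (mnm h o' \<alpha>) x = (\<Prod>j\<in>UNIV. dpow (\<alpha> j) (count_list is j) ((x $ j - o' $ j) / h)) / h ^ length is"
proof -
  let ?F = "\<lambda>j r t. dpow (\<alpha> j) r ((t - o' $ j) / h) / h ^ r"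
  have D: "(?F j r has_real_derivative ?F j (Suc r) t) (at t)" for j r t
  proof -
    have "((\<lambda>t. dpow (\<alpha> j) r ((t - o' $ j) / h)) has_real_derivative dpow (\<alpha> j) (Suc r) ((t - o' $ j) / h) * (1 / h)) (at t)"
      by (rule DERIV_chain2[OF dpow_deriv]) (use h in \<open>auto intro!: derivative_eq_intros\<close>)
    from DERIV_cdivide[OF this, of "h ^ r"] show ?thesis by simp
  qed
  have m: "mnm h o' \<alpha> = (\<lambda>x. \<Prod>j\<in>UNIV. ?F j 0 (x $ j))" by (auto simp: mnm_def dpow_def fun_eq_iff)
  show "smooth (mnm h o' \<alpha>)" unfolding m by (rule smooth_tensor(1)[where F = ?F, OF D])
  have "(\<Sum>j\<in>UNIV. count_list is j) = length is"
    by (simp add: sum_count_set[of "is" UNIV, simplified])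
  then have "(\<Prod>j\<in>UNIV. h ^ count_list is j) = h ^ length is" by (simp flip: power_sum)
  then show "pds is (mnm h o' \<alpha>) x = (\<Prod>j\<in>UNIV. dpow (\<alpha> j) (count_list is j) ((x $ j - o' $ j) / h)) / h ^ length is"
    unfolding m smooth_tensor(2)[where F = ?F, OF D] by (simp add: prod_dividef)
qed

definition pev :: "nat \<Rightarrow> real \<Rightarrow> real^'n::finite \<Rightarrow> (('n \<Rightarrow> nat) \<Rightarrow> real) \<Rightarrow> real^'n \<Rightarrow> real" where
  "pev k h o' c x = (\<Sum>\<alpha>\<in>Idx k. c \<alpha> * mnm h o' \<alpha> x)"

lemma smooth_pev:
  assumes h: "h \<noteq> 0"
  shows "smooth (pev k h o' c)" "pds is (pev k h o' c) x = (\<Sum>\<alpha>\<in>Idx k. c \<alpha> * pds is (mnm h o' \<alpha>) x)"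
proof -
  have p: "pev k h o' c = (\<lambda>x. \<Sum>\<alpha>\<in>Idx k. c \<alpha> * mnm h o' \<alpha> x)" by (auto simp: pev_def)
  have s: "smooth (\<lambda>x. c \<alpha> * mnm h o' \<alpha> x)" for \<alpha> by (intro smooth_cmult smooth_mnm h)
  show "smooth (pev k h o' c)" unfolding p by (rule smooth_sum(1)[OF s])
  show "pds is (pev k h o' c) x = (\<Sum>\<alpha>\<in>Idx k. c \<alpha> * pds is (mnm h o' \<alpha>) x)"
    unfolding p smooth_sum(2)[OF s] smooth_cmult(2)[OF smooth_mnm(1)[OF h]] by simp
qed

lemma pds_pev_perm:
  assumes "h \<noteq> 0" "mset is = mset js" shows "pds is (pev k h o' c) = pds js (pev k h o' c)"
proof -
  have "count_list is = count_list js" "length is = length js"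
    using assms(2) by (auto simp: fun_eq_iff simp flip: count_mset dest: mset_eq_length)
  then show ?thesis by (auto simp: fun_eq_iff smooth_pev[OF assms(1)] smooth_mnm[OF assms(1)])
qed

lemma pds_mnm_low:
  assumes "h \<noteq> 0" "sum \<alpha> UNIV < length is" shows "pds is (mnm h o' \<alpha>) x = 0"
proof -
  have "\<exists>j. count_list is j > \<alpha> j"
  proof (rule ccontr)
    assume "\<not> (\<exists>j. count_list is j > \<alpha> j)"
    then have "(\<Sum>j\<in>UNIV. count_list is j) \<le> sum \<alpha> UNIV" by (intro sum_mono) (auto simp: not_less)
    then show False using assms(2) by (simp add: sum_count_set[of "is" UNIV, simplified])
  qed
  then obtain j where "count_list is j > \<alpha> j" by blast
  then have "(\<Prod>j\<in>UNIV. dpow (\<alpha> j) (count_list is j) ((x $ j - o' $ j) / h)) = 0"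
    by (intro prod_zero bexI[of _ j]) (auto simp: dpow_def)
  then show ?thesis by (simp add: smooth_mnm[OF assms(1)])
qed

text \<open>With equal totals a mismatch forces some variable to be differentiated more often than
  its exponent allows; derivatives of order equal to the degree therefore single out one
  coefficient.\<close>

lemma pds_mnm_eq:
  assumes "h \<noteq> 0" "sum \<alpha> UNIV = length is"
  shows "pds is (mnm h o' \<alpha>) x = (if \<alpha> = count_list is then (\<Prod>j\<in>UNIV. fact (\<alpha> j)) / h ^ length is else 0)"
proof (cases "\<alpha> = count_list is")
  case True
  then show ?thesis by (simp add: smooth_mnm[OF assms(1)] dpow_def)
next
  case False
  have "\<exists>j. count_list is j > \<alpha> j"
  proof (rule ccontr)
    assume "\<not> (\<exists>j. count_list is j > \<alpha> j)"
    then have le: "count_list is j \<le> \<alpha> j" for j by (auto simp: not_less)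
    obtain j where j: "count_list is j \<noteq> \<alpha> j" using False by (metis ext)
    then have "count_list is j < \<alpha> j" using le[of j] by simp
    then have "(\<Sum>j\<in>UNIV. count_list is j) < sum \<alpha> UNIV"
      by (intro sum_strict_mono_ex1 bexI[of _ j]) (use le in auto)
    then show False using assms(2) by (simp add: sum_count_set[of "is" UNIV, simplified])
  qed
  then obtain j where "count_list is j > \<alpha> j" by blast
  then have "(\<Prod>j\<in>UNIV. dpow (\<alpha> j) (count_list is j) ((x $ j - o' $ j) / h)) = 0"
    by (intro prod_zero bexI[of _ j]) (auto simp: dpow_def)
  then show ?thesis using False by (simp add: smooth_mnm[OF assms(1)])
qed

lemma ex_list_count: "\<exists>is::'n::finite list. count_list is = \<alpha>"
proof -
  obtain xs where xs: "set xs = (UNIV::'n set)" "distinct xs" using finite_distinct_list[OF finite] by blast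
  have "count_list (concat (map (\<lambda>x. replicate (\<alpha> x) x) ys)) j = (if j \<in> set ys then \<alpha> j else 0)" if "distinct ys" for ys :: "'n list" and j
    using that
  proof (induction ys)
    case (Cons y ys)
    have "count_list (replicate n x) j = (if j = x then n else 0)" for n and x :: 'n by (induction n) auto
    with Cons show ?case by (auto simp: count_list_append)
  qed simp
  with xs have "count_list (concat (map (\<lambda>x. replicate (\<alpha> x) x) xs)) = \<alpha>" by (auto simp: fun_eq_iff)
  then show ?thesis by blast
qed

text \<open>Downward induction on the order: monomials of total degree \<open>n\<close> adjust the
  means of the derivatives of order \<open>n\<close> and are annihilated by derivatives of higher
  order, so what has been achieved persists.\<close>

lemma mean_zero_poly:
  fixes u :: "real^'n::finite \<Rightarrow> real"
  assumes h: "h > 0" and mk: "m \<le> Suc k" and Q: "open Q" "bounded Q" and \<mu>: "(LINT x|lebesgue_on Q. 1) > (0::real)"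
    and w: "\<And>is. length is \<le> m \<Longrightarrow> is_wd Q is u (U is)" and l: "l \<le> m"
  shows "\<exists>c. (\<forall>\<alpha>. m \<le> sum \<alpha> UNIV \<longrightarrow> c \<alpha> = 0) \<and>
     (\<forall>is. l \<le> length is \<and> length is < m \<longrightarrow> (LINT x|lebesgue_on Q. U is x - pds is (pev k h o' c) x) = 0)"
  using l
proof (induction rule: inc_induct)
  case base
  show ?case by (intro exI[of _ "\<lambda>_. 0"]) auto
next
  case (step n)
  let ?M = "lebesgue_on Q"
  interpret finite_measure ?M by (rule finite_measure_on_bounded[OF Q])
  have h0: "h \<noteq> 0" using h by simp
  from step.IH obtain c where IH: "(\<forall>\<alpha>. m \<le> sum \<alpha> UNIV \<longrightarrow> c \<alpha> = 0) \<and>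
    (\<forall>is. Suc n \<le> length is \<and> length is < m \<longrightarrow> (LINT x|?M. U is x - pds is (pev k h o' c) x) = 0)" ..
  then have c0: "c \<alpha> = 0" if "m \<le> sum \<alpha> UNIV" for \<alpha> using that by simp
  from IH have c: "(LINT x|?M. U is x - pds is (pev k h o' c) x) = 0" if "Suc n \<le> length is" "length is < m" for "is"
    using that by simp
  \<comment> \<open>A representative list for each multi-index; lists with the same counts have the
    same weak derivative almost everywhere, so one coefficient serves them all.\<close>
  define ism where "ism = (\<lambda>\<alpha>::'n \<Rightarrow> nat. SOME is. count_list is = \<alpha>)"
  have ism: "count_list (ism \<alpha>) = \<alpha>" for \<alpha> unfolding ism_def by (rule someI_ex[OF ex_list_count])
  define D where "D = (\<lambda>is. LINT x|?M. U is x - pds is (pev k h o' c) x)"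
  define \<mu> where "\<mu> = (LINT x|?M. (1::real))"
  \<comment> \<open>The factorials and the power of \<open>h\<close> undo the derivative of the
    monomial, and \<mu> turns the integral \<open>D\<close> into a mean.\<close>
  define \<delta> where "\<delta> = (\<lambda>\<alpha>::'n \<Rightarrow> nat. if sum \<alpha> UNIV = n then h ^ n / (\<Prod>j\<in>UNIV. fact (\<alpha> j)) * (D (ism \<alpha>) / \<mu>) else 0)"
  define c' where "c' = (\<lambda>\<alpha>. c \<alpha> + \<delta> \<alpha>)"
  have split: "pds is (pev k h o' c') x = pds is (pev k h o' c) x + (\<Sum>\<alpha>\<in>Idx k. \<delta> \<alpha> * pds is (mnm h o' \<alpha>) x)" for "is" x
    unfolding smooth_pev(2)[OF h0] c'_def by (simp add: distrib_right sum.distrib)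
  have int1: "integrable ?M (\<lambda>x. U is x - pds is (pev k h o' c) x)" if "length is < m" for "is"
  proof -
    have "sqint ?M (\<lambda>x. U is x - pds is (pev k h o' c) x)"
      using that by (intro sqint_diff is_wd_sqint[OF w] smooth_sqint_on[OF Q smooth_pev(1)[OF h0]]) simp
    moreover have "sqint ?M (\<lambda>x. 1)" by (auto simp: sqint_def)
    ultimately show ?thesis using sqint_mult by fastforce
  qed
  have "(LINT x|?M. U is x - pds is (pev k h o' c') x) = 0" if L: "n \<le> length is" "length is < m" for "is"
  proof (cases "length is = n")
    case False
    have "\<delta> \<alpha> * pds is (mnm h o' \<alpha>) x = 0" for \<alpha> x
      using False L(1) pds_mnm_low[OF h0, of \<alpha> "is"] by (cases "sum \<alpha> UNIV = n") (auto simp: \<delta>_def)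
    then have "(\<Sum>\<alpha>\<in>Idx k. \<delta> \<alpha> * pds is (mnm h o' \<alpha>) x) = 0" for x by (intro sum.neutral) blast
    then have "pds is (pev k h o' c') x = pds is (pev k h o' c) x" for x unfolding split by simp
    then show ?thesis using c[of "is"] False L by simp
  next
    case True
    \<comment> \<open>Here \<open>m \<le> Suc k\<close> is used: orders below \<open>m\<close> never
      call for an exponent above \<open>k\<close>.\<close>
    have "count_list is j \<le> k" for j using count_le_length[of "is" j] True L mk by linarith
    then have cnt: "count_list is \<in> Idx k" by (simp add: Idx_def)
    have sc: "sum (count_list is) UNIV = n" using True sum_count_set[of "is" UNIV] by simp
    have "(\<Sum>\<alpha>\<in>Idx k. \<delta> \<alpha> * pds is (mnm h o' \<alpha>) x) = (\<Sum>\<alpha>\<in>Idx k. if \<alpha> = count_list is then D (ism (count_list is)) / \<mu> else 0)" for x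
    proof (rule sum.cong[OF refl])
      fix \<alpha> :: "'n \<Rightarrow> nat"
      have f: "(\<Prod>j\<in>UNIV. fact (\<alpha> j) :: real) \<noteq> 0" by simp
      show "\<delta> \<alpha> * pds is (mnm h o' \<alpha>) x = (if \<alpha> = count_list is then D (ism (count_list is)) / \<mu> else 0)"
      proof (cases "sum \<alpha> UNIV = n")
        case s: True
        then show ?thesis using pds_mnm_eq[OF h0, of \<alpha> "is" o' x] True f h0 by (auto simp: \<delta>_def)
      next
        case False
        then show ?thesis using sc by (auto simp: \<delta>_def)
      qed
    qed
    then have e: "(\<Sum>\<alpha>\<in>Idx k. \<delta> \<alpha> * pds is (mnm h o' \<alpha>) x) = D (ism (count_list is)) / \<mu>" for x using cnt by simp
    have pm: "mset (ism (count_list is)) = mset is" by (rule multiset_eqI) (simp add: count_mset ism)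
    have "D (ism (count_list is)) = D is"
    proof -
      have "AE x in ?M. U (ism (count_list is)) x = U is x"
      proof (rule is_wd_unique[OF Q _ w])
        have "length (ism (count_list is)) \<le> m" using mset_eq_length[OF pm] L by simp
        from is_wd_perm[OF w[OF this] pm] show "is_wd Q is u (U (ism (count_list is)))" .
      qed (use L in simp)
      then have ae: "AE x in ?M. U (ism (count_list is)) x - pds (ism (count_list is)) (pev k h o' c) x = U is x - pds is (pev k h o' c) x"
        unfolding pds_pev_perm[OF h0 pm] by eventually_elim simp
      have "length (ism (count_list is)) < m" using mset_eq_length[OF pm] L by simp
      then show ?thesis unfolding D_def
        using ae int1[of "is"] int1[of "ism (count_list is)"] L by (intro integral_cong_AE) auto
    qed
    with e have "(LINT x|?M. U is x - pds is (pev k h o' c') x) = (LINT x|?M. (U is x - pds is (pev k h o' c) x) - D is / \<mu> * 1)"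
      unfolding split by (simp add: algebra_simps)
    also have "\<dots> = D is - D is / \<mu> * \<mu>"
      unfolding D_def \<mu>_def using int1[OF L(2)] by (subst Bochner_Integration.integral_diff) auto
    also have "\<dots> = 0" using assms(5) by (simp add: \<mu>_def)
    finally show ?thesis .
  qed
  moreover have "c' \<alpha> = 0" if "m \<le> sum \<alpha> UNIV" for \<alpha> using c0[OF that] step.hyps that by (auto simp: c'_def \<delta>_def)
  ultimately show ?case by (intro exI[of _ c']) auto
qed

text \<open>The derivatives of the error of order below \<open>m\<close> have mean zero, so the
  Poincare inequality can be iterated up to order \<open>m\<close>, where a polynomial of degree
  below \<open>m\<close> no longer contributes.\<close>

theorem bramble_hilbert:
  fixes u :: "real^'n::finite \<Rightarrow> real"
  assumes h: "h > 0" and side: "\<And>i. b $ i - a $ i = h" and mk: "m \<le> Suc k"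
  defines "Q \<equiv> box a b"
  assumes u: "sqint (lebesgue_on Q) u" and w: "\<And>is. length is \<le> m \<Longrightarrow> is_wd Q is u (U is)"
  obtains c where "\<And>\<alpha>. m \<le> sum \<alpha> UNIV \<Longrightarrow> c \<alpha> = 0"
    "\<And>j. j \<le> m \<Longrightarrow> (\<Sum>is | length is = j. (l2 (lebesgue_on Q) (\<lambda>x. U is x - pds is (pev k h o' c) x))\<^sup>2)
       \<le> (real CARD('n) * 2 ^ CARD('n) / 2 * h\<^sup>2) ^ (m - j) * (\<Sum>is | length is = m. (l2 (lebesgue_on Q) (U is))\<^sup>2)"
proof -
  let ?M = "lebesgue_on Q"
  have Q: "open Q" "bounded Q" by (auto simp: Q_def)
  have h0: "h \<noteq> 0" using h by simp
  have \<mu>: "(LINT x|?M. 1) > (0::real)"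
  proof -
    have p: "(b - a) \<bullet> v = h" if "v \<in> Basis" for v :: "real^'n"
      using that side by (auto simp: Basis_vec_def inner_axis)
    then have "a \<bullet> v \<le> b \<bullet> v" if "v \<in> Basis" for v :: "real^'n" using p[OF that] h by (simp add: inner_diff_left)
    then have "measure lborel (box a b) > 0" using p h by (simp add: measure_lborel_box_eq prod_pos)
    then have "measure lebesgue (box a b) > 0" by simp
    then show ?thesis by (simp add: Q_def measure_restrict_space)
  qed
  obtain c where c0: "\<And>\<alpha>. m \<le> sum \<alpha> UNIV \<Longrightarrow> c \<alpha> = 0"
    and c: "\<And>is. length is < m \<Longrightarrow> (LINT x|?M. U is x - pds is (pev k h o' c) x) = 0"
    using mean_zero_poly[OF h mk Q \<mu> w, of 0 o'] by auto
  let ?p = "pev k h o' c"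
  let ?C = "real CARD('n) * 2 ^ CARD('n) / 2 * h\<^sup>2"
  define S where "S = (\<lambda>j. \<Sum>is | length (is::'n list) = j. (l2 ?M (\<lambda>x. U is x - pds is ?p x))\<^sup>2)"
  have ew: "is_wd Q is (\<lambda>x. u x - ?p x) (\<lambda>x. U is x - pds is ?p x)" if "length is \<le> m" for "is"
    by (intro is_wd_diff[OF Q u smooth_sqint_on0[OF Q smooth_pev(1)[OF h0]] w[OF that]] is_wd_smooth[OF Q smooth_pev(1)[OF h0]] pds_pev_perm[OF h0]) simp
  have stepS: "S j \<le> ?C * S (Suc j)" if j: "j < m" for j
  proof -
    have "S j \<le> (\<Sum>is | length (is::'n list) = j. ?C * (\<Sum>i\<in>UNIV. (l2 ?M (\<lambda>x. U (is @ [i]) x - pds (is @ [i]) ?p x))\<^sup>2))"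
      unfolding S_def
    proof (rule sum_mono)
      fix "is" :: "'n list" assume "is \<in> {is. length is = j}"
      then have L: "length is \<le> m" "length (is @ [i]) \<le> m" "length is < m" for i using j by auto
      show "(l2 ?M (\<lambda>x. U is x - pds is ?p x))\<^sup>2 \<le> ?C * (\<Sum>i\<in>UNIV. (l2 ?M (\<lambda>x. U (is @ [i]) x - pds (is @ [i]) ?p x))\<^sup>2)"
      proof (rule poincare_weak[OF side h, folded Q_def])
        show "sqint ?M (\<lambda>x. U is x - pds is ?p x)" by (rule is_wd_sqint[OF ew[OF L(1)]])
        show "is_wd Q [i] (\<lambda>x. U is x - pds is ?p x) (\<lambda>x. U (is @ [i]) x - pds (is @ [i]) ?p x)" for i
          by (rule is_wd_snoc[OF ew[OF L(1)] ew[OF L(2)]])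
        show "(LINT x|?M. U is x - pds is ?p x) = 0" by (rule c[OF L(3)])
      qed
    qed
    also have "\<dots> = ?C * S (Suc j)" unfolding S_def sum_lists_snoc sum_distrib_left[symmetric] ..
    finally show ?thesis .
  qed
  have top: "S m = (\<Sum>is | length (is::'n list) = m. (l2 ?M (U is))\<^sup>2)"
    unfolding S_def
  proof (rule sum.cong[OF refl])
    fix "is" :: "'n list" assume "is \<in> {is. length is = m}"
    then have L: "length is = m" by simp
    have "c \<alpha> * pds is (mnm h o' \<alpha>) x = 0" for \<alpha> x
      using c0[of \<alpha>] pds_mnm_low[OF h0, of \<alpha> "is"] L by (cases "m \<le> sum \<alpha> UNIV") auto
    then have "(\<Sum>\<alpha>\<in>Idx k. c \<alpha> * pds is (mnm h o' \<alpha>) x) = 0" for x by (intro sum.neutral) blast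
    then have "pds is ?p x = 0" for x by (simp add: smooth_pev(2)[OF h0])
    then show "(l2 ?M (\<lambda>x. U is x - pds is ?p x))\<^sup>2 = (l2 ?M (U is))\<^sup>2" by simp
  qed
  have fin: "S j \<le> ?C ^ (m - j) * S m" if "j \<le> m" for j
    using that
  proof (induction rule: inc_induct)
    case (step n)
    have "S n \<le> ?C * S (Suc n)" by (rule stepS[OF step.hyps(2)])
    also have "\<dots> \<le> ?C * (?C ^ (m - Suc n) * S m)" by (rule mult_left_mono[OF step.IH]) simp
    also have "\<dots> = ?C ^ (m - n) * S m" using step.hyps by (simp add: Suc_diff_Suc flip: power_Suc mult.assoc)
    finally show ?case .
  qed simp
  show thesis
    by (rule that[OF c0], assumption) (use fin[unfolded top, unfolded S_def] in blast)
qed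

section \<open>Coefficient bounds and jumps across faces\<close>

definition vz :: "('n::finite \<Rightarrow> int) \<Rightarrow> real^'n" where "vz z = (\<chi> j. of_int (z j))"

lemma vz_nth[simp]: "vz z $ j = of_int (z j)"
  by (simp add: vz_def)

lemma One_nth: "(\<Sum>x\<in>(Basis :: (real^'n::finite) set). x $ j) = 1"
proof -
  have B: "(Basis :: (real^'n) set) = range ax" by (auto simp: Basis_vec_def)
  have inj: "inj (ax :: 'n \<Rightarrow> real^'n)" by (auto simp: inj_def axis_eq_axis)
  have "(\<Sum>x\<in>range (ax :: 'n \<Rightarrow> real^'n). x $ j) = (\<Sum>i\<in>UNIV. (ax i :: real^'n) $ j)"
    by (subst sum.reindex[OF inj]) (simp add: o_def)
  also have "\<dots> = 1" by (simp add: axis_def)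
  finally show ?thesis unfolding B .
qed

text \<open>Cubes of the full lattice through \<open>a\<close>, whether or not they belong to the
  mesh; the outside ones carry the zero polynomial.\<close>

definition lc :: "real^'n::finite \<Rightarrow> real \<Rightarrow> ('n \<Rightarrow> int) \<Rightarrow> (real^'n) set" where
  "lc a h z = cube (a + h *\<^sub>R vz z) h"

lemma mem_lc: "x \<in> lc a h z \<longleftrightarrow> (\<forall>j. a $ j + h * of_int (z j) \<le> x $ j \<and> x $ j \<le> a $ j + h * of_int (z j) + h)"
  by (simp add: lc_def cube_def mem_box_cart One_nth)

lemma lc_borel[measurable]: "lc a h z \<in> sets borel" and lc_compact: "compact (lc a h z)"
  by (auto simp: lc_def cube_def)

definition pr :: "'n::finite \<Rightarrow> real \<Rightarrow> real^'n \<Rightarrow> real^'n" where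
  "pr i s x = (\<chi> j. if j = i then s else x $ j)"

lemma pr_nth[simp]: "pr i s x $ j = (if j = i then s else x $ j)"
  by (simp add: pr_def)

lemma pr_eq: "pr i s x = x + (s - x $ i) *\<^sub>R ax i"
  by (auto simp: vec_eq_iff axis_def)

lemma pr_continuous: "continuous_on UNIV (pr i s)"
  unfolding pr_eq[abs_def] by (intro continuous_intros)

lemma integrable_on_lc:
  assumes "continuous_on UNIV f" shows "integrable lborel (\<lambda>x. indicator (lc a h z) x * (f x :: real))"
  using borel_integrable_compact[OF lc_compact[of a h z], of f] continuous_on_subset[OF assms] by simp

lemma nn_integral_lin:
  fixes c :: ennreal
  assumes "f \<in> borel_measurable M" "g \<in> borel_measurable M"
  shows "(\<integral>\<^sup>+x. 2 * f x + 2 * (c * g x) \<partial>M) = 2 * (\<integral>\<^sup>+x. f x \<partial>M) + 2 * (c * (\<integral>\<^sup>+x. g x \<partial>M))"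
  using assms by (simp add: nn_integral_add nn_integral_cmult)

text \<open>A trace inequality in which the face integral is replaced by the volume integral of the
  function composed with the projection onto the face.\<close>
lemma trace_cube:
  fixes q :: "real^'n::finite \<Rightarrow> real"
  assumes q: "smooth q" and h: "h > 0" and s: "s = a $ i + h * of_int (z i) \<or> s = a $ i + h * of_int (z i) + h"
  shows "(\<integral>x. indicator (lc a h z) x * (q (pr i s x))\<^sup>2 \<partial>lborel)
    \<le> 2 * (\<integral>x. indicator (lc a h z) x * (q x)\<^sup>2 \<partial>lborel) + 2 * h\<^sup>2 * (\<integral>x. indicator (lc a h z) x * (pdx i q x)\<^sup>2 \<partial>lborel)"
proof -
  let ?K = "lc a h z"
  \<comment> \<open>The sign of the direction in which points of the cube reach the face.\<close>
  define \<sigma> :: real where "\<sigma> = (if s = a $ i + h * of_int (z i) then -1 else 1)"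
  have qc: "continuous_on UNIV q" "continuous_on UNIV (pdx i q)" using smooth_cont[OF q, of "[]"] smooth_cont[OF q, of "[i]"] by auto
  have prc: "continuous_on UNIV (\<lambda>x. q (pr i s x))" by (rule continuous_on_compose2[OF qc(1) pr_continuous]) simp
  have [measurable]: "q \<in> borel_measurable borel" "pdx i q \<in> borel_measurable borel" "(\<lambda>x. q (pr i s x)) \<in> borel_measurable borel"
    using qc prc by (auto intro: borel_measurable_continuous_onI)
  let ?F = "\<lambda>x. indicator ?K x * ennreal ((pdx i q x)\<^sup>2)"
  have pt: "indicator ?K x * ennreal ((q (pr i s x))\<^sup>2) \<le> 2 * (indicator ?K x * ennreal ((q x)\<^sup>2)) +
      2 * (ennreal h * (\<integral>\<^sup>+t. indicator {0..h} t * ?F (x + t *\<^sub>R (\<sigma> *\<^sub>R ax i)) \<partial>lborel))" for x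
  proof (cases "x \<in> ?K")
    case True
    define D where "D = \<sigma> * (s - x $ i)"
    have xi: "a $ i + h * of_int (z i) \<le> x $ i" "x $ i \<le> a $ i + h * of_int (z i) + h" using True by (auto simp: mem_lc)
    have D: "0 \<le> D" "D \<le> h" using s xi h by (auto simp: D_def \<sigma>_def)
    have \<sigma>2: "\<sigma> * \<sigma> = 1" by (simp add: \<sigma>_def)
    have "D *\<^sub>R (\<sigma> *\<^sub>R ax i) = ((\<sigma> * \<sigma>) * (s - x $ i)) *\<^sub>R (ax i :: real^'n)" by (simp add: D_def mult_ac)
    then have prD: "pr i s x = x + D *\<^sub>R (\<sigma> *\<^sub>R ax i)" by (simp add: pr_eq \<sigma>2)
    have inK: "x + t *\<^sub>R (\<sigma> *\<^sub>R ax i) \<in> ?K" if "0 \<le> t" "t \<le> D" for t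
    proof -
      have "a $ i + h * of_int (z i) \<le> x $ i + t * \<sigma> \<and> x $ i + t * \<sigma> \<le> a $ i + h * of_int (z i) + h"
        using that D s xi by (auto simp: D_def \<sigma>_def split: if_splits)
      then show ?thesis using True by (auto simp: mem_lc axis_def)
    qed
    have "ennreal ((q (x + D *\<^sub>R (\<sigma> *\<^sub>R ax i)) - q (x + 0 *\<^sub>R (\<sigma> *\<^sub>R ax i)))\<^sup>2) \<le>
        ennreal (D - 0) * (\<integral>\<^sup>+t. indicator {0..D} t * ennreal ((\<sigma> * pdx i q (x + t *\<^sub>R (\<sigma> *\<^sub>R ax i)))\<^sup>2) \<partial>lborel)"
    proof (rule deriv_sq_le)
      fix t
      have "((\<lambda>t. q (x + (\<sigma> * t) *\<^sub>R ax i)) has_real_derivative pdx i q (x + (\<sigma> * t) *\<^sub>R ax i) * \<sigma>) (at t)"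
        using DERIV_chain2[OF smooth_deriv[OF q, of "[]" x i] DERIV_cmult_Id[of \<sigma>]] by simp
      then show "((\<lambda>t. q (x + t *\<^sub>R (\<sigma> *\<^sub>R ax i))) has_real_derivative \<sigma> * pdx i q (x + t *\<^sub>R (\<sigma> *\<^sub>R ax i))) (at t)"
        by (simp add: mult.commute)
      show "continuous_on UNIV (\<lambda>t. \<sigma> * pdx i q (x + t *\<^sub>R (\<sigma> *\<^sub>R ax i)))"
        by (intro continuous_on_mult_left continuous_on_compose2[OF qc(2)]) (auto intro!: continuous_intros)
    qed (use D in simp)
    also have "\<dots> \<le> ennreal h * (\<integral>\<^sup>+t. indicator {0..h} t * ?F (x + t *\<^sub>R (\<sigma> *\<^sub>R ax i)) \<partial>lborel)"
    proof (rule mult_mono[OF _ nn_integral_mono])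
      show "ennreal (D - 0) \<le> ennreal h" using D by (intro ennreal_leI) simp
      show "indicator {0..D} t * ennreal ((\<sigma> * pdx i q (x + t *\<^sub>R (\<sigma> *\<^sub>R ax i)))\<^sup>2) \<le> indicator {0..h} t * ?F (x + t *\<^sub>R (\<sigma> *\<^sub>R ax i))" for t
        using inK[of t] D \<sigma>2 by (cases "t \<in> {0..D}") (auto simp: indicator_def power_mult_distrib power2_eq_square[of \<sigma>])
    qed auto
    finally have A: "ennreal ((q (pr i s x) - q x)\<^sup>2) \<le> ennreal h * (\<integral>\<^sup>+t. indicator {0..h} t * ?F (x + t *\<^sub>R (\<sigma> *\<^sub>R ax i)) \<partial>lborel)"
      by (simp add: prD)
    have "(q (pr i s x))\<^sup>2 \<le> 2 * (q x)\<^sup>2 + 2 * (q (pr i s x) - q x)\<^sup>2"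
      using zero_le_power2[of "2 * q x - q (pr i s x)"] by (simp add: power2_eq_square algebra_simps)
    then have "ennreal ((q (pr i s x))\<^sup>2) \<le> ennreal (2 * (q x)\<^sup>2 + 2 * (q (pr i s x) - q x)\<^sup>2)"
      by (rule ennreal_leI)
    also have "\<dots> = 2 * ennreal ((q x)\<^sup>2) + 2 * ennreal ((q (pr i s x) - q x)\<^sup>2)"
      by (subst ennreal_plus) (auto simp: ennreal_mult)
    also have "\<dots> \<le> 2 * ennreal ((q x)\<^sup>2) + 2 * (ennreal h * (\<integral>\<^sup>+t. indicator {0..h} t * ?F (x + t *\<^sub>R (\<sigma> *\<^sub>R ax i)) \<partial>lborel))"
      by (intro add_mono mult_left_mono A) auto
    finally show ?thesis using True by simp
  qed simp
  have "(\<integral>\<^sup>+x. indicator ?K x * ennreal ((q (pr i s x))\<^sup>2) \<partial>lborel) \<le> (\<integral>\<^sup>+x. 2 * (indicator ?K x * ennreal ((q x)\<^sup>2)) +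
      2 * (ennreal h * (\<integral>\<^sup>+t. indicator {0..h} t * ?F (x + t *\<^sub>R (\<sigma> *\<^sub>R ax i)) \<partial>lborel)) \<partial>lborel)"
    by (intro nn_integral_mono pt)
  also have "\<dots> = 2 * (\<integral>\<^sup>+x. indicator ?K x * ennreal ((q x)\<^sup>2) \<partial>lborel) + 2 * (ennreal h * (ennreal h * (\<integral>\<^sup>+x. ?F x \<partial>lborel)))"
  proof -
    have m: "(\<lambda>x. \<integral>\<^sup>+t. indicator {0..h} t * ?F (x + t *\<^sub>R (\<sigma> *\<^sub>R ax i)) \<partial>lborel) \<in> borel_measurable lborel" by measurable
    have l: "(\<integral>\<^sup>+x. \<integral>\<^sup>+t. indicator {0..h} t * ?F (x + t *\<^sub>R (\<sigma> *\<^sub>R ax i)) \<partial>lborel \<partial>lborel) = ennreal h * (\<integral>\<^sup>+x. ?F x \<partial>lborel)"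
      by (rule nn_integral_lines) (use h in auto)
    show ?thesis
      unfolding l[symmetric] by (rule nn_integral_lin[OF _ m]) measurable
  qed
  finally have N: "(\<integral>\<^sup>+x. indicator ?K x * ennreal ((q (pr i s x))\<^sup>2) \<partial>lborel) \<le> 2 * (\<integral>\<^sup>+x. indicator ?K x * ennreal ((q x)\<^sup>2) \<partial>lborel) + 2 * (ennreal h * (ennreal h * (\<integral>\<^sup>+x. ?F x \<partial>lborel)))" .
  have conv: "(\<integral>\<^sup>+x. indicator ?K x * ennreal ((f x)\<^sup>2) \<partial>lborel) = ennreal (\<integral>x. indicator ?K x * (f x)\<^sup>2 \<partial>lborel)" if "continuous_on UNIV f" for f
  proof -
    have "(\<integral>\<^sup>+x. indicator ?K x * ennreal ((f x)\<^sup>2) \<partial>lborel) = (\<integral>\<^sup>+x. ennreal (indicator ?K x * (f x)\<^sup>2) \<partial>lborel)"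
      by (intro nn_integral_cong) (auto simp: indicator_def)
    also have "\<dots> = ennreal (\<integral>x. indicator ?K x * (f x)\<^sup>2 \<partial>lborel)"
      by (rule nn_integral_eq_integral) (auto intro!: integrable_on_lc continuous_intros that)
    finally show ?thesis .
  qed
  have "ennreal (\<integral>x. indicator ?K x * (q (pr i s x))\<^sup>2 \<partial>lborel)
    \<le> ennreal (2 * (\<integral>x. indicator ?K x * (q x)\<^sup>2 \<partial>lborel) + 2 * h\<^sup>2 * (\<integral>x. indicator ?K x * (pdx i q x)\<^sup>2 \<partial>lborel))"
    using N h unfolding conv[OF prc] conv[OF qc(1)] conv[OF qc(2)]
    by (simp add: ennreal_mult ennreal_plus power2_eq_square mult.assoc flip: ennreal_numeral)
  then show ?thesis using h by (subst (asm) ennreal_le_iff) (auto intro!: add_nonneg_nonneg mult_nonneg_nonneg)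
qed

section \<open>Equivalence of the coefficient norm and the L2 norm on reference cubes\<close>

lemma dpow_0: "dpow a r 0 = (if r = a then fact a else 0)"
  by (auto simp: dpow_def)

lemma pds_pev_0:
  fixes c :: "('n::finite \<Rightarrow> nat) \<Rightarrow> real"
  assumes "count_list is \<in> Idx k"
  shows "pds is (pev k 1 0 c) 0 = c (count_list is) * (\<Prod>j\<in>UNIV. fact (count_list is j))"
proof -
  have "pds is (pev k 1 0 c) 0 = (\<Sum>\<alpha>\<in>Idx k. c \<alpha> * (\<Prod>j\<in>UNIV. dpow (\<alpha> j) (count_list is j) 0))"
    by (simp add: smooth_pev smooth_mnm)
  also have "\<dots> = (\<Sum>\<alpha>\<in>Idx k. if \<alpha> = count_list is then c \<alpha> * (\<Prod>j\<in>UNIV. fact (\<alpha> j)) else 0)"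
  proof (rule sum.cong[OF refl])
    fix \<alpha> :: "'n \<Rightarrow> nat"
    show "c \<alpha> * (\<Prod>j\<in>UNIV. dpow (\<alpha> j) (count_list is j) 0) = (if \<alpha> = count_list is then c \<alpha> * (\<Prod>j\<in>UNIV. fact (\<alpha> j)) else 0)"
    proof (cases "\<alpha> = count_list is")
      case False
      then obtain j where "count_list is j \<noteq> \<alpha> j" by (metis ext)
      then have "(\<Prod>j\<in>UNIV. dpow (\<alpha> j) (count_list is j) 0) = 0" by (intro prod_zero bexI[of _ j]) (auto simp: dpow_0)
      with False show ?thesis by simp
    qed (simp add: dpow_0)
  qed
  finally show ?thesis using assms by simp
qed

lemma finite_subsequence:
  fixes f :: "nat \<Rightarrow> 'a \<Rightarrow> real"
  assumes "finite I" "\<And>n \<alpha>. \<alpha> \<in> I \<Longrightarrow> \<bar>f n \<alpha>\<bar> \<le> B"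
  obtains r l where "strict_mono r" "\<And>\<alpha>. \<alpha> \<in> I \<Longrightarrow> (\<lambda>n. f (r n) \<alpha>) \<longlonglongrightarrow> l \<alpha>"
proof -
  have "\<exists>r l. strict_mono (r::nat\<Rightarrow>nat) \<and> (\<forall>\<alpha>\<in>I. (\<lambda>n. f (r n) \<alpha>) \<longlonglongrightarrow> l \<alpha>)"
    using assms
  proof (induction I rule: finite_induct)
    case empty
    then show ?case by (intro exI[of _ id]) (auto simp: strict_mono_def)
  next
    case (insert \<alpha> I)
    then obtain r l where r: "strict_mono (r::nat\<Rightarrow>nat)" "\<forall>\<alpha>\<in>I. (\<lambda>n. f (r n) \<alpha>) \<longlonglongrightarrow> l \<alpha>" by auto
    have "bounded (range (\<lambda>n. f (r n) \<alpha>))" unfolding bounded_iff using insert.prems[of \<alpha>] by auto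
    then obtain x s where s: "strict_mono (s::nat\<Rightarrow>nat)" "((\<lambda>n. f (r n) \<alpha>) \<circ> s) \<longlonglongrightarrow> x"
      using bounded_imp_convergent_subsequence by blast
    have "(\<lambda>n. f ((r \<circ> s) n) \<beta>) \<longlonglongrightarrow> (l(\<alpha> := x)) \<beta>" if "\<beta> \<in> insert \<alpha> I" for \<beta>
    proof (cases "\<beta> = \<alpha>")
      case True
      then show ?thesis using s(2) by (simp add: o_def)
    next
      case False
      then have "(\<lambda>n. f (r n) \<beta>) \<longlonglongrightarrow> l \<beta>" using that r(2) by auto
      from LIMSEQ_subseq_LIMSEQ[OF this s(1)] show ?thesis using False by (simp add: o_def)
    qed
    moreover have "strict_mono (r \<circ> s)" by (rule strict_mono_o[OF r(1) s(1)])
    ultimately show ?case by blast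
  qed
  then show thesis using that by blast
qed

text \<open>Equivalence of norms in finite dimension by compactness: normalised counterexamples have
  a subsequence whose limit has coefficient norm 1 but vanishes on the cube. Cubes with
  \<open>z j\<close> in {-1, 0} are those having the origin as a corner, where the coefficients are
  read off as derivatives.\<close>

lemma coeff_bound_one:
  fixes z :: "'n::finite \<Rightarrow> int"
  assumes z: "\<And>j. z j \<in> {-1, 0}"
  shows "\<exists>C>0. \<forall>c. (\<Sum>\<alpha>\<in>Idx k. (c \<alpha>)\<^sup>2) \<le> C * (\<integral>x. indicator (lc 0 1 z) x * (pev k 1 0 c x)\<^sup>2 \<partial>lborel)"
proof -
  let ?K = "lc 0 1 z :: (real^'n) set"
  define N where "N = (\<lambda>c. \<integral>x. indicator ?K x * (pev k 1 0 c x)\<^sup>2 \<partial>lborel)"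
  define Mx where "Mx = (\<lambda>\<alpha> \<beta>. \<integral>x. indicator ?K x * (mnm 1 0 \<alpha> x * mnm 1 0 \<beta> x) \<partial>lborel)"
  have mc: "continuous_on UNIV (mnm 1 0 \<alpha> :: real^'n \<Rightarrow> real)" for \<alpha> using smooth_cont[OF smooth_mnm(1), of 1 "[]"] by simp
  have pc: "continuous_on UNIV (pev k 1 0 c :: real^'n \<Rightarrow> real)" for c using smooth_cont[OF smooth_pev(1), of 1 "[]"] by simp
  have Nq: "N c = (\<Sum>\<alpha>\<in>Idx k. \<Sum>\<beta>\<in>Idx k. c \<alpha> * c \<beta> * Mx \<alpha> \<beta>)" for c
  proof -
    have "N c = (\<integral>x. (\<Sum>\<alpha>\<in>Idx k. \<Sum>\<beta>\<in>Idx k. c \<alpha> * c \<beta> * (indicator ?K x * (mnm 1 0 \<alpha> x * mnm 1 0 \<beta> x))) \<partial>lborel)"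
      unfolding N_def pev_def power2_eq_square sum_product
      by (rule Bochner_Integration.integral_cong) (auto simp: sum_distrib_left mult_ac)
    also have "\<dots> = (\<Sum>\<alpha>\<in>Idx k. \<Sum>\<beta>\<in>Idx k. c \<alpha> * c \<beta> * Mx \<alpha> \<beta>)"
      unfolding Mx_def using integrable_on_lc[OF continuous_on_mult[OF mc mc], of 0 1 z]
      by (simp add: Bochner_Integration.integral_sum)
    finally show ?thesis .
  qed
  have pos: "c \<beta> = 0" if N0: "N c = 0" and \<beta>: "\<beta> \<in> Idx k" for c \<beta>
  proof -
    let ?O = "interior ?K"
    have "AE x in lborel. indicator ?K x * (pev k 1 0 c x)\<^sup>2 = 0"
      using N0 integrable_on_lc[of "\<lambda>x. (pev k 1 0 c x)\<^sup>2"] pc unfolding N_def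
      by (subst integral_nonneg_eq_0_iff_AE[symmetric]) (auto intro!: continuous_intros)
    then have ae: "AE x in lebesgue. x \<in> ?K \<longrightarrow> pev k 1 0 c x = 0"
      by (intro AE_completion) (auto simp: indicator_def elim!: eventually_mono)
    have op: "open (?O \<inter> {x. pev k 1 0 c x \<noteq> 0})"
      using open_Collect_neq[OF pc continuous_on_const] by auto
    have "negligible (?O \<inter> {x. pev k 1 0 c x \<noteq> 0})"
    proof -
      obtain Z where Z: "Z \<in> null_sets lebesgue" "{x. \<not> (x \<in> ?K \<longrightarrow> pev k 1 0 c x = 0)} \<subseteq> Z"
        using ae by (auto simp: eventually_ae_filter)
      have "?O \<inter> {x. pev k 1 0 c x \<noteq> 0} \<subseteq> Z" using Z(2) interior_subset[of ?K] by auto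
      then show ?thesis using Z(1) negligible_subset by (auto simp: negligible_iff_null_sets[symmetric])
    qed
    then have "?O \<inter> {x. pev k 1 0 c x \<noteq> 0} = {}" using op open_not_negligible by blast
    then have zero: "pev k 1 0 c x = 0" if "x \<in> ?O" for x using that by blast
    obtain "is" :: "'n list" where cnt: "count_list is = \<beta>" using ex_list_count by blast
    have z1: "pds is (pev k 1 0 c) x = 0" if "x \<in> ?O" for x
      using pds_local[OF open_interior, of ?K "pev k 1 0 c" "\<lambda>_. 0" x "is"] zero that by (simp add: smooth_zero)
    \<comment> \<open>The origin is only a corner, so the vanishing of derivatives in the interior
      is carried to it by continuity.\<close>
    have "0 \<in> closure ?O"
    proof -
      have "of_int (z j) \<le> (0::real) \<and> 0 \<le> of_int (z j) + (1::real)" for j using z[of j] by auto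
      then have "(0::real^'n) \<in> ?K" by (simp add: mem_lc)
      moreover have "closure ?O = ?K"
        unfolding lc_def cube_def interior_cbox by (rule closure_box) (simp add: interval_ne_empty_cart One_nth)
      ultimately show ?thesis by simp
    qed
    then have "pds is (pev k 1 0 c) 0 = 0"
      using continuous_constant_on_closure[of ?O "pds is (pev k 1 0 c)" 0 0] z1
        continuous_on_subset[OF smooth_cont[OF smooth_pev(1), of 1 "is" k 0 c]] by auto
    then have "c \<beta> * (\<Prod>j\<in>UNIV. fact (\<beta> j)) = 0" using pds_pev_0[of "is" k c] \<beta> cnt by simp
    then show ?thesis by simp
  qed
  have "\<exists>C>0. \<forall>c. (\<Sum>\<alpha>\<in>Idx k. (c \<alpha>)\<^sup>2) \<le> C * N c"
  proof (rule ccontr)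
    assume "\<not> ?thesis"
    then have "\<forall>n. \<exists>c. (\<Sum>\<alpha>\<in>Idx k. (c \<alpha>)\<^sup>2) > real (Suc n) * N c" by (metis not_less of_nat_0_less_iff zero_less_Suc)
    then obtain c where c: "\<And>n. (\<Sum>\<alpha>\<in>Idx k. (c n \<alpha>)\<^sup>2) > real (Suc n) * N (c n)" by metis
    have N0: "N c \<ge> 0" for c by (simp add: N_def)
    define S where "S = (\<lambda>n. sqrt (\<Sum>\<alpha>\<in>Idx k. (c n \<alpha>)\<^sup>2))"
    have S2: "(S n)\<^sup>2 = (\<Sum>\<alpha>\<in>Idx k. (c n \<alpha>)\<^sup>2)" for n by (simp add: S_def sum_nonneg)
    have S0: "S n > 0" for n
    proof -
      have "0 \<le> real (Suc n) * N (c n)" using N0[of "c n"] by simp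
      then have "(\<Sum>\<alpha>\<in>Idx k. (c n \<alpha>)\<^sup>2) > 0" using c[of n] by linarith
      then show ?thesis by (simp add: S_def)
    qed
    define d where "d = (\<lambda>n \<alpha>. c n \<alpha> / S n)"
    have d1: "(\<Sum>\<alpha>\<in>Idx k. (d n \<alpha>)\<^sup>2) = 1" for n
      using S0[of n] by (simp add: d_def power_divide flip: sum_divide_distrib S2)
    have Nd: "N (d n) = N (c n) / (S n)\<^sup>2" for n
      unfolding Nq d_def by (simp add: sum_divide_distrib power2_eq_square)
    have Nlt: "N (d n) \<le> inverse (real (Suc n))" for n
    proof -
      have "real (Suc n) * N (c n) < (S n)\<^sup>2" using c[of n] S2 by simp
      then show ?thesis unfolding Nd using S0[of n] by (simp add: field_simps del: of_nat_Suc)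
    qed
    have dle: "\<bar>d n \<alpha>\<bar> \<le> 1" if "\<alpha> \<in> Idx k" for n \<alpha>
    proof -
      have "(d n \<alpha>)\<^sup>2 \<le> (\<Sum>\<alpha>\<in>Idx k. (d n \<alpha>)\<^sup>2)" by (rule member_le_sum[OF that]) auto
      then show ?thesis unfolding d1 by (simp add: abs_square_le_1)
    qed
    obtain r l where r: "strict_mono r" and l: "\<And>\<alpha>. \<alpha> \<in> Idx k \<Longrightarrow> (\<lambda>n. d (r n) \<alpha>) \<longlonglongrightarrow> l \<alpha>"
      by (rule finite_subsequence[of "Idx k" d 1, OF finite_Idx dle]) (assumption, rule that)
    have "(\<lambda>n. N (d (r n))) \<longlonglongrightarrow> N l" unfolding Nq by (intro tendsto_intros l)
    moreover have "(\<lambda>n. N (d (r n))) \<longlonglongrightarrow> 0"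
    proof (rule Lim_null_comparison)
      show "\<forall>\<^sub>F n in sequentially. norm (N (d (r n))) \<le> inverse (real (Suc (r n)))" using Nlt N0 by (simp del: of_nat_Suc)
      show "(\<lambda>n. inverse (real (Suc (r n)))) \<longlonglongrightarrow> 0"
        using LIMSEQ_subseq_LIMSEQ[OF LIMSEQ_inverse_real_of_nat r] by (simp add: o_def)
    qed
    ultimately have "N l = 0" using LIMSEQ_unique by blast
    then have l0: "l \<alpha> = 0" if "\<alpha> \<in> Idx k" for \<alpha> using pos that by blast
    have "(\<lambda>n. \<Sum>\<alpha>\<in>Idx k. (d (r n) \<alpha>)\<^sup>2) \<longlonglongrightarrow> (\<Sum>\<alpha>\<in>Idx k. (l \<alpha>)\<^sup>2)" by (intro tendsto_intros l)
    then have "(\<lambda>n::nat. 1::real) \<longlonglongrightarrow> 0" unfolding d1 using l0 by simp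
    then show False using LIMSEQ_unique[OF tendsto_const] by fastforce
  qed
  then show ?thesis unfolding N_def .
qed

text \<open>Only finitely many cubes surround a vertex, so the constants can be summed into
  one.\<close>

lemma coeff_bound:
  obtains C where "C > 0" "\<And>(z :: 'n::finite \<Rightarrow> int) c. (\<And>j. z j \<in> {-1, 0}) \<Longrightarrow>
    (\<Sum>\<alpha>\<in>Idx k. (c \<alpha>)\<^sup>2) \<le> C * (\<integral>x. indicator (lc 0 1 z) x * (pev k 1 0 c x)\<^sup>2 \<partial>lborel)"
proof -
  define Z where "Z = {z :: 'n \<Rightarrow> int. \<forall>j. z j \<in> {-1, 0}}"
  have "Z = PiE UNIV (\<lambda>_. {-1, 0})" by (auto simp: Z_def PiE_def)
  then have fin: "finite Z" using finite_PiE[of "UNIV :: 'n set" "\<lambda>_. {-1, 0::int}"] by auto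
  let ?P = "\<lambda>z C. C > 0 \<and> (\<forall>c. (\<Sum>\<alpha>\<in>Idx k. (c \<alpha>)\<^sup>2) \<le> C * (\<integral>x. indicator (lc 0 1 z) x * (pev k 1 0 c x)\<^sup>2 \<partial>lborel))"
  have "\<forall>z. \<exists>C. z \<in> Z \<longrightarrow> ?P z C"
  proof (intro allI)
    fix z :: "'n \<Rightarrow> int"
    show "\<exists>C. z \<in> Z \<longrightarrow> ?P z C"
    proof (cases "z \<in> Z")
      case True
      then have "\<And>j. z j \<in> {-1, 0}" by (simp add: Z_def)
      from coeff_bound_one[of z k, OF this] show ?thesis by blast
    qed simp
  qed
  from choice[OF this] obtain C where C: "\<forall>z. z \<in> Z \<longrightarrow> ?P z (C z)" ..
  show thesis
  proof (rule that[of "(\<Sum>z\<in>Z. C z) + 1"])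
    have "(\<Sum>z\<in>Z. C z) \<ge> 0" by (rule sum_nonneg) (use C in \<open>auto intro: less_imp_le\<close>)
    then show "(\<Sum>z\<in>Z. C z) + 1 > 0" by simp
    fix z :: "'n \<Rightarrow> int" and c assume "\<And>j. z j \<in> {-1, 0}"
    then have z: "z \<in> Z" by (simp add: Z_def)
    have "C z \<le> (\<Sum>z\<in>Z. C z) + 1" using member_le_sum[OF z, of C] C fin by (fastforce intro: less_imp_le)
    moreover have "(\<Sum>\<alpha>\<in>Idx k. (c \<alpha>)\<^sup>2) \<le> C z * (\<integral>x. indicator (lc 0 1 z) x * (pev k 1 0 c x)\<^sup>2 \<partial>lborel)" using C z by blast
    ultimately show "(\<Sum>\<alpha>\<in>Idx k. (c \<alpha>)\<^sup>2) \<le> ((\<Sum>z\<in>Z. C z) + 1) * (\<integral>x. indicator (lc 0 1 z) x * (pev k 1 0 c x)\<^sup>2 \<partial>lborel)"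
      by (elim order_trans) (intro mult_right_mono, auto)
  qed
qed

lemma mnm_scale: "h \<noteq> 0 \<Longrightarrow> mnm h o' \<alpha> (o' + h *\<^sub>R y) = mnm 1 0 \<alpha> y"
  by (simp add: mnm_def)

lemma integral_lc_scale:
  fixes f :: "real^'n::finite \<Rightarrow> real"
  assumes h: "h > 0" and f: "continuous_on UNIV f"
  shows "(\<integral>x. indicator (lc o' h z) x * f x \<partial>lborel) = h ^ CARD('n) * (\<integral>y. indicator (lc 0 1 z) y * f (o' + h *\<^sub>R y) \<partial>lborel)"
proof -
  have [measurable]: "f \<in> borel_measurable borel" by (rule borel_measurable_continuous_onI[OF f])
  have "(o' + h *\<^sub>R y \<in> lc o' h z) = (y \<in> lc 0 1 z)" for y
  proof -
    have "(o' $ j + h * of_int (z j) \<le> o' $ j + h * y $ j) = (of_int (z j) \<le> y $ j)"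
      "(o' $ j + h * y $ j \<le> o' $ j + h * of_int (z j) + h) = (y $ j \<le> of_int (z j) + 1)" for j
      using h mult_le_cancel_left_pos[OF h, of "y $ j" "of_int (z j) + 1"] by (auto simp: distrib_left)
    then show ?thesis by (simp add: mem_lc)
  qed
  then show ?thesis using h
    by (subst lborel_integral_affine(1)[where c = h and t = o']) (auto simp: indicator_def)
qed

lemma mnm_pr: "mnm h o' \<alpha> (pr i (o' $ i) x) = (if \<alpha> i = 0 then mnm h o' \<alpha> x else 0)"
  unfolding mnm_def by (auto intro!: prod.cong prod_zero bexI[of _ i])

lemma pdx_mnm_pr:
  assumes h: "h \<noteq> 0"
  shows "pdx i (mnm h o' \<alpha>) (pr i (o' $ i) x) = (if \<alpha> i = 1 then mnm h o' (\<alpha>(i := 0)) x / h else 0)"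
proof -
  have "pdx i (mnm h o' \<alpha>) (pr i (o' $ i) x) = (\<Prod>j\<in>UNIV. dpow (\<alpha> j) (count_list [i] j) ((pr i (o' $ i) x $ j - o' $ j) / h)) / h"
    using smooth_mnm(2)[OF h, of "[i]" o' \<alpha> "pr i (o' $ i) x"] by simp
  also have "(\<Prod>j\<in>UNIV. dpow (\<alpha> j) (count_list [i] j) ((pr i (o' $ i) x $ j - o' $ j) / h)) = (if \<alpha> i = 1 then mnm h o' (\<alpha>(i := 0)) x else 0)"
  proof (cases "\<alpha> i = 1")
    case True
    then show ?thesis unfolding mnm_def by (auto intro!: prod.cong simp: dpow_def)
  next
    case False
    then show ?thesis by (auto intro!: prod_zero bexI[of _ i] simp: dpow_0)
  qed
  finally show ?thesis by simp
qed

text \<open>The coefficients with exponent 0 or 1 in direction \<open>i\<close> are those of the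
  trace and of the scaled normal derivative on the hyperplane through \<open>o'\<close>. Both are
  polynomials constant in direction \<open>i\<close>, so the bound for full-dimensional cubes
  applies to them.\<close>

lemma face_coeff:
  fixes D :: "('n::finite \<Rightarrow> nat) \<Rightarrow> real" and o' :: "real^'n"
  assumes h: "h > 0" and k: "k \<ge> 1"
    and C: "C > 0" "\<And>(z :: 'n \<Rightarrow> int) c. (\<And>j. z j \<in> {-1, 0}) \<Longrightarrow>
      (\<Sum>\<alpha>\<in>Idx k. (c \<alpha>)\<^sup>2) \<le> C * (\<integral>x. indicator (lc 0 1 z) x * (pev k 1 0 c x)\<^sup>2 \<partial>lborel)"
    and z: "\<And>j. z j \<in> {-1, 0}"
  defines "d \<equiv> pev k h o' D"
  shows "h ^ CARD('n) * (\<Sum>\<alpha> | \<alpha> \<in> Idx k \<and> \<alpha> i \<le> 1. (D \<alpha>)\<^sup>2) \<le> C * ((\<integral>x. indicator (lc o' h z) x * (d (pr i (o' $ i) x))\<^sup>2 \<partial>lborel)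
     + h\<^sup>2 * (\<integral>x. indicator (lc o' h z) x * (pdx i d (pr i (o' $ i) x))\<^sup>2 \<partial>lborel))"
proof -
  have h0: "h \<noteq> 0" using h by simp
  define D0 where "D0 = (\<lambda>\<alpha>. if \<alpha> i = 0 then D \<alpha> else 0)"
  \<comment> \<open>Lowering the exponent from 1 to 0 writes the normal derivative, up to the factor
    1/\<open>h\<close>, as a polynomial in the tangential variables.\<close>
  define D1 where "D1 = (\<lambda>\<alpha>. if \<alpha> i = 0 then D (\<alpha>(i := 1)) else 0)"
  have e0: "d (pr i (o' $ i) x) = pev k h o' D0 x" for x
    unfolding d_def pev_def D0_def by (auto intro!: sum.cong simp: mnm_pr)
  have re: "(\<Sum>\<alpha> | \<alpha> \<in> Idx k \<and> \<alpha> i = 1. f \<alpha>) = (\<Sum>\<beta> | \<beta> \<in> Idx k \<and> \<beta> i = 0. f (\<beta>(i := 1)))" for f :: "('n \<Rightarrow> nat) \<Rightarrow> real"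
    by (rule sum.reindex_bij_witness[where i = "\<lambda>\<beta>. \<beta>(i := 1)" and j = "\<lambda>\<alpha>. \<alpha>(i := 0)"])
       (use k in \<open>auto simp: Idx_def fun_upd_idem\<close>)
  have e1: "pdx i d (pr i (o' $ i) x) = pev k h o' D1 x / h" for x
  proof -
    have "pdx i d (pr i (o' $ i) x) = (\<Sum>\<alpha>\<in>Idx k. D \<alpha> * (if \<alpha> i = 1 then mnm h o' (\<alpha>(i := 0)) x / h else 0))"
      unfolding d_def using smooth_pev(2)[OF h0, of "[i]" k o' D] by (simp add: pdx_mnm_pr[OF h0])
    also have "\<dots> = (\<Sum>\<alpha> | \<alpha> \<in> Idx k \<and> \<alpha> i = 1. D \<alpha> * (mnm h o' (\<alpha>(i := 0)) x / h))"
      by (rule sum.mono_neutral_cong_right) auto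
    also have "\<dots> = (\<Sum>\<beta> | \<beta> \<in> Idx k \<and> \<beta> i = 0. D (\<beta>(i := 1)) * (mnm h o' \<beta> x / h))"
      unfolding re by (rule sum.cong) (auto simp: fun_upd_idem)
    also have "\<dots> = (\<Sum>\<beta>\<in>Idx k. D1 \<beta> * (mnm h o' \<beta> x / h))"
      by (rule sum.mono_neutral_cong_left) (auto simp: D1_def)
    finally show ?thesis by (simp add: pev_def sum_divide_distrib)
  qed
  have b: "h ^ CARD('n) * (\<Sum>\<alpha>\<in>Idx k. (c \<alpha>)\<^sup>2) \<le> C * (\<integral>x. indicator (lc o' h z) x * (pev k h o' c x)\<^sup>2 \<partial>lborel)" for c
  proof -
    have pc: "continuous_on UNIV (pev k h o' c)" using smooth_cont[OF smooth_pev(1)[OF h0], of "[]"] by simp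
    have "h ^ CARD('n) * (\<Sum>\<alpha>\<in>Idx k. (c \<alpha>)\<^sup>2) \<le> h ^ CARD('n) * (C * (\<integral>x. indicator (lc 0 1 z) x * (pev k 1 0 c x)\<^sup>2 \<partial>lborel))"
      by (rule mult_left_mono[OF C(2)[of z, OF z]]) (use h in simp)
    also have "\<dots> = C * (\<integral>x. indicator (lc o' h z) x * (pev k h o' c x)\<^sup>2 \<partial>lborel)"
    proof -
      have "(\<integral>x. indicator (lc o' h z) x * (pev k h o' c x)\<^sup>2 \<partial>lborel) = h ^ CARD('n) * (\<integral>y. indicator (lc 0 1 z) y * (pev k h o' c (o' + h *\<^sub>R y))\<^sup>2 \<partial>lborel)"
        by (rule integral_lc_scale[OF h]) (intro continuous_intros pc)
      moreover have "pev k h o' c (o' + h *\<^sub>R y) = pev k 1 0 c y" for y by (simp add: pev_def mnm_scale[OF h0])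
      ultimately show ?thesis by simp
    qed
    finally show ?thesis .
  qed
  have "(\<Sum>\<alpha> | \<alpha> \<in> Idx k \<and> \<alpha> i \<le> 1. (D \<alpha>)\<^sup>2) = (\<Sum>\<alpha> | \<alpha> \<in> Idx k \<and> \<alpha> i = 0. (D \<alpha>)\<^sup>2) + (\<Sum>\<alpha> | \<alpha> \<in> Idx k \<and> \<alpha> i = 1. (D \<alpha>)\<^sup>2)"
  proof -
    have "{\<alpha> \<in> Idx k. \<alpha> i \<le> 1} = {\<alpha> \<in> Idx k. \<alpha> i = 0} \<union> {\<alpha> \<in> Idx k. \<alpha> i = 1}" by (auto simp: le_Suc_eq)
    then show ?thesis by (simp add: sum.union_disjoint disjoint_iff)
  qed
  also have "(\<Sum>\<alpha> | \<alpha> \<in> Idx k \<and> \<alpha> i = 0. (D \<alpha>)\<^sup>2) = (\<Sum>\<alpha>\<in>Idx k. (D0 \<alpha>)\<^sup>2)"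
    by (rule sum.mono_neutral_cong_left) (auto simp: D0_def)
  also have "(\<Sum>\<alpha> | \<alpha> \<in> Idx k \<and> \<alpha> i = 1. (D \<alpha>)\<^sup>2) = (\<Sum>\<alpha>\<in>Idx k. (D1 \<alpha>)\<^sup>2)"
    unfolding re by (rule sum.mono_neutral_cong_left) (auto simp: D1_def)
  finally have S: "(\<Sum>\<alpha> | \<alpha> \<in> Idx k \<and> \<alpha> i \<le> 1. (D \<alpha>)\<^sup>2) = (\<Sum>\<alpha>\<in>Idx k. (D0 \<alpha>)\<^sup>2) + (\<Sum>\<alpha>\<in>Idx k. (D1 \<alpha>)\<^sup>2)" .
  have "h\<^sup>2 * (\<integral>x. indicator (lc o' h z) x * (pdx i d (pr i (o' $ i) x))\<^sup>2 \<partial>lborel) = (\<integral>x. indicator (lc o' h z) x * (pev k h o' D1 x)\<^sup>2 \<partial>lborel)"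
    unfolding e1 integral_mult_right_zero[symmetric] by (rule Bochner_Integration.integral_cong) (use h in \<open>auto simp: power_divide\<close>)
  then show ?thesis unfolding S e0 using b[of D0] b[of D1] by (simp add: distrib_left)
qed

text \<open>A squared H2 norm in which each derivative carries the power of \<open>h\<close> that
  makes it scale like the square integral itself.\<close>

definition rho :: "real \<Rightarrow> (real^'n::finite \<Rightarrow> real) \<Rightarrow> (real^'n) set \<Rightarrow> real" where
  "rho h q K = (\<Sum>is | length is \<le> 2. h ^ (2 * length is) * (\<integral>x. indicator K x * (pds is q x)\<^sup>2 \<partial>lborel))"

lemma finite_lists_length_le[simp]: "finite {is :: 'n::finite list. length is \<le> m}"
  using finite_lists_length_le[of "UNIV :: 'n set" m] by simp

lemma rho_ge:
  assumes "h > 0"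
  shows "(\<integral>x. indicator K x * (q x)\<^sup>2 \<partial>lborel) + h\<^sup>2 * (\<integral>x. indicator K x * (pdx i q x)\<^sup>2 \<partial>lborel)
    + h ^ 4 * (\<integral>x. indicator K x * (pdx i (pdx i q) x)\<^sup>2 \<partial>lborel) \<le> rho h q K"
proof -
  have "(\<Sum>is\<in>{[], [i], [i, i]}. h ^ (2 * length is) * (\<integral>x. indicator K x * (pds is q x)\<^sup>2 \<partial>lborel)) \<le> rho h q K"
    unfolding rho_def using assms by (intro sum_mono2) auto
  then show ?thesis by (simp add: power2_eq_square power4_eq_xxxx add.assoc mult.assoc)
qed

lemma rho_nonneg: "h > 0 \<Longrightarrow> rho h q K \<ge> 0"
  unfolding rho_def by (intro sum_nonneg) auto

text \<open>A function independent of the variable \<open>i\<close> has the same integral over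
  lattice cubes that differ only in direction \<open>i\<close>. This takes the place of integration
  over the common face.\<close>

lemma face_translate:
  fixes F :: "real^'n::finite \<Rightarrow> real"
  assumes [measurable]: "F \<in> borel_measurable borel" and inv: "\<And>x t. F (x + t *\<^sub>R ax i) = F x" and z: "\<And>j. j \<noteq> i \<Longrightarrow> z j = z' j"
  shows "(\<integral>x. indicator (lc a h z) x * F x \<partial>lborel) = (\<integral>x. indicator (lc a h z') x * F x \<partial>lborel)"
proof -
  let ?t = "(h * of_int (z i - z' i)) *\<^sub>R (ax i :: real^'n)"
  have m: "(?t + 1 *\<^sub>R x \<in> lc a h z) = (x \<in> lc a h z')" for x
  proof -
    have "(a $ j + h * of_int (z j) \<le> (?t + 1 *\<^sub>R x) $ j \<and> (?t + 1 *\<^sub>R x) $ j \<le> a $ j + h * of_int (z j) + h)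
        = (a $ j + h * of_int (z' j) \<le> x $ j \<and> x $ j \<le> a $ j + h * of_int (z' j) + h)" for j
      using z[of j] by (cases "j = i") (auto simp: axis_def algebra_simps)
    then show ?thesis by (simp add: mem_lc)
  qed
  have F: "F (?t + 1 *\<^sub>R x) = F x" for x using inv[of x "h * of_int (z i - z' i)"] by (simp add: add.commute)
  have "(\<integral>x. indicator (lc a h z) x * F x \<partial>lborel) = (\<integral>x. indicator (lc a h z) (?t + 1 *\<^sub>R x) * F (?t + 1 *\<^sub>R x) \<partial>lborel)"
    by (subst lborel_integral_affine(1)[where c = 1 and t = ?t]) auto
  also have "\<dots> = (\<integral>x. indicator (lc a h z') x * F x \<partial>lborel)"
    unfolding F by (rule Bochner_Integration.integral_cong) (use m in \<open>auto simp: indicator_def simp del: scaleR_one\<close>)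
  finally show ?thesis .
qed

text \<open>Two one-sided trace inequalities, one for each cube; the second is transported to the
  first cube by translation in direction \<open>i\<close>.\<close>

lemma jump_trace:
  fixes q1 q2 :: "real^'n::finite \<Rightarrow> real"
  assumes q: "smooth q1" "smooth q2" and h: "h > 0" and z: "\<And>j. j \<noteq> i \<Longrightarrow> z1 j = z2 j"
    and s1: "s = a $ i + h * of_int (z1 i) \<or> s = a $ i + h * of_int (z1 i) + h"
    and s2: "s = a $ i + h * of_int (z2 i) \<or> s = a $ i + h * of_int (z2 i) + h"
  shows "(\<integral>x. indicator (lc a h z1) x * (q2 (pr i s x) - q1 (pr i s x))\<^sup>2 \<partial>lborel)
    \<le> 4 * ((\<integral>x. indicator (lc a h z1) x * (q1 x)\<^sup>2 \<partial>lborel) + h\<^sup>2 * (\<integral>x. indicator (lc a h z1) x * (pdx i q1 x)\<^sup>2 \<partial>lborel)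
       + (\<integral>x. indicator (lc a h z2) x * (q2 x)\<^sup>2 \<partial>lborel) + h\<^sup>2 * (\<integral>x. indicator (lc a h z2) x * (pdx i q2 x)\<^sup>2 \<partial>lborel))"
proof -
  have c: "continuous_on UNIV (\<lambda>x. q1 (pr i s x))" "continuous_on UNIV (\<lambda>x. q2 (pr i s x))"
    by (rule continuous_on_compose2[OF smooth_cont[OF q(1), of "[]", simplified] pr_continuous], simp,
        rule continuous_on_compose2[OF smooth_cont[OF q(2), of "[]", simplified] pr_continuous], simp)
  let ?I = "indicator (lc a h z1) :: real^'n \<Rightarrow> real"
  have i: "integrable lborel (\<lambda>x. ?I x * (q1 (pr i s x))\<^sup>2)" "integrable lborel (\<lambda>x. ?I x * (q2 (pr i s x))\<^sup>2)"
    "integrable lborel (\<lambda>x. ?I x * (q2 (pr i s x) - q1 (pr i s x))\<^sup>2)"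
    by (intro integrable_on_lc continuous_intros c)+
  have "(q2 (pr i s x) - q1 (pr i s x))\<^sup>2 \<le> 2 * (q1 (pr i s x))\<^sup>2 + 2 * (q2 (pr i s x))\<^sup>2" for x
    using zero_le_power2[of "q1 (pr i s x) + q2 (pr i s x)"] by (simp add: power2_eq_square algebra_simps)
  then have "(\<integral>x. ?I x * (q2 (pr i s x) - q1 (pr i s x))\<^sup>2 \<partial>lborel) \<le> (\<integral>x. 2 * (?I x * (q1 (pr i s x))\<^sup>2) + 2 * (?I x * (q2 (pr i s x))\<^sup>2) \<partial>lborel)"
    using i by (intro integral_mono) (auto simp: indicator_def)
  also have "\<dots> = 2 * (\<integral>x. ?I x * (q1 (pr i s x))\<^sup>2 \<partial>lborel) + 2 * (\<integral>x. ?I x * (q2 (pr i s x))\<^sup>2 \<partial>lborel)"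
    using i by simp
  also have "(\<integral>x. ?I x * (q2 (pr i s x))\<^sup>2 \<partial>lborel) = (\<integral>x. indicator (lc a h z2) x * (q2 (pr i s x))\<^sup>2 \<partial>lborel)"
  proof (rule face_translate[OF _ _ z])
    show "(\<lambda>x. (q2 (pr i s x))\<^sup>2) \<in> borel_measurable borel" by (intro borel_measurable_continuous_onI continuous_intros c)
    have "pr i s (x + t *\<^sub>R ax i) = pr i s x" for x t by (auto simp: vec_eq_iff axis_def)
    then show "(q2 (pr i s (x + t *\<^sub>R ax i)))\<^sup>2 = (q2 (pr i s x))\<^sup>2" for x t by simp
  qed
  finally show ?thesis using trace_cube[where i = i and z = z1 and a = a, OF q(1) h s1] trace_cube[where i = i and z = z2 and a = a, OF q(2) h s2] by (simp add: distrib_left)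
qed

text \<open>The smooth \<phi> cancels in the difference of the two errors, so on the common
  hyperplane the jump of the polynomials is a difference of error traces. Only exponents 0 and 1 in
  direction \<open>i\<close> are controlled, which matches the value and slope data of C1 Hermite
  elements.\<close>

lemma jump_coeff:
  fixes c1 c2 :: "('n::finite \<Rightarrow> nat) \<Rightarrow> real" and a :: "real^'n"
  assumes h: "h > 0" and k: "k \<ge> 1" and \<phi>: "smooth \<phi>"
    and C: "C > 0" "\<And>(z :: 'n \<Rightarrow> int) c. (\<And>j. z j \<in> {-1, 0}) \<Longrightarrow>
      (\<Sum>\<alpha>\<in>Idx k. (c \<alpha>)\<^sup>2) \<le> C * (\<integral>x. indicator (lc 0 1 z) x * (pev k 1 0 c x)\<^sup>2 \<partial>lborel)"
    and z1: "\<And>j. z1 j - w j \<in> {-1, 0}" and z2: "z2 i - w i \<in> {-1, 0}" and z: "\<And>j. j \<noteq> i \<Longrightarrow> z1 j = z2 j"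
  defines "o' \<equiv> a + h *\<^sub>R vz w"
  shows "h ^ CARD('n) * (\<Sum>\<alpha> | \<alpha> \<in> Idx k \<and> \<alpha> i \<le> 1. (c1 \<alpha> - c2 \<alpha>)\<^sup>2)
    \<le> 8 * C * (rho h (\<lambda>x. \<phi> x - pev k h o' c1 x) (lc a h z1) + rho h (\<lambda>x. \<phi> x - pev k h o' c2 x) (lc a h z2))"
proof -
  have h0: "h \<noteq> 0" using h by simp
  let ?p1 = "pev k h o' c1" and ?p2 = "pev k h o' c2"
  let ?q1 = "\<lambda>x. \<phi> x - ?p1 x" and ?q2 = "\<lambda>x. \<phi> x - ?p2 x"
  let ?d = "pev k h o' (\<lambda>\<alpha>. c1 \<alpha> - c2 \<alpha>)"
  note sp = smooth_pev(1)[OF h0]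
  have sq: "smooth ?q1" "smooth ?q2" by (intro smooth_diff(1) \<phi> sp)+
  have lc: "lc o' h (\<lambda>j. z1 j - w j) = lc a h z1"
    by (auto simp: set_eq_iff mem_lc o'_def algebra_simps)
  have d: "?d = (\<lambda>x. ?q2 x - ?q1 x)" by (auto simp: pev_def left_diff_distrib sum_subtractf)
  have pd: "pdx i ?d = (\<lambda>x. pdx i ?q2 x - pdx i ?q1 x)"
    unfolding d using smooth_diff(2)[OF sq(2,1), of "[i]"] by simp
  have s: "o' $ i = a $ i + h * of_int (w i)" by (simp add: o'_def)
  have s1: "o' $ i = a $ i + h * of_int (z1 i) \<or> o' $ i = a $ i + h * of_int (z1 i) + h"
  proof -
    have "z1 i = w i \<or> z1 i = w i - 1" using z1[of i] by auto
    then show ?thesis unfolding s by (elim disjE) (simp_all add: right_diff_distrib)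
  qed
  have s2: "o' $ i = a $ i + h * of_int (z2 i) \<or> o' $ i = a $ i + h * of_int (z2 i) + h"
  proof -
    have "z2 i = w i \<or> z2 i = w i - 1" using z2 by auto
    then show ?thesis unfolding s by (elim disjE) (simp_all add: right_diff_distrib)
  qed
  have sq': "smooth (pdx i ?q1)" "smooth (pdx i ?q2)" using smooth_pds[OF sq(1), of "[i]"] smooth_pds[OF sq(2), of "[i]"] by auto
  let ?N = "\<lambda>zz f. \<integral>x. indicator (lc a h zz) x * (f x)\<^sup>2 \<partial>lborel"
  have T0: "(\<integral>x. indicator (lc a h z1) x * (?d (pr i (o' $ i) x))\<^sup>2 \<partial>lborel)
    \<le> 4 * (?N z1 ?q1 + h\<^sup>2 * ?N z1 (pdx i ?q1) + ?N z2 ?q2 + h\<^sup>2 * ?N z2 (pdx i ?q2))"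
    unfolding d by (rule jump_trace[where i = i and ?z1.0 = z1 and ?z2.0 = z2 and a = a, OF sq h z s1 s2])
  \<comment> \<open>The trace of the normal derivative calls for second normal derivatives, which is
    why \<open>rho\<close> goes up to order 2.\<close>
  have T1: "(\<integral>x. indicator (lc a h z1) x * (pdx i ?d (pr i (o' $ i) x))\<^sup>2 \<partial>lborel)
    \<le> 4 * (?N z1 (pdx i ?q1) + h\<^sup>2 * ?N z1 (pdx i (pdx i ?q1)) + ?N z2 (pdx i ?q2) + h\<^sup>2 * ?N z2 (pdx i (pdx i ?q2)))"
    unfolding pd by (rule jump_trace[where i = i and ?z1.0 = z1 and ?z2.0 = z2 and a = a, OF sq' h z s1 s2])
  have nn: "?N zz f \<ge> 0" for zz and f :: "real^'n \<Rightarrow> real" by simp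
  have "h ^ CARD('n) * (\<Sum>\<alpha> | \<alpha> \<in> Idx k \<and> \<alpha> i \<le> 1. (c1 \<alpha> - c2 \<alpha>)\<^sup>2)
    \<le> C * ((\<integral>x. indicator (lc a h z1) x * (?d (pr i (o' $ i) x))\<^sup>2 \<partial>lborel) + h\<^sup>2 * (\<integral>x. indicator (lc a h z1) x * (pdx i ?d (pr i (o' $ i) x))\<^sup>2 \<partial>lborel))"
    unfolding lc[symmetric] by (rule face_coeff[where z = "\<lambda>j. z1 j - w j", OF h k C z1])
  also have "\<dots> \<le> C * (8 * (rho h ?q1 (lc a h z1) + rho h ?q2 (lc a h z2)))"
  proof (rule mult_left_mono)
    have "h\<^sup>2 * (\<integral>x. indicator (lc a h z1) x * (pdx i ?d (pr i (o' $ i) x))\<^sup>2 \<partial>lborel)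
      \<le> h\<^sup>2 * (4 * (?N z1 (pdx i ?q1) + h\<^sup>2 * ?N z1 (pdx i (pdx i ?q1)) + ?N z2 (pdx i ?q2) + h\<^sup>2 * ?N z2 (pdx i (pdx i ?q2))))"
      by (rule mult_left_mono[OF T1]) simp
    also have "\<dots> = 4 * (h\<^sup>2 * ?N z1 (pdx i ?q1) + h ^ 4 * ?N z1 (pdx i (pdx i ?q1)) + h\<^sup>2 * ?N z2 (pdx i ?q2) + h ^ 4 * ?N z2 (pdx i (pdx i ?q2)))"
      by (simp add: algebra_simps power2_eq_square power4_eq_xxxx)
    finally have T1': "h\<^sup>2 * (\<integral>x. indicator (lc a h z1) x * (pdx i ?d (pr i (o' $ i) x))\<^sup>2 \<partial>lborel) \<le> \<dots>" .
    have r1: "?N z1 ?q1 + h\<^sup>2 * ?N z1 (pdx i ?q1) + h ^ 4 * ?N z1 (pdx i (pdx i ?q1)) \<le> rho h ?q1 (lc a h z1)" by (rule rho_ge[OF h])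
    have r2: "?N z2 ?q2 + h\<^sup>2 * ?N z2 (pdx i ?q2) + h ^ 4 * ?N z2 (pdx i (pdx i ?q2)) \<le> rho h ?q2 (lc a h z2)" by (rule rho_ge[OF h])
    have p: "h\<^sup>2 * ?N zz f \<ge> 0" "h ^ 4 * ?N zz f \<ge> 0" for zz and f :: "real^'n \<Rightarrow> real" using nn[of zz f] by simp_all
    show "(\<integral>x. indicator (lc a h z1) x * (?d (pr i (o' $ i) x))\<^sup>2 \<partial>lborel) + h\<^sup>2 * (\<integral>x. indicator (lc a h z1) x * (pdx i ?d (pr i (o' $ i) x))\<^sup>2 \<partial>lborel)
      \<le> 8 * (rho h ?q1 (lc a h z1) + rho h ?q2 (lc a h z2))"
      using T0 T1' r1 r2 nn[of z1 ?q1] nn[of z2 ?q2] p(2)[of z1 "pdx i (pdx i ?q1)"] p(2)[of z2 "pdx i (pdx i ?q2)"]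
      by (smt (verit))
  qed (use C in simp)
  finally show ?thesis by (simp only: mult.assoc mult.left_commute[of C])
qed

section \<open>Tensor products of piecewise smooth functions\<close>

text \<open>C1 profiles with a bounded second derivative that is continuous off \<open>E\<close>:
  the orders 0 and 1 are globally Lipschitz, and classical derivatives are only claimed off the
  countable set \<open>E\<close>. Bounds and measurability for every \<open>r\<close> avoid case
  distinctions in products.\<close>

definition pw2 :: "(nat \<Rightarrow> real \<Rightarrow> real) \<Rightarrow> real set \<Rightarrow> real \<Rightarrow> bool" where
  "pw2 f E B \<longleftrightarrow> countable E \<and> B \<ge> 1 \<and> (\<forall>r t. \<bar>f r t\<bar> \<le> B) \<and> (\<forall>r. f r \<in> borel_measurable borel) \<and>
     (\<forall>r\<le>1. \<forall>s t. \<bar>f r t - f r s\<bar> \<le> B * \<bar>t - s\<bar>) \<and>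
     (\<forall>r\<le>1. \<forall>t. t \<notin> E \<longrightarrow> (f r has_real_derivative f (Suc r) t) (at t)) \<and>
     (\<forall>r\<le>2. \<forall>t. t \<notin> E \<longrightarrow> isCont (f r) t)"

text \<open>Candidate for the derivative of the product \<open>tens F []\<close> along
  \<open>is\<close>; for profiles satisfying \<open>pw2\<close> it is meaningful up to length
  2.\<close>

definition tens :: "('n::finite \<Rightarrow> nat \<Rightarrow> real \<Rightarrow> real) \<Rightarrow> 'n list \<Rightarrow> real^'n \<Rightarrow> real" where
  "tens F is x = (\<Prod>j\<in>UNIV. F j (count_list is j) (x $ j))"

lemma AE_component_notin:
  assumes "countable E" shows "AE x in lborel. (x :: real^'n::finite) $ i \<notin> E"
proof -
  have "negligible (\<Union>e\<in>E. {x :: real^'n. x $ i = e})"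
    using assms negligible_standard_hyperplane[OF axis_in_Basis_iff[THEN iffD2, of "1::real"], of i]
    by (intro negligible_countable_Union) (auto simp: inner_axis)
  then have "AE x in lebesgue. x \<notin> (\<Union>e\<in>E. {x :: real^'n. x $ i = e})"
    by (intro AE_not_in) (simp add: negligible_iff_null_sets)
  then have "AE x in lebesgue. x $ i \<notin> E" by eventually_elim auto
  then show ?thesis by (simp add: AE_completion_iff)
qed

context
  fixes F :: "'n::finite \<Rightarrow> nat \<Rightarrow> real \<Rightarrow> real" and E :: "'n \<Rightarrow> real set" and B :: real
  assumes F: "\<And>j. pw2 (F j) (E j) B"
begin

lemma tens_B: "B \<ge> 1" "\<bar>F j r t\<bar> \<le> B" "F j r \<in> borel_measurable borel" "countable (E j)"
  "r \<le> 1 \<Longrightarrow> \<bar>F j r t - F j r s\<bar> \<le> B * \<bar>t - s\<bar>"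
  "r \<le> 1 \<Longrightarrow> t \<notin> E j \<Longrightarrow> (F j r has_real_derivative F j (Suc r) t) (at t)"
  "r \<le> 2 \<Longrightarrow> t \<notin> E j \<Longrightarrow> isCont (F j r) t"
  using F[of j] unfolding pw2_def by blast+

lemma tens_bounded: "\<bar>tens F is x\<bar> \<le> B ^ CARD('n)"
proof -
  have "(\<Prod>j\<in>UNIV. \<bar>F j (count_list is j) (x $ j)\<bar>) \<le> (\<Prod>j\<in>(UNIV::'n set). B)"
    using tens_B(2) by (intro prod_mono) auto
  then show ?thesis by (simp add: tens_def abs_prod)
qed

lemma tens_borel: "tens F is \<in> borel_measurable borel"
proof -
  have "(\<lambda>x::real^'n. F j r (x $ j)) \<in> borel_measurable borel" for j r
    by (rule measurable_compose[OF _ tens_B(3)]) (intro borel_measurable_continuous_onI continuous_intros)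
  then show ?thesis unfolding tens_def[abs_def] by (intro borel_measurable_prod)
qed

lemma tens_line: "tens F is (x + t *\<^sub>R ax i) = F i (count_list is i) (x $ i + t) * (\<Prod>j\<in>UNIV - {i}. F j (count_list is j) (x $ j))"
  unfolding tens_def by (subst prod.remove[of _ i]) (auto simp: axis_def intro!: prod.cong)

lemma tens_rest: "\<bar>\<Prod>j\<in>UNIV - {i}. F j (count_list is j) (x $ j)\<bar> \<le> B ^ CARD('n)"
proof -
  have "(\<Prod>j\<in>UNIV - {i}. \<bar>F j (count_list is j) (x $ j)\<bar>) \<le> (\<Prod>j\<in>(UNIV::'n set) - {i}. B)"
    using tens_B(2) by (intro prod_mono) auto
  also have "\<dots> = B ^ (CARD('n) - 1)" by (simp add: card_Diff_singleton)
  also have "\<dots> \<le> B ^ CARD('n)" using tens_B(1) by (intro power_increasing) auto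
  finally show ?thesis by (simp add: abs_prod)
qed

lemma tens_lipschitz:
  assumes "length is \<le> 1"
  shows "\<bar>tens F is (x + t *\<^sub>R ax i) - tens F is x\<bar> \<le> \<bar>t\<bar> * (B * B ^ CARD('n))"
proof -
  let ?R = "\<Prod>j\<in>UNIV - {i}. F j (count_list is j) (x $ j)"
  have c: "count_list is i \<le> 1" using count_le_length[of "is" i] assms by linarith
  have "tens F is (x + t *\<^sub>R ax i) - tens F is x = (F i (count_list is i) (x $ i + t) - F i (count_list is i) (x $ i)) * ?R"
    using tens_line[of "is" x t i] tens_line[of "is" x 0 i] by (simp add: left_diff_distrib)
  then have "\<bar>tens F is (x + t *\<^sub>R ax i) - tens F is x\<bar> = \<bar>F i (count_list is i) (x $ i + t) - F i (count_list is i) (x $ i)\<bar> * \<bar>?R\<bar>"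
    by (simp add: abs_mult)
  also have "\<dots> \<le> (B * \<bar>t\<bar>) * B ^ CARD('n)"
    using tens_B(5)[OF c, of i "x $ i + t" "x $ i"] tens_rest[where i = i and ?is = "is" and x = x] tens_B(1) by (intro mult_mono) auto
  finally show ?thesis by (simp add: mult_ac)
qed

lemma tens_deriv:
  assumes "length is \<le> 1" "x $ i \<notin> E i"
  shows "((\<lambda>t. tens F is (x + t *\<^sub>R ax i)) has_real_derivative tens F (i # is) x) (at 0)"
proof -
  let ?R = "\<Prod>j\<in>UNIV - {i}. F j (count_list is j) (x $ j)"
  have c: "count_list is i \<le> 1" using count_le_length[of "is" i] assms by linarith
  have "(F i (count_list is i) has_real_derivative F i (Suc (count_list is i)) (x $ i)) (at (x $ i))"
    by (rule tens_B(6)[OF c assms(2)])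
  then have "((\<lambda>t. F i (count_list is i) (t + x $ i)) has_real_derivative F i (Suc (count_list is i)) (x $ i)) (at 0)"
    by (simp add: DERIV_shift[symmetric])
  then have "((\<lambda>t. F i (count_list is i) (x $ i + t) * ?R) has_real_derivative F i (Suc (count_list is i)) (x $ i) * ?R) (at 0)"
    by (intro DERIV_cmult_right) (simp add: add.commute)
  moreover have "tens F (i # is) x = F i (Suc (count_list is i)) (x $ i) * ?R"
    unfolding tens_def by (subst prod.remove[of _ i]) (auto intro!: prod.cong)
  ultimately show ?thesis unfolding tens_line by simp
qed

text \<open>Profiles of order 0 and 1 are Lipschitz, which is what passing one derivative to the
  factors requires; hence exactly two derivatives can be passed.\<close>

lemma mol_tens_pds:
  assumes e: "e > 0" and "length is \<le> 2"
  shows "pds is (mol e (tens F [])) = mol e (tens F is)"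
proof -
  have d: "pdx i (mol e (tens F js)) = mol e (tens F (i # js))" if "length js \<le> 1" for i js
  proof
    fix x
    have "AE x in lborel. ((\<lambda>t. tens F js (x + t *\<^sub>R ax i)) has_real_derivative tens F (i # js) x) (at 0)"
      using AE_component_notin[OF tens_B(4), of i i] by eventually_elim (rule tens_deriv[OF that])
    from mol_deriv[OF tens_borel tens_borel tens_bounded tens_lipschitz[OF that] this e]
    show "pdx i (mol e (tens F js)) x = mol e (tens F (i # js)) x"
      unfolding pdx_def by (rule DERIV_imp_deriv)
  qed
  consider "is = []" | i where "is = [i]" | i j where "is = [i, j]"
    using assms(2) by (cases "is"; cases "tl is") (auto simp: length_Suc_conv)
  then show ?thesis by cases (simp_all add: d)
qed

end

text \<open>Dilation by \<open>l\<close> shrinks the support towards \<open>c\<close>. The exponent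
  is capped at 2 to keep the bounds uniform in \<open>r\<close>; the factor 8 combines
  \<open>l ^ 2 \<le> 4\<close> with the Lipschitz constant 2 of the inner map.\<close>

lemma pw2_dilate:
  assumes f: "pw2 f E B" and l: "1 \<le> l" "l \<le> 2"
  shows "pw2 (\<lambda>r t. l ^ min r 2 * f r (c + l * (t - c))) {t. c + l * (t - c) \<in> E} (8 * B)"
proof -
  let ?g = "\<lambda>r t. l ^ min r 2 * f r (c + l * (t - c))"
  have cE: "countable E" and B: "B \<ge> 1" and b: "\<And>r t. \<bar>f r t\<bar> \<le> B" and m: "\<And>r. f r \<in> borel_measurable borel"
    and L: "\<And>r s t. r \<le> 1 \<Longrightarrow> \<bar>f r t - f r s\<bar> \<le> B * \<bar>t - s\<bar>"
    and d: "\<And>r t. r \<le> 1 \<Longrightarrow> t \<notin> E \<Longrightarrow> (f r has_real_derivative f (Suc r) t) (at t)"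
    and ct: "\<And>r t. r \<le> 2 \<Longrightarrow> t \<notin> E \<Longrightarrow> isCont (f r) t" using f unfolding pw2_def by blast+
  have lp: "0 \<le> l ^ min r 2" "l ^ min r 2 \<le> 4" for r
  proof -
    show "0 \<le> l ^ min r 2" using l by simp
    have "l ^ min r 2 \<le> 2 ^ min r 2" using l by (intro power_mono) auto
    also have "\<dots> \<le> 2 ^ 2" by (rule power_increasing) auto
    finally show "l ^ min r 2 \<le> 4" by simp
  qed
  have "t \<in> (\<lambda>e. c + (e - c) / l) ` E" if "c + l * (t - c) \<in> E" for t
    by (rule image_eqI[OF _ that]) (use l in simp)
  then have "{t. c + l * (t - c) \<in> E} \<subseteq> (\<lambda>e. c + (e - c) / l) ` E" by blast
  then have 1: "countable {t. c + l * (t - c) \<in> E}" using cE countable_subset by blast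
  have 2: "\<bar>?g r t\<bar> \<le> 8 * B" for r t
  proof -
    have "\<bar>?g r t\<bar> \<le> 4 * B" unfolding abs_mult using lp[of r] b[of r] by (intro mult_mono) auto
    then show ?thesis using B by linarith
  qed
  have 3: "?g r \<in> borel_measurable borel" for r using m[of r] by measurable
  have 4: "\<bar>?g r t - ?g r s\<bar> \<le> 8 * B * \<bar>t - s\<bar>" if "r \<le> 1" for r s t
  proof -
    have "\<bar>?g r t - ?g r s\<bar> = l ^ min r 2 * \<bar>f r (c + l * (t - c)) - f r (c + l * (s - c))\<bar>"
      using lp[of r] by (simp add: abs_mult flip: right_diff_distrib)
    also have "\<dots> \<le> 4 * (B * \<bar>(c + l * (t - c)) - (c + l * (s - c))\<bar>)"
      by (rule mult_mono[OF lp(2) L[OF that]]) auto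
    also have "(c + l * (t - c)) - (c + l * (s - c)) = l * (t - s)" by (simp add: algebra_simps)
    also have "4 * (B * \<bar>l * (t - s)\<bar>) \<le> 4 * (B * (2 * \<bar>t - s\<bar>))" using l B by (intro mult_left_mono) (auto simp: abs_mult intro!: mult_right_mono)
    finally show ?thesis by simp
  qed
  have 5: "(?g r has_real_derivative ?g (Suc r) t) (at t)" if r: "r \<le> 1" and t: "t \<notin> {t. c + l * (t - c) \<in> E}" for r t
  proof -
    have "((\<lambda>t. f r (c + l * (t - c))) has_real_derivative f (Suc r) (c + l * (t - c)) * l) (at t)"
      by (rule DERIV_chain2[OF d[OF r]]) (use t in \<open>auto intro!: derivative_eq_intros\<close>)
    from DERIV_cmult[OF this, of "l ^ min r 2"] show ?thesis using r by (cases r) (auto simp: mult_ac power2_eq_square)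
  qed
  have 6: "isCont (?g r) t" if r: "r \<le> 2" and t: "t \<notin> {t. c + l * (t - c) \<in> E}" for r t
    using t by (intro continuous_intros isCont_o2[OF _ ct[OF r]]) auto
  show ?thesis unfolding pw2_def using 1 2 3 4 5 6 B by auto
qed

text \<open>The support is a closed box that may touch the boundary of \<Omega>, so mollification
  alone would leave the domain. Dilating by \<open>lam n\<close> towards the centre makes room for
  it, and dominated convergence then recovers the derivatives up to order 2 in the limit.\<close>

lemma tensor_H20:
  fixes F :: "'n::finite \<Rightarrow> nat \<Rightarrow> real \<Rightarrow> real"
  assumes \<Omega>: "open \<Omega>" "bounded \<Omega>" and F: "\<And>j. pw2 (F j) (E j) B"
    and lo: "\<And>j. lo $ j + l \<le> hi $ j" "l > 0" and box: "box lo hi \<subseteq> \<Omega>"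
    and zero: "\<And>j r t. t < lo $ j \<or> t > hi $ j \<Longrightarrow> F j r t = 0"
  shows "H20 \<Omega> (tens F [])" "length is \<le> 2 \<Longrightarrow> is_wd \<Omega> is (tens F []) (tens F is)"
proof -
  let ?M = "lebesgue_on \<Omega>"
  have fin: "finite_measure ?M" by (rule finite_measure_on_bounded[OF \<Omega>])
  define c where "c = (\<lambda>j. (lo $ j + hi $ j) / 2)"
  define lam where "lam = (\<lambda>n::nat. 1 + 1 / (real n + 1))"
  have lam: "1 \<le> lam n" "lam n \<le> 2" "lam n > 1" for n by (auto simp: lam_def)
  have laml: "lam \<longlonglongrightarrow> 1" unfolding lam_def by real_asymp
  \<comment> \<open>The dilation frees a layer of half the side divided by n + 2, and half the side
    is at least \<open>l\<close>/2; the mollification radius is kept below that.\<close>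
  define e where "e = (\<lambda>n::nat. min 1 (l / 4) / (real n + 2))"
  have e: "e n > 0" for n using lo(2) by (simp add: e_def)
  have el: "e \<longlonglongrightarrow> 0" unfolding e_def by real_asymp
  define G where "G = (\<lambda>n j r t. lam n ^ min r 2 * F j r (c j + lam n * (t - c j)))"
  have G: "pw2 (G n j) {t. c j + lam n * (t - c j) \<in> E j} (8 * B)" for n j
    unfolding G_def by (rule pw2_dilate[OF F lam(1,2)])
  have supp: "\<bar>t - c j\<bar> \<le> (hi $ j - lo $ j) / 2 / lam n" if "G n j r t \<noteq> 0" for n j r t
  proof -
    have "F j r (c j + lam n * (t - c j)) \<noteq> 0" using that by (auto simp: G_def)
    then have "lo $ j \<le> c j + lam n * (t - c j)" "c j + lam n * (t - c j) \<le> hi $ j" using zero[of "c j + lam n * (t - c j)" j r] by force+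
    then have "lam n * (t - c j) \<le> (hi $ j - lo $ j) / 2" "- ((hi $ j - lo $ j) / 2) \<le> lam n * (t - c j)" by (auto simp: c_def field_simps)
    then have "\<bar>lam n * (t - c j)\<bar> \<le> (hi $ j - lo $ j) / 2" by (intro abs_leI) linarith+
    then show ?thesis using lam(3)[of n] by (simp add: abs_mult pos_le_divide_eq mult_ac)
  qed
  have tsupp: "\<bar>x $ j - c j\<bar> \<le> (hi $ j - lo $ j) / 2 / lam n" if "tens (G n) is x \<noteq> 0" for n j "is" x
  proof (rule supp)
    show "G n j (count_list is j) (x $ j) \<noteq> 0"
    proof
      assume "G n j (count_list is j) (x $ j) = 0"
      then have "tens (G n) is x = 0" unfolding tens_def by (intro prod_zero bexI[of _ j]) auto
      with that show False by simp
    qed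
  qed
  define \<psi> where "\<psi> = (\<lambda>n. mol (e n) (tens (G n) []))"
  have tb: "tens (G n) is \<in> borel_measurable borel" for n "is" by (rule tens_borel[OF G])
  have tbd: "\<bar>tens (G n) is x\<bar> \<le> (8 * B) ^ CARD('n)" for n "is" x by (rule tens_bounded[OF G])
  have tint: "integrable lborel (tens (G n) [])" for n
  proof (rule bounded_support_integrable(1)[OF tb tbd])
    fix x assume nz: "tens (G n) [] x \<noteq> 0"
    have "\<bar>x $ j\<bar> \<le> \<bar>c j\<bar> + (hi $ j - lo $ j) / 2 / lam n" for j using tsupp[OF nz, of j] by linarith
    then have "(\<Sum>j\<in>UNIV. \<bar>x $ j\<bar>) \<le> (\<Sum>j\<in>UNIV. \<bar>c j\<bar> + (hi $ j - lo $ j) / 2 / lam n)" by (intro sum_mono)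
    then show "norm x \<le> (\<Sum>j\<in>UNIV. \<bar>c j\<bar> + (hi $ j - lo $ j) / 2 / lam n)" using norm_le_l1_cart[of x] by linarith
  qed
  have pds: "pds is (\<psi> n) = mol (e n) (tens (G n) is)" if "length is \<le> 2" for n "is"
    unfolding \<psi>_def by (rule mol_tens_pds[OF G e that])
  have test: "test_fun \<Omega> (\<psi> n)" for n
  proof -
    have s: "smooth (\<psi> n)" unfolding \<psi>_def by (rule mol_smooth(1)[OF tb tint e])
    define r where "r = (\<lambda>j. (hi $ j - lo $ j) / 2 / lam n + e n)"
    let ?K = "cbox (\<chi> j. c j - r j) (\<chi> j. c j + r j)"
    have rlt: "r j < (hi $ j - lo $ j) / 2" for j
    proof -
      have inv: "1 / lam n = 1 - 1 / (real n + 2)" by (simp add: lam_def field_simps)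
      have "(hi $ j - lo $ j) / 2 / lam n = (hi $ j - lo $ j) / 2 * (1 / lam n)" by simp
      also have "\<dots> = (hi $ j - lo $ j) / 2 - (hi $ j - lo $ j) / 2 / (real n + 2)" unfolding inv by (simp add: right_diff_distrib)
      finally have "r j = (hi $ j - lo $ j) / 2 - ((hi $ j - lo $ j) / 2 - min 1 (l / 4)) / (real n + 2)"
        by (simp add: r_def e_def diff_divide_distrib)
      moreover have "min 1 (l / 4) < (hi $ j - lo $ j) / 2"
      proof (rule le_less_trans[OF min.cobounded2])
        have "l \<le> hi $ j - lo $ j" using lo(1)[of j] by simp
        then show "l / 4 < (hi $ j - lo $ j) / 2" using lo(2) by simp
      qed
      then have p: "(hi $ j - lo $ j) / 2 - min 1 (l / 4) > 0" by (rule diff_gt_0_iff_gt[THEN iffD2])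
      have "((hi $ j - lo $ j) / 2 - min 1 (l / 4)) / (real n + 2) > 0" by (rule divide_pos_pos[OF p]) simp
      ultimately show ?thesis by linarith
    qed
    have "{x. \<psi> n x \<noteq> 0} \<subseteq> ?K"
    proof
      fix x assume "x \<in> {x. \<psi> n x \<noteq> 0}"
      then obtain y where y: "ker y \<noteq> 0" "tens (G n) [] (x - e n *\<^sub>R y) \<noteq> 0"
        unfolding \<psi>_def using mol_outside by blast
      have "\<bar>x $ j - c j\<bar> \<le> r j" for j
      proof -
        have "\<bar>y $ j\<bar> < 1" using ker_outside0[of y j] y(1) by force
        then have "\<bar>e n * y $ j\<bar> \<le> e n" using e[of n] by (simp add: abs_mult mult_left_le)
        moreover have "\<bar>(x - e n *\<^sub>R y) $ j - c j\<bar> \<le> (hi $ j - lo $ j) / 2 / lam n" by (rule tsupp[OF y(2)])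
        ultimately show ?thesis by (simp add: r_def)
      qed
      then have "c j - r j \<le> x $ j \<and> x $ j \<le> c j + r j" for j by (simp add: abs_le_iff algebra_simps)
      then show "x \<in> ?K" by (simp add: mem_box_cart)
    qed
    then have cl: "closure {x. \<psi> n x \<noteq> 0} \<subseteq> ?K" by (rule closure_minimal) (rule closed_cbox)
    have "?K \<subseteq> box lo hi"
    proof
      fix x assume "x \<in> ?K"
      then have "c j - r j \<le> x $ j \<and> x $ j \<le> c j + r j" for j by (simp add: mem_box_cart)
      then have "lo $ j < x $ j \<and> x $ j < hi $ j" for j using rlt[of j] by (smt (verit) c_def field_sum_of_halves diff_divide_distrib add_divide_distrib)
      then show "x \<in> box lo hi" by (simp add: mem_box_cart)
    qed
    moreover have "compact (closure {x. \<psi> n x \<noteq> 0})"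
      using cl bounded_subset[OF bounded_cbox] by (simp add: compact_eq_bounded_closed) blast
    ultimately show ?thesis unfolding test_fun_iff cpt_supp_def using s cl box by blast
  qed
  have tF: "sqint ?M (tens F is)" for "is"
    by (rule sqint_bounded[OF fin borel_measurable_lebesgue_onI[OF tens_borel[OF F]] tens_bounded[OF F]])
  have lim: "(\<lambda>n. l2 ?M (\<lambda>x. pds is (\<psi> n) x - tens F is x)) \<longlonglongrightarrow> 0" if L: "length is \<le> 2" for "is"
    unfolding pds[OF L]
  proof (rule l2_dominated(2)[where w = "\<lambda>_. (8 * B) ^ CARD('n)"])
    have shm: "(\<lambda>y. tens (G n) is (x - e n *\<^sub>R y)) \<in> borel_measurable borel" for n x
      by (rule measurable_compose[OF _ tb]) (intro borel_measurable_continuous_onI continuous_intros)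
    show "mol (e n) (tens (G n) is) \<in> borel_measurable ?M" for n
      unfolding pds[OF L, symmetric] by (intro borel_measurable_lebesgue_onI smooth_borel test_funD(1)[OF test])
    show "tens F is \<in> borel_measurable ?M" by (rule borel_measurable_lebesgue_onI[OF tens_borel[OF F]])
    show "sqint ?M (\<lambda>_. (8 * B) ^ CARD('n))" by (rule sqint_bounded[OF fin _ order_refl]) simp
    show "\<bar>mol (e n) (tens (G n) is) x\<bar> \<le> (8 * B) ^ CARD('n)" for n x
    proof -
      have "\<bar>mol (e n) (tens (G n) is) x\<bar> \<le> (\<integral>y. \<bar>ker y * tens (G n) is (x - e n *\<^sub>R y)\<bar> \<partial>lborel)"
        unfolding mol_def by (rule integral_abs_bound)
      also have "\<dots> \<le> (\<integral>y. ker (y::real^'n) * (8 * B) ^ CARD('n) \<partial>lborel)"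
      proof (intro integral_mono)
        show "integrable lborel (\<lambda>y. \<bar>ker y * tens (G n) is (x - e n *\<^sub>R y)\<bar>)"
          by (intro integrable_abs ker_mult_integrable[where B = "(8 * B) ^ CARD('n)"] tbd shm)
        show "\<bar>ker y * tens (G n) is (x - e n *\<^sub>R y)\<bar> \<le> ker y * (8 * B) ^ CARD('n)" for y
          unfolding abs_mult abs_of_nonneg[OF ker_nonneg] by (rule mult_left_mono[OF tbd ker_nonneg])
      qed (simp add: ker_integrable)
      finally show ?thesis by (simp add: ker_integral)
    qed
    have ae: "AE x in lborel. \<forall>j\<in>UNIV. x $ j \<notin> E j"
      by (rule AE_ball_countable[THEN iffD2]) (auto intro!: AE_component_notin tens_B(4)[OF F])
    have "AE x in lborel. (\<lambda>n. mol (e n) (tens (G n) is) x) \<longlonglongrightarrow> tens F is x"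
      using ae
    proof eventually_elim
      case (elim x)
      show ?case unfolding mol_def
      proof (rule ker_avg_tendsto[OF _ tbd])
        show "(\<lambda>y. tens (G n) is (x - e n *\<^sub>R y)) \<in> borel_measurable borel" for n by (rule shm)
        fix y :: "real^'n"
        have "(\<lambda>n. \<Prod>j\<in>UNIV. G n j (count_list is j) ((x - e n *\<^sub>R y) $ j)) \<longlonglongrightarrow> (\<Prod>j\<in>UNIV. F j (count_list is j) (x $ j))"
        proof (rule tendsto_prod)
          fix j :: 'n
          have c2: "count_list is j \<le> 2" using count_le_length[of "is" j] L by linarith
          have "(\<lambda>n. c j + lam n * ((x - e n *\<^sub>R y) $ j - c j)) \<longlonglongrightarrow> c j + 1 * (x $ j - 0 * y $ j - c j)"
            unfolding vector_minus_component vector_scaleR_component real_scaleR_def by (intro tendsto_intros laml el)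
          then have a: "(\<lambda>n. c j + lam n * ((x - e n *\<^sub>R y) $ j - c j)) \<longlonglongrightarrow> x $ j" by simp
          have "isCont (F j (count_list is j)) (x $ j)" by (rule tens_B(7)[OF F c2]) (use elim in simp)
          from isCont_tendsto_compose[OF this a]
          have "(\<lambda>n. lam n ^ min (count_list is j) 2 * F j (count_list is j) (c j + lam n * ((x - e n *\<^sub>R y) $ j - c j))) \<longlonglongrightarrow> 1 ^ min (count_list is j) 2 * F j (count_list is j) (x $ j)"
            by (intro tendsto_intros laml)
          then show "(\<lambda>n. G n j (count_list is j) ((x - e n *\<^sub>R y) $ j)) \<longlonglongrightarrow> F j (count_list is j) (x $ j)" by (simp add: G_def)
        qed
        then show "(\<lambda>n. tens (G n) is (x - e n *\<^sub>R y)) \<longlonglongrightarrow> tens F is x" by (simp add: tens_def)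
      qed
    qed
    then have "AE x in lebesgue. (\<lambda>n. mol (e n) (tens (G n) is) x) \<longlonglongrightarrow> tens F is x" by (rule AE_completion)
    then show "AE x in ?M. (\<lambda>n. mol (e n) (tens (G n) is) x) \<longlonglongrightarrow> tens F is x"
      using \<Omega>(1) by (subst AE_restrict_space_iff) (auto elim: eventually_mono)
  qed
  note H = H20I[OF \<Omega> tF[of "[]"] test tF lim]
  show "H20 \<Omega> (tens F [])" by (rule H(1)) auto
  show "length is \<le> 2 \<Longrightarrow> is_wd \<Omega> is (tens F []) (tens F is)" by (rule H(2)) auto
qed

section \<open>Hermite splines\<close>

text \<open>Pieces on \<open>[-1,0]\<close> and \<open>[0,1]\<close> of the one-dimensional reference functions attached to a node
  (first argument \<open>True\<close>) or to an interval \<open>[0,1]\<close>: the node functions are the cubic Hermite basis, and the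
  interval function of index \<open>b\<close> is \<open>t ^ b\<close> minus its cubic Hermite interpolant.\<close>

definition gp :: "bool \<Rightarrow> nat \<Rightarrow> int \<Rightarrow> real poly" where
  "gp ev b z = (if ev then
      (if z = -1 then (if b = 0 then [:1, 0, -3, -2:] else if b = 1 then [:0, 1, 2, 1:] else 0)
       else if z = 0 then (if b = 0 then [:1, 0, -3, 2:] else if b = 1 then [:0, 1, -2, 1:] else 0) else 0)
    else if z = 0 \<and> 2 \<le> b then monom 1 b + [:0, 0, real b - 3, 2 - real b:] else 0)"

lemma gp_zero: "z \<noteq> -1 \<Longrightarrow> z \<noteq> 0 \<Longrightarrow> gp ev b z = 0" "z \<noteq> 0 \<Longrightarrow> gp False b z = 0"
  "b \<ge> 2 \<Longrightarrow> gp True b z = 0" "b < 2 \<Longrightarrow> gp False b z = 0"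
  by (auto simp: gp_def)

lemma degree_gp: "degree (gp ev b z) \<le> max 3 b"
proof -
  have "degree (monom 1 b + [:0, 0, real b - 3, 2 - real b:]) \<le> max 3 b"
    by (rule order_trans[OF degree_add_le_max]) (auto simp: degree_monom_eq le_max_iff_disj numeral_3_eq_3)
  then show ?thesis by (auto simp: gp_def le_max_iff_disj numeral_3_eq_3)
qed

text \<open>Values and slopes agree at the shared node and vanish at the outer ends, so the glued
  profiles are C1.\<close>

lemma gp_match:
  assumes "r \<le> 1"
  shows "poly ((pderiv ^^ r) (gp ev b (-1))) (-1) = 0" "poly ((pderiv ^^ r) (gp ev b 0)) 1 = 0"
    "poly ((pderiv ^^ r) (gp ev b (-1))) 0 = poly ((pderiv ^^ r) (gp ev b 0)) 0"
    "\<not> ev \<Longrightarrow> poly ((pderiv ^^ r) (gp ev b 0)) 0 = 0"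
proof -
  have "r = 0 \<or> r = 1" using assms by auto
  then show "poly ((pderiv ^^ r) (gp ev b (-1))) (-1) = 0" "poly ((pderiv ^^ r) (gp ev b 0)) 1 = 0"
    "poly ((pderiv ^^ r) (gp ev b (-1))) 0 = poly ((pderiv ^^ r) (gp ev b 0)) 0"
    "\<not> ev \<Longrightarrow> poly ((pderiv ^^ r) (gp ev b 0)) 0 = 0"
    by (auto simp: gp_def pderiv_add pderiv_monom poly_monom pderiv_pCons power_0_left)
qed

text \<open>All profiles other than the slope functions, which have index 1, have zero derivative at
  both ends. Normal derivatives on a face therefore only see basis functions with exponent 1 in the
  normal direction.\<close>

lemma gp_normal:
  assumes "b \<noteq> 1" shows "poly (pderiv (gp ev b z)) (of_int z) = 0" "poly (pderiv (gp ev b z)) (of_int z + 1) = 0"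
  using assms by (auto simp: gp_def pderiv_add pderiv_monom poly_monom pderiv_pCons power_0_left)

text \<open>For \<open>r \<le> 1\<close> the two pieces are evaluated at clamped arguments and the
  doubly counted value at 0 is subtracted, so continuity and the Lipschitz bound come from the
  pieces directly. The second derivative is set to 0 at the nodes and higher orders are 0, since
  \<open>pw2\<close> asks for bounds at every \<open>r\<close>.\<close>

definition gs :: "bool \<Rightarrow> nat \<Rightarrow> nat \<Rightarrow> real \<Rightarrow> real" where
  "gs ev b r t = (let q = (\<lambda>z. poly ((pderiv ^^ r) (gp ev b z))) in
     if r \<le> 1 then q (-1) (max (-1) (min 0 t)) + q 0 (max 0 (min 1 t)) - q 0 0
     else if r = 2 then (if -1 < t \<and> t < 0 then q (-1) t else if 0 < t \<and> t < 1 then q 0 t else 0) else 0)"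

lemma gs_out: "t < -1 \<or> t > 1 \<Longrightarrow> gs ev b r t = 0" "t < 0 \<Longrightarrow> gs False b r t = 0"
  using gp_match[of r ev b] gp_match[of r False b] by (auto simp: gs_def Let_def gp_zero(2) poly_0)

lemma gs_piece:
  assumes "of_int z < t" "t < of_int z + 1" "r \<le> 2"
  shows "gs ev b r t = poly ((pderiv ^^ r) (gp ev b z)) t"
proof -
  have z0: "(pderiv ^^ r) 0 = (0 :: real poly)" for r by (induction r) auto
  consider "z = -1" | "z = 0" | "z < -1" | "z > 0" by linarith
  then show ?thesis
  proof cases
    case 3 then have "t < -1" using assms by linarith
    then show ?thesis using 3 by (simp add: gs_out gp_zero(1) z0)
  next
    case 4 then have "t > 1" using assms by linarith
    then show ?thesis using 4 by (simp add: gs_out gp_zero(1) z0)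
  qed (use assms gp_match[of r ev b] in \<open>auto simp: gs_def Let_def\<close>)
qed

lemma poly_lipschitz:
  "\<exists>L\<ge>1. \<forall>s\<in>{-1..1}. \<forall>t\<in>{-1..1}. \<bar>poly q s\<bar> \<le> L \<and> \<bar>poly q s - poly q t\<bar> \<le> L * \<bar>s - (t :: real)\<bar>"
proof -
  have "compact (poly p ` {-1..1})" for p :: "real poly" by (intro compact_continuous_image continuous_intros) auto
  then have b: "\<exists>M. \<forall>s\<in>{-1..1}. \<bar>poly p s\<bar> \<le> M" for p :: "real poly"
    using compact_imp_bounded[of "poly p ` {-1..1}"] by (auto simp: bounded_iff)
  obtain M where M: "\<And>s. s \<in> {-1..1} \<Longrightarrow> \<bar>poly q s\<bar> \<le> M" using b by blast
  obtain N where N: "\<And>s. s \<in> {-1..1} \<Longrightarrow> \<bar>poly (pderiv q) s\<bar> \<le> N" using b by blast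
  define L where "L = max 1 (max M N)"
  have "\<bar>poly q s - poly q t\<bar> \<le> L * \<bar>s - t\<bar>" if "s \<in> {-1..1}" "t \<in> {-1..1}" for s t :: real
  proof -
    have "norm (poly q s - poly q t) \<le> L * norm (s - t)"
    proof (rule field_differentiable_bound[of "{-1..1}"])
      show "(poly q has_field_derivative poly (pderiv q) z) (at z within {-1..1})" for z
        by (rule DERIV_subset[OF poly_DERIV]) simp
      show "norm (poly (pderiv q) z) \<le> L" if "z \<in> {-1..1}" for z using N[OF that] by (simp add: L_def)
    qed (use that in auto)
    then show ?thesis by simp
  qed
  moreover have "\<bar>poly q s\<bar> \<le> L" if "s \<in> {-1..1}" for s using M[OF that] by (simp add: L_def)
  ultimately show ?thesis by (intro exI[of _ L]) (auto simp: L_def)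
qed

lemma pw2_mono:
  assumes "pw2 f E B" "B \<le> B'" shows "pw2 f E B'"
proof -
  have "B * \<bar>t - s\<bar> \<le> B' * \<bar>t - s\<bar>" for s t :: real using assms(2) by (rule mult_right_mono) simp
  then show ?thesis using assms unfolding pw2_def by (meson order_trans)
qed

lemma gs_off:
  assumes t: "t \<notin> \<int>" and r: "r \<le> 2"
  shows "isCont (gs ev b r) t" "r \<le> 1 \<Longrightarrow> (gs ev b r has_real_derivative gs ev b (Suc r) t) (at t)"
proof -
  let ?z = "\<lfloor>t\<rfloor>" let ?S = "{of_int ?z <..< of_int ?z + (1::real)}"
  have "t \<noteq> of_int ?z" using t by (metis Ints_of_int)
  then have tS: "t \<in> ?S" using floor_correct[of t] by (auto simp: less_le)
  have e: "gs ev b r s = poly ((pderiv ^^ r) (gp ev b ?z)) s" if "s \<in> ?S" "r \<le> 2" for s r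
    using that by (intro gs_piece) auto
  have "(gs ev b r has_real_derivative poly (pderiv ((pderiv ^^ r) (gp ev b ?z))) t) (at t)"
    by (rule has_field_derivative_transform_within_open[OF poly_DERIV, of ?S]) (use tS e[OF _ r] in auto)
  then show "isCont (gs ev b r) t" "r \<le> 1 \<Longrightarrow> (gs ev b r has_real_derivative gs ev b (Suc r) t) (at t)"
    using e[OF tS, of "Suc r"] by (auto intro: DERIV_isCont)
qed

lemma pw2_gs: "\<exists>B. pw2 (gs ev b) \<int> B"
proof -
  let ?q = "\<lambda>r z. (pderiv ^^ r) (gp ev b z)"
  have "\<forall>p. \<exists>L\<ge>1. \<forall>s\<in>{-1..1}. \<forall>t\<in>{-1..1}. \<bar>poly p s\<bar> \<le> L \<and> \<bar>poly p s - poly p t\<bar> \<le> L * \<bar>s - (t :: real)\<bar>"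
    using poly_lipschitz by blast
  then obtain L where L0: "\<forall>p. L p \<ge> 1 \<and> (\<forall>s\<in>{-1..1}. \<forall>t\<in>{-1..1}. \<bar>poly p s\<bar> \<le> L p \<and> \<bar>poly p s - poly p t\<bar> \<le> L p * \<bar>s - (t :: real)\<bar>)"
    by (rule exE[OF choice])
  have L: "\<And>p. L p \<ge> 1" "\<And>p s. s \<in> {-1..1} \<Longrightarrow> \<bar>poly p s\<bar> \<le> L p"
    "\<And>p s t. s \<in> {-1..1} \<Longrightarrow> t \<in> {-1..1} \<Longrightarrow> \<bar>poly p s - poly p t\<bar> \<le> L p * \<bar>s - t\<bar>" using L0 by blast+
  define B where "B = (\<Sum>r\<in>{0,1,2}. L (?q r (-1)) + 2 * L (?q r 0))"
  have Lr: "L (?q r (-1)) + 2 * L (?q r 0) \<le> B" if "r \<le> 2" for r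
  proof -
    have "0 \<le> L p" for p using L(1)[of p] by linarith
    then show ?thesis unfolding B_def by (intro member_le_sum) (use that in auto)
  qed
  have B: "B \<ge> 1" using Lr[of 0] L(1)[of "?q 0 (-1)"] L(1)[of "?q 0 0"] by auto
  have c: "max (-1) (min 0 t) \<in> {-1..1::real}" "max 0 (min 1 t) \<in> {-1..1::real}" for t by auto
  have lip: "\<bar>gs ev b r t - gs ev b r s\<bar> \<le> B * \<bar>t - s\<bar>" if r: "r \<le> 1" for r s t
  proof -
    have "\<bar>gs ev b r t - gs ev b r s\<bar> \<le> \<bar>poly (?q r (-1)) (max (-1) (min 0 t)) - poly (?q r (-1)) (max (-1) (min 0 s))\<bar>
      + \<bar>poly (?q r 0) (max 0 (min 1 t)) - poly (?q r 0) (max 0 (min 1 s))\<bar>"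
      using r unfolding gs_def Let_def by simp linarith
    also have "\<dots> \<le> L (?q r (-1)) * \<bar>max (-1) (min 0 t) - max (-1) (min 0 s)\<bar> + L (?q r 0) * \<bar>max 0 (min 1 t) - max 0 (min 1 s)\<bar>"
      by (intro add_mono L(3) c)
    also have "\<dots> \<le> L (?q r (-1)) * \<bar>t - s\<bar> + L (?q r 0) * \<bar>t - s\<bar>"
      using L(1)[of "?q r (-1)"] L(1)[of "?q r 0"] by (intro add_mono mult_left_mono) auto
    also have "\<dots> \<le> (L (?q r (-1)) + 2 * L (?q r 0)) * \<bar>t - s\<bar>"
      using L(1)[of "?q r 0"] by (simp add: algebra_simps)
    also have "\<dots> \<le> B * \<bar>t - s\<bar>" using r by (intro mult_right_mono Lr) auto
    finally show ?thesis .
  qed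
  have bnd: "\<bar>gs ev b r t\<bar> \<le> B" for r t
  proof -
    consider "r \<le> 1" | "r = 2" | "r > 2" by linarith
    then show ?thesis
    proof cases
      case 1
      have "\<bar>gs ev b r t\<bar> \<le> L (?q r (-1)) + L (?q r 0) + L (?q r 0)"
      proof -
        have tri: "\<bar>x + y - u\<bar> \<le> l + m + m" if "\<bar>x\<bar> \<le> l" "\<bar>y\<bar> \<le> m" "\<bar>u\<bar> \<le> m" for x y u l m :: real using that by linarith
        have e: "gs ev b r t = poly (?q r (-1)) (max (-1) (min 0 t)) + poly (?q r 0) (max 0 (min 1 t)) - poly (?q r 0) 0"
          using 1 by (simp only: gs_def Let_def if_True)
        show ?thesis unfolding e by (rule tri[OF L(2)[OF c(1)] L(2)[OF c(2)] L(2)]) simp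
      qed
      then show ?thesis using Lr[of r] 1 by simp
    next
      case 2
      have "\<bar>gs ev b r t\<bar> \<le> L (?q r (-1)) + 2 * L (?q r 0)"
      proof -
        have "\<not> r \<le> 1" using 2 by simp
        then have "gs ev b r t = (if -1 < t \<and> t < 0 then poly (?q r (-1)) t else if 0 < t \<and> t < 1 then poly (?q r 0) t else 0)"
          unfolding gs_def Let_def using 2 by simp
        then show ?thesis
          using L(2)[of t "?q r (-1)"] L(2)[of t "?q r 0"] L(1)[of "?q r (-1)"] L(1)[of "?q r 0"] by (auto split: if_splits)
      qed
      then show ?thesis using Lr[of r] 2 by simp
    qed (use B in \<open>simp add: gs_def\<close>)
  qed
  have "gs ev b r \<in> borel_measurable borel" for r
  proof -
    have [measurable]: "poly q \<in> borel_measurable borel" for q :: "real poly" by (intro borel_measurable_continuous_onI continuous_intros)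
    show ?thesis unfolding gs_def[abs_def] Let_def by measurable
  qed
  moreover have "countable (\<int> :: real set)" by (simp add: Ints_def)
  ultimately have "pw2 (gs ev b) \<int> B"
    unfolding pw2_def using B bnd lip gs_off by auto
  then show ?thesis ..
qed

lemma pw2_gs_uniform: "\<exists>B. \<forall>ev. \<forall>b\<le>k. pw2 (gs ev b) \<int> B"
proof -
  have "\<forall>p. \<exists>B. pw2 (gs (fst p) (snd p)) \<int> B" using pw2_gs by blast
  from choice[OF this] obtain B where B: "\<And>p. pw2 (gs (fst p) (snd p)) \<int> (B p)" by blast
  have "pw2 (gs ev b) \<int> (\<Sum>p\<in>UNIV \<times> {..k}. B p)" if "b \<le> k" for ev b
  proof (rule pw2_mono)
    show "pw2 (gs ev b) \<int> (B (ev, b))" using B[of "(ev, b)"] by simp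
    show "B (ev, b) \<le> (\<Sum>p\<in>UNIV \<times> {..k}. B p)"
    proof (rule member_le_sum)
      show "0 \<le> B p" for p using B[of p] by (auto simp: pw2_def)
    qed (use that in auto)
  qed
  then show ?thesis by blast
qed

text \<open>Transfers reference profiles to the lattice of width \<open>h\<close>. The bound grows
  with 1/\<open>h\<close>, which is harmless because it only serves to place the spline basis in
  \<open>H20\<close>; error bounds use the reference constant and explicit powers of
  \<open>h\<close>.\<close>

lemma pw2_affine:
  assumes f: "pw2 f E B" and h: "h > 0"
  shows "pw2 (\<lambda>r t. f r ((t - a) / h - w) / h ^ min r 2) {t. (t - a) / h - w \<in> E} (B * max 1 (1 / h) ^ 3)"
proof -
  define m where "m = max 1 (1 / h)"
  have m: "m \<ge> 1" "1 / h \<le> m" by (auto simp: m_def)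
  have F: "B \<ge> 1" "\<And>r t. \<bar>f r t\<bar> \<le> B" "\<And>r. f r \<in> borel_measurable borel" "countable E"
    "\<And>r t s. r \<le> 1 \<Longrightarrow> \<bar>f r t - f r s\<bar> \<le> B * \<bar>t - s\<bar>"
    "\<And>r t. r \<le> 1 \<Longrightarrow> t \<notin> E \<Longrightarrow> (f r has_real_derivative f (Suc r) t) (at t)"
    "\<And>r t. r \<le> 2 \<Longrightarrow> t \<notin> E \<Longrightarrow> isCont (f r) t"
    using f unfolding pw2_def by blast+
  have hp: "1 / h ^ r \<le> m ^ r" for r using power_mono[OF m(2), of r] h by (simp add: power_divide)
  have mp: "m ^ r \<le> m ^ 3" if "r \<le> 3" for r using that m by (intro power_increasing) auto
  have hp3: "1 / h ^ r \<le> m ^ 3" if "r \<le> 3" for r by (rule order_trans[OF hp mp[OF that]])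
  have "{t. (t - a) / h - w \<in> E} \<subseteq> (\<lambda>s. a + h * (s + w)) ` E"
  proof
    fix t assume "t \<in> {t. (t - a) / h - w \<in> E}"
    then show "t \<in> (\<lambda>s. a + h * (s + w)) ` E" using h by (intro image_eqI[of _ _ "(t - a) / h - w"]) auto
  qed
  then have "countable {t. (t - a) / h - w \<in> E}" by (rule countable_subset) (rule countable_image[OF F(4)])
  moreover have "B * m ^ 3 \<ge> 1" using F(1) one_le_power[OF m(1), of 3] by (metis mult_mono' mult_1 zero_le_one)
  moreover have "\<bar>f r ((t - a) / h - w) / h ^ min r 2\<bar> \<le> B * m ^ 3" for r t
  proof -
    have "\<bar>f r ((t - a) / h - w) / h ^ min r 2\<bar> = \<bar>f r ((t - a) / h - w)\<bar> * (1 / h ^ min r 2)" using h by (simp add: abs_mult)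
    also have "\<dots> \<le> B * m ^ 3" using F(1,2) hp3[of "min r 2"] h by (intro mult_mono) auto
    finally show ?thesis .
  qed
  moreover have "(\<lambda>t. f r ((t - a) / h - w) / h ^ min r 2) \<in> borel_measurable borel" for r
    using measurable_compose[OF _ F(3)[of r], of "\<lambda>t. (t - a) / h - w"] by simp
  moreover have "\<bar>f r ((t - a) / h - w) / h ^ min r 2 - f r ((s - a) / h - w) / h ^ min r 2\<bar> \<le> B * m ^ 3 * \<bar>t - s\<bar>" if r: "r \<le> 1" for r s t
  proof -
    have "\<bar>f r ((t - a) / h - w) / h ^ min r 2 - f r ((s - a) / h - w) / h ^ min r 2\<bar>
      = \<bar>f r ((t - a) / h - w) - f r ((s - a) / h - w)\<bar> / h ^ r" using h r by (simp add: min_def flip: diff_divide_distrib)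
    also have "\<dots> \<le> (B * \<bar>((t - a) / h - w) - ((s - a) / h - w)\<bar>) / h ^ r" using h r by (intro divide_right_mono F(5)) auto
    also have "\<dots> = B * \<bar>t - s\<bar> * (1 / h ^ Suc r)" using h by (simp add: field_simps flip: diff_divide_distrib)
    also have "\<dots> \<le> B * \<bar>t - s\<bar> * m ^ 3" using hp3[of "Suc r"] r F(1) by (intro mult_left_mono) auto
    finally show ?thesis by (simp add: mult_ac)
  qed
  moreover have "((\<lambda>t. f r ((t - a) / h - w) / h ^ min r 2) has_real_derivative f (Suc r) ((t - a) / h - w) / h ^ min (Suc r) 2) (at t)"
    if r: "r \<le> 1" and t: "(t - a) / h - w \<notin> E" for r t
  proof -
    have "((\<lambda>t. (t - a) / h - w) has_real_derivative 1 / h) (at t)" using h by (auto intro!: derivative_eq_intros)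
    from DERIV_chain2[OF F(6)[OF r t] this]
    have "((\<lambda>t. f r ((t - a) / h - w)) has_real_derivative f (Suc r) ((t - a) / h - w) * (1 / h)) (at t)" .
    from DERIV_cdivide[OF this, of "h ^ r"] show ?thesis using r h by (simp add: min_def mult.commute)
  qed
  moreover have "isCont (\<lambda>t. f r ((t - a) / h - w) / h ^ min r 2) t" if "r \<le> 2" "(t - a) / h - w \<notin> E" for r t
  proof -
    have "isCont (\<lambda>t. f r ((t - a) / h - w)) t"
      by (rule isCont_o2[where g = "f r" and f = "\<lambda>t. (t - a) / h - w", OF _ F(7)[OF that]]) (use h in \<open>auto intro!: continuous_intros\<close>)
    then show ?thesis using h by (intro continuous_intros) auto
  qed
  ultimately show ?thesis unfolding pw2_def m_def[symmetric] mem_Collect_eq by blast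
qed

subsection \<open>Change of origin and partition identity\<close>

text \<open>Coefficients after re-expansion about the lattice point with index \<open>w\<close>, by
  the binomial theorem in each variable; in units of \<open>h\<close> the shift is the integer
  vector \<open>w\<close>.\<close>

definition sh :: "nat \<Rightarrow> ('n::finite \<Rightarrow> int) \<Rightarrow> (('n \<Rightarrow> nat) \<Rightarrow> real) \<Rightarrow> ('n \<Rightarrow> nat) \<Rightarrow> real" where
  "sh k w C \<beta> = (\<Sum>\<alpha>\<in>Idx k. C \<alpha> * (\<Prod>i\<in>UNIV. real (\<alpha> i choose \<beta> i) * of_int (w i) ^ (\<alpha> i - \<beta> i)))"

lemma Idx_PiE: "(Idx k :: ('n::finite \<Rightarrow> nat) set) = PiE UNIV (\<lambda>_. {..k})"
  by (auto simp: Idx_def PiE_def Pi_def)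

lemma binomial_upto:
  assumes "a \<le> k" shows "(\<Sum>b\<le>k. real (a choose b) * w ^ (a - b) * t ^ b) = (w + t) ^ a"
proof -
  have "(\<Sum>b\<le>k. real (a choose b) * w ^ (a - b) * t ^ b) = (\<Sum>b\<le>a. real (a choose b) * w ^ (a - b) * t ^ b)"
    using assms by (intro sum.mono_neutral_right) auto
  then show ?thesis using binomial_ring[of t w a] by (simp add: mult_ac add.commute)
qed

lemma pev_sh:
  fixes w :: "'n::finite \<Rightarrow> int"
  assumes h: "h > 0"
  shows "pev k h (a + h *\<^sub>R vz w) (sh k w C) x = pev k h a C x"
proof -
  let ?t = "\<lambda>j. (x $ j - (a + h *\<^sub>R vz w) $ j) / h"
  have t: "of_int (w j) + ?t j = (x $ j - a $ j) / h" for j using h by (simp add: field_simps)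
  have "pev k h (a + h *\<^sub>R vz w) (sh k w C) x
    = (\<Sum>\<alpha>\<in>Idx k. C \<alpha> * (\<Sum>\<beta>\<in>Idx k. \<Prod>j\<in>UNIV. real (\<alpha> j choose \<beta> j) * of_int (w j) ^ (\<alpha> j - \<beta> j) * ?t j ^ \<beta> j))"
    unfolding pev_def sh_def mnm_def sum_distrib_right sum_distrib_left
    by (subst sum.swap) (simp add: prod.distrib mult.assoc)
  also have "\<dots> = (\<Sum>\<alpha>\<in>Idx k. C \<alpha> * (\<Prod>j\<in>UNIV. \<Sum>b\<le>k. real (\<alpha> j choose b) * of_int (w j) ^ (\<alpha> j - b) * ?t j ^ b))"
    unfolding Idx_PiE by (subst prod_sum_PiE) auto
  also have "\<dots> = pev k h a C x"
    unfolding pev_def mnm_def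
    by (intro sum.cong refl arg_cong2[where f = times] prod.cong) (use t in \<open>auto simp: Idx_def binomial_upto\<close>)
  finally show ?thesis .
qed

text \<open>A nonzero contribution requires \<beta> \<le> \<alpha> in every component, so the total
  degree cannot grow under a change of origin.\<close>

lemma sh_degree:
  assumes "\<And>\<alpha>. k < sum \<alpha> UNIV \<Longrightarrow> C \<alpha> = 0" "k < sum \<beta> UNIV" shows "sh k w C \<beta> = 0"
  unfolding sh_def
proof (rule sum.neutral, rule ballI)
  fix \<alpha> :: "'a \<Rightarrow> nat"
  show "C \<alpha> * (\<Prod>i\<in>UNIV. real (\<alpha> i choose \<beta> i) * of_int (w i) ^ (\<alpha> i - \<beta> i)) = 0"
  proof (cases "\<forall>i. \<beta> i \<le> \<alpha> i")
    case True
    then have "sum \<beta> UNIV \<le> sum \<alpha> UNIV" by (intro sum_mono) auto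
    then show ?thesis using assms by simp
  next
    case False
    then obtain i where "\<alpha> i < \<beta> i" by (auto simp: not_le)
    then have "(\<Prod>i\<in>UNIV. real (\<alpha> i choose \<beta> i) * of_int (w i) ^ (\<alpha> i - \<beta> i)) = 0"
      by (intro prod_zero bexI[of _ i]) auto
    then show ?thesis by simp
  qed
qed

lemma sh_zero: "sh k w (\<lambda>_. 0) = (\<lambda>_. 0)"
  by (simp add: sh_def fun_eq_iff)

text \<open>The derivative of the binomial identity at t = 1. It expresses the slope at the right
  node through the coefficients at the left node.\<close>

lemma binomial_deriv_upto:
  assumes "a \<le> k" shows "(\<Sum>b\<le>k. real (a choose b) * w ^ (a - b) * real b) = real a * (w + 1) ^ (a - 1)"
proof -
  have 1: "((\<lambda>t. \<Sum>b\<le>k. real (a choose b) * w ^ (a - b) * t ^ b) has_real_derivative (\<Sum>b\<le>k. real (a choose b) * w ^ (a - b) * real b)) (at 1)"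
    by (auto intro!: derivative_eq_intros sum.cong)
  have 2: "((\<lambda>t. (w + t) ^ a) has_real_derivative real a * (w + 1) ^ (a - 1)) (at 1)"
    by (auto intro!: derivative_eq_intros)
  show ?thesis using DERIV_unique[OF 1] 2 unfolding binomial_upto[OF assms] by blast
qed

text \<open>On the unit interval t^b consists of its value and slope at 0, the interval function
  when b \<ge> 2, and value 1 and slope b at the node 1.\<close>

lemma hermite_reproduce:
  "(if b < 2 then poly (gp True b 0) t else 0) + poly (gp False b 0) t + poly (gp True 0 (-1)) (t - 1) + real b * poly (gp True 1 (-1)) (t - 1) = t ^ b"
proof -
  consider "b = 0" | "b = 1" | "b \<ge> 2" by linarith
  then show ?thesis by cases (auto simp: gp_def poly_monom algebra_simps power2_eq_square power3_eq_cube)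
qed

text \<open>Three cells meet the interval: left node, interior and right node. Each expands the
  monomial about its own lattice point \<open>m div 2\<close>, and the Hermite pieces weighted with
  these coefficients reassemble it.\<close>

lemma partition_1d:
  fixes z :: int and y :: real
  assumes a: "a \<le> k" and k: "k \<ge> 1"
  shows "(\<Sum>m\<in>{2 * z..2 * z + 2}. \<Sum>b\<le>k. real (a choose b) * of_int (m div 2) ^ (a - b) *
           poly (gp (even m) b (z - m div 2)) (y - of_int (m div 2))) = y ^ a"
proof -
  let ?B = "\<lambda>b. real (a choose b) * of_int z ^ (a - b)" let ?t = "y - of_int z"
  have s: "{2 * z..2 * z + 2} = {2 * z, 2 * z + 1, 2 * z + 2}" by auto
  have d: "(2 * z + 2) div 2 = z + 1" by simp
  have dz: "z - (z + 1) = -1" by simp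
  have T: "(\<Sum>b\<le>k. real (a choose b) * w ^ (a - b) * poly (gp True b \<zeta>) x) = w ^ a * poly (gp True 0 \<zeta>) x + real a * w ^ (a - 1) * poly (gp True 1 \<zeta>) x" for w \<zeta> x
  proof -
    have "(\<Sum>b\<le>k. real (a choose b) * w ^ (a - b) * poly (gp True b \<zeta>) x) = (\<Sum>b\<in>{0,1}. real (a choose b) * w ^ (a - b) * poly (gp True b \<zeta>) x)"
      using k by (intro sum.mono_neutral_right) (auto simp: gp_def)
    then show ?thesis by simp
  qed
  have e: "of_int (z + 1) = (of_int z + 1 :: real)" by simp
  have "(\<Sum>m\<in>{2 * z..2 * z + 2}. \<Sum>b\<le>k. real (a choose b) * of_int (m div 2) ^ (a - b) *
           poly (gp (even m) b (z - m div 2)) (y - of_int (m div 2)))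
    = (\<Sum>b\<le>k. ?B b * poly (gp True b 0) ?t) + (\<Sum>b\<le>k. ?B b * poly (gp False b 0) ?t)
      + (\<Sum>b\<le>k. real (a choose b) * of_int (z + 1) ^ (a - b) * poly (gp True b (-1)) (?t - 1))"
    unfolding s by (simp add: d algebra_simps)
  \<comment> \<open>At the right node only the coefficients of order 0 and 1 matter; they are the
    value and slope there, rewritten through the coefficients at the left node.\<close>
  also have "(\<Sum>b\<le>k. real (a choose b) * of_int (z + 1) ^ (a - b) * poly (gp True b (-1)) (?t - 1))
    = (\<Sum>b\<le>k. ?B b * poly (gp True 0 (-1)) (?t - 1)) + (\<Sum>b\<le>k. ?B b * (real b * poly (gp True 1 (-1)) (?t - 1)))"
    unfolding T e using binomial_upto[OF a, of "of_int z" 1] binomial_deriv_upto[OF a, of "of_int z"]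
    by (simp flip: sum_distrib_right mult.assoc)
  also have "(\<Sum>b\<le>k. ?B b * poly (gp True b 0) ?t) + (\<Sum>b\<le>k. ?B b * poly (gp False b 0) ?t) + \<dots> = (\<Sum>b\<le>k. ?B b * ?t ^ b)"
    unfolding sum.distrib[symmetric]
  proof (rule sum.cong[OF refl])
    fix b
    have "(if b < 2 then poly (gp True b 0) ?t else 0) = poly (gp True b 0) ?t" by (simp add: gp_zero(3))
    then show "?B b * poly (gp True b 0) ?t + ?B b * poly (gp False b 0) ?t + (?B b * poly (gp True 0 (-1)) (?t - 1) + ?B b * (real b * poly (gp True 1 (-1)) (?t - 1))) = ?B b * ?t ^ b"
      unfolding hermite_reproduce[of b ?t, symmetric] by (simp only: distrib_left add.assoc)
  qed
  also have "\<dots> = y ^ a" by (simp add: binomial_upto[OF a])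
  finally show ?thesis .
qed

text \<open>Cells are the points of the doubled lattice; an even entry stands for a lattice node, an odd entry
  for a lattice interval.\<close>

definition cells :: "('n::finite \<Rightarrow> int) \<Rightarrow> ('n \<Rightarrow> int) set" where
  "cells z = PiE UNIV (\<lambda>i. {2 * z i..2 * z i + 2})"

lemma cells_iff: "c \<in> cells z \<longleftrightarrow> (\<forall>i. 2 * z i \<le> c i \<and> c i \<le> 2 * z i + 2)"
  by (auto simp: cells_def PiE_def Pi_def)

lemma finite_cells[simp]: "finite (cells z)"
  unfolding cells_def by (intro finite_PiE) auto

abbreviation hf :: "('n \<Rightarrow> int) \<Rightarrow> 'n \<Rightarrow> int" where "hf c \<equiv> \<lambda>i. c i div 2"

text \<open>The polynomial with which the basis function of cell \<open>c\<close> agrees on cube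
  \<open>z\<close>, continued to the whole space; being smooth, it can be differentiated classically
  up to closed faces.\<close>

definition Gt :: "real \<Rightarrow> real^'n::finite \<Rightarrow> ('n \<Rightarrow> int) \<Rightarrow> ('n \<Rightarrow> nat) \<Rightarrow> ('n \<Rightarrow> int) \<Rightarrow> 'n \<Rightarrow> nat \<Rightarrow> real \<Rightarrow> real" where
  "Gt h a c \<beta> z j r t = poly ((pderiv ^^ r) (gp (even (c j)) (\<beta> j) (z j - hf c j))) ((t - a $ j) / h - of_int (hf c j)) / h ^ r"

text \<open>If every cell takes its coefficients from one and the same polynomial, that polynomial
  is reproduced; the multivariate identity is the distributed product of the one-dimensional
  ones.\<close>

lemma pev_partition:
  fixes a :: "real^'n::finite"
  assumes k: "k \<ge> 1"
  shows "(\<Sum>c\<in>cells z. \<Sum>\<beta>\<in>Idx k. sh k (hf c) C \<beta> * tens (Gt h a c \<beta> z) [] x) = pev k h a C x"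
proof -
  let ?y = "\<lambda>j. (x $ j - a $ j) / h"
  let ?T = "\<lambda>\<alpha> j m b. real (\<alpha> j choose b) * of_int (m div 2) ^ (\<alpha> j - b) * poly (gp (even m) b (z j - m div 2)) (?y j - of_int (m div 2))"
  have "(\<Sum>c\<in>cells z. \<Sum>\<beta>\<in>Idx k. sh k (hf c) C \<beta> * tens (Gt h a c \<beta> z) [] x)
    = (\<Sum>c\<in>cells z. \<Sum>\<beta>\<in>Idx k. \<Sum>\<alpha>\<in>Idx k. C \<alpha> * (\<Prod>j\<in>UNIV. ?T \<alpha> j (c j) (\<beta> j)))"
    by (simp add: sh_def sum_distrib_right tens_def Gt_def prod.distrib mult.assoc)
  also have "\<dots> = (\<Sum>c\<in>cells z. \<Sum>\<alpha>\<in>Idx k. \<Sum>\<beta>\<in>Idx k. C \<alpha> * (\<Prod>j\<in>UNIV. ?T \<alpha> j (c j) (\<beta> j)))"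
    by (rule sum.cong[OF refl], rule sum.swap)
  also have "\<dots> = (\<Sum>\<alpha>\<in>Idx k. \<Sum>c\<in>cells z. \<Sum>\<beta>\<in>Idx k. C \<alpha> * (\<Prod>j\<in>UNIV. ?T \<alpha> j (c j) (\<beta> j)))"
    by (rule sum.swap)
  also have "\<dots> = (\<Sum>\<alpha>\<in>Idx k. C \<alpha> * (\<Prod>j\<in>UNIV. \<Sum>m\<in>{2 * z j..2 * z j + 2}. \<Sum>b\<le>k. ?T \<alpha> j m b))"
    by (simp add: prod_sum_PiE cells_def Idx_PiE flip: sum_distrib_left)
  also have "\<dots> = (\<Sum>\<alpha>\<in>Idx k. C \<alpha> * (\<Prod>j\<in>UNIV. ?y j ^ \<alpha> j))"
    by (intro sum.cong refl arg_cong2[where f = times] prod.cong partition_1d k) (auto simp: Idx_def)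
  finally show ?thesis by (simp add: pev_def mnm_def)
qed

lemma smooth_Gt:
  assumes h: "h > 0"
  shows "smooth (tens (Gt h a c \<beta> z) [])" "pds is (tens (Gt h a c \<beta> z) []) = tens (Gt h a c \<beta> z) is"
proof -
  have d: "(Gt h a c \<beta> z j r has_real_derivative Gt h a c \<beta> z j (Suc r) t) (at t)" for j r t
  proof -
    have "((\<lambda>t. (t - a $ j) / h - of_int (hf c j)) has_real_derivative 1 / h) (at t)" using h by (auto intro!: derivative_eq_intros)
    from DERIV_chain2[OF poly_DERIV this]
    have "((\<lambda>t. poly q ((t - a $ j) / h - of_int (hf c j))) has_real_derivative poly (pderiv q) ((t - a $ j) / h - of_int (hf c j)) * (1 / h)) (at t)" for q .
    from DERIV_cdivide[OF this, of "(pderiv ^^ r) (gp (even (c j)) (\<beta> j) (z j - hf c j))" "h ^ r"]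
    show ?thesis unfolding Gt_def[abs_def] by (simp add: mult.commute)
  qed
  have e: "tens (Gt h a c \<beta> z) is = (\<lambda>x. \<Prod>j\<in>UNIV. Gt h a c \<beta> z j (count_list is j) (x $ j))" for "is"
    by (simp add: tens_def fun_eq_iff)
  show "smooth (tens (Gt h a c \<beta> z) [])" "pds is (tens (Gt h a c \<beta> z) []) = tens (Gt h a c \<beta> z) is"
    using smooth_tensor[of "Gt h a c \<beta> z", OF d] by (simp_all add: e)
qed

section \<open>Quasi-interpolation by Hermite splines\<close>

lemma H20_zero:
  assumes \<Omega>: "open \<Omega>" "bounded \<Omega>"
  shows "H20 \<Omega> (\<lambda>_::real^'n::finite. 0)" "is_wd \<Omega> is (\<lambda>_. 0) (\<lambda>_. 0)"
proof -
  have s: "smooth (\<lambda>_::real^'n. 0)" by (rule smooth_zero)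
  have p: "pds is (\<lambda>_::real^'n. 0) = (\<lambda>_. 0)" for "is" by (induction "is") (auto simp: pdx_def)
  have t: "test_fun \<Omega> (\<lambda>_::real^'n. 0)" unfolding test_fun_iff cpt_supp_def using s by simp
  show "H20 \<Omega> (\<lambda>_::real^'n. 0)"
    by (rule H20I(1)[OF \<Omega>, where \<phi> = "\<lambda>_ _. 0" and U = "\<lambda>_ _. 0"]) (auto simp: p t l2_def intro: sqint_zero)
  show "is_wd \<Omega> is (\<lambda>_. 0) (\<lambda>_. 0)"
    using is_wd_smooth[OF \<Omega> s, of "is"] by (simp add: p)
qed

lemma H20_sum:
  fixes f :: "'i \<Rightarrow> real^'n::finite \<Rightarrow> real"
  assumes \<Omega>: "open \<Omega>" "bounded \<Omega>" and I: "finite I" and f: "\<And>i. i \<in> I \<Longrightarrow> H20 \<Omega> (f i)"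
    and D: "\<And>i is. i \<in> I \<Longrightarrow> length is \<le> 2 \<Longrightarrow> is_wd \<Omega> is (f i) (D i is)"
  shows "H20 \<Omega> (\<lambda>x. \<Sum>i\<in>I. d i * f i x) \<and>
    (\<forall>is. length is \<le> 2 \<longrightarrow> is_wd \<Omega> is (\<lambda>x. \<Sum>i\<in>I. d i * f i x) (\<lambda>x. \<Sum>i\<in>I. d i * D i is x))"
  using I f D
proof (induction I)
  case empty
  then show ?case using H20_zero[OF \<Omega>] by simp
next
  case (insert i I)
  have IH: "H20 \<Omega> (\<lambda>x. \<Sum>i\<in>I. d i * f i x)"
    "\<And>is. length is \<le> 2 \<Longrightarrow> is_wd \<Omega> is (\<lambda>x. \<Sum>i\<in>I. d i * f i x) (\<lambda>x. \<Sum>i\<in>I. d i * D i is x)"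
    using insert by auto
  have fi: "H20 \<Omega> (f i)" "\<And>is. length is \<le> 2 \<Longrightarrow> is_wd \<Omega> is (f i) (D i is)" using insert by auto
  have sq: "sqint (lebesgue_on \<Omega>) g" if "H20 \<Omega> g" for g using that Hm_sqint by (auto simp: H20_def)
  have "H20 \<Omega> (\<lambda>x. d i * f i x + 1 * (\<Sum>i\<in>I. d i * f i x))" by (rule H20_lin[OF \<Omega> fi(1) IH(1)])
  moreover have "is_wd \<Omega> is (\<lambda>x. d i * f i x + 1 * (\<Sum>i\<in>I. d i * f i x)) (\<lambda>x. d i * D i is x + 1 * (\<Sum>i\<in>I. d i * D i is x))"
    if "length is \<le> 2" for "is"
    by (rule is_wd_lin[OF \<Omega> sq[OF fi(1)] sq[OF IH(1)] fi(2)[OF that] IH(2)[OF that]])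
  ultimately show ?case using insert by simp
qed

definition bx :: "real^'n::finite \<Rightarrow> real \<Rightarrow> ('n \<Rightarrow> int) \<Rightarrow> (real^'n) set" where
  "bx a h z = box (a + h *\<^sub>R vz z) (a + h *\<^sub>R vz z + h *\<^sub>R One)"

lemma mem_bx: "x \<in> bx a h z \<longleftrightarrow> (\<forall>j. a $ j + h * of_int (z j) < x $ j \<and> x $ j < a $ j + h * of_int (z j) + h)"
  by (simp add: bx_def mem_box_cart One_nth)

lemma open_bx: "open (bx a h z)" and bounded_bx: "bounded (bx a h z)"
  by (auto simp: bx_def open_box bounded_box)

lemma bx_interior: "bx a h z = interior (lc a h z)"
  by (simp add: bx_def lc_def cube_def interior_cbox)

lemma measure_bx: "h > 0 \<Longrightarrow> measure lebesgue (bx a h z) = h ^ CARD('n)" for a :: "real^'n::finite"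
proof -
  assume h: "h > 0"
  have e: "(a + h *\<^sub>R vz z + h *\<^sub>R One) \<bullet> b - (a + h *\<^sub>R vz z) \<bullet> b = h" if "b \<in> Basis" for b :: "real^'n"
    using that by (simp add: inner_add_left inner_sum_left inner_Basis if_distrib sum.delta cong: if_cong)
  have le: "(a + h *\<^sub>R vz z) \<bullet> b \<le> (a + h *\<^sub>R vz z + h *\<^sub>R One) \<bullet> b" if "b \<in> Basis" for b :: "real^'n" using e[OF that] h by linarith
  have "measure lebesgue (bx a h z) = measure lborel (bx a h z)" by (simp add: bx_def measure_completion)
  also have "\<dots> = (\<Prod>b\<in>(Basis :: (real^'n) set). h)"
    unfolding bx_def measure_lborel_box_eq using le e by (simp add: inner_diff_left inner_add_left)
  also have "\<dots> = h ^ CARD('n)" by simp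
  finally show ?thesis .
qed

lemma bx_lc_disjoint:
  assumes h: "h > 0" and x: "x \<in> bx a h z" "x \<in> lc a h z'" shows "z = z'"
proof (rule ext, rule ccontr)
  fix j assume ne: "z j \<noteq> z' j"
  have b: "a $ j + h * of_int (z j) < x $ j" "x $ j < a $ j + h * of_int (z j) + h"
    "a $ j + h * of_int (z' j) \<le> x $ j" "x $ j \<le> a $ j + h * of_int (z' j) + h"
    using x by (auto simp: mem_bx mem_lc)
  have "h * of_int (z j) < h * (of_int (z' j) + 1)" "h * of_int (z' j) < h * (of_int (z j) + 1)"
    using b by (simp_all add: distrib_left)
  then have "real_of_int (z j) < of_int (z' j) + 1" "real_of_int (z' j) < of_int (z j) + 1" using h by simp_all
  then show False using ne by linarith
qed

lemma bx_ne: "h > 0 \<Longrightarrow> closure (bx a h z) = lc a h z"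
  unfolding bx_def lc_def cube_def
proof (rule closure_box)
  assume "h > 0"
  then have "a + h *\<^sub>R vz z + (h/2) *\<^sub>R One \<in> box (a + h *\<^sub>R vz z) (a + h *\<^sub>R vz z + h *\<^sub>R One)"
    by (simp add: mem_box_cart One_nth)
  then show "box (a + h *\<^sub>R vz z) (a + h *\<^sub>R vz z + h *\<^sub>R One) \<noteq> {}" by blast
qed

text \<open>\<open>C\<close> holds the coefficients of the local polynomials, all expanded about the
  common origin \<open>a\<close> so that neighbours can be compared. The value 0 off the mesh
  encodes the boundary condition, \<open>Cdeg\<close> the bound on the total degree.\<close>

locale spline_mesh =
  fixes \<Omega> :: "(real^'n::finite) set" and h :: real and \<T> :: "(real^'n) set" and a :: "real^'n" and k :: nat
    and C :: "('n \<Rightarrow> int) \<Rightarrow> ('n \<Rightarrow> nat) \<Rightarrow> real" and Mz :: "('n \<Rightarrow> int) set"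
  assumes \<Omega>: "open \<Omega>" "bounded \<Omega>" and mesh: "cube_mesh \<Omega> h \<T>" and a: "a \<in> \<T>" and k: "k \<ge> 4"
    and Mz_def: "Mz = {z. a + h *\<^sub>R vz z \<in> \<T>}"
    and Cdeg: "\<And>z \<alpha>. k < sum \<alpha> UNIV \<Longrightarrow> C z \<alpha> = 0" and Cout: "\<And>z. z \<notin> Mz \<Longrightarrow> C z = (\<lambda>_. 0)"
begin

lemma h: "h > 0" using mesh by (simp add: cube_mesh_def)

lemma finite_Mz: "finite Mz"
proof -
  have "inj (\<lambda>z. a + h *\<^sub>R vz z)"
  proof (rule injI)
    fix z z' :: "'n \<Rightarrow> int" assume "a + h *\<^sub>R vz z = a + h *\<^sub>R vz z'"
    then have "vz z = vz z'" using h by simp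
    then have "vz z $ j = vz z' $ j" for j by simp
    then show "z = z'" by (auto simp: fun_eq_iff)
  qed
  moreover have "finite \<T>" using mesh by (simp add: cube_mesh_def)
  ultimately have "finite ((\<lambda>z. a + h *\<^sub>R vz z) -` \<T>)" by (rule finite_vimageI[rotated])
  then show ?thesis by (simp add: Mz_def vimage_def)
qed

lemma mesh_index: assumes "t \<in> \<T>" obtains z where "z \<in> Mz" "t = a + h *\<^sub>R vz z"
proof -
  have "\<forall>i. \<exists>z::int. (t - a) $ i = of_int z * h" using mesh a assms by (simp add: cube_mesh_def)
  from choice[OF this] obtain z :: "'n \<Rightarrow> int" where z: "\<forall>i. (t - a) $ i = of_int (z i) * h" ..
  then have "t $ i = (a + h *\<^sub>R vz z) $ i" for i using z[THEN spec, of i] by (simp add: algebra_simps)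
  then have "t = a + h *\<^sub>R vz z" by (simp add: vec_eq_iff)
  with assms that[of z] show ?thesis by (simp add: Mz_def)
qed

lemma mesh_union: "(\<Union>t\<in>\<T>. cube t h) = (\<Union>z\<in>Mz. lc a h z)"
proof
  show "(\<Union>t\<in>\<T>. cube t h) \<subseteq> (\<Union>z\<in>Mz. lc a h z)"
  proof
    fix x assume "x \<in> (\<Union>t\<in>\<T>. cube t h)"
    then obtain t where t: "t \<in> \<T>" "x \<in> cube t h" by blast
    obtain z where "z \<in> Mz" "t = a + h *\<^sub>R vz z" by (rule mesh_index[OF t(1)])
    with t(2) show "x \<in> (\<Union>z\<in>Mz. lc a h z)" by (auto simp: lc_def)
  qed
qed (auto simp: Mz_def lc_def)

lemma dom_eq: "\<Omega> = interior (\<Union>z\<in>Mz. lc a h z)"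
  using mesh unfolding cube_mesh_def mesh_union by blast

lemma bx_subset: "z \<in> Mz \<Longrightarrow> bx a h z \<subseteq> \<Omega>"
  unfolding dom_eq bx_interior by (intro interior_mono) blast

lemma lc_outside: assumes "z \<notin> Mz" shows "lc a h z \<inter> \<Omega> = {}"
proof -
  have "\<Omega> \<inter> bx a h z = {}"
  proof (rule ccontr)
    assume "\<Omega> \<inter> bx a h z \<noteq> {}"
    then obtain y where y: "y \<in> \<Omega>" "y \<in> bx a h z" by blast
    then obtain z' where "z' \<in> Mz" "y \<in> lc a h z'" using interior_subset dom_eq by blast
    with bx_lc_disjoint[OF h y(2)] assms show False by blast
  qed
  then show ?thesis using open_Int_closure_eq_empty[OF \<Omega>(1)] bx_ne[OF h] by blast
qed

text \<open>Lattice hyperplanes are null sets; off them closed lattice cubes and their interiors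
  contain the same points, and each point of \<Omega> lies in exactly one.\<close>

lemma AE_cover: "AE x in lebesgue. indicator \<Omega> x = (\<Sum>z\<in>Mz. indicator (bx a h z) x :: real)"
proof -
  have "AE x in lborel. \<forall>j\<in>UNIV. (x :: real^'n) $ j \<notin> range (\<lambda>i::int. a $ j + h * of_int i)"
    by (rule AE_ball_countable[THEN iffD2]) (auto intro!: AE_component_notin)
  then have "AE x in lebesgue. \<forall>j\<in>UNIV. (x :: real^'n) $ j \<notin> range (\<lambda>i::int. a $ j + h * of_int i)" by (rule AE_completion)
  then show ?thesis
  proof eventually_elim
    case (elim x)
    have lcbx: "x \<in> bx a h z" if "x \<in> lc a h z" for z
      unfolding mem_bx
    proof
      fix j
      have "x $ j \<noteq> a $ j + h * of_int (z j)" "x $ j \<noteq> a $ j + h * of_int (z j + 1)" using elim by blast+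
      then show "a $ j + h * of_int (z j) < x $ j \<and> x $ j < a $ j + h * of_int (z j) + h"
        using that by (auto simp: mem_lc less_le distrib_left)
    qed
    show ?case
    proof (cases "x \<in> \<Omega>")
      case True
      then obtain z where z: "z \<in> Mz" "x \<in> lc a h z" using interior_subset dom_eq by blast
      have "x \<in> bx a h z' \<longleftrightarrow> z' = z" for z' using bx_lc_disjoint[OF h _ z(2)] lcbx[OF z(2)] by blast
      then have "(\<Sum>z'\<in>Mz. indicator (bx a h z') x :: real) = (\<Sum>z'\<in>Mz. if z' = z then 1 else 0)"
        by (intro sum.cong) (auto simp: indicator_def)
      then show ?thesis using True z(1) finite_Mz by simp
    next
      case False
      then have "x \<notin> bx a h z" if "z \<in> Mz" for z using bx_subset[OF that] by blast
      then show ?thesis using False by (simp add: indicator_def)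
    qed
  qed
qed

lemma l2_cover:
  assumes f: "sqint (lebesgue_on \<Omega>) f"
  shows "(l2 (lebesgue_on \<Omega>) f)\<^sup>2 = (\<Sum>z\<in>Mz. (l2 (lebesgue_on (bx a h z)) f)\<^sup>2)"
proof -
  have i: "integrable lebesgue (\<lambda>x. indicator S x * (f x)\<^sup>2)" and e: "(LINT x|lebesgue_on S. (f x)\<^sup>2) = (LINT x|lebesgue. indicator S x * (f x)\<^sup>2)"
    if "open S" "S \<subseteq> \<Omega>" for S
  proof -
    have S: "S \<inter> space lebesgue \<in> sets lebesgue" using that(1) by simp
    have "integrable (lebesgue_on S) (\<lambda>x. (f x)\<^sup>2)"
      using lebesgue_on_sub(3)[OF that(1) \<Omega>(1) that(2) f] by (simp add: sqint_def)
    then show "integrable lebesgue (\<lambda>x. indicator S x * (f x)\<^sup>2)" using integrable_restrict_space[OF S, of "\<lambda>x. (f x)\<^sup>2"] by simp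
    show "(LINT x|lebesgue_on S. (f x)\<^sup>2) = (LINT x|lebesgue. indicator S x * (f x)\<^sup>2)"
      using integral_restrict_space[OF S, of "\<lambda>x. (f x)\<^sup>2"] by simp
  qed
  have "(l2 (lebesgue_on \<Omega>) f)\<^sup>2 = (LINT x|lebesgue. indicator \<Omega> x * (f x)\<^sup>2)" unfolding l2_sq by (rule e[OF \<Omega>(1) order_refl])
  also have "\<dots> = (LINT x|lebesgue. (\<Sum>z\<in>Mz. indicator (bx a h z) x * (f x)\<^sup>2))"
  proof (rule integral_cong_AE)
    show "(\<lambda>x. indicator \<Omega> x * (f x)\<^sup>2) \<in> borel_measurable lebesgue" using i[OF \<Omega>(1) order_refl] by (rule borel_measurable_integrable)
    show "(\<lambda>x. \<Sum>z\<in>Mz. indicator (bx a h z) x * (f x)\<^sup>2) \<in> borel_measurable lebesgue"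
      by (intro borel_measurable_sum borel_measurable_integrable i open_bx bx_subset)
    show "AE x in lebesgue. indicator \<Omega> x * (f x)\<^sup>2 = (\<Sum>z\<in>Mz. indicator (bx a h z) x * (f x)\<^sup>2)"
      using AE_cover by eventually_elim (simp add: sum_distrib_right)
  qed
  also have "\<dots> = (\<Sum>z\<in>Mz. LINT x|lebesgue. indicator (bx a h z) x * (f x)\<^sup>2)"
    by (rule Bochner_Integration.integral_sum) (intro i open_bx bx_subset)
  also have "\<dots> = (\<Sum>z\<in>Mz. (l2 (lebesgue_on (bx a h z)) f)\<^sup>2)"
    unfolding l2_sq by (intro sum.cong refl e[symmetric] open_bx bx_subset)
  finally show ?thesis .
qed

text \<open>Each cell takes its coefficients from one adjacent cube, from a cube outside the mesh whenever there is one,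
  so that the spline vanishes to first order on the boundary.\<close>

definition own :: "('n \<Rightarrow> int) \<Rightarrow> 'n \<Rightarrow> int" where
  "own c = (SOME z. c \<in> cells z \<and> ((\<exists>z'. c \<in> cells z' \<and> z' \<notin> Mz) \<longrightarrow> z \<notin> Mz))"

text \<open>Cells all of whose adjacent cubes belong to the mesh. Every other cell takes its
  coefficients from an outside cube and contributes 0, so restricting the spline to this finite set
  loses nothing.\<close>

definition Nc :: "('n \<Rightarrow> int) set" where "Nc = {c. \<forall>z. c \<in> cells z \<longrightarrow> z \<in> Mz}"

definition dc :: "('n \<Rightarrow> int) \<Rightarrow> ('n \<Rightarrow> nat) \<Rightarrow> real" where "dc c = sh k (hf c) (C (own c))"

definition Fs :: "('n \<Rightarrow> int) \<Rightarrow> ('n \<Rightarrow> nat) \<Rightarrow> 'n \<Rightarrow> nat \<Rightarrow> real \<Rightarrow> real" where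
  "Fs c \<beta> j r t = gs (even (c j)) (\<beta> j) r ((t - a $ j) / h - of_int (hf c j)) / h ^ min r 2"

text \<open>The spline itself is \<open>Vs []\<close>; lists of length 1 and 2 give its piecewise
  derivatives, later shown to be the weak ones.\<close>

definition Vs :: "'n list \<Rightarrow> real^'n \<Rightarrow> real" where
  "Vs is x = (\<Sum>c\<in>Nc. \<Sum>\<beta>\<in>Idx k. dc c \<beta> * tens (Fs c \<beta>) is x)"

lemma cells_hf: "c \<in> cells (hf c)" for c :: "'n \<Rightarrow> int"
proof -
  have "2 * (m div 2) \<le> m \<and> m \<le> 2 * (m div 2) + 2" for m :: int by presburger
  then show ?thesis unfolding cells_iff by blast
qed

lemma own: "c \<in> cells (own c)" "c \<notin> Nc \<Longrightarrow> own c \<notin> Mz"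
proof -
  have "\<exists>z. c \<in> cells z \<and> ((\<exists>z'. c \<in> cells z' \<and> z' \<notin> Mz) \<longrightarrow> z \<notin> Mz)" using cells_hf by blast
  from someI_ex[OF this] show "c \<in> cells (own c)" "c \<notin> Nc \<Longrightarrow> own c \<notin> Mz" unfolding own_def Nc_def by blast+
qed

lemma dc_out: "c \<notin> Nc \<Longrightarrow> dc c = (\<lambda>_. 0)"
  unfolding dc_def using Cout own(2) by (simp add: sh_zero)

lemma dc_deg: "k < sum \<beta> UNIV \<Longrightarrow> dc c \<beta> = 0"
  unfolding dc_def by (rule sh_degree[OF Cdeg])

lemma finite_Nc: "finite Nc"
proof (rule finite_subset)
  show "Nc \<subseteq> (\<Union>z\<in>Mz. cells z)" using cells_hf by (auto simp: Nc_def)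
qed (simp add: finite_Mz)

lemma cells_div: "c \<in> cells z \<longleftrightarrow> (\<forall>i. (even (c i) \<and> z i - hf c i \<in> {-1, 0}) \<or> (odd (c i) \<and> z i = hf c i))" for c :: "'n \<Rightarrow> int"
proof -
  have "2 * y \<le> m \<and> m \<le> 2 * y + 2 \<longleftrightarrow> (even m \<and> y - m div 2 \<in> {-1, 0}) \<or> (odd m \<and> y = m div 2)" for m y :: int
    by simp presburger
  then show ?thesis unfolding cells_iff by blast
qed

lemma pderiv_iter_0: "(pderiv ^^ r) 0 = (0 :: real poly)"
  by (induction r) auto

lemma Gt_zero: "gp (even (c j)) (\<beta> j) (z j - hf c j) = 0 \<Longrightarrow> tens (Gt h a c \<beta> z) is x = 0" for c :: "'n \<Rightarrow> int"
proof -
  assume g: "gp (even (c j)) (\<beta> j) (z j - hf c j) = 0"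
  have "Gt h a c \<beta> z j (count_list is j) (x $ j) = 0" unfolding Gt_def g pderiv_iter_0 by simp
  then show ?thesis unfolding tens_def by (intro prod_zero bexI[of _ j]) auto
qed

lemma Gt_not_cell: assumes "c \<notin> cells z" shows "tens (Gt h a c \<beta> z) is x = 0"
proof -
  obtain i where i: "\<not> ((even (c i) \<and> z i - hf c i \<in> {-1, 0}) \<or> (odd (c i) \<and> z i = hf c i))" using assms unfolding cells_div by blast
  show ?thesis
    by (rule Gt_zero[of _ i]) (use i in \<open>cases "even (c i)"; auto intro: gp_zero\<close>)
qed

lemma Fs_Gt: assumes x: "x \<in> bx a h z" and L: "length is \<le> 2" shows "tens (Fs c \<beta>) is x = tens (Gt h a c \<beta> z) is x"
  unfolding tens_def
proof (rule prod.cong[OF refl])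
  fix j
  have c: "count_list is j \<le> 2" using count_le_length[of "is" j] L by linarith
  have "of_int (z j) < (x $ j - a $ j) / h" "(x $ j - a $ j) / h < of_int (z j) + 1"
    using x h by (auto simp: mem_bx field_simps)
  then show "Fs c \<beta> j (count_list is j) (x $ j) = Gt h a c \<beta> z j (count_list is j) (x $ j)"
    unfolding Fs_def Gt_def using c by (subst gs_piece[of "z j - hf c j"]) auto
qed

text \<open>Basis functions of cells not adjacent to the cube vanish on it, and cells outside
  \<open>Nc\<close> have zero coefficients, so the two index sets can be exchanged.\<close>

lemma Vs_local:
  assumes x: "x \<in> bx a h z" and L: "length is \<le> 2"
  shows "Vs is x = (\<Sum>c\<in>cells z. \<Sum>\<beta>\<in>Idx k. dc c \<beta> * tens (Gt h a c \<beta> z) is x)"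
proof -
  have "Vs is x = (\<Sum>c\<in>Nc. \<Sum>\<beta>\<in>Idx k. dc c \<beta> * tens (Gt h a c \<beta> z) is x)" unfolding Vs_def by (simp add: Fs_Gt[OF x L])
  also have "\<dots> = (\<Sum>c\<in>Nc \<inter> cells z. \<Sum>\<beta>\<in>Idx k. dc c \<beta> * tens (Gt h a c \<beta> z) is x)"
    by (rule sum.mono_neutral_right[OF finite_Nc]) (auto simp: Gt_not_cell)
  also have "\<dots> = (\<Sum>c\<in>cells z. \<Sum>\<beta>\<in>Idx k. dc c \<beta> * tens (Gt h a c \<beta> z) is x)"
  proof (rule sum.mono_neutral_left)
    show "\<forall>c\<in>cells z - Nc \<inter> cells z. (\<Sum>\<beta>\<in>Idx k. dc c \<beta> * tens (Gt h a c \<beta> z) is x) = 0"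
    proof
      fix c assume "c \<in> cells z - Nc \<inter> cells z"
      then have "dc c = (\<lambda>_. 0)" by (intro dc_out) blast
      then show "(\<Sum>\<beta>\<in>Idx k. dc c \<beta> * tens (Gt h a c \<beta> z) is x) = 0" by simp
    qed
  qed auto
  finally show ?thesis .
qed

text \<open>The local polynomial in the same basis as the spline on this cube, so that their
  difference is a matter of coefficients only.\<close>

lemma pev_local:
  "pds is (pev k h a (C z)) x = (\<Sum>c\<in>cells z. \<Sum>\<beta>\<in>Idx k. sh k (hf c) (C z) \<beta> * tens (Gt h a c \<beta> z) is x)"
proof -
  have e: "pev k h a (C z) = (\<lambda>x. \<Sum>c\<in>cells z. \<Sum>\<beta>\<in>Idx k. sh k (hf c) (C z) \<beta> * tens (Gt h a c \<beta> z) [] x)"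
    using pev_partition[where k = k and C = "C z" and h = h and a = a and z = z] k by auto
  have 1: "smooth (\<lambda>x. sh k (hf c) (C z) \<beta> * tens (Gt h a c \<beta> z) [] x)"
    "pds is (\<lambda>x. sh k (hf c) (C z) \<beta> * tens (Gt h a c \<beta> z) [] x) = (\<lambda>x. sh k (hf c) (C z) \<beta> * tens (Gt h a c \<beta> z) is x)" for c \<beta>
    using smooth_cmult[OF smooth_Gt(1)[OF h, of a c \<beta> z]] by (simp_all add: smooth_Gt(2)[OF h])
  show ?thesis unfolding e
    by (subst smooth_sum(2), rule smooth_sum(1)[OF 1(1)], subst smooth_sum(2)[OF 1(1)]) (simp add: 1(2))
qed

text \<open>Two cubes containing the same cell are joined by changing one index at a time, and all
  cubes on the way still contain the cell. An odd entry of \<open>c\<close> fixes the index; an even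
  entry means a step across a face through the cell, where \<open>jump_coeff\<close> bounds the
  change by \<open>X\<close>.\<close>

lemma flip_chain:
  assumes \<phi>: "smooth \<phi>" and Cc: "Cc > 0" "\<And>(z :: 'n \<Rightarrow> int) c. (\<And>j. z j \<in> {-1, 0}) \<Longrightarrow>
      (\<Sum>\<alpha>\<in>Idx k. (c \<alpha>)\<^sup>2) \<le> Cc * (\<integral>x. indicator (lc 0 1 z) x * (pev k 1 0 c x)\<^sup>2 \<partial>lborel)"
    and R: "\<And>z. c \<in> cells z \<Longrightarrow> rho h (\<lambda>x. \<phi> x - pev k h a (C z) x) (lc a h z) \<le> R"
    and X: "X \<ge> 0" "h ^ CARD('n) * X\<^sup>2 = 16 * Cc * R"
    and \<beta>: "\<beta> \<in> Idx k" "\<And>i. even (c i) \<Longrightarrow> \<beta> i \<le> 1"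
  shows "finite D \<Longrightarrow> c \<in> cells z1 \<Longrightarrow> c \<in> cells z2 \<Longrightarrow> {j. z1 j \<noteq> z2 j} \<subseteq> D \<Longrightarrow>
    \<bar>sh k (hf c) (C z1) \<beta> - sh k (hf c) (C z2) \<beta>\<bar> \<le> real (card D) * X"
proof (induction D arbitrary: z1 rule: finite_induct)
  case empty
  then have "z1 = z2" by auto
  then show ?case by simp
next
  case (insert i D)
  let ?z = "z1(i := z2 i)"
  have c1: "c \<in> cells ?z" using insert.prems(1,2) by (auto simp: cells_iff)
  have IH: "\<bar>sh k (hf c) (C ?z) \<beta> - sh k (hf c) (C z2) \<beta>\<bar> \<le> real (card D) * X"
    by (rule insert.IH[OF c1 insert.prems(2)]) (use insert.prems(3) in auto)
  have "\<bar>sh k (hf c) (C z1) \<beta> - sh k (hf c) (C ?z) \<beta>\<bar> \<le> X"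
  proof (cases "even (c i)")
    case False
    then have "z1 i = z2 i" using insert.prems(1,2) unfolding cells_div by metis
    then have "?z = z1" by auto
    then show ?thesis using X(1) by simp
  next
    case True
    have z1: "\<And>j. z1 j - hf c j \<in> {-1, 0}" and z2: "\<And>j. ?z j - hf c j \<in> {-1, 0}"
      using insert.prems(1) c1 unfolding cells_div by fastforce+
    let ?d = "\<lambda>\<alpha>. sh k (hf c) (C z1) \<alpha> - sh k (hf c) (C ?z) \<alpha>"
    have k1: "k \<ge> 1" using k by simp
    have "h ^ CARD('n) * (\<Sum>\<alpha> | \<alpha> \<in> Idx k \<and> \<alpha> i \<le> 1. (?d \<alpha>)\<^sup>2)
      \<le> 8 * Cc * (rho h (\<lambda>x. \<phi> x - pev k h (a + h *\<^sub>R vz (hf c)) (sh k (hf c) (C z1)) x) (lc a h z1)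
         + rho h (\<lambda>x. \<phi> x - pev k h (a + h *\<^sub>R vz (hf c)) (sh k (hf c) (C ?z)) x) (lc a h ?z))"
      by (rule jump_coeff[where w = "hf c" and i = i and ?z1.0 = z1 and ?z2.0 = ?z and \<phi> = \<phi> and C = Cc, OF h k1 \<phi> Cc(1) _ z1 z2[of i]])
        (rule Cc(2), assumption, simp)
    \<comment> \<open>Both cubes contain the cell, so both errors are at most \<open>R\<close>;
      hence the factor 16 in the relation that fixes \<open>X\<close>.\<close>
    also have "\<dots> \<le> 8 * Cc * (R + R)"
      unfolding pev_sh[OF h] using Cc(1) R[OF insert.prems(1)] R[OF c1] by (intro mult_left_mono add_mono) auto
    finally have 1: "h ^ CARD('n) * (\<Sum>\<alpha> | \<alpha> \<in> Idx k \<and> \<alpha> i \<le> 1. (?d \<alpha>)\<^sup>2) \<le> h ^ CARD('n) * X\<^sup>2"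
      unfolding X(2) by simp
    have "(?d \<beta>)\<^sup>2 \<le> (\<Sum>\<alpha> | \<alpha> \<in> Idx k \<and> \<alpha> i \<le> 1. (?d \<alpha>)\<^sup>2)"
      by (rule member_le_sum) (use \<beta> True finite_Idx in auto)
    also have "\<dots> \<le> X\<^sup>2" using 1 h by simp
    finally show ?thesis using X(1) abs_le_square_iff[of "?d \<beta>" X] by simp
  qed
  then have "\<bar>sh k (hf c) (C z1) \<beta> - sh k (hf c) (C z2) \<beta>\<bar> \<le> X + real (card D) * X" using IH by linarith
  then show ?case using insert.hyps by (simp add: distrib_right)
qed

text \<open>On a cube the spline deviates from the local polynomial only through coefficients owned
  by neighbouring cubes. The bound is the number of basis functions times the largest coefficient
  difference times the size of a basis derivative.\<close>

lemma Vs_pointwise: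
  assumes \<phi>: "smooth \<phi>" and Cc: "Cc > 0" "\<And>(z :: 'n \<Rightarrow> int) c. (\<And>j. z j \<in> {-1, 0}) \<Longrightarrow>
      (\<Sum>\<alpha>\<in>Idx k. (c \<alpha>)\<^sup>2) \<le> Cc * (\<integral>x. indicator (lc 0 1 z) x * (pev k 1 0 c x)\<^sup>2 \<partial>lborel)"
    and R: "\<And>z'. (\<And>j. \<bar>z' j - z j\<bar> \<le> 1) \<Longrightarrow> rho h (\<lambda>x. \<phi> x - pev k h a (C z') x) (lc a h z') \<le> R"
    and X: "X \<ge> 0" "h ^ CARD('n) * X\<^sup>2 = 16 * Cc * R"
    and K: "\<And>ev b. b \<le> k \<Longrightarrow> pw2 (gs ev b) \<int> K"
    and x: "x \<in> bx a h z" and L: "length is \<le> 2"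
  shows "\<bar>Vs is x - pds is (pev k h a (C z)) x\<bar>
    \<le> real (card (cells z)) * real (card (Idx k :: ('n \<Rightarrow> nat) set)) * (real CARD('n) * X * (K ^ CARD('n) / h ^ length is))"
proof -
  have K0: "K \<ge> 0" using K[of 0 True] by (auto simp: pw2_def)
  have term_le: "\<bar>(dc c \<beta> - sh k (hf c) (C z) \<beta>) * tens (Gt h a c \<beta> z) is x\<bar> \<le> real CARD('n) * X * (K ^ CARD('n) / h ^ length is)"
    if c: "c \<in> cells z" and \<beta>: "\<beta> \<in> Idx k" for c \<beta>
  proof (cases "\<forall>i. even (c i) \<longrightarrow> \<beta> i \<le> 1")
    case False
    \<comment> \<open>At nodes only value and slope functions are nonzero, so the exponents not
      covered by the jump bound carry no basis function.\<close>
    then obtain i where "even (c i)" "\<beta> i \<ge> 2" by (auto simp: not_le)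
    then have "tens (Gt h a c \<beta> z) is x = 0" by (intro Gt_zero[of _ i]) (simp add: gp_zero(3))
    then show ?thesis using X(1) h K0 by simp
  next
    case True
    have R': "rho h (\<lambda>x. \<phi> x - pev k h a (C z') x) (lc a h z') \<le> R" if "c \<in> cells z'" for z'
    proof (rule R)
      fix j
      have "2 * z j \<le> c j" "c j \<le> 2 * z j + 2" "2 * z' j \<le> c j" "c j \<le> 2 * z' j + 2" using c that by (auto simp: cells_iff)
      then show "\<bar>z' j - z j\<bar> \<le> 1" by linarith
    qed
    have 1: "\<bar>dc c \<beta> - sh k (hf c) (C z) \<beta>\<bar> \<le> real CARD('n) * X"
      unfolding dc_def by (rule flip_chain[OF \<phi> Cc R' X \<beta> _ finite_class.finite_UNIV own(1) c]) (use True in auto)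
    have 2: "\<bar>tens (Gt h a c \<beta> z) is x\<bar> \<le> K ^ CARD('n) / h ^ length is"
    proof -
      have "\<bar>tens (Gt h a c \<beta> z) is x\<bar> = (\<Prod>j\<in>UNIV. \<bar>Fs c \<beta> j (count_list is j) (x $ j)\<bar>)"
        unfolding Fs_Gt[OF x L, symmetric] by (simp add: tens_def abs_prod)
      also have "\<dots> \<le> (\<Prod>j\<in>(UNIV::'n set). K / h ^ count_list is j)"
      proof (rule prod_mono, rule conjI)
        fix j
        have "min (count_list is j) 2 = count_list is j" using count_le_length[of "is" j] L by linarith
        moreover have "\<bar>gs (even (c j)) (\<beta> j) r t\<bar> \<le> K" for r t using K[of "\<beta> j" "even (c j)"] \<beta> by (simp add: pw2_def Idx_def)
        ultimately show "\<bar>Fs c \<beta> j (count_list is j) (x $ j)\<bar> \<le> K / h ^ count_list is j"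
          using h unfolding Fs_def by (simp add: divide_right_mono)
      qed simp
      also have "\<dots> = K ^ CARD('n) / h ^ (\<Sum>j\<in>UNIV. count_list is j)" by (simp add: prod_dividef power_sum)
      also have "(\<Sum>j\<in>UNIV. count_list is j) = length is" by (simp add: sum_count_set[of "is" UNIV, simplified])
      finally show ?thesis .
    qed
    show ?thesis unfolding abs_mult by (rule mult_mono[OF 1 2]) (use X(1) in auto)
  qed
  have "Vs is x - pds is (pev k h a (C z)) x = (\<Sum>c\<in>cells z. \<Sum>\<beta>\<in>Idx k. (dc c \<beta> - sh k (hf c) (C z) \<beta>) * tens (Gt h a c \<beta> z) is x)"
    unfolding Vs_local[OF x L] pev_local by (simp add: left_diff_distrib sum_subtractf)
  also have "\<bar>\<dots>\<bar> \<le> (\<Sum>c\<in>cells z. \<Sum>\<beta>\<in>Idx k. \<bar>(dc c \<beta> - sh k (hf c) (C z) \<beta>) * tens (Gt h a c \<beta> z) is x\<bar>)"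
    by (rule order_trans[OF sum_abs]) (intro sum_mono sum_abs)
  also have "\<dots> \<le> (\<Sum>c\<in>cells z. \<Sum>\<beta>\<in>(Idx k :: ('n \<Rightarrow> nat) set). real CARD('n) * X * (K ^ CARD('n) / h ^ length is))"
    by (intro sum_mono term_le)
  finally show ?thesis by (simp add: mult.assoc)
qed

end

section \<open>Membership of the spline in the Bell element space\<close>

lemma tensor_poly_coeffs:
  fixes Q :: "'n::finite \<Rightarrow> real poly"
  assumes "\<And>j. degree (Q j) \<le> m j"
  shows "\<exists>c. \<forall>x::real^'n. (\<Prod>j\<in>UNIV. poly (Q j) (x $ j)) = (\<Sum>\<alpha>\<in>{\<alpha>. \<forall>j. \<alpha> j \<le> m j}. c \<alpha> * (\<Prod>j\<in>UNIV. (x $ j) ^ \<alpha> j))"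
proof (intro exI[of _ "\<lambda>\<alpha>. \<Prod>j\<in>UNIV. coeff (Q j) (\<alpha> j)"] allI)
  fix x :: "real^'n"
  have A: "{\<alpha>. \<forall>j. \<alpha> j \<le> m j} = PiE UNIV (\<lambda>j. {..m j})" by (auto simp: PiE_def Pi_def)
  have "poly (Q j) t = (\<Sum>i\<le>m j. coeff (Q j) i * t ^ i)" for j t
    unfolding poly_altdef using assms[of j] by (intro sum.mono_neutral_left) (auto simp: coeff_eq_0)
  then have "(\<Prod>j\<in>UNIV. poly (Q j) (x $ j)) = (\<Prod>j\<in>UNIV. \<Sum>i\<le>m j. coeff (Q j) i * (x $ j) ^ i)" by simp
  also have "\<dots> = (\<Sum>\<alpha>\<in>{\<alpha>. \<forall>j. \<alpha> j \<le> m j}. \<Prod>j\<in>UNIV. coeff (Q j) (\<alpha> j) * (x $ j) ^ \<alpha> j)"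
    unfolding A by (rule prod_sum_PiE) auto
  finally show "(\<Prod>j\<in>UNIV. poly (Q j) (x $ j)) = (\<Sum>\<alpha>\<in>{\<alpha>. \<forall>j. \<alpha> j \<le> m j}. (\<Prod>j\<in>UNIV. coeff (Q j) (\<alpha> j)) * (\<Prod>j\<in>UNIV. (x $ j) ^ \<alpha> j))"
    by (simp add: prod.distrib)
qed

lemma coeffs_sum:
  fixes f :: "'i \<Rightarrow> 'x \<Rightarrow> real" and mon :: "'a \<Rightarrow> 'x \<Rightarrow> real"
  assumes "\<And>i. i \<in> I \<Longrightarrow> \<exists>c. \<forall>x. P x \<longrightarrow> f i x = (\<Sum>\<alpha>\<in>A. c \<alpha> * mon \<alpha> x)"
  shows "\<exists>c. \<forall>x. P x \<longrightarrow> (\<Sum>i\<in>I. f i x) = (\<Sum>\<alpha>\<in>A. c \<alpha> * mon \<alpha> x)"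
proof -
  have "\<forall>i\<in>I. \<exists>c. \<forall>x. P x \<longrightarrow> f i x = (\<Sum>\<alpha>\<in>A. c \<alpha> * mon \<alpha> x)" using assms by blast
  from bchoice[OF this] obtain c where c: "\<forall>i\<in>I. \<forall>x. P x \<longrightarrow> f i x = (\<Sum>\<alpha>\<in>A. c i \<alpha> * mon \<alpha> x)" ..
  have "(\<Sum>i\<in>I. f i x) = (\<Sum>\<alpha>\<in>A. (\<Sum>i\<in>I. c i \<alpha>) * mon \<alpha> x)" if "P x" for x
  proof -
    have "(\<Sum>i\<in>I. f i x) = (\<Sum>i\<in>I. \<Sum>\<alpha>\<in>A. c i \<alpha> * mon \<alpha> x)" using c that by (intro sum.cong) auto
    also have "\<dots> = (\<Sum>\<alpha>\<in>A. \<Sum>i\<in>I. c i \<alpha> * mon \<alpha> x)" by (rule sum.swap)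
    finally show ?thesis by (simp add: sum_distrib_right)
  qed
  then show ?thesis by (intro exI[of _ "\<lambda>\<alpha>. \<Sum>i\<in>I. c i \<alpha>"] allI impI)
qed

lemma degree_pderiv_iter: "degree ((pderiv ^^ r) p) \<le> degree (p :: real poly)"
  by (induction r) (auto intro: order_trans[OF _ diff_le_self] simp: degree_pderiv)

lemma Gt_poly:
  "\<exists>Q. degree Q \<le> max 3 (\<beta> j) \<and> (\<forall>t. Gt h a c \<beta> z j r t = poly Q t)"
proof -
  let ?p = "(pderiv ^^ r) (gp (even (c j)) (\<beta> j) (z j - hf c j))"
  let ?q = "[:- (a $ j / h) - of_int (hf c j), 1 / h:]"
  have "degree (smult (1 / h ^ r) (pcompose ?p ?q)) \<le> degree ?p * degree ?q"
    by (rule order_trans[OF degree_smult_le]) (simp add: degree_pcompose)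
  also have "\<dots> \<le> degree ?p * 1" by (intro mult_left_mono) auto
  also have "\<dots> \<le> max 3 (\<beta> j)" using degree_pderiv_iter[of r "gp (even (c j)) (\<beta> j) (z j - hf c j)"] degree_gp[of "even (c j)" "\<beta> j" "z j - hf c j"] by linarith
  finally have "degree (smult (1 / h ^ r) (pcompose ?p ?q)) \<le> max 3 (\<beta> j)" .
  moreover have "Gt h a c \<beta> z j r t = poly (smult (1 / h ^ r) (pcompose ?p ?q)) t" for t
    unfolding Gt_def by (simp add: poly_pcompose diff_divide_distrib algebra_simps)
  ultimately show ?thesis by blast
qed

context spline_mesh
begin

definition pz :: "('n \<Rightarrow> int) \<Rightarrow> real^'n \<Rightarrow> real" where
  "pz z x = (\<Sum>c\<in>cells z. \<Sum>\<beta>\<in>Idx k. dc c \<beta> * tens (Gt h a c \<beta> z) [] x)"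

lemma pds_pz: "pds is (pz z) x = (\<Sum>c\<in>cells z. \<Sum>\<beta>\<in>Idx k. dc c \<beta> * tens (Gt h a c \<beta> z) is x)"
proof -
  have e: "pz z = (\<lambda>x. \<Sum>c\<in>cells z. \<Sum>\<beta>\<in>Idx k. dc c \<beta> * tens (Gt h a c \<beta> z) [] x)" by (simp add: pz_def fun_eq_iff)
  have 1: "smooth (\<lambda>x. dc c \<beta> * tens (Gt h a c \<beta> z) [] x)"
    "pds is (\<lambda>x. dc c \<beta> * tens (Gt h a c \<beta> z) [] x) = (\<lambda>x. dc c \<beta> * tens (Gt h a c \<beta> z) is x)" for c \<beta>
    using smooth_cmult[OF smooth_Gt(1)[OF h, of a c \<beta> z]] by (simp_all add: smooth_Gt(2)[OF h])
  show ?thesis unfolding e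
    by (subst smooth_sum(2), rule smooth_sum(1)[OF 1(1)], subst smooth_sum(2)[OF 1(1)]) (simp add: 1(2))
qed

text \<open>On the hyperplane the factor in direction \<open>i\<close> is a number, which together
  with \<open>d\<close> is treated as a constant polynomial in that direction.\<close>

lemma Gt_coeffs:
  assumes "\<And>j. j \<noteq> i \<Longrightarrow> max 3 (\<beta> j) \<le> m j"
  shows "\<exists>c'. \<forall>x. x $ i = s \<longrightarrow> d * tens (Gt h a c \<beta> z) is x = (\<Sum>\<alpha>\<in>{\<alpha>. \<alpha> i = 0 \<and> (\<forall>j. j \<noteq> i \<longrightarrow> \<alpha> j \<le> m j)}. c' \<alpha> * (\<Prod>j\<in>UNIV. (x $ j) ^ \<alpha> j))"
proof -
  have "\<forall>j. \<exists>Q. degree Q \<le> max 3 (\<beta> j) \<and> (\<forall>t. Gt h a c \<beta> z j (count_list is j) t = poly Q t)" using Gt_poly by blast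
  from choice[OF this] obtain Q where Q: "\<forall>j. degree (Q j) \<le> max 3 (\<beta> j) \<and> (\<forall>t. Gt h a c \<beta> z j (count_list is j) t = poly (Q j) t)" ..
  let ?Q = "\<lambda>j. if j = i then [:d * poly (Q i) s:] else Q j"
  have "degree (?Q j) \<le> (if j = i then 0 else m j)" for j using Q assms[of j] by (auto intro: order_trans)
  from tensor_poly_coeffs[of ?Q, OF this] obtain c' where
    c': "\<forall>x::real^'n. (\<Prod>j\<in>UNIV. poly (?Q j) (x $ j)) = (\<Sum>\<alpha>\<in>{\<alpha>. \<forall>j. \<alpha> j \<le> (if j = i then 0 else m j)}. c' \<alpha> * (\<Prod>j\<in>UNIV. (x $ j) ^ \<alpha> j))" ..
  have S: "{\<alpha>. \<forall>j. \<alpha> j \<le> (if j = i then 0 else m j)} = {\<alpha>. \<alpha> i = 0 \<and> (\<forall>j. j \<noteq> i \<longrightarrow> \<alpha> j \<le> m j)}"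
    by (auto split: if_splits)
  have "d * tens (Gt h a c \<beta> z) is x = (\<Prod>j\<in>UNIV. poly (?Q j) (x $ j))" if "x $ i = s" for x
  proof -
    have "tens (Gt h a c \<beta> z) is x = (\<Prod>j\<in>UNIV. poly (Q j) (x $ j))" unfolding tens_def using Q by simp
    also have "\<dots> = poly (Q i) s * (\<Prod>j\<in>UNIV - {i}. poly (Q j) (x $ j))" using that by (subst prod.remove[of _ i]) auto
    finally have 1: "d * tens (Gt h a c \<beta> z) is x = d * poly (Q i) s * (\<Prod>j\<in>UNIV - {i}. poly (Q j) (x $ j))" by simp
    have "(\<Prod>j\<in>UNIV. poly (?Q j) (x $ j)) = poly (?Q i) (x $ i) * (\<Prod>j\<in>UNIV - {i}. poly (?Q j) (x $ j))" by (subst prod.remove[of _ i]) auto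
    also have "\<dots> = d * poly (Q i) s * (\<Prod>j\<in>UNIV - {i}. poly (Q j) (x $ j))" by simp
    finally show ?thesis using 1 by simp
  qed
  then show ?thesis using c' unfolding S by auto
qed

lemma pz_Qk: "Qk k (pz z)"
proof -
  have "\<exists>c'. \<forall>x. True \<longrightarrow> dc c \<beta> * tens (Gt h a c \<beta> z) [] x = (\<Sum>\<alpha>\<in>{\<alpha>. \<forall>j. \<alpha> j \<le> k}. c' \<alpha> * (\<Prod>j\<in>UNIV. (x $ j) ^ \<alpha> j))"
    if "\<beta> \<in> Idx k" for c \<beta>
  proof -
    have "\<forall>j. \<exists>Q. degree Q \<le> max 3 (\<beta> j) \<and> (\<forall>t. Gt h a c \<beta> z j 0 t = poly Q t)" using Gt_poly by blast
    from choice[OF this] obtain Q where Q: "\<forall>j. degree (Q j) \<le> max 3 (\<beta> j) \<and> (\<forall>t. Gt h a c \<beta> z j 0 t = poly (Q j) t)" ..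
    have "degree (Q j) \<le> k" for j
    proof -
      have "degree (Q j) \<le> max 3 (\<beta> j)" "\<beta> j \<le> k" using Q that by (auto simp: Idx_def)
      then show ?thesis using k by auto
    qed
    from tensor_poly_coeffs[of Q, OF this] obtain c' where
      "\<forall>x::real^'n. (\<Prod>j\<in>UNIV. poly (Q j) (x $ j)) = (\<Sum>\<alpha>\<in>{\<alpha>. \<forall>j. \<alpha> j \<le> k}. c' \<alpha> * (\<Prod>j\<in>UNIV. (x $ j) ^ \<alpha> j))" ..
    moreover have "tens (Gt h a c \<beta> z) [] x = (\<Prod>j\<in>UNIV. poly (Q j) (x $ j))" for x unfolding tens_def using Q by simp
    ultimately show ?thesis by (intro exI[of _ "\<lambda>\<alpha>. dc c \<beta> * c' \<alpha>"]) (simp add: sum_distrib_left mult.assoc)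
  qed
  then have "\<exists>c'. \<forall>x. True \<longrightarrow> pz z x = (\<Sum>\<alpha>\<in>{\<alpha>. \<forall>j. \<alpha> j \<le> k}. c' \<alpha> * (\<Prod>j\<in>UNIV. (x $ j) ^ \<alpha> j))"
    unfolding pz_def by (intro coeffs_sum)
  then show ?thesis unfolding Qk_def by simp
qed

text \<open>A basis function has nonzero normal derivative on the face only if its exponent in the
  normal direction is 1; total degree at most \<open>k\<close> then leaves at most
  \<open>k - 1\<close> for every other exponent. The cubic Hermite parts fit because
  \<open>k \<ge> 4\<close> gives 3 \<le> k - 1.\<close>

lemma pz_face:
  assumes s: "s = a $ i + h * of_int (z i) \<or> s = a $ i + h * of_int (z i) + h"
  shows "\<exists>c'. \<forall>x. x $ i = s \<longrightarrow> pdx i (pz z) x = (\<Sum>\<alpha>\<in>{\<alpha>. \<alpha> i = 0 \<and> (\<forall>j. \<alpha> j \<le> k - 1)}. c' \<alpha> * (\<Prod>j\<in>UNIV. (x $ j) ^ \<alpha> j))"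
proof -
  let ?A = "{\<alpha>. \<alpha> i = 0 \<and> (\<forall>j. \<alpha> j \<le> k - 1)}"
  have A: "{\<alpha>. \<alpha> i = 0 \<and> (\<forall>j. j \<noteq> i \<longrightarrow> \<alpha> j \<le> k - 1)} = ?A" by auto (metis zero_le)
  have "\<exists>c'. \<forall>x. x $ i = s \<longrightarrow> dc c \<beta> * tens (Gt h a c \<beta> z) [i] x = (\<Sum>\<alpha>\<in>?A. c' \<alpha> * (\<Prod>j\<in>UNIV. (x $ j) ^ \<alpha> j))"
    if "\<beta> \<in> Idx k" for c \<beta>
  proof (cases "dc c \<beta> = 0 \<or> \<beta> i \<noteq> 1")
    case True
    have "dc c \<beta> * tens (Gt h a c \<beta> z) [i] x = 0" if x: "x $ i = s" for x
    proof (cases "dc c \<beta> = 0")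
      case False
      then have b: "\<beta> i \<noteq> 1" using True by simp
      let ?\<zeta> = "z i - hf c i"
      have "(s - a $ i) / h - of_int (hf c i) = of_int ?\<zeta> \<or> (s - a $ i) / h - of_int (hf c i) = of_int ?\<zeta> + 1"
        using s h by (auto simp: field_simps)
      then have "poly (pderiv (gp (even (c i)) (\<beta> i) ?\<zeta>)) ((s - a $ i) / h - of_int (hf c i)) = 0"
        using gp_normal[OF b, of "even (c i)" ?\<zeta>] by metis
      then have "Gt h a c \<beta> z i (count_list [i] i) (x $ i) = 0" using x by (simp add: Gt_def)
      then have "tens (Gt h a c \<beta> z) [i] x = 0" unfolding tens_def by (intro prod_zero bexI[of _ i]) auto
      then show ?thesis by simp
    qed simp
    then show ?thesis by (intro exI[of _ "\<lambda>_. 0"]) simp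
  next
    case False
    then have "sum \<beta> UNIV \<le> k" using dc_deg[of \<beta> c] by (meson not_le)
    have "max 3 (\<beta> j) \<le> k - 1" if "j \<noteq> i" for j
    proof -
      have "(\<Sum>l\<in>{i, j}. \<beta> l) \<le> sum \<beta> UNIV" by (rule sum_mono2) auto
      then show ?thesis using that False \<open>sum \<beta> UNIV \<le> k\<close> k by simp arith
    qed
    from Gt_coeffs[of i \<beta> "\<lambda>_. k - 1", OF this] show ?thesis unfolding A by blast
  qed
  then have "\<exists>c'. \<forall>x. x $ i = s \<longrightarrow> pds [i] (pz z) x = (\<Sum>\<alpha>\<in>?A. c' \<alpha> * (\<Prod>j\<in>UNIV. (x $ j) ^ \<alpha> j))"
    unfolding pds_pz by (intro coeffs_sum)
  then show ?thesis by simp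
qed

lemma pz_VT: "VT k (a + h *\<^sub>R vz z) h (pz z)"
  unfolding VT_def
proof (intro conjI allI ballI pz_Qk)
  fix i s assume "s \<in> {(a + h *\<^sub>R vz z) $ i, (a + h *\<^sub>R vz z) $ i + h}"
  then have "s = a $ i + h * of_int (z i) \<or> s = a $ i + h * of_int (z i) + h" by auto
  from pz_face[of s i z, OF this] show "\<exists>c. \<forall>x\<in>cube (a + h *\<^sub>R vz z) h. x $ i = s \<longrightarrow>
          pdx i (pz z) x = (\<Sum>\<alpha>\<in>{\<alpha>. \<alpha> i = 0 \<and> (\<forall>j. \<alpha> j \<le> k - 1)}. c \<alpha> * (\<Prod>j\<in>UNIV. (x $ j) ^ \<alpha> j))" by blast
qed

text \<open>The support is covered by the lattice cubes adjacent to the cell, and for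
  \<open>c \<in> Nc\<close> all of these belong to the mesh.\<close>

lemma Fs_H20:
  assumes K: "\<And>ev b. b \<le> k \<Longrightarrow> pw2 (gs ev b) \<int> K" and c: "c \<in> Nc" and \<beta>: "\<beta> \<in> Idx k"
  shows "H20 \<Omega> (tens (Fs c \<beta>) [])" "length is \<le> 2 \<Longrightarrow> is_wd \<Omega> is (tens (Fs c \<beta>) []) (tens (Fs c \<beta>) is)"
proof -
  \<comment> \<open>In a node direction the support spans the two intervals at the node, in an
    interval direction only the interval itself.\<close>
  define lo hi :: "real^'n" where "lo = (\<chi> j. a $ j + h * (of_int (hf c j) - (if even (c j) then 1 else 0)))"
    and "hi = (\<chi> j. a $ j + h * (of_int (hf c j) + 1))"
  have F: "pw2 (Fs c \<beta> j) {t. (t - a $ j) / h - of_int (hf c j) \<in> \<int>} (K * max 1 (1 / h) ^ 3)" for j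
    unfolding Fs_def[abs_def] by (rule pw2_affine[OF K h]) (use \<beta> in \<open>simp add: Idx_def\<close>)
  have l: "lo $ j + h \<le> hi $ j" for j using h by (simp add: lo_def hi_def algebra_simps)
  have zero: "Fs c \<beta> j r t = 0" if "t < lo $ j \<or> t > hi $ j" for j r t
  proof -
    let ?\<tau> = "(t - a $ j) / h - of_int (hf c j)"
    have "?\<tau> < - (if even (c j) then 1 else 0) \<or> ?\<tau> > 1"
      using that h by (auto simp: lo_def hi_def field_simps)
    then have "gs (even (c j)) (\<beta> j) r ?\<tau> = 0" by (cases "even (c j)") (auto simp: gs_out)
    then show ?thesis by (simp add: Fs_def)
  qed
  have "box lo hi \<subseteq> (\<Union>z\<in>Mz. lc a h z)"
  proof
    fix x assume x: "x \<in> box lo hi"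
    define z where "z j = \<lfloor>(x $ j - a $ j) / h\<rfloor>" for j
    have fl: "of_int (z j) \<le> (x $ j - a $ j) / h" "(x $ j - a $ j) / h < of_int (z j) + 1" for j
      unfolding z_def by linarith+
    have "x \<in> lc a h z" unfolding mem_lc
    proof
      fix j show "a $ j + h * of_int (z j) \<le> x $ j \<and> x $ j \<le> a $ j + h * of_int (z j) + h"
        using fl[of j] h by (simp add: field_simps)
    qed
    moreover have "c \<in> cells z" unfolding cells_div
    proof
      fix j
      have "lo $ j < x $ j" "x $ j < hi $ j" using x by (auto simp: mem_box_cart)
      then have "of_int (hf c j) - (if even (c j) then 1 else 0) < (x $ j - a $ j) / h" "(x $ j - a $ j) / h < of_int (hf c j) + 1"
        using h by (auto simp: lo_def hi_def field_simps)
      then show "(even (c j) \<and> z j - hf c j \<in> {-1, 0}) \<or> (odd (c j) \<and> z j = hf c j)"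
        using fl[of j] by (cases "even (c j)") (simp_all, linarith+)
    qed
    ultimately show "x \<in> (\<Union>z\<in>Mz. lc a h z)" using c by (auto simp: Nc_def)
  qed
  then have "box lo hi \<subseteq> \<Omega>" unfolding dom_eq by (rule interior_maximal) (rule open_box)
  note T = tensor_H20[where F = "Fs c \<beta>" and l = h, OF \<Omega> F l h this zero]
  show "H20 \<Omega> (tens (Fs c \<beta>) [])" by (rule T(1))
  show "length is \<le> 2 \<Longrightarrow> is_wd \<Omega> is (tens (Fs c \<beta>) []) (tens (Fs c \<beta>) is)" by (rule T(2))
qed

lemma Vs_H20:
  assumes K: "\<And>ev b. b \<le> k \<Longrightarrow> pw2 (gs ev b) \<int> K"
  shows "H20 \<Omega> (Vs [])" "length is \<le> 2 \<Longrightarrow> is_wd \<Omega> is (Vs []) (Vs is)"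
proof -
  let ?I = "Nc \<times> (Idx k :: ('n \<Rightarrow> nat) set)"
  have V: "Vs is = (\<lambda>x. \<Sum>i\<in>?I. dc (fst i) (snd i) * tens (Fs (fst i) (snd i)) is x)" for "is"
    by (simp add: Vs_def fun_eq_iff sum.cartesian_product case_prod_unfold)
  have "finite ?I" by (simp add: finite_Nc)
  from H20_sum[OF \<Omega> this, of "\<lambda>i. tens (Fs (fst i) (snd i)) []" "\<lambda>i is. tens (Fs (fst i) (snd i)) is" "\<lambda>i. dc (fst i) (snd i)"]
  show "H20 \<Omega> (Vs [])" "length is \<le> 2 \<Longrightarrow> is_wd \<Omega> is (Vs []) (Vs is)"
    unfolding V using Fs_H20[OF K] by auto
qed

lemma Vs_Vh:
  assumes K: "\<And>ev b. b \<le> k \<Longrightarrow> pw2 (gs ev b) \<int> K"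
  shows "Vh k \<Omega> h \<T> (Vs [])"
  unfolding Vh_def
proof (intro conjI ballI)
  show "H20 \<Omega> (Vs [])" by (rule Vs_H20[OF K])
  fix t assume "t \<in> \<T>"
  then obtain z where z: "z \<in> Mz" "t = a + h *\<^sub>R vz z" by (rule mesh_index)
  have i: "interior (cube t h) = bx a h z" unfolding bx_interior lc_def z(2) ..
  have "AE x in lebesgue_on (interior (cube t h)). Vs [] x = pz z x"
    unfolding i by (rule AE_I2) (simp add: Vs_local pz_def)
  then show "\<exists>p. VT k t h p \<and> (AE x in lebesgue_on (interior (cube t h)). Vs [] x = p x)"
    using pz_VT[of z] z(2) by blast
qed

section \<open>Global error of the quasi-interpolant\<close>

definition patch :: "('n \<Rightarrow> int) \<Rightarrow> ('n \<Rightarrow> int) set" where "patch z = PiE UNIV (\<lambda>j. {z j - 1..z j + 1})"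

lemma patch: "finite (patch z)" "card (patch z) = 3 ^ CARD('n)" "z' \<in> patch z \<longleftrightarrow> (\<forall>j. \<bar>z' j - z j\<bar> \<le> 1)"
proof -
  show "finite (patch z)" unfolding patch_def by (intro finite_PiE) auto
  show "card (patch z) = 3 ^ CARD('n)" unfolding patch_def by (subst card_PiE) auto
  have "m \<in> {l - 1..l + 1} \<longleftrightarrow> \<bar>m - l\<bar> \<le> 1" for m l :: int by auto
  then show "z' \<in> patch z \<longleftrightarrow> (\<forall>j. \<bar>z' j - z j\<bar> \<le> 1)" unfolding patch_def PiE_def Pi_def by simp
qed

lemma card_cells: "card (cells z) = 3 ^ CARD('n)" for z :: "'n \<Rightarrow> int"
  unfolding cells_def by (subst card_PiE) auto

lemma card_Idx: "card (Idx k :: ('n \<Rightarrow> nat) set) = (k + 1) ^ CARD('n)"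
  unfolding Idx_PiE by (subst card_PiE) auto

text \<open>The pointwise bound on a cube involves the errors on the 3^n cubes of its patch, and in
  the sum over the mesh each error is counted at most 3^n times. A test function stands in for the
  approximated function, so that the errors are classical integrals.\<close>

lemma Vs_l2:
  assumes \<phi>: "test_fun \<Omega> \<phi>" and Cc: "Cc > 0" "\<And>(z :: 'n \<Rightarrow> int) c. (\<And>j. z j \<in> {-1, 0}) \<Longrightarrow>
      (\<Sum>\<alpha>\<in>Idx k. (c \<alpha>)\<^sup>2) \<le> Cc * (\<integral>x. indicator (lc 0 1 z) x * (pev k 1 0 c x)\<^sup>2 \<partial>lborel)"
    and K: "\<And>ev b. b \<le> k \<Longrightarrow> pw2 (gs ev b) \<int> K" and L: "length is \<le> 2"
  defines "\<rho> \<equiv> \<lambda>z. rho h (\<lambda>x. \<phi> x - pev k h a (C z) x) (lc a h z)"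
  shows "(\<Sum>z\<in>Mz. (l2 (lebesgue_on (bx a h z)) (\<lambda>x. Vs is x - pds is (pev k h a (C z)) x))\<^sup>2) * h ^ (2 * length is)
    \<le> (3 ^ CARD('n) * (real k + 1) ^ CARD('n) * real CARD('n) * K ^ CARD('n))\<^sup>2 * (16 * Cc) * 3 ^ CARD('n) * (\<Sum>z\<in>Mz. \<rho> z)"
proof -
  let ?e = "\<lambda>z. l2 (lebesgue_on (bx a h z)) (\<lambda>x. Vs is x - pds is (pev k h a (C z)) x)"
  define K0 where "K0 = 3 ^ CARD('n) * (real k + 1) ^ CARD('n) * real CARD('n) * K ^ CARD('n)"
  have \<rho>0: "\<rho> z \<ge> 0" for z unfolding \<rho>_def by (rule rho_nonneg[OF h])
  \<comment> \<open>Outside cubes carry the zero polynomial and do not meet \<Omega>, off which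
    \<phi> vanishes with all derivatives. This is how the boundary condition enters the
    estimate.\<close>
  have out: "\<rho> z = 0" if "z \<notin> Mz" for z
  proof -
    have "pev k h a (C z) x = 0" for x by (simp add: Cout[OF that] pev_def)
    then have "\<rho> z = rho h \<phi> (lc a h z)" by (simp add: \<rho>_def)
    moreover have "indicator (lc a h z) x * (pds js \<phi> x)\<^sup>2 = 0" for js x
      using lc_outside[OF that] pds_test_outside[OF \<phi>, of x js] by (auto simp: indicator_def)
    ultimately show ?thesis by (simp add: rho_def)
  qed
  have loc: "(?e z)\<^sup>2 * h ^ (2 * length is) \<le> K0\<^sup>2 * (16 * Cc) * (\<Sum>z'\<in>patch z. \<rho> z')" if z: "z \<in> Mz" for z
  proof -
    define R where "R = (\<Sum>z'\<in>patch z. \<rho> z')"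
    \<comment> \<open>Solves the relation between coefficient jumps and errors required by
      \<open>flip_chain\<close>; its power of \<open>h\<close> cancels when the pointwise bound is
      squared and integrated over a cube.\<close>
    define X where "X = sqrt (16 * Cc * R / h ^ CARD('n))"
    have R0: "R \<ge> 0" unfolding R_def by (intro sum_nonneg \<rho>0)
    have X: "X \<ge> 0" "h ^ CARD('n) * X\<^sup>2 = 16 * Cc * R" using R0 Cc(1) h by (auto simp: X_def)
    have Rz: "rho h (\<lambda>x. \<phi> x - pev k h a (C z') x) (lc a h z') \<le> R" if "\<And>j. \<bar>z' j - z j\<bar> \<le> 1" for z'
    proof -
      have "\<rho> z' \<le> R" unfolding R_def by (rule member_le_sum) (use that patch \<rho>0 in auto)
      then show ?thesis by (simp add: \<rho>_def)
    qed
    define B where "B = K0 * X / h ^ length is"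
    have pw: "\<bar>Vs is x - pds is (pev k h a (C z)) x\<bar> \<le> B" if "x \<in> bx a h z" for x
      using Vs_pointwise[OF test_funD(1)[OF \<phi>] Cc Rz X K that L]
      by (simp add: B_def K0_def card_cells card_Idx algebra_simps)
    let ?M = "lebesgue_on (bx a h z)"
    have fin: "finite_measure ?M" by (rule finite_measure_on_bounded[OF open_bx bounded_bx])
    have sB: "sqint ?M (\<lambda>_. B)" by (rule sqint_bounded[OF fin _ order_refl]) simp
    have "sqint ?M (\<lambda>x. Vs is x - pds is (pev k h a (C z)) x)"
    proof (rule sqint_diff)
      show "sqint ?M (Vs is)"
        by (rule lebesgue_on_sub(3)[OF open_bx \<Omega>(1) bx_subset[OF z] is_wd_sqint[OF Vs_H20(2)[OF K L]]])
      show "sqint ?M (pds is (pev k h a (C z)))" using h by (intro smooth_sqint_on open_bx bounded_bx smooth_pev(1)) auto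
    qed
    then have "(\<lambda>x. Vs is x - pds is (pev k h a (C z)) x) \<in> borel_measurable ?M" by (simp add: sqint_def)
    moreover have "\<bar>Vs is x - pds is (pev k h a (C z)) x\<bar> \<le> \<bar>B\<bar>" if "x \<in> space ?M" for x
      using pw[of x] that by (simp add: order_trans[OF _ abs_ge_self])
    ultimately have "?e z \<le> l2 ?M (\<lambda>_. B)" by (rule l2_mono(2)[OF sB])
    then have "(?e z)\<^sup>2 \<le> (l2 ?M (\<lambda>_. B))\<^sup>2" by (intro power_mono l2_nonneg)
    also have "\<dots> = B\<^sup>2 * h ^ CARD('n)" unfolding l2_sq using measure_bx[OF h, of a z] open_bx[of a h z]
      by (simp add: measure_restrict_space)
    finally have "(?e z)\<^sup>2 * h ^ (2 * length is) \<le> B\<^sup>2 * h ^ CARD('n) * h ^ (2 * length is)" using h by (intro mult_right_mono) auto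
    also have "\<dots> = K0\<^sup>2 * (h ^ CARD('n) * X\<^sup>2)"
      using h by (simp add: B_def power_divide power_mult_distrib power_even_eq)
    finally show ?thesis unfolding X(2) R_def by (simp add: mult.assoc)
  qed
  have "(\<Sum>z\<in>Mz. (?e z)\<^sup>2) * h ^ (2 * length is) \<le> (\<Sum>z\<in>Mz. K0\<^sup>2 * (16 * Cc) * (\<Sum>z'\<in>patch z. \<rho> z'))"
    unfolding sum_distrib_right by (intro sum_mono loc)
  also have "\<dots> = K0\<^sup>2 * (16 * Cc) * (\<Sum>z\<in>Mz. \<Sum>z'\<in>patch z. \<rho> z')" by (simp add: sum_distrib_left)
  also have "\<dots> \<le> K0\<^sup>2 * (16 * Cc) * (3 ^ CARD('n) * (\<Sum>z\<in>Mz. \<rho> z))"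
  proof (rule mult_left_mono)
    have "(\<Sum>z'\<in>patch z. \<rho> z') = (\<Sum>z'\<in>Mz. if z' \<in> patch z then \<rho> z' else 0)" for z
    proof -
      have "(\<Sum>z'\<in>patch z. \<rho> z') = (\<Sum>z'\<in>Mz \<inter> patch z. \<rho> z')"
        by (rule sum.mono_neutral_right) (use patch(1) out in auto)
      then show ?thesis by (simp add: sum.inter_restrict[OF finite_Mz])
    qed
    then have "(\<Sum>z\<in>Mz. \<Sum>z'\<in>patch z. \<rho> z') = (\<Sum>z\<in>Mz. \<Sum>z'\<in>Mz. if z' \<in> patch z then \<rho> z' else 0)" by simp
    also have "\<dots> = (\<Sum>z'\<in>Mz. \<Sum>z\<in>Mz. if z' \<in> patch z then \<rho> z' else 0)" by (rule sum.swap)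
    \<comment> \<open>Being neighbours is symmetric, so each \<open>z'\<close> lies in at most 3^n
      patches.\<close>
    also have "\<dots> \<le> (\<Sum>z'\<in>Mz. 3 ^ CARD('n) * \<rho> z')"
    proof (rule sum_mono)
      fix z'
      have sym: "z' \<in> patch z \<longleftrightarrow> z \<in> patch z'" for z unfolding patch by (simp add: abs_minus_commute)
      have "(\<Sum>z\<in>Mz. if z' \<in> patch z then \<rho> z' else 0) = (\<Sum>z\<in>Mz \<inter> patch z'. \<rho> z')"
        unfolding sym by (rule sum.inter_restrict[OF finite_Mz, symmetric])
      also have "\<dots> \<le> (\<Sum>z\<in>patch z'. \<rho> z')" by (rule sum_mono2) (use patch(1) \<rho>0 in auto)
      finally show "(\<Sum>z\<in>Mz. if z' \<in> patch z then \<rho> z' else 0) \<le> 3 ^ CARD('n) * \<rho> z'" by (simp add: patch(2))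
    qed
    finally show "(\<Sum>z\<in>Mz. \<Sum>z'\<in>patch z. \<rho> z') \<le> 3 ^ CARD('n) * (\<Sum>z\<in>Mz. \<rho> z)" by (simp add: sum_distrib_left)
  qed (use Cc(1) in simp)
  finally show ?thesis unfolding K0_def by (simp only: mult.assoc)
qed

end

section \<open>Approximation and error estimates\<close>

lemma integral_lc_bx:
  fixes f :: "real^'n::finite \<Rightarrow> real"
  assumes f: "f \<in> borel_measurable borel"
  shows "(\<integral>x. indicator (lc a h z) x * f x \<partial>lborel) = (LINT x|lebesgue_on (bx a h z). f x)"
proof -
  have bb: "bx a h z \<in> sets borel" by (rule borel_open[OF open_bx])
  have "negligible (lc a h z - bx a h z)" unfolding lc_def cube_def bx_def by (rule negligible_frontier_interval)
  then have "AE x in lebesgue. x \<notin> lc a h z - bx a h z" by (intro AE_not_in) (simp add: negligible_iff_null_sets)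
  then have ae: "AE x in lborel. x \<notin> lc a h z - bx a h z" by (simp add: AE_completion_iff)
  have sub: "bx a h z \<subseteq> lc a h z" unfolding bx_interior by (rule interior_subset)
  have "(\<integral>x. indicator (lc a h z) x * f x \<partial>lborel) = (\<integral>x. indicator (bx a h z) x * f x \<partial>lborel)"
  proof (rule integral_cong_AE)
    show "AE x in lborel. indicator (lc a h z) x * f x = indicator (bx a h z) x * f x"
      using ae by eventually_elim (use sub in \<open>auto simp: indicator_def\<close>)
  qed (use f bb in auto)
  then show ?thesis using lebesgue_on_integral_lborel(1)[OF bb f] by simp
qed

lemma sum_sq_le: "(x + y)\<^sup>2 \<le> 2 * x\<^sup>2 + 2 * (y :: real)\<^sup>2"
  using sum_squares_bound[of x y] by (simp add: power2_sum)

lemma l2_sq_triangle: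
  assumes "sqint M f" "sqint M g" "sqint M k"
  shows "(l2 M (\<lambda>x. f x - k x))\<^sup>2 \<le> 2 * (l2 M (\<lambda>x. f x - g x))\<^sup>2 + 2 * (l2 M (\<lambda>x. g x - k x))\<^sup>2"
  by (rule order_trans[OF power_mono[OF l2_triangle_diff[OF assms] l2_nonneg] sum_sq_le])

text \<open>The constant is fixed before \<open>h\<close>, the mesh, \<open>m\<close> and
  \<open>w\<close>, since it is used for the solution and for the dual problem. The local
  polynomials approximate \<open>w\<close> itself, but their coefficients are compared through test
  functions tending to \<open>w\<close>, which the final limit removes.\<close>

theorem spline_approximation:
  fixes \<Omega> :: "(real^'n::finite) set"
  assumes \<Omega>: "open \<Omega>" "bounded \<Omega>" and k: "k \<ge> 4"
  shows "\<exists>A\<ge>0. \<forall>h \<T> m w. cube_mesh \<Omega> h \<T> \<and> 2 \<le> m \<and> m \<le> k + 1 \<and> Hm m \<Omega> w \<and> H20 \<Omega> w \<longrightarrow>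
    (\<exists>v. Vh k \<Omega> h \<T> v \<and> semi 2 \<Omega> (\<lambda>x. w x - v x) \<le> A * h ^ (m - 2) * semi m \<Omega> w)"
proof -
  obtain K where K: "\<And>ev b. b \<le> k \<Longrightarrow> pw2 (gs ev b) \<int> K" using pw2_gs_uniform[of k] by blast
  obtain Cc where Cc: "Cc > 0" "\<And>(z :: 'n \<Rightarrow> int) c. (\<And>j. z j \<in> {-1, 0}) \<Longrightarrow>
      (\<Sum>\<alpha>\<in>Idx k. (c \<alpha>)\<^sup>2) \<le> Cc * (\<integral>x. indicator (lc 0 1 z) x * (pev k 1 0 c x)\<^sup>2 \<partial>lborel)"
  proof (rule coeff_bound[where k = k and 'n = 'n])
    fix C :: real assume 1: "C > 0" and 2: "\<And>(z :: 'n \<Rightarrow> int) c. (\<And>j. z j \<in> {-1, 0}) \<Longrightarrow>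
      (\<Sum>\<alpha>\<in>Idx k. (c \<alpha>)\<^sup>2) \<le> C * (\<integral>x. indicator (lc 0 1 z) x * (pev k 1 0 c x)\<^sup>2 \<partial>lborel)"
    show thesis by (rule that[OF 1]) (rule 2)
  qed
  \<comment> \<open>Bounds the iterated Poincare constant for all orders at once: the base is at
    least 1 and at most \<open>k + 1\<close> steps are made.\<close>
  define G where "G = (real CARD('n) * 2 ^ CARD('n) / 2) ^ (k + 1)"
  define K2 where "K2 = (3 ^ CARD('n) * (real k + 1) ^ CARD('n) * real CARD('n) * K ^ CARD('n))\<^sup>2 * (16 * Cc) * 3 ^ CARD('n)"
  define N1 N2 where "N1 = real (card {is :: 'n list. length is \<le> 2})" and "N2 = real (card {is :: 'n list. length is = 2})"
  define A2 where "A2 = N2 * (2 * G + 4 * K2 * N1 * G)"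
  have n1: "real CARD('n) * 2 ^ CARD('n) / 2 \<ge> 1"
  proof -
    have "(1::real) \<le> real CARD('n)" using zero_less_card_finite[where 'a = 'n] by linarith
    moreover have "(2::real) ^ 1 \<le> 2 ^ CARD('n)" by (rule power_increasing) (use zero_less_card_finite[where 'a = 'n] in auto)
    ultimately have "1 * 2 \<le> real CARD('n) * 2 ^ CARD('n)" by (intro mult_mono) auto
    then show ?thesis by simp
  qed
  have G0: "G \<ge> 0" and K20: "K2 \<ge> 0" and N0: "N1 \<ge> 0" "N2 \<ge> 0" using Cc(1) by (auto simp: G_def K2_def N1_def N2_def)
  have A20: "A2 \<ge> 0" unfolding A2_def using G0 K20 N0 by simp
  have "\<exists>v. Vh k \<Omega> h \<T> v \<and> semi 2 \<Omega> (\<lambda>x. w x - v x) \<le> sqrt A2 * h ^ (m - 2) * semi m \<Omega> w"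
    if mesh: "cube_mesh \<Omega> h \<T>" and m: "2 \<le> m" "m \<le> k + 1" and Hm: "Hm m \<Omega> w" and H: "H20 \<Omega> w" for h \<T> m w
  proof -
    have h: "h > 0" and "\<T> \<noteq> {}" using mesh by (auto simp: cube_mesh_def)
    then obtain a where a: "a \<in> \<T>" by blast
    define Mz where "Mz = {z. a + h *\<^sub>R vz z \<in> \<T>}"
    have bxs: "bx a h z \<subseteq> \<Omega>" if "z \<in> Mz" for z
    proof -
      have "bx a h z \<subseteq> interior (\<Union>t\<in>\<T>. cube t h)"
        using that unfolding Mz_def bx_interior lc_def by (intro interior_mono) blast
      then show ?thesis using mesh by (simp add: cube_mesh_def)
    qed
    have wds: "sqint (lebesgue_on \<Omega>) (wd \<Omega> is w)" if "length is \<le> m" for "is" using is_wd_sqint[OF Hm_wd[OF Hm that]] .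
    let ?S = "\<lambda>z. \<Sum>is | length is = m. (l2 (lebesgue_on (bx a h z)) (wd \<Omega> is w))\<^sup>2"
    define P where "P z c \<longleftrightarrow> (\<forall>\<alpha>. m \<le> sum \<alpha> UNIV \<longrightarrow> c \<alpha> = 0) \<and> (\<forall>j\<le>m. (\<Sum>is | length is = j. (l2 (lebesgue_on (bx a h z)) (\<lambda>x. wd \<Omega> is w x - pds is (pev k h a c) x))\<^sup>2)
       \<le> (real CARD('n) * 2 ^ CARD('n) / 2 * h\<^sup>2) ^ (m - j) * ?S z)" for z c
    have ex: "\<exists>c. P z c" if z: "z \<in> Mz" for z
    proof -
      have side: "(a + h *\<^sub>R vz z + h *\<^sub>R One) $ i - (a + h *\<^sub>R vz z) $ i = h" for i by (simp add: One_nth)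
      have w1: "sqint (lebesgue_on (box (a + h *\<^sub>R vz z) (a + h *\<^sub>R vz z + h *\<^sub>R One))) w"
        using lebesgue_on_sub(3)[OF open_bx \<Omega>(1) bxs[OF z] Hm_sqint[OF Hm]] by (simp add: bx_def)
      have w2: "is_wd (box (a + h *\<^sub>R vz z) (a + h *\<^sub>R vz z + h *\<^sub>R One)) is w (wd \<Omega> is w)" if "length is \<le> m" for "is"
        using is_wd_sub[OF open_bx \<Omega>(1) bxs[OF z] Hm_wd[OF Hm that]] by (simp add: bx_def)
      have mk: "m \<le> Suc k" using m by simp
      obtain c where 1: "\<And>\<alpha>. m \<le> sum \<alpha> UNIV \<Longrightarrow> c \<alpha> = 0"
        and 2: "\<And>j. j \<le> m \<Longrightarrow> (\<Sum>is | length is = j. (l2 (lebesgue_on (box (a + h *\<^sub>R vz z) (a + h *\<^sub>R vz z + h *\<^sub>R One))) (\<lambda>x. wd \<Omega> is w x - pds is (pev k h a c) x))\<^sup>2)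
         \<le> (real CARD('n) * 2 ^ CARD('n) / 2 * h\<^sup>2) ^ (m - j) * (\<Sum>is | length is = m. (l2 (lebesgue_on (box (a + h *\<^sub>R vz z) (a + h *\<^sub>R vz z + h *\<^sub>R One))) (wd \<Omega> is w))\<^sup>2)"
        by (rule bramble_hilbert[where o' = a and U = "\<lambda>is. wd \<Omega> is w", OF h side mk w1 w2]) (assumption, rule that)
      show ?thesis unfolding P_def by (intro exI[of _ c] conjI allI impI) (rule 1, assumption, unfold bx_def, rule 2, assumption)
    qed
    have "\<forall>z. \<exists>c. (z \<in> Mz \<longrightarrow> P z c) \<and> (z \<notin> Mz \<longrightarrow> c = (\<lambda>_. 0))"
    proof
      fix z show "\<exists>c. (z \<in> Mz \<longrightarrow> P z c) \<and> (z \<notin> Mz \<longrightarrow> c = (\<lambda>_. 0))"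
        using ex[of z] by (cases "z \<in> Mz") auto
    qed
    from choice[OF this] obtain C where C: "\<forall>z. (z \<in> Mz \<longrightarrow> P z (C z)) \<and> (z \<notin> Mz \<longrightarrow> C z = (\<lambda>_. 0))" ..
    have C1: "C z \<alpha> = 0" if "z \<in> Mz" "m \<le> sum \<alpha> UNIV" for z \<alpha> using C that unfolding P_def by blast
    have C2: "(\<Sum>is | length is = j. (l2 (lebesgue_on (bx a h z)) (\<lambda>x. wd \<Omega> is w x - pds is (pev k h a (C z)) x))\<^sup>2)
       \<le> (real CARD('n) * 2 ^ CARD('n) / 2 * h\<^sup>2) ^ (m - j) * ?S z" if "z \<in> Mz" "j \<le> m" for z j
    proof -
      have "P z (C z)" using C that(1) by blast
      from this[unfolded P_def, THEN conjunct2, rule_format, OF that(2)] show ?thesis .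
    qed
    \<comment> \<open>The local polynomials have degree below \<open>m \<le> k + 1\<close>, hence
      total degree at most \<open>k\<close>.\<close>
    interpret spline_mesh \<Omega> h \<T> a k C Mz
    proof
      show "C z \<alpha> = 0" if "k < sum \<alpha> UNIV" for z \<alpha>
      proof -
        have "m \<le> sum \<alpha> UNIV" using that m by linarith
        then show ?thesis using C C1 by (cases "z \<in> Mz") auto
      qed
      show "C z = (\<lambda>_. 0)" if "z \<notin> Mz" for z using C that by blast
    qed (use \<Omega> mesh a k in \<open>auto simp: Mz_def\<close>)
    let ?M = "lebesgue_on \<Omega>" let ?B = "\<lambda>z. lebesgue_on (bx a h z)"
    let ?p = "\<lambda>z. pev k h a (C z)"
    have sub: "sqint (?B z) f" if "sqint ?M f" "z \<in> Mz" for f z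
      by (rule lebesgue_on_sub(3)[OF open_bx \<Omega>(1) bxs[OF that(2)] that(1)])
    have h0: "h \<noteq> 0" using h by simp
    have sp: "sqint (?B z) (pds is (?p z))" for z "is" by (intro smooth_sqint_on open_bx bounded_bx smooth_pev(1) h0)
    define E where "E is = (\<Sum>z\<in>Mz. (l2 (?B z) (\<lambda>x. wd \<Omega> is w x - pds is (?p z) x))\<^sup>2)" for "is"
    define Sm where "Sm = (semi m \<Omega> w)\<^sup>2"
    have Sm0: "Sm \<ge> 0" by (simp add: Sm_def)
    have SS: "(\<Sum>z\<in>Mz. ?S z) = Sm"
    proof -
      have "(\<Sum>z\<in>Mz. ?S z) = (\<Sum>is | length is = m. \<Sum>z\<in>Mz. (l2 (?B z) (wd \<Omega> is w))\<^sup>2)" by (rule sum.swap)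
      also have "\<dots> = (\<Sum>is | length is = m. (norm0 \<Omega> (wd \<Omega> is w))\<^sup>2)"
        by (rule sum.cong[OF refl]) (simp add: norm0_eq_l2 l2_cover[OF wds])
      finally show ?thesis by (simp add: Sm_def semi_sq)
    qed
    \<comment> \<open>The weight belonging to the order of the derivative and the approximation rate
      combine to the same power \<open>h ^ (2 * m)\<close> for all orders.\<close>
    have E: "h ^ (2 * length is) * E is \<le> G * h ^ (2 * m) * Sm" if L: "length is \<le> 2" for "is"
    proof -
      let ?j = "length is"
      have jm: "?j \<le> m" using L m by linarith
      have "E is \<le> (\<Sum>z\<in>Mz. \<Sum>js | length js = ?j. (l2 (?B z) (\<lambda>x. wd \<Omega> js w x - pds js (?p z) x))\<^sup>2)"
        unfolding E_def by (intro sum_mono member_le_sum) (auto simp: finite_lists_length)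
      also have "\<dots> \<le> (\<Sum>z\<in>Mz. (real CARD('n) * 2 ^ CARD('n) / 2 * h\<^sup>2) ^ (m - ?j) * ?S z)"
        by (intro sum_mono C2 jm)
      also have "\<dots> = (real CARD('n) * 2 ^ CARD('n) / 2 * h\<^sup>2) ^ (m - ?j) * Sm"
        unfolding SS[symmetric] by (simp only: sum_distrib_left)
      also have "\<dots> \<le> (G * h ^ (2 * (m - ?j))) * Sm"
      proof (rule mult_right_mono[OF _ Sm0])
        have "(real CARD('n) * 2 ^ CARD('n) / 2) ^ (m - ?j) \<le> G"
          unfolding G_def by (rule power_increasing[OF _ n1]) (use m in linarith)
        then show "(real CARD('n) * 2 ^ CARD('n) / 2 * h\<^sup>2) ^ (m - ?j) \<le> G * h ^ (2 * (m - ?j))"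
          unfolding power_mult_distrib[of _ "h\<^sup>2"] power_mult using h by (intro mult_right_mono) auto
      qed
      finally have "h ^ (2 * ?j) * E is \<le> h ^ (2 * ?j) * (G * h ^ (2 * (m - ?j)) * Sm)" using h by (intro mult_left_mono) auto
      also have "\<dots> = G * h ^ (2 * ?j + 2 * (m - ?j)) * Sm" by (simp add: power_add)
      also have "2 * ?j + 2 * (m - ?j) = 2 * m" using jm by simp
      finally show ?thesis .
    qed
    obtain \<phi> :: "nat \<Rightarrow> real^'n \<Rightarrow> real" where t: "\<And>n. test_fun \<Omega> (\<phi> n)"
      and l: "\<And>is. length is \<le> 2 \<Longrightarrow> (\<lambda>n. l2 ?M (\<lambda>x. pds is (\<phi> n) x - wd \<Omega> is w x)) \<longlonglongrightarrow> 0"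
      by (rule H20_approx[OF \<Omega> H]) (rule that)
    define \<delta> where "\<delta> is n = (l2 ?M (\<lambda>x. pds is (\<phi> n) x - wd \<Omega> is w x))\<^sup>2" for "is" n
    \<comment> \<open>The error against the test function splits into its distance \<delta> to
      \<open>w\<close>, which will vanish, and the error \<open>E\<close> of the local
      polynomials.\<close>
    have rho_le: "(\<Sum>z\<in>Mz. rho h (\<lambda>x. \<phi> n x - ?p z x) (lc a h z)) \<le> (\<Sum>is | length is \<le> 2. h ^ (2 * length is) * (2 * \<delta> is n + 2 * E is))" for n
    proof -
      have 1: "(\<integral>x. indicator (lc a h z) x * (pds is (\<lambda>x. \<phi> n x - ?p z x) x)\<^sup>2 \<partial>lborel) = (l2 (?B z) (\<lambda>x. pds is (\<phi> n) x - pds is (?p z) x))\<^sup>2" for z "is"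
      proof -
        have s: "smooth (\<phi> n)" "smooth (?p z)" using test_funD(1)[OF t] smooth_pev(1)[OF h0] by auto
        have e: "pds is (\<lambda>x. \<phi> n x - ?p z x) = (\<lambda>x. pds is (\<phi> n) x - pds is (?p z) x)"
          using pds_lin[OF s, of "is" 1 "-1"] by simp
        have [measurable]: "pds is (\<phi> n) \<in> borel_measurable borel" "pds is (?p z) \<in> borel_measurable borel"
          using smooth_borel s by auto
        show ?thesis unfolding e l2_sq by (rule integral_lc_bx) measurable
      qed
      have "(\<Sum>z\<in>Mz. rho h (\<lambda>x. \<phi> n x - ?p z x) (lc a h z))
        = (\<Sum>is | length is \<le> 2. h ^ (2 * length is) * (\<Sum>z\<in>Mz. (l2 (?B z) (\<lambda>x. pds is (\<phi> n) x - pds is (?p z) x))\<^sup>2))"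
        unfolding rho_def 1 by (subst sum.swap) (simp add: sum_distrib_left)
      also have "\<dots> \<le> (\<Sum>is | length is \<le> 2. h ^ (2 * length is) * (2 * \<delta> is n + 2 * E is))"
      proof (rule sum_mono)
        fix "is" :: "'n list" assume "is \<in> {is. length is \<le> 2}"
        then have L: "length is \<le> 2" "length is \<le> m" using m by auto
        have s1: "sqint ?M (pds is (\<phi> n))" by (rule smooth_sqint_on[OF \<Omega> test_funD(1)[OF t]])
        have "(\<Sum>z\<in>Mz. (l2 (?B z) (\<lambda>x. pds is (\<phi> n) x - pds is (?p z) x))\<^sup>2)
          \<le> (\<Sum>z\<in>Mz. 2 * (l2 (?B z) (\<lambda>x. pds is (\<phi> n) x - wd \<Omega> is w x))\<^sup>2 + 2 * (l2 (?B z) (\<lambda>x. wd \<Omega> is w x - pds is (?p z) x))\<^sup>2)"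
          by (intro sum_mono l2_sq_triangle sub s1 wds L(2) sp)
        also have "\<dots> = 2 * \<delta> is n + 2 * E is"
          unfolding \<delta>_def E_def l2_cover[OF sqint_diff[OF s1 wds[OF L(2)]]] by (simp add: sum.distrib sum_distrib_left)
        finally show "h ^ (2 * length is) * (\<Sum>z\<in>Mz. (l2 (?B z) (\<lambda>x. pds is (\<phi> n) x - pds is (?p z) x))\<^sup>2)
          \<le> h ^ (2 * length is) * (2 * \<delta> is n + 2 * E is)" using h by (intro mult_left_mono) auto
      qed
      finally show ?thesis .
    qed
    have V: "(\<Sum>z\<in>Mz. (l2 (?B z) (\<lambda>x. Vs is x - pds is (?p z) x))\<^sup>2) * h ^ 4 \<le> K2 * (N1 * (2 * (G * h ^ (2 * m) * Sm)))"
      if L: "length is = 2" for "is"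
    proof -
      let ?R = "\<lambda>n. K2 * (\<Sum>is | length is \<le> 2. h ^ (2 * length is) * (2 * \<delta> is n + 2 * E is))"
      have L2: "length is \<le> 2" and L4: "2 * length is = 4" using L by auto
      have "(\<Sum>z\<in>Mz. (l2 (?B z) (\<lambda>x. Vs is x - pds is (?p z) x))\<^sup>2) * h ^ 4 \<le> ?R n" for n
      proof -
        have "(\<Sum>z\<in>Mz. (l2 (?B z) (\<lambda>x. Vs is x - pds is (?p z) x))\<^sup>2) * h ^ 4 \<le> K2 * (\<Sum>z\<in>Mz. rho h (\<lambda>x. \<phi> n x - ?p z x) (lc a h z))"
          using Vs_l2[OF t Cc K L2] unfolding K2_def L4 .
        also have "\<dots> \<le> ?R n" by (rule mult_left_mono[OF rho_le K20])
        finally show ?thesis .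
      qed
      \<comment> \<open>The spline does not depend on \<open>n\<close>, so only the right-hand side
        has to converge.\<close>
      moreover have "?R \<longlonglongrightarrow> K2 * (\<Sum>is | length is \<le> 2. h ^ (2 * length is) * (2 * 0\<^sup>2 + 2 * E is))"
        unfolding \<delta>_def by (intro tendsto_intros l) auto
      ultimately have "(\<Sum>z\<in>Mz. (l2 (?B z) (\<lambda>x. Vs is x - pds is (?p z) x))\<^sup>2) * h ^ 4
        \<le> K2 * (\<Sum>is | length is \<le> 2. h ^ (2 * length is) * (2 * 0\<^sup>2 + 2 * E is))"
        by (intro LIMSEQ_le_const) auto
      also have "\<dots> \<le> K2 * (\<Sum>is | length (is :: 'n list) \<le> 2. 2 * (G * h ^ (2 * m) * Sm))"
      proof (rule mult_left_mono[OF sum_mono K20])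
        fix "is" :: "'n list" assume "is \<in> {is. length is \<le> 2}"
        then show "h ^ (2 * length is) * (2 * 0\<^sup>2 + 2 * E is) \<le> 2 * (G * h ^ (2 * m) * Sm)" using E[of "is"] by simp
      qed
      finally show ?thesis by (simp add: N1_def)
    qed
    have vH: "H20 \<Omega> (Vs [])" and vV: "Vh k \<Omega> h \<T> (Vs [])" using Vs_H20(1)[OF K] Vs_Vh[OF K] by auto
    have hm: "h ^ (2 * m) = h ^ (2 * (m - 2)) * h ^ 4"
    proof -
      have "2 * m = 2 * (m - 2) + 4" using m by simp
      then show ?thesis by (metis power_add)
    qed
    have D: "(norm0 \<Omega> (wd \<Omega> is (\<lambda>x. w x - Vs [] x)))\<^sup>2 \<le> (2 * G + 4 * K2 * N1 * G) * (h ^ (2 * (m - 2)) * Sm)" if L: "length is = 2" for "is"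
    proof -
      have Lm: "length is \<le> m" and L2: "length is \<le> 2" and L4: "2 * length is = 4" using L m by auto
      have sv: "sqint ?M (Vs is)" by (rule is_wd_sqint[OF Vs_H20(2)[OF K L2]])
      have "is_wd \<Omega> is (\<lambda>x. w x - Vs [] x) (\<lambda>x. wd \<Omega> is w x - Vs is x)"
        using vH Hm_sqint by (intro is_wd_diff[OF \<Omega>] Hm_sqint[OF Hm] Hm_wd[OF Hm Lm] Vs_H20(2)[OF K L2]) (auto simp: H20_def)
      then have "(norm0 \<Omega> (wd \<Omega> is (\<lambda>x. w x - Vs [] x)))\<^sup>2 = (l2 ?M (\<lambda>x. wd \<Omega> is w x - Vs is x))\<^sup>2" by (simp add: norm0_wd[OF \<Omega>])
      also have "\<dots> = (\<Sum>z\<in>Mz. (l2 (?B z) (\<lambda>x. wd \<Omega> is w x - Vs is x))\<^sup>2)" by (rule l2_cover) (intro sqint_diff wds Lm sv)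
      also have "\<dots> \<le> (\<Sum>z\<in>Mz. 2 * (l2 (?B z) (\<lambda>x. wd \<Omega> is w x - pds is (?p z) x))\<^sup>2 + 2 * (l2 (?B z) (\<lambda>x. pds is (?p z) x - Vs is x))\<^sup>2)"
        by (intro sum_mono l2_sq_triangle sub sv wds Lm sp)
      also have "\<dots> = 2 * E is + 2 * (\<Sum>z\<in>Mz. (l2 (?B z) (\<lambda>x. Vs is x - pds is (?p z) x))\<^sup>2)"
        unfolding E_def by (simp add: sum.distrib sum_distrib_left l2_diff_commute[of _ _ "Vs is"])
      finally have 1: "(norm0 \<Omega> (wd \<Omega> is (\<lambda>x. w x - Vs [] x)))\<^sup>2 \<le> 2 * E is + 2 * (\<Sum>z\<in>Mz. (l2 (?B z) (\<lambda>x. Vs is x - pds is (?p z) x))\<^sup>2)" .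
      have h4: "h ^ 4 > 0" using h by simp
      have 2: "E is \<le> G * (h ^ (2 * (m - 2)) * Sm)"
      proof -
        have "h ^ 4 * E is \<le> h ^ 4 * (G * (h ^ (2 * (m - 2)) * Sm))" using E[OF L2] unfolding L4 hm by (simp add: mult_ac)
        then show ?thesis using h4 by (rule mult_left_le_imp_le)
      qed
      have 3: "(\<Sum>z\<in>Mz. (l2 (?B z) (\<lambda>x. Vs is x - pds is (?p z) x))\<^sup>2) \<le> 2 * K2 * N1 * G * (h ^ (2 * (m - 2)) * Sm)"
      proof -
        have "h ^ 4 * (\<Sum>z\<in>Mz. (l2 (?B z) (\<lambda>x. Vs is x - pds is (?p z) x))\<^sup>2) \<le> h ^ 4 * (2 * K2 * N1 * G * (h ^ (2 * (m - 2)) * Sm))"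
          using V[OF L] unfolding hm by (simp add: mult_ac)
        then show ?thesis using h4 by (rule mult_left_le_imp_le)
      qed
      have "(2 * G + 4 * K2 * N1 * G) * (h ^ (2 * (m - 2)) * Sm) = 2 * (G * (h ^ (2 * (m - 2)) * Sm)) + 2 * (2 * K2 * N1 * G * (h ^ (2 * (m - 2)) * Sm))"
        by (simp add: algebra_simps)
      then show ?thesis using 1 2 3 by linarith
    qed
    have "(semi 2 \<Omega> (\<lambda>x. w x - Vs [] x))\<^sup>2 \<le> (\<Sum>is | length (is :: 'n list) = 2. (2 * G + 4 * K2 * N1 * G) * (h ^ (2 * (m - 2)) * Sm))"
      unfolding semi_sq by (intro sum_mono D) simp
    also have "\<dots> = A2 * (h ^ (2 * (m - 2)) * Sm)" by (simp add: A2_def N2_def)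
    also have "\<dots> = (sqrt A2 * h ^ (m - 2) * semi m \<Omega> w)\<^sup>2"
      using A20 by (simp add: power_mult_distrib Sm_def power_even_eq)
    finally have "semi 2 \<Omega> (\<lambda>x. w x - Vs [] x) \<le> sqrt A2 * h ^ (m - 2) * semi m \<Omega> w"
      by (rule power2_le_imp_le) (use A20 h semi_nonneg[of m \<Omega> w] in simp)
    then show ?thesis using vV by blast
  qed
  then show ?thesis using A20 by (intro exI[of _ "sqrt A2"]) auto
qed

section \<open>Galerkin orthogonality and duality\<close>

lemma ip0_commute: "ip0 \<Omega> u v = ip0 \<Omega> v u"
  by (simp add: ip0_def mult.commute)

lemma ip0_wlap_diff:
  fixes u v w :: "real^'n::finite \<Rightarrow> real"
  assumes \<Omega>: "open \<Omega>" "bounded \<Omega>" and H: "H20 \<Omega> u" "H20 \<Omega> v" "H20 \<Omega> w"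
  shows "ip0 \<Omega> (wlap \<Omega> (\<lambda>x. u x - v x)) (wlap \<Omega> w) = ip0 \<Omega> (wlap \<Omega> u) (wlap \<Omega> w) - ip0 \<Omega> (wlap \<Omega> v) (wlap \<Omega> w)"
proof -
  let ?M = "lebesgue_on \<Omega>"
  have s: "sqint ?M (wlap \<Omega> f)" if "H20 \<Omega> f" for f using that by (intro wlap_sqint) (simp add: H20_def)
  have i: "integrable ?M (\<lambda>x. wlap \<Omega> f x * wlap \<Omega> w x)" if "H20 \<Omega> f" for f by (rule sqint_mult[OF s[OF that] s[OF H(3)]])
  have d: "H20 \<Omega> (\<lambda>x. u x - v x)" by (rule H20_diff(1)[OF \<Omega> H(1,2)])
  have "ip0 \<Omega> (wlap \<Omega> (\<lambda>x. u x - v x)) (wlap \<Omega> w) = (LINT x|?M. wlap \<Omega> u x * wlap \<Omega> w x - wlap \<Omega> v x * wlap \<Omega> w x)"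
    unfolding ip0_def
  proof (rule integral_cong_AE)
    show "AE x in ?M. wlap \<Omega> (\<lambda>x. u x - v x) x * wlap \<Omega> w x = wlap \<Omega> u x * wlap \<Omega> w x - wlap \<Omega> v x * wlap \<Omega> w x"
      using H20_diff(2)[OF \<Omega> H(1,2)] by eventually_elim (simp add: left_diff_distrib)
  qed (use i[OF d] i[OF H(1)] i[OF H(2)] in \<open>auto intro!: borel_measurable_diff\<close>)
  also have "\<dots> = ip0 \<Omega> (wlap \<Omega> u) (wlap \<Omega> w) - ip0 \<Omega> (wlap \<Omega> v) (wlap \<Omega> w)"
    unfolding ip0_def by (rule Bochner_Integration.integral_diff[OF i[OF H(1)] i[OF H(2)]])
  finally show ?thesis .
qed

lemma ip0_wlap_CS:
  fixes u v :: "real^'n::finite \<Rightarrow> real"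
  assumes \<Omega>: "open \<Omega>" "bounded \<Omega>" and H: "H20 \<Omega> u" "H20 \<Omega> v"
  shows "ip0 \<Omega> (wlap \<Omega> u) (wlap \<Omega> v) \<le> semi 2 \<Omega> u * semi 2 \<Omega> v"
    and "ip0 \<Omega> (wlap \<Omega> u) (wlap \<Omega> u) = (semi 2 \<Omega> u)\<^sup>2"
proof -
  have s: "sqint (lebesgue_on \<Omega>) (wlap \<Omega> f)" if "H20 \<Omega> f" for f using that by (intro wlap_sqint) (simp add: H20_def)
  show "ip0 \<Omega> (wlap \<Omega> u) (wlap \<Omega> v) \<le> semi 2 \<Omega> u * semi 2 \<Omega> v"
    using l2_CS[OF s[OF H(1)] s[OF H(2)]] unfolding semi2_wlap[OF \<Omega> H(1)] semi2_wlap[OF \<Omega> H(2)] norm0_eq_l2 ip0_def by linarith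
  show "ip0 \<Omega> (wlap \<Omega> u) (wlap \<Omega> u) = (semi 2 \<Omega> u)\<^sup>2"
    unfolding semi2_wlap[OF \<Omega> H(1)] norm0_eq_l2 l2_sq ip0_def by (simp add: power2_eq_square)
qed

theorem theorem4p2:
  fixes \<Omega> :: "(real^'n::finite) set" and k :: nat
  assumes dim: "CARD('n) = 2 \<or> CARD('n) = 3"
    and dom: "open \<Omega>" "bounded \<Omega>" "connected \<Omega>"
    and k: "k \<ge> 4"
    and reg: "\<exists>Creg. \<forall>g w. L2 \<Omega> g \<and> H20 \<Omega> w \<and>
                 (\<forall>v. H20 \<Omega> v \<longrightarrow> ip0 \<Omega> (wlap \<Omega> w) (wlap \<Omega> v) = ip0 \<Omega> g v)
               \<longrightarrow> Hm 4 \<Omega> w \<and> semi 4 \<Omega> w \<le> Creg * norm0 \<Omega> g"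
  shows "\<exists>C. \<forall>h \<T> f u uh.
           cube_mesh \<Omega> h \<T> \<and> L2 \<Omega> f \<and>
           Hm (k + 1) \<Omega> u \<and> H20 \<Omega> u \<and>
           (\<forall>v. H20 \<Omega> v \<longrightarrow> ip0 \<Omega> (wlap \<Omega> u) (wlap \<Omega> v) = ip0 \<Omega> f v) \<and>
           Vh k \<Omega> h \<T> uh \<and>
           (\<forall>v. Vh k \<Omega> h \<T> v \<longrightarrow> ip0 \<Omega> (wlap \<Omega> uh) (wlap \<Omega> v) = ip0 \<Omega> f v)
           \<longrightarrow> norm0 \<Omega> (\<lambda>x. u x - uh x) + h\<^sup>2 * semi 2 \<Omega> (\<lambda>x. u x - uh x)
               \<le> C * h ^ (k + 1) * semi (k + 1) \<Omega> u"
proof -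
  note \<Omega> = dom(1,2)
  obtain Creg where reg: "\<And>g w. L2 \<Omega> g \<Longrightarrow> H20 \<Omega> w \<Longrightarrow> (\<And>v. H20 \<Omega> v \<Longrightarrow> ip0 \<Omega> (wlap \<Omega> w) (wlap \<Omega> v) = ip0 \<Omega> g v)
      \<Longrightarrow> Hm 4 \<Omega> w \<and> semi 4 \<Omega> w \<le> Creg * norm0 \<Omega> g" using reg by auto
  obtain A where A0: "A \<ge> 0" and A: "\<And>h \<T> m w. cube_mesh \<Omega> h \<T> \<Longrightarrow> 2 \<le> m \<Longrightarrow> m \<le> k + 1 \<Longrightarrow> Hm m \<Omega> w \<Longrightarrow> H20 \<Omega> w \<Longrightarrow>
      \<exists>v. Vh k \<Omega> h \<T> v \<and> semi 2 \<Omega> (\<lambda>x. w x - v x) \<le> A * h ^ (m - 2) * semi m \<Omega> w"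
    using spline_approximation[OF \<Omega> k] by auto
  \<comment> \<open>The outer \<open>A\<close> comes from approximating the solution,
    \<open>A * \<bar>Creg\<bar>\<close> from the dual problem, and the summand 1 from the energy
    term itself.\<close>
  have main: "norm0 \<Omega> (\<lambda>x. u x - uh x) + h\<^sup>2 * semi 2 \<Omega> (\<lambda>x. u x - uh x) \<le> ((A * \<bar>Creg\<bar> + 1) * A) * h ^ (k + 1) * semi (k + 1) \<Omega> u"
    if mesh: "cube_mesh \<Omega> h \<T>" and u: "Hm (k + 1) \<Omega> u" "H20 \<Omega> u"
      and eq: "\<And>v. H20 \<Omega> v \<Longrightarrow> ip0 \<Omega> (wlap \<Omega> u) (wlap \<Omega> v) = ip0 \<Omega> f v"
      and uh: "Vh k \<Omega> h \<T> uh" "\<And>v. Vh k \<Omega> h \<T> v \<Longrightarrow> ip0 \<Omega> (wlap \<Omega> uh) (wlap \<Omega> v) = ip0 \<Omega> f v" for h \<T> f u uh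
  proof -
    let ?e = "\<lambda>x. u x - uh x"
    have h: "h > 0" using mesh by (simp add: cube_mesh_def)
    have VH: "H20 \<Omega> v" if "Vh k \<Omega> h \<T> v" for v using that by (simp add: Vh_def)
    have e: "H20 \<Omega> ?e" by (rule H20_diff(1)[OF \<Omega> u(2) VH[OF uh(1)]])
    have orth: "ip0 \<Omega> (wlap \<Omega> ?e) (wlap \<Omega> v) = 0" if "Vh k \<Omega> h \<T> v" for v
      using ip0_wlap_diff[OF \<Omega> u(2) VH[OF uh(1)] VH[OF that]] eq[OF VH[OF that]] uh(2)[OF that] by simp
    \<comment> \<open>Orthogonality permits subtracting any discrete function from \<open>w\<close>;
      this is used once with the solution and once with the dual solution.\<close>
    have galerkin: "ip0 \<Omega> (wlap \<Omega> ?e) (wlap \<Omega> w) \<le> semi 2 \<Omega> ?e * semi 2 \<Omega> (\<lambda>x. w x - v x)" if w: "H20 \<Omega> w" and v: "Vh k \<Omega> h \<T> v" for w v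
    proof -
      have "ip0 \<Omega> (wlap \<Omega> ?e) (wlap \<Omega> w) = ip0 \<Omega> (wlap \<Omega> (\<lambda>x. w x - v x)) (wlap \<Omega> ?e)"
        using ip0_wlap_diff[OF \<Omega> w VH[OF v] e] orth[OF v] by (simp add: ip0_commute[of \<Omega> "wlap \<Omega> ?e"])
      also have "\<dots> \<le> semi 2 \<Omega> (\<lambda>x. w x - v x) * semi 2 \<Omega> ?e" by (rule ip0_wlap_CS(1)[OF \<Omega> H20_diff(1)[OF \<Omega> w VH[OF v]] e])
      finally show ?thesis by (simp add: mult.commute)
    qed
    have k2: "2 \<le> k + 1" using k by simp
    obtain v where v: "Vh k \<Omega> h \<T> v" "semi 2 \<Omega> (\<lambda>x. u x - v x) \<le> A * h ^ (k + 1 - 2) * semi (k + 1) \<Omega> u"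
      using A[OF mesh k2 order_refl u] by blast
    \<comment> \<open>Cea's argument with constant 1: the discrete part of the error drops out by
      orthogonality, and the form is the squared seminorm.\<close>
    have "(semi 2 \<Omega> ?e)\<^sup>2 = ip0 \<Omega> (wlap \<Omega> ?e) (wlap \<Omega> u)"
      using ip0_wlap_CS(2)[OF \<Omega> e e] ip0_wlap_diff[OF \<Omega> u(2) VH[OF uh(1)] e] orth[OF uh(1)]
        ip0_commute[of \<Omega> "wlap \<Omega> u" "wlap \<Omega> ?e"] ip0_commute[of \<Omega> "wlap \<Omega> uh" "wlap \<Omega> ?e"] by linarith
    also have "\<dots> \<le> semi 2 \<Omega> ?e * semi 2 \<Omega> (\<lambda>x. u x - v x)" by (rule galerkin[OF u(2) v(1)])
    finally have "semi 2 \<Omega> ?e \<le> semi 2 \<Omega> (\<lambda>x. u x - v x)"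
      using semi_nonneg[of 2 \<Omega> ?e] semi_nonneg[of 2 \<Omega> "\<lambda>x. u x - v x"]
      by (cases "semi 2 \<Omega> ?e = 0") (auto simp: power2_eq_square)
    then have e2: "semi 2 \<Omega> ?e \<le> A * h ^ (k - 1) * semi (k + 1) \<Omega> u" using v(2) by simp
    have se: "sqint (lebesgue_on \<Omega>) ?e" using e Hm_sqint by (auto simp: H20_def)
    \<comment> \<open>The dual problem, with the error itself as right-hand side.\<close>
    obtain w where w: "H20 \<Omega> w" "\<And>v. H20 \<Omega> v \<Longrightarrow> ip0 \<Omega> (wlap \<Omega> w) (wlap \<Omega> v) = ip0 \<Omega> ?e v"
      by (rule biharmonic_solution_exists[OF \<Omega> se]) (rule that)
    have "L2 \<Omega> ?e" using se by (simp add: L2_eq_sqint)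
    from reg[OF this w] have w4: "Hm 4 \<Omega> w" "semi 4 \<Omega> w \<le> Creg * norm0 \<Omega> ?e" by auto
    have k4: "4 \<le> k + 1" using k by simp
    \<comment> \<open>The approximation result for m = 4, which yields the two extra powers of
      \<open>h\<close>.\<close>
    obtain v' where v': "Vh k \<Omega> h \<T> v'" "semi 2 \<Omega> (\<lambda>x. w x - v' x) \<le> A * h ^ (4 - 2) * semi 4 \<Omega> w"
      using A[OF mesh _ k4 w4(1) w(1)] by auto
    have n0: "norm0 \<Omega> ?e \<ge> 0" by (simp add: norm0_eq_l2 l2_nonneg)
    \<comment> \<open>The sign of the regularity constant is unknown, hence the absolute
      value.\<close>
    have "semi 4 \<Omega> w \<le> \<bar>Creg\<bar> * norm0 \<Omega> ?e" using w4(2) mult_right_mono[OF abs_ge_self[of Creg] n0] by linarith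
    then have "A * h\<^sup>2 * semi 4 \<Omega> w \<le> A * h\<^sup>2 * (\<bar>Creg\<bar> * norm0 \<Omega> ?e)" using A0 by (intro mult_left_mono) auto
    then have wv: "semi 2 \<Omega> (\<lambda>x. w x - v' x) \<le> A * h\<^sup>2 * (\<bar>Creg\<bar> * norm0 \<Omega> ?e)" using v'(2) by simp
    have "(norm0 \<Omega> ?e)\<^sup>2 = ip0 \<Omega> ?e ?e" unfolding norm0_eq_l2 l2_sq ip0_def by (simp add: power2_eq_square)
    also have "\<dots> = ip0 \<Omega> (wlap \<Omega> ?e) (wlap \<Omega> w)" using w(2)[OF e] ip0_commute[of \<Omega> "wlap \<Omega> w" "wlap \<Omega> ?e"] by linarith
    also have "\<dots> \<le> semi 2 \<Omega> ?e * semi 2 \<Omega> (\<lambda>x. w x - v' x)" by (rule galerkin[OF w(1) v'(1)])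
    also have "\<dots> \<le> semi 2 \<Omega> ?e * (A * h\<^sup>2 * (\<bar>Creg\<bar> * norm0 \<Omega> ?e))" by (rule mult_left_mono[OF wv semi_nonneg])
    finally have "norm0 \<Omega> ?e * norm0 \<Omega> ?e \<le> (A * \<bar>Creg\<bar> * h\<^sup>2 * semi 2 \<Omega> ?e) * norm0 \<Omega> ?e"
      by (simp add: power2_eq_square mult_ac)
    then have e0: "norm0 \<Omega> ?e \<le> A * \<bar>Creg\<bar> * h\<^sup>2 * semi 2 \<Omega> ?e"
      using n0 A0 semi_nonneg[of 2 \<Omega> ?e] by (cases "norm0 \<Omega> ?e = 0") auto
    have "norm0 \<Omega> ?e + h\<^sup>2 * semi 2 \<Omega> ?e \<le> (A * \<bar>Creg\<bar> + 1) * h\<^sup>2 * semi 2 \<Omega> ?e" using e0 by (simp add: algebra_simps)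
    also have "\<dots> \<le> (A * \<bar>Creg\<bar> + 1) * h\<^sup>2 * (A * h ^ (k - 1) * semi (k + 1) \<Omega> u)"
      using A0 by (intro mult_left_mono e2) auto
    also have "\<dots> = ((A * \<bar>Creg\<bar> + 1) * A) * (h\<^sup>2 * h ^ (k - 1)) * semi (k + 1) \<Omega> u" by (simp only: mult_ac)
    also have "h\<^sup>2 * h ^ (k - 1) = h ^ (k + 1)" using k by (simp flip: power_add)
    finally show ?thesis .
  qed
  show ?thesis by (rule exI[of _ "(A * \<bar>Creg\<bar> + 1) * A"]) (intro allI impI, elim conjE, rule main, auto)
qed

end
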